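(* Let $\Gamma$, $v$, $\Lambda=(\lambda_n)_{n\ge n_0}$ be as in the context, let $w$ be the Bessel weight sequence for $\Lambda$ with respect to $(\Gamma,v)$, and suppose $V_n\to\infty$ and $v_n=o(V_n)$ as $n\to\infty$. Then $H_{(\Gamma,v);(\Lambda,w)}$ is invertible if and only if $\sup_nV_nQ_n<\infty$ and one of the following holds: (0) $\Lambda$ is an exact $v$-perturbation of $\Gamma$ and there are positive constants $C,\delta$ such that $\varrho_m/\varrho_n\le C(V_m/V_n)^{1-\delta}$ whenever $m>n$; (1) $\Lambda$ is a $v$-perturbation of $\Gamma$ of deficiency $1$ and there are positive constants $C,\delta$ such that $\varrho_m/\varrho_n\ge C(V_m/V_n)^{1+\delta}$ whenever $m>n$.
   Context: $\Gamma=(\gamma_n)_{n\ge1}$ are distinct complex numbers with $\inf_n|\gamma_{n+1}|/|\gamma_n|>1$; $v=(v_n)$ positive with $\sum_nv_n/(1+|\gamma_n|^2)<\infty$. $\ell^2_u=\{(a_k):\sum|a_k|^2u_k<\infty\}$; $H_{(\Gamma,v)}a(z)=\sum_na_nv_n/(z-\gamma_n)$; $H_{(\Gamma,v);(\Lambda,w)}a=(H_{(\Gamma,v)}a(\lambda_n))_n$ from $\ell^2_v$ to $\ell^2_w$; invertible means bijective with bounded inverse. Bessel weight: $w_n=(\sum_kv_k/|\lambda_n-\gamma_k|^2)^{-1}$. $V_1=1$, $V_n=\sum_{j<n}v_j$; $P_n=\sum_{j>n}v_j/|\gamma_j|^2$; $Q_n=\sum_{m=n+1}^\infty w_m/|\lambda_m|^2$;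 $\varrho_n=\prod_{m=\max(1,n_0)}^n|\gamma_m|^2/|\lambda_m|^2$. $\Omega_1=\{|z|<(|\gamma_1|+|\gamma_2|)/2\}$, $\Omega_n=\{(|\gamma_{n-1}|+|\gamma_n|)/2\le|z|<(|\gamma_n|+|\gamma_{n+1}|)/2\}$ ($n\ge2$); $D_n(v;M)=\{\lambda\in\Omega_n: Mv_n/|\lambda-\gamma_n|^2\ge\max(V_n/|\lambda|^2,P_n)\}$. $\Lambda$ is a sequence of distinct nonzero complex numbers disjoint from $\Gamma$, indexed $(\lambda_n)_{n\ge n_0}$ by consecutive integers with $|\lambda_n|$ increasing. $\Lambda$ is a $v$-perturbation of $\Gamma$ if $n_0$ can be chosen so that for some sufficiently large $M$, $\lambda_n\in D_n(v;M)$ for all but finitely many $n$ (and the indexing uses this $n_0$); it is exact if $n_0=1$, of deficiency $n_0-1$ if $n_0>1$, of excess $1-n_0$ if $n_0<1$. *)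

theory Defs
  imports "HOL-Analysis.Analysis" "HOL-Library.Landau_Symbols"
begin

text \<open>Gamma = (gamma n) indexed by n >= 1 (type nat); Lambda = (lam n) indexed by
  integers n >= n0 (type int).  Weighted l^2 spaces are realised as functions
  vanishing off the index set.\<close>

definition wl2 :: "('i \<Rightarrow> real) \<Rightarrow> 'i set \<Rightarrow> ('i \<Rightarrow> complex) set" where
  "wl2 u I = {a. (\<forall>k. k \<notin> I \<longrightarrow> a k = 0) \<and> (\<lambda>k. (cmod (a k))^2 * u k) summable_on I}"

definition wl2_norm :: "('i \<Rightarrow> real) \<Rightarrow> 'i set \<Rightarrow> ('i \<Rightarrow> complex) \<Rightarrow> real" where
  "wl2_norm u I a = sqrt (\<Sum>\<^sub>\<infinity>k\<in>I. (cmod (a k))^2 * u k)"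

definition Htrans :: "(nat \<Rightarrow> complex) \<Rightarrow> (nat \<Rightarrow> real) \<Rightarrow> (nat \<Rightarrow> complex) \<Rightarrow> complex \<Rightarrow> complex" where
  "Htrans \<gamma> v a z = (\<Sum>\<^sub>\<infinity>n\<in>{1..}. a n * complex_of_real (v n) / (z - \<gamma> n))"

definition Hop :: "(nat \<Rightarrow> complex) \<Rightarrow> (nat \<Rightarrow> real) \<Rightarrow> (int \<Rightarrow> complex) \<Rightarrow> int
     \<Rightarrow> (nat \<Rightarrow> complex) \<Rightarrow> (int \<Rightarrow> complex)" where
  "Hop \<gamma> v lam n0 a = (\<lambda>n. if n0 \<le> n then Htrans \<gamma> v a (lam n) else 0)"

definition H_invertible :: "(nat \<Rightarrow> complex) \<Rightarrow> (nat \<Rightarrow> real) \<Rightarrow> (int \<Rightarrow> complex) \<Rightarrow> int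
     \<Rightarrow> (int \<Rightarrow> real) \<Rightarrow> bool" where
  "H_invertible \<gamma> v lam n0 w \<longleftrightarrow>
     bij_betw (Hop \<gamma> v lam n0) (wl2 v {1..}) (wl2 w {n0..}) \<and>
     (\<exists>C. \<forall>b\<in>wl2 w {n0..}.
        wl2_norm v {1..} (the_inv_into (wl2 v {1..}) (Hop \<gamma> v lam n0) b) \<le> C * wl2_norm w {n0..} b)"

definition bessel_weight :: "(nat \<Rightarrow> complex) \<Rightarrow> (nat \<Rightarrow> real) \<Rightarrow> (int \<Rightarrow> complex) \<Rightarrow> int \<Rightarrow> real" where
  "bessel_weight \<gamma> v lam n = inverse (\<Sum>\<^sub>\<infinity>k\<in>{1..}. v k / (cmod (lam n - \<gamma> k))^2)"

definition Vseq :: "(nat \<Rightarrow> real) \<Rightarrow> nat \<Rightarrow> real" where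
  "Vseq v n = (if n \<le> 1 then 1 else (\<Sum>j\<in>{1..<n}. v j))"

definition Pseq :: "(nat \<Rightarrow> complex) \<Rightarrow> (nat \<Rightarrow> real) \<Rightarrow> nat \<Rightarrow> real" where
  "Pseq \<gamma> v n = (\<Sum>\<^sub>\<infinity>j\<in>{n<..}. v j / (cmod (\<gamma> j))^2)"

definition Qseq :: "(int \<Rightarrow> complex) \<Rightarrow> int \<Rightarrow> (int \<Rightarrow> real) \<Rightarrow> nat \<Rightarrow> real" where
  "Qseq lam n0 w n = (\<Sum>\<^sub>\<infinity>m\<in>{int n + 1..} \<inter> {n0..}. w m / (cmod (lam m))^2)"

definition Qfinite :: "(int \<Rightarrow> complex) \<Rightarrow> int \<Rightarrow> (int \<Rightarrow> real) \<Rightarrow> nat \<Rightarrow> bool" where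
  "Qfinite lam n0 w n \<longleftrightarrow> (\<lambda>m. w m / (cmod (lam m))^2) summable_on ({int n + 1..} \<inter> {n0..})"

definition rho :: "(nat \<Rightarrow> complex) \<Rightarrow> (int \<Rightarrow> complex) \<Rightarrow> int \<Rightarrow> nat \<Rightarrow> real" where
  "rho \<gamma> lam n0 n = (\<Prod>m\<in>{max 1 n0..int n}. (cmod (\<gamma> (nat m)))^2 / (cmod (lam m))^2)"

definition Omega :: "(nat \<Rightarrow> complex) \<Rightarrow> nat \<Rightarrow> complex set" where
  "Omega \<gamma> n = (if n = 1 then {z. cmod z < (cmod (\<gamma> 1) + cmod (\<gamma> 2)) / 2}
     else {z. (cmod (\<gamma> (n - 1)) + cmod (\<gamma> n)) / 2 \<le> cmod z \<and>
              cmod z < (cmod (\<gamma> n) + cmod (\<gamma> (n + 1))) / 2})"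

definition Dset :: "(nat \<Rightarrow> complex) \<Rightarrow> (nat \<Rightarrow> real) \<Rightarrow> real \<Rightarrow> nat \<Rightarrow> complex set" where
  "Dset \<gamma> v M n = {z \<in> Omega \<gamma> n.
     M * v n / (cmod (z - \<gamma> n))^2 \<ge> max (Vseq v n / (cmod z)^2) (Pseq \<gamma> v n)}"

definition vpert :: "(nat \<Rightarrow> complex) \<Rightarrow> (nat \<Rightarrow> real) \<Rightarrow> (int \<Rightarrow> complex) \<Rightarrow> int \<Rightarrow> bool" where
  "vpert \<gamma> v lam n0 \<longleftrightarrow>
     (\<exists>M. finite {n::int. n0 \<le> n \<and> \<not> (1 \<le> n \<and> lam n \<in> Dset \<gamma> v M (nat n))})"

end

theory Submission
  imports Defs
begin

text \<open>
  With \<open>c = a v\<close> the operator becomes the Cauchy transform of residues \<open>c\<close> with \<open>\<Sum> |c k|^2 / v k < \<infinity>\<close>.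
  At a point \<open>\<lambda> n\<close> of the \<open>n\<close>-th set \<open>D\<close> it equals
  \<open>c n / (\<lambda> n - \<gamma> n) + (\<Sum>k<n. c k) / \<lambda> n\<close> up to an operator that is small on far tails, since
  \<open>\<gamma>\<close> is lacunary and \<open>v = o(V)\<close>.  For the partial sums of \<open>c\<close>, divided by the product of the
  \<open>\<gamma> j / \<lambda> j\<close>, this main part is a first order difference equation.  Solving it with bounds amounts to
  a weighted discrete Hardy inequality: summation from the start of the tail leads to condition (0),
  summation from infinity to condition (1), where an auxiliary pole at the origin absorbs the initial
  value.  Finitely many poles and rows are then added in pairs, or exchanged, by multipliers
  \<open>(\<gamma> k - \<mu>) / (\<gamma> k - \<zeta>)\<close> that move a zero of the transform.

  Conversely, testing an invertible system on the residues \<open>v k\<close>, \<open>k < n\<close>, bounds \<open>V n * Q n\<close>, and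
  unit vectors show that almost every \<open>D\<close> contains a row.  A uniqueness theorem for zeros asymptotic to
  the poles shows that from some point on the rows are the \<open>\<lambda> n\<close> up to a constant shift of index.  The lower bound on tails
  is a Hardy inequality; its capacity form forces one of the two growth conditions according to
  whether \<open>\<Sum> v n / \<rho> n\<close> diverges or converges.  The growth condition makes an index shift of
  0 or 1 invertible, and two invertible systems with the same rows and nested sets of poles coincide.
\<close>

text \<open>Two obstacles shape the development. Invertibility gives a bijection and a bound for the
  inverse, but testing a system on vectors needs a bound for the transform itself; it comes from the
  uniform boundedness principle. This and the Neumann series call for a complete space, hence the
  type \<open>ell2\<close>. Moreover the infinite matrix can be controlled only on far tails, where
  the off-diagonal part is small compared with the solution operator of the main part. A tail system
  has as many rows as poles, or one pole more (the auxiliary one). The squared modulus of the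
  homogeneous solution of the difference equation is \<rho> up to a constant factor. The Hardy
  weights are \<open>ucoef\<close>, of size v / \<rho>, and \<open>hcoef\<close>, dominated by
  \<rho> times the terms of Q. Inside D the Bessel weight is comparable with the squared distance to
  the pole divided by v, which makes the norm of the data fit the increments of the solution. The
  Hardy inequality asks that a sum of one weight up to n times the tail of the other from n on stay
  bounded; the exponents 1 - \<delta> and 1 + \<delta> decide which weight is summed from which
  end.\<close>

lemma nonneg_bounded_summable:
  fixes f :: "'a \<Rightarrow> real"
  assumes "\<And>x. x \<in> A \<Longrightarrow> 0 \<le> f x" "\<And>F. finite F \<Longrightarrow> F \<subseteq> A \<Longrightarrow> sum f F \<le> B"
  shows "f summable_on A" "infsum f A \<le> B"
proof -
  show s: "f summable_on A"
    by (rule nonneg_bdd_above_summable_on) (use assms in \<open>auto simp: bdd_above_def\<close>)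
  show "infsum f A \<le> B"
    using infsum_le_finite_sums[OF s] assms(2) by blast
qed

lemma infsum_Cauchy_Schwarz:
  fixes f g :: "'a \<Rightarrow> 'b::{real_normed_div_algebra,banach}"
  assumes f: "(\<lambda>x. (norm (f x))^2) summable_on A" and g: "(\<lambda>x. (norm (g x))^2) summable_on A"
  shows "(\<lambda>x. norm (f x * g x)) summable_on A"
    and "(infsum (\<lambda>x. norm (f x * g x)) A)^2 \<le> infsum (\<lambda>x. (norm (f x))^2) A * infsum (\<lambda>x. (norm (g x))^2) A"
    and "(norm (infsum (\<lambda>x. f x * g x) A))^2 \<le> infsum (\<lambda>x. (norm (f x))^2) A * infsum (\<lambda>x. (norm (g x))^2) A"
proof -
  define a b where "a = infsum (\<lambda>x. (norm (f x))^2) A" and "b = infsum (\<lambda>x. (norm (g x))^2) A"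
  have a0: "a \<ge> 0" and b0: "b \<ge> 0" unfolding a_def b_def by (auto intro: infsum_nonneg)
  have fin: "(\<Sum>x\<in>F. norm (f x * g x)) \<le> sqrt (a * b)" if F: "finite F" "F \<subseteq> A" for F
  proof -
    have "(\<Sum>x\<in>F. norm (f x * g x)) = (\<Sum>x\<in>F. \<bar>norm (f x)\<bar> * \<bar>norm (g x)\<bar>)"
      by (simp add: norm_mult)
    also have "\<dots> \<le> L2_set (\<lambda>x. norm (f x)) F * L2_set (\<lambda>x. norm (g x)) F"
      by (rule L2_set_mult_ineq)
    also have "\<dots> = sqrt ((\<Sum>x\<in>F. (norm (f x))^2) * (\<Sum>x\<in>F. (norm (g x))^2))"
      by (simp add: L2_set_def real_sqrt_mult)
    also have "\<dots> \<le> sqrt (a * b)"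
      unfolding a_def b_def using F f g
      by (intro real_sqrt_le_mono mult_mono finite_sum_le_infsum) (auto intro: infsum_nonneg sum_nonneg)
    finally show ?thesis .
  qed
  show s: "(\<lambda>x. norm (f x * g x)) summable_on A"
    by (rule nonneg_bounded_summable[where B="sqrt (a*b)"]) (use fin in auto)
  have le: "infsum (\<lambda>x. norm (f x * g x)) A \<le> sqrt (a * b)"
    by (rule nonneg_bounded_summable) (use fin in auto)
  have n0: "0 \<le> infsum (\<lambda>x. norm (f x * g x)) A" by (auto intro: infsum_nonneg)
  have "(infsum (\<lambda>x. norm (f x * g x)) A)^2 \<le> (sqrt (a*b))^2"
    using le n0 by (intro power_mono)
  thus *: "(infsum (\<lambda>x. norm (f x * g x)) A)^2 \<le> infsum (\<lambda>x. (norm (f x))^2) A * infsum (\<lambda>x. (norm (g x))^2) A"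
    using a0 b0 by (simp add: a_def b_def)
  have "norm (infsum (\<lambda>x. f x * g x) A) \<le> infsum (\<lambda>x. norm (f x * g x)) A"
    by (rule norm_infsum_bound[OF s])
  hence "(norm (infsum (\<lambda>x. f x * g x) A))^2 \<le> (infsum (\<lambda>x. norm (f x * g x)) A)^2"
    by (intro power_mono) auto
  with * show "(norm (infsum (\<lambda>x. f x * g x) A))^2 \<le> infsum (\<lambda>x. (norm (f x))^2) A * infsum (\<lambda>x. (norm (g x))^2) A"
    by linarith
qed

lemma cmod_add_sq_le: "(cmod (x + y))^2 \<le> 2 * (cmod x)^2 + 2 * (cmod y)^2"
proof -
  have "(cmod (x + y))^2 \<le> (cmod x + cmod y)^2"
    by (intro power_mono norm_triangle_ineq) auto
  also have "\<dots> \<le> 2 * (cmod x)^2 + 2 * (cmod y)^2"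
    using sum_squares_bound[of "cmod x" "cmod y"] by (simp add: power2_sum)
  finally show ?thesis .
qed

lemma cmod_diff_sq_le: "(cmod (x - y))^2 \<le> 2 * (cmod x)^2 + 2 * (cmod y)^2"
  using cmod_add_sq_le[of x "- y"] by simp

subsection \<open>The Hilbert space of square-summable sequences\<close>

text \<open>Made a type of its own so that it can be an instance of \<open>banach\<close>: the fixed
  point theorem behind the Neumann series and the Baire category argument both need this class.
  Weighted residue spaces are mapped into it by multiplying with the square root of the
  weight.\<close>

typedef ell2 = "{x :: nat \<Rightarrow> complex. (\<lambda>k. (cmod (x k))^2) summable_on UNIV}"
  morphisms coord Ell2
  by (rule exI[of _ "\<lambda>_. 0"]) simp

setup_lifting type_definition_ell2

lemma sq_summable_add:
  assumes "(\<lambda>k. (cmod (x k))^2) summable_on A" "(\<lambda>k. (cmod (y k))^2) summable_on A"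
  shows "(\<lambda>k. (cmod (x k + y k))^2) summable_on A"
proof (rule summable_on_comparison_test)
  show "(\<lambda>k. 2 * (cmod (x k))^2 + 2 * (cmod (y k))^2) summable_on A"
    by (intro summable_on_add summable_on_cmult_right assms)
qed (use cmod_add_sq_le in auto)

lemma sq_summable_scale:
  assumes "(\<lambda>k. (cmod (x k))^2) summable_on A"
  shows "(\<lambda>k. (cmod (r * x k))^2) summable_on A"
  using summable_on_cmult_right[OF assms, of "(cmod r)^2"] by (simp add: norm_mult power_mult_distrib)

instantiation ell2 :: real_normed_vector
begin

lift_definition zero_ell2 :: ell2 is "\<lambda>_. 0" by simp
lift_definition plus_ell2 :: "ell2 \<Rightarrow> ell2 \<Rightarrow> ell2" is "\<lambda>x y k. x k + y k"
  by (rule sq_summable_add)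
lift_definition uminus_ell2 :: "ell2 \<Rightarrow> ell2" is "\<lambda>x k. - x k" by simp
lift_definition minus_ell2 :: "ell2 \<Rightarrow> ell2 \<Rightarrow> ell2" is "\<lambda>x y k. x k - y k"
proof -
  fix x y :: "nat \<Rightarrow> complex"
  assume "(\<lambda>k. (cmod (x k))^2) summable_on UNIV" "(\<lambda>k. (cmod (y k))^2) summable_on UNIV"
  thus "(\<lambda>k. (cmod (x k - y k))^2) summable_on UNIV"
    using sq_summable_add[of x UNIV "\<lambda>k. - y k"] by simp
qed
lift_definition scaleR_ell2 :: "real \<Rightarrow> ell2 \<Rightarrow> ell2" is "\<lambda>r x k. complex_of_real r * x k"
  by (rule sq_summable_scale)
lift_definition norm_ell2 :: "ell2 \<Rightarrow> real" is "\<lambda>x. sqrt (\<Sum>\<^sub>\<infinity>k. (cmod (x k))^2)" .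
definition sgn_ell2 :: "ell2 \<Rightarrow> ell2" where "sgn_ell2 x = scaleR (inverse (norm x)) x"
definition dist_ell2 :: "ell2 \<Rightarrow> ell2 \<Rightarrow> real" where "dist_ell2 x y = norm (x - y)"
definition uniformity_ell2 :: "(ell2 \<times> ell2) filter"
  where "uniformity_ell2 = (INF e\<in>{0<..}. principal {(x, y). dist x y < e})"
definition open_ell2 :: "ell2 set \<Rightarrow> bool"
  where "open_ell2 S \<longleftrightarrow> (\<forall>x\<in>S. \<forall>\<^sub>F (x', y) in uniformity. x' = x \<longrightarrow> y \<in> S)"

lemma L2_set_coord_le: "finite F \<Longrightarrow> L2_set (\<lambda>k. cmod (coord x k)) F \<le> norm x"
  unfolding L2_set_def by transfer (intro real_sqrt_le_mono finite_sum_le_infsum; simp)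

text \<open>The norm is the least upper bound of its finite sections, so the triangle inequality and
  the completeness proof reduce to finite sums.\<close>

lemma norm_ell2_le:
  assumes "\<And>F. finite F \<Longrightarrow> L2_set (\<lambda>k. cmod (coord x k)) F \<le> B"
  shows "norm x \<le> B"
proof -
  have B: "B \<ge> 0" using assms[of "{}"] by simp
  have "(\<Sum>k\<in>F. (cmod (coord x k))^2) \<le> B^2" if "finite F" for F
  proof -
    have "(L2_set (\<lambda>k. cmod (coord x k)) F)^2 \<le> B^2"
      using assms[OF that] by (intro power_mono) auto
    thus ?thesis by (simp add: L2_set_def sum_nonneg)
  qed
  hence "(\<Sum>\<^sub>\<infinity>k. (cmod (coord x k))^2) \<le> B^2"
    by (intro nonneg_bounded_summable) auto
  hence "sqrt (\<Sum>\<^sub>\<infinity>k. (cmod (coord x k))^2) \<le> sqrt (B^2)"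
    by (rule real_sqrt_le_mono)
  thus ?thesis using B by (simp add: norm_ell2.rep_eq)
qed

instance
proof
  fix x y z :: ell2 and a b :: real
  show "x + y + z = x + (y + z)" "x + y = y + x" "0 + x = x" "- x + x = 0" "x - y = x + - y"
    "a *\<^sub>R (x + y) = a *\<^sub>R x + a *\<^sub>R y" "(a + b) *\<^sub>R x = a *\<^sub>R x + b *\<^sub>R x"
    "a *\<^sub>R b *\<^sub>R x = (a * b) *\<^sub>R x" "1 *\<^sub>R x = x"
    by (transfer; simp add: algebra_simps)+
  show "dist x y = norm (x - y)" by (simp add: dist_ell2_def)
  show "sgn x = scaleR (inverse (norm x)) x" by (simp add: sgn_ell2_def)
  show "uniformity = (INF e\<in>{0<..}. principal {(x :: ell2, y). dist x y < e})"
    by (simp add: uniformity_ell2_def)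
  show "open U \<longleftrightarrow> (\<forall>x\<in>U. \<forall>\<^sub>F (x', y) in uniformity. x' = x \<longrightarrow> y \<in> U)" for U :: "ell2 set"
    by (simp add: open_ell2_def)
  show "norm x = 0 \<longleftrightarrow> x = 0"
  proof
    assume "norm x = 0"
    hence "cmod (coord x k) = 0" for k
      using L2_set_coord_le[of "{k}" x] by (simp add: L2_set_def)
    thus "x = 0" by (intro coord_inject[THEN iffD1] ext) (simp add: zero_ell2.rep_eq)
  qed (simp add: norm_ell2.rep_eq zero_ell2.rep_eq)
  show "norm (x + y) \<le> norm x + norm y"
  proof (rule norm_ell2_le)
    fix F :: "nat set" assume F: "finite F"
    have "L2_set (\<lambda>k. cmod (coord (x + y) k)) F \<le> L2_set (\<lambda>k. cmod (coord x k) + cmod (coord y k)) F"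
      by (intro L2_set_mono) (auto simp: plus_ell2.rep_eq norm_triangle_ineq)
    also have "\<dots> \<le> L2_set (\<lambda>k. cmod (coord x k)) F + L2_set (\<lambda>k. cmod (coord y k)) F"
      by (rule L2_set_triangle_ineq)
    also have "\<dots> \<le> norm x + norm y"
      using L2_set_coord_le[OF F] by (intro add_mono)
    finally show "L2_set (\<lambda>k. cmod (coord (x + y) k)) F \<le> norm x + norm y" .
  qed
  show "norm (a *\<^sub>R x) = \<bar>a\<bar> * norm x"
    by transfer (simp add: norm_mult power_mult_distrib infsum_cmult_right' real_sqrt_mult)
qed

end

lemma coord_minus: "coord (x - y) k = coord x k - coord y k"
  by (simp add: minus_ell2.rep_eq)

lemma coord_plus: "coord (x + y) k = coord x k + coord y k"
  by (simp add: plus_ell2.rep_eq)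

lemma coord_scaleR: "coord (r *\<^sub>R x) k = of_real r * coord x k"
  by (simp add: scaleR_ell2.rep_eq)

lemma cmod_coord_le: "cmod (coord x k) \<le> norm x"
  using L2_set_coord_le[of "{k}" x] by (simp add: L2_set_def)

lemma norm_ell2_sq: "(norm x)^2 = (\<Sum>\<^sub>\<infinity>k. (cmod (coord x k))^2)"
  by (simp add: norm_ell2.rep_eq infsum_nonneg)

instance ell2 :: banach
proof
  fix X :: "nat \<Rightarrow> ell2" assume X: "Cauchy X"
  have "Cauchy (\<lambda>n. coord (X n) k)" for k
  proof (rule CauchyI)
    fix e :: real assume "e > 0"
    then obtain M where M: "\<And>m n. m \<ge> M \<Longrightarrow> n \<ge> M \<Longrightarrow> norm (X m - X n) < e"
      using CauchyD[OF X] by blast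
    show "\<exists>M. \<forall>m\<ge>M. \<forall>n\<ge>M. norm (coord (X m) k - coord (X n) k) < e"
      using M cmod_coord_le[of "X _ - X _" k] by (auto simp: coord_minus intro!: exI[of _ M]) (meson le_less_trans)
  qed
  hence "\<exists>l. (\<lambda>n. coord (X n) k) \<longlonglongrightarrow> l" for k
    by (simp add: Cauchy_convergent_iff convergent_def)
  then obtain l where l: "\<And>k. (\<lambda>n. coord (X n) k) \<longlonglongrightarrow> l k" by metis
  \<comment> \<open>A Cauchy estimate between \<open>X m\<close> and \<open>X n\<close> passes to
    the coordinatewise limit because a finite section depends continuously on finitely many
    coordinates; uniformity in \<open>F\<close> gives both the summability of \<open>l\<close> and
    the convergence.\<close>
  have near: "L2_set (\<lambda>k. cmod (l k - coord (X n) k)) F \<le> e"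
    if "\<And>m. m \<ge> M \<Longrightarrow> norm (X m - X n) \<le> e" and F: "finite F" for M n e F
  proof (rule tendsto_upperbound)
    show "(\<lambda>m. L2_set (\<lambda>k. cmod (coord (X m) k - coord (X n) k)) F) \<longlonglongrightarrow> L2_set (\<lambda>k. cmod (l k - coord (X n) k)) F"
      unfolding L2_set_def by (intro tendsto_intros l)
    show "\<forall>\<^sub>F m in sequentially. L2_set (\<lambda>k. cmod (coord (X m) k - coord (X n) k)) F \<le> e"
    proof (rule eventually_sequentiallyI[of M])
      fix m assume "m \<ge> M"
      thus "L2_set (\<lambda>k. cmod (coord (X m) k - coord (X n) k)) F \<le> e"
        using L2_set_coord_le[OF F, of "X m - X n"] that(1)[of m] by (simp add: coord_minus)
    qed
  qed simp
  have sq: "(\<lambda>k. (cmod (l k))^2) summable_on UNIV"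
  proof -
    obtain M where M: "\<And>m n. m \<ge> M \<Longrightarrow> n \<ge> M \<Longrightarrow> norm (X m - X n) < 1"
      using CauchyD[OF X, of 1] by auto
    have "(\<lambda>k. (cmod (l k - coord (X M) k))^2) summable_on UNIV"
    proof (rule nonneg_bounded_summable[where B=1])
      fix F :: "nat set" assume F: "finite F"
      have "L2_set (\<lambda>k. cmod (l k - coord (X M) k)) F \<le> 1"
        by (rule near[where M=M]) (use M F in \<open>auto intro: less_imp_le\<close>)
      thus "(\<Sum>k\<in>F. (cmod (l k - coord (X M) k))^2) \<le> 1"
        by (simp add: L2_set_def)
    qed simp
    moreover have "(\<lambda>k. (cmod (coord (X M) k))^2) summable_on UNIV"
      using coord[of "X M"] by simp
    ultimately show ?thesis
      using sq_summable_add[of "\<lambda>k. l k - coord (X M) k" UNIV "coord (X M)"] by simp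
  qed
  define L where "L = Ell2 l"
  have cL: "coord L = l" unfolding L_def using sq by (simp add: Ell2_inverse)
  have "X \<longlonglongrightarrow> L"
  proof (rule LIMSEQ_I)
    fix e :: real assume e: "e > 0"
    then obtain M where M: "\<And>m n. m \<ge> M \<Longrightarrow> n \<ge> M \<Longrightarrow> norm (X m - X n) < e / 2"
      using CauchyD[OF X, of "e/2"] by auto
    have "norm (X n - L) < e" if n: "n \<ge> M" for n
    proof -
      have "norm (L - X n) \<le> e / 2"
      proof (rule norm_ell2_le)
        fix F :: "nat set" assume F: "finite F"
        show "L2_set (\<lambda>k. cmod (coord (L - X n) k)) F \<le> e / 2"
          unfolding coord_minus cL by (rule near[where M=M]) (use M n F in \<open>auto intro: less_imp_le\<close>)
      qed
      thus ?thesis using e by (simp add: norm_minus_commute)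
    qed
    thus "\<exists>no. \<forall>n\<ge>no. norm (X n - L) < e" by blast
  qed
  thus "convergent X" by (auto simp: convergent_def)
qed

text \<open>The solution is the fixed point of the contraction \<open>\<lambda>x. y - L x\<close>;
  the estimate \<open>norm x \<le> norm y + norm x / 2\<close> gives the factor 2.\<close>

lemma Neumann_solve:
  fixes L :: "'a::banach \<Rightarrow> 'a"
  assumes add: "\<And>x y. L (x - y) = L x - L y" and bd: "\<And>x. norm (L x) \<le> norm x / 2"
  shows "\<exists>x. x + L x = y \<and> norm x \<le> 2 * norm y"
proof -
  have "\<exists>!x. y - L x = x"
  proof (rule banach_fix_type[where c="1/2"])
    have "dist (y - L x) (y - L x') \<le> 1 / 2 * dist x x'" for x x'
      using bd[of "x - x'"] by (simp add: dist_norm add norm_minus_commute)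
    thus "\<forall>x x'. dist (y - L x) (y - L x') \<le> 1 / 2 * dist x x'" by blast
  qed auto
  then obtain x where x: "y - L x = x" by blast
  hence "x + L x = y" by (metis diff_add_cancel)
  moreover have "norm x \<le> norm y + norm x / 2"
    using norm_triangle_ineq4[of y "L x"] bd[of x] x by simp
  ultimately show ?thesis by auto
qed

text \<open>Baire's theorem for the closed sets \<open>E k\<close>, which cover the space by
  pointwise boundedness: one of them contains a ball, and rescaling every vector into that ball
  gives the uniform constant. Formulated for seminorms because it is applied to Euclidean norms of
  finite families of row values.\<close>

theorem uniform_boundedness:
  fixes p :: "'i \<Rightarrow> 'a::banach \<Rightarrow> real"
  assumes tri: "\<And>i x y. p i (x + y) \<le> p i x + p i y"
    and hom: "\<And>i r x. p i (r *\<^sub>R x) = \<bar>r\<bar> * p i x"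
    and bd: "\<And>i. \<exists>K. \<forall>x. p i x \<le> K * norm x"
    and pw: "\<And>x. \<exists>K. \<forall>i. p i x \<le> K"
  shows "\<exists>K. \<forall>i x. p i x \<le> K * norm x"
proof -
  have neg: "p i (- x) = p i x" for i x using hom[of i "-1" x] by simp
  have cont: "continuous_on UNIV (p i)" for i
  proof -
    obtain K where K: "\<And>x. p i x \<le> K * norm x" using bd by blast
    have "\<bar>p i x - p i y\<bar> \<le> \<bar>K\<bar> * norm (x - y)" for x y
    proof -
      have "p i x \<le> p i (x - y) + p i y" "p i y \<le> p i (y - x) + p i x"
        using tri[of i "x - y" y] tri[of i "y - x" x] by auto
      moreover have "p i (y - x) = p i (x - y)" using neg[of i "x - y"] by simp
      moreover have "K * norm (x - y) \<le> \<bar>K\<bar> * norm (x - y)" by (intro mult_right_mono) auto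
      ultimately show ?thesis using K[of "x - y"] by linarith
    qed
    hence "\<bar>K\<bar>-lipschitz_on UNIV (p i)"
      by (intro lipschitz_onI) (auto simp: dist_norm)
    thus ?thesis by (rule lipschitz_on_continuous_on)
  qed
  define E where "E k = {x. \<forall>i. p i x \<le> real k}" for k :: nat
  have clE: "closed (E k)" for k
  proof -
    have "E k = (\<Inter>i. {x. p i x \<le> real k})" by (auto simp: E_def)
    moreover have "closed {x. p i x \<le> real k}" for i
      by (intro closed_Collect_le cont continuous_on_const)
    ultimately show ?thesis by auto
  qed
  have "\<Union>(range E) = UNIV"
  proof -
    have "\<exists>k. x \<in> E k" for x
    proof -
      obtain K where K: "\<And>i. p i x \<le> K" using pw by blast
      obtain k :: nat where "K \<le> real k" using real_arch_simple by blast
      thus ?thesis using K by (auto simp: E_def intro: order_trans)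
    qed
    thus ?thesis by auto
  qed
  moreover have "interior (\<Union>(range E)) = {}" if "\<And>k. interior (E k) = {}"
    using Baire_category_alt[of euclidean "range E"] that clE completely_metrizable_space_euclidean
    by (auto simp: closedin_def)
  ultimately obtain k where "interior (E k) \<noteq> {}" by auto
  then obtain x0 where x0: "x0 \<in> interior (E k)" by blast
  obtain r where r: "r > 0" "ball x0 r \<subseteq> E k"
    using x0 by (meson mem_interior)
  have "p i x \<le> (4 * real k / r) * norm x" for i x
  proof (cases "x = 0")
    case True thus ?thesis using hom[of i 0 0] by simp
  next
    case False
    define s where "s = r / (2 * norm x)"
    have s: "s > 0" using False r by (simp add: s_def)
    have "norm (s *\<^sub>R x) < r" using False r by (simp add: s_def)
    hence "x0 + s *\<^sub>R x \<in> E k" using r by (auto simp: dist_norm)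
    moreover have "x0 \<in> E k" using r by auto
    ultimately have "p i (x0 + s *\<^sub>R x) \<le> k" "p i x0 \<le> k" by (auto simp: E_def)
    moreover have "p i (s *\<^sub>R x) \<le> p i (x0 + s *\<^sub>R x) + p i (- x0)"
      using tri[of i "x0 + s *\<^sub>R x" "- x0"] by simp
    ultimately have "s * p i x \<le> 2 * k" using neg[of i x0] hom[of i s x] s by simp
    thus ?thesis using s False r by (simp add: s_def field_simps)
  qed
  thus ?thesis by blast
qed

subsection \<open>Cauchy transforms with square-summable residues\<close>

abbreviation sqsum :: "('i \<Rightarrow> real) \<Rightarrow> 'i set \<Rightarrow> ('i \<Rightarrow> complex) \<Rightarrow> real" where
  "sqsum u A x \<equiv> \<Sum>\<^sub>\<infinity>k\<in>A. (cmod (x k))^2 * u k"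

abbreviation sqsummable :: "('i \<Rightarrow> real) \<Rightarrow> 'i set \<Rightarrow> ('i \<Rightarrow> complex) \<Rightarrow> bool" where
  "sqsummable u A x \<equiv> (\<lambda>k. (cmod (x k))^2 * u k) summable_on A"

definition nsq :: "(nat \<Rightarrow> real) \<Rightarrow> (nat \<Rightarrow> complex) \<Rightarrow> real" where
  "nsq u c = (\<Sum>\<^sub>\<infinity>k. (cmod (c k))^2 * u k)"

definition supp_space :: "(nat \<Rightarrow> real) \<Rightarrow> nat set \<Rightarrow> (nat \<Rightarrow> complex) set" where
  "supp_space u C = {c. (\<forall>k. k \<notin> C \<longrightarrow> c k = 0) \<and> sqsummable u UNIV c}"

text \<open>Terms with \<open>z = \<gamma> k\<close> are 0 by division by zero. Hence the transform
  can be evaluated at a pole that carries no residue, in particular at \<open>\<gamma> p\<close>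
  when a pole is removed, and at the origin.\<close>

definition ctrans :: "(nat \<Rightarrow> complex) \<Rightarrow> (nat \<Rightarrow> complex) \<Rightarrow> complex \<Rightarrow> complex" where
  "ctrans \<gamma> c z = (\<Sum>\<^sub>\<infinity>k. c k / (z - \<gamma> k))"

abbreviation solvable :: "(nat \<Rightarrow> complex) \<Rightarrow> (nat \<Rightarrow> real) \<Rightarrow> nat set \<Rightarrow> 'r set \<Rightarrow> ('r \<Rightarrow> complex) \<Rightarrow> ('r \<Rightarrow> real) \<Rightarrow> real \<Rightarrow> bool" where
  "solvable \<gamma> u C R l w B \<equiv> \<forall>b. sqsummable w R b \<longrightarrow>
     (\<exists>c\<in>supp_space u C. (\<forall>n\<in>R. ctrans \<gamma> c (l n) = b n) \<and> nsq u c \<le> B * sqsum w R b)"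

text \<open>Poles \<open>C\<close> and rows \<open>R\<close> are separate parameters so that each
  can be changed on its own. The first clause only asks for values in the row space; boundedness of
  the transform follows from it by the uniform boundedness principle and is extracted when
  needed.\<close>

definition interp_sys :: "(nat \<Rightarrow> complex) \<Rightarrow> (nat \<Rightarrow> real) \<Rightarrow> nat set \<Rightarrow> 'r set \<Rightarrow> ('r \<Rightarrow> complex) \<Rightarrow> ('r \<Rightarrow> real) \<Rightarrow> bool" where
  "interp_sys \<gamma> u C R l w \<longleftrightarrow>
     (\<forall>c\<in>supp_space u C. sqsummable w R (\<lambda>n. ctrans \<gamma> c (l n))) \<and>
     (\<exists>B\<ge>0. solvable \<gamma> u C R l w B) \<and>
     (\<forall>c\<in>supp_space u C. (\<forall>n\<in>R. ctrans \<gamma> c (l n) = 0) \<longrightarrow> c = (\<lambda>_. 0))"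

lemma supp_spaceD: "c \<in> supp_space u C \<Longrightarrow> k \<notin> C \<Longrightarrow> c k = 0"
  and supp_space_summable: "c \<in> supp_space u C \<Longrightarrow> sqsummable u UNIV c"
  by (auto simp: supp_space_def)

lemma supp_space_mono: "C \<subseteq> D \<Longrightarrow> c \<in> supp_space u C \<Longrightarrow> c \<in> supp_space u D"
  by (auto simp: supp_space_def)

lemma supp_space_restrict: "c \<in> supp_space u D \<Longrightarrow> (\<And>k. k \<notin> C \<Longrightarrow> c k = 0) \<Longrightarrow> c \<in> supp_space u C"
  by (auto simp: supp_space_def)

lemma wsq_summable_add:
  fixes u :: "'a \<Rightarrow> real"
  assumes "\<And>k. k \<in> A \<Longrightarrow> 0 \<le> u k"
    and "sqsummable u A x" "sqsummable u A y"
  shows "sqsummable u A (\<lambda>k. x k + y k)"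
    and "sqsum u A (\<lambda>k. x k + y k) \<le> 2 * sqsum u A x + 2 * sqsum u A y"
proof -
  have le: "(cmod (x k + y k))^2 * u k \<le> 2 * ((cmod (x k))^2 * u k) + 2 * ((cmod (y k))^2 * u k)" if "k \<in> A" for k
    using mult_right_mono[OF cmod_add_sq_le[of "x k" "y k"] assms(1)[OF that]] by (simp add: algebra_simps)
  have s: "(\<lambda>k. 2 * ((cmod (x k))^2 * u k) + 2 * ((cmod (y k))^2 * u k)) summable_on A"
    by (intro summable_on_add summable_on_cmult_right assms)
  show 1: "sqsummable u A (\<lambda>k. x k + y k)"
    by (rule summable_on_comparison_test[OF s]) (use le assms(1) in auto)
  have "sqsum u A (\<lambda>k. x k + y k) \<le> (\<Sum>\<^sub>\<infinity>k\<in>A. 2 * ((cmod (x k))^2 * u k) + 2 * ((cmod (y k))^2 * u k))"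
    by (rule infsum_mono[OF 1 s le])
  also have "\<dots> = 2 * sqsum u A x + 2 * sqsum u A y"
    by (subst infsum_add) (use assms in \<open>auto intro!: summable_on_cmult_right simp: infsum_cmult_right'\<close>)
  finally show "sqsum u A (\<lambda>k. x k + y k) \<le> 2 * sqsum u A x + 2 * sqsum u A y" .
qed

lemma wsq_summable_scale:
  fixes u :: "'a \<Rightarrow> real"
  assumes "sqsummable u A x"
  shows "sqsummable u A (\<lambda>k. r * x k)"
  using summable_on_cmult_right[OF assms, of "(cmod r)^2"] by (simp add: norm_mult power_mult_distrib mult.assoc)

lemma infsum_wsq_scale:
  fixes u :: "'a \<Rightarrow> real"
  shows "sqsum u A (\<lambda>k. r * x k) = (cmod r)^2 * sqsum u A x"
  by (simp add: norm_mult power_mult_distrib mult.assoc infsum_cmult_right')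

text \<open>\<open>away\<close> and \<open>usum\<close> make the kernel at every \<open>z\<close>
  square-summable against the weights, and \<open>away\<close> makes every multiplier
  \<open>(\<gamma> k - \<mu>) / (\<gamma> k - z)\<close> bounded. Together with distinctness of the
  poles this is what adding, removing and comparing systems rests on.\<close>

locale poles =
  fixes \<gamma> :: "nat \<Rightarrow> complex" and u :: "nat \<Rightarrow> real"
  assumes inj: "inj \<gamma>"
    and u_pos: "u k > 0"
    and away: "\<exists>\<delta>>0. \<forall>k. \<gamma> k \<noteq> z \<longrightarrow> \<delta> * (1 + cmod (\<gamma> k)) \<le> cmod (z - \<gamma> k)"
    and usum: "(\<lambda>k. inverse (u k) / (1 + cmod (\<gamma> k))^2) summable_on UNIV"
begin

lemma u_nonneg [simp]: "0 \<le> u k" using u_pos[of k] by simp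

lemma kernel_summable: "(\<lambda>k. inverse (u k) / (cmod (z - \<gamma> k))^2) summable_on UNIV"
proof -
  obtain \<delta> where d: "\<delta> > 0" "\<And>k. \<gamma> k \<noteq> z \<Longrightarrow> \<delta> * (1 + cmod (\<gamma> k)) \<le> cmod (z - \<gamma> k)" using away by blast
  show ?thesis
  proof (rule summable_on_comparison_test)
    show "(\<lambda>k. (1 / \<delta>^2) * (inverse (u k) / (1 + cmod (\<gamma> k))^2)) summable_on UNIV"
      by (intro summable_on_cmult_right usum)
    fix k
    show "inverse (u k) / (cmod (z - \<gamma> k))^2 \<le> (1 / \<delta>^2) * (inverse (u k) / (1 + cmod (\<gamma> k))^2)"
    proof (cases "\<gamma> k = z")
      case False
      have "0 < 1 + cmod (\<gamma> k)" by (smt (verit) norm_ge_zero)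
      hence p: "0 < \<delta> * (1 + cmod (\<gamma> k))" using d by simp
      have "(\<delta> * (1 + cmod (\<gamma> k)))^2 \<le> (cmod (z - \<gamma> k))^2"
        using d(2)[OF False] p by (intro power_mono) auto
      hence "inverse (u k) / (cmod (z - \<gamma> k))^2 \<le> inverse (u k) / (\<delta> * (1 + cmod (\<gamma> k)))^2"
        using p by (intro divide_left_mono) (auto simp: intro!: mult_pos_pos)
      thus ?thesis by (simp add: power_mult_distrib)
    qed simp
  qed simp
qed

lemma bounded_multiplier: "\<exists>B\<ge>0. \<forall>k. cmod ((\<gamma> k - \<mu>) / (\<gamma> k - z)) \<le> B"
proof -
  obtain \<delta> where d: "\<delta> > 0" "\<And>k. \<gamma> k \<noteq> z \<Longrightarrow> \<delta> * (1 + cmod (\<gamma> k)) \<le> cmod (z - \<gamma> k)" using away by blast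
  have "cmod ((\<gamma> k - \<mu>) / (\<gamma> k - z)) \<le> (1 + cmod \<mu>) / \<delta>" for k
  proof (cases "\<gamma> k = z")
    case False
    have p: "0 < 1 + cmod (\<gamma> k)" by (smt (verit) norm_ge_zero)
    have "cmod (\<gamma> k - \<mu>) \<le> (1 + cmod \<mu>) * (1 + cmod (\<gamma> k))"
      using norm_triangle_ineq4[of "\<gamma> k" \<mu>] by (simp add: algebra_simps) (smt (verit) mult_nonneg_nonneg norm_ge_zero)
    hence "cmod (\<gamma> k - \<mu>) * \<delta> \<le> (1 + cmod \<mu>) * (\<delta> * (1 + cmod (\<gamma> k)))"
      using d by (simp add: mult.commute mult.left_commute)
    also have "\<dots> \<le> (1 + cmod \<mu>) * cmod (\<gamma> k - z)"
      using d(2)[OF False] by (intro mult_left_mono) (auto simp: norm_minus_commute)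
    finally show ?thesis using d False by (simp add: norm_divide field_simps)
  qed (use d in simp)
  thus ?thesis using d by (intro exI[of _ "(1 + cmod \<mu>) / \<delta>"]) auto
qed

lemma supp_space_add: "c \<in> supp_space u C \<Longrightarrow> d \<in> supp_space u C \<Longrightarrow> (\<lambda>k. c k + d k) \<in> supp_space u C"
  by (auto simp: supp_space_def intro: wsq_summable_add)

lemma supp_space_scale: "c \<in> supp_space u C \<Longrightarrow> (\<lambda>k. r * c k) \<in> supp_space u C"
  by (auto simp: supp_space_def intro: wsq_summable_scale)

lemma supp_space_diff: "c \<in> supp_space u C \<Longrightarrow> d \<in> supp_space u C \<Longrightarrow> (\<lambda>k. c k - d k) \<in> supp_space u C"
  using supp_space_add[of c C "\<lambda>k. (-1) * d k"] supp_space_scale[of d C "-1"] by simp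

lemma supp_space_zero: "(\<lambda>_. 0) \<in> supp_space u C" by (simp add: supp_space_def)

lemma supp_space_mult:
  assumes "c \<in> supp_space u C" "\<And>k. cmod (m k) \<le> B"
  shows "(\<lambda>k. m k * c k) \<in> supp_space u C" "nsq u (\<lambda>k. m k * c k) \<le> B^2 * nsq u c"
proof -
  have s: "(\<lambda>k. B^2 * ((cmod (c k))^2 * u k)) summable_on UNIV"
    using assms(1) by (intro summable_on_cmult_right supp_space_summable)
  have le: "(cmod (m k * c k))^2 * u k \<le> B^2 * ((cmod (c k))^2 * u k)" for k
  proof -
    have "(cmod (m k))^2 \<le> B^2" using assms(2) by (intro power_mono) auto
    hence "(cmod (m k))^2 * ((cmod (c k))^2 * u k) \<le> B^2 * ((cmod (c k))^2 * u k)"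
      by (intro mult_right_mono) auto
    thus ?thesis by (simp add: norm_mult power_mult_distrib mult.assoc)
  qed
  have s2: "sqsummable u UNIV (\<lambda>k. m k * c k)"
    by (rule summable_on_comparison_test[OF s]) (use le in auto)
  thus "(\<lambda>k. m k * c k) \<in> supp_space u C" using assms(1) by (auto simp: supp_space_def)
  show "nsq u (\<lambda>k. m k * c k) \<le> B^2 * nsq u c"
    unfolding nsq_def infsum_cmult_right'[symmetric] by (rule infsum_mono[OF s2 s le])
qed

lemma nsq_nonneg [simp]: "0 \<le> nsq u c" by (auto simp: nsq_def intro: infsum_nonneg)

lemma nsq_scale: "nsq u (\<lambda>k. r * c k) = (cmod r)^2 * nsq u c"
  by (simp add: nsq_def infsum_wsq_scale)

lemma nsq_add_le: "c \<in> supp_space u C \<Longrightarrow> d \<in> supp_space u D \<Longrightarrow> nsq u (\<lambda>k. c k + d k) \<le> 2 * nsq u c + 2 * nsq u d"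
  unfolding nsq_def by (rule wsq_summable_add) (auto simp: supp_space_def)

lemma term_le_nsq: "c \<in> supp_space u C \<Longrightarrow> (cmod (c k))^2 * u k \<le> nsq u c"
  using finite_sum_le_infsum[of "\<lambda>k. (cmod (c k))^2 * u k" UNIV "{k}"] by (simp add: nsq_def supp_space_def)

lemma nsq_le_0: "c \<in> supp_space u C \<Longrightarrow> nsq u c \<le> 0 \<Longrightarrow> c = (\<lambda>_. 0)"
  using term_le_nsq[of c C] u_pos by (intro ext) (smt (verit) mult_pos_pos norm_ge_zero power2_less_eq_zero_iff zero_less_power2 norm_eq_zero)

lemma unit_supp_space: "(\<lambda>j. if j = k then 1 else 0) \<in> supp_space u {k}"
  and nsq_unit: "nsq u (\<lambda>j. if j = k then 1 else 0) = u k"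
  and ctrans_unit: "ctrans \<gamma> (\<lambda>j. if j = k then 1 else 0) z = 1 / (z - \<gamma> k)"
proof -
  have 1: "((\<lambda>j. (cmod (if j = k then 1 else 0))^2 * u j) has_sum u k) UNIV"
    by (rule has_sum_finite_neutralI[where B="{k}"]) auto
  show "(\<lambda>j. if j = k then 1 else 0) \<in> supp_space u {k}"
    using 1 by (auto simp: supp_space_def summable_on_def)
  show "nsq u (\<lambda>j. if j = k then 1 else 0) = u k"
    unfolding nsq_def by (rule infsumI[OF 1])
  show "ctrans \<gamma> (\<lambda>j. if j = k then 1 else 0) z = 1 / (z - \<gamma> k)"
    unfolding ctrans_def
    by (rule infsumI, rule has_sum_finite_neutralI[where B="{k}"]) auto
qed

text \<open>Cauchy-Schwarz with the factor \<open>sqrt (u k)\<close> on the residue and its inverse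
  on the kernel. The kernel sum runs over \<open>C\<close> only: for residues supported far out it
  is a tail, and its smallness is what later arguments use.\<close>

lemma
  assumes "c \<in> supp_space u C"
  shows ctrans_abs_summable: "(\<lambda>k. cmod (c k / (z - \<gamma> k))) summable_on UNIV"
    and ctrans_sq_le: "(cmod (ctrans \<gamma> c z))^2 \<le> nsq u c * (\<Sum>\<^sub>\<infinity>k\<in>C. inverse (u k) / (cmod (z - \<gamma> k))^2)"
proof -
  define f where "f k = c k * of_real (sqrt (u k))" for k
  define g where "g k = inverse (of_real (sqrt (u k)) * (z - \<gamma> k))" for k
  have fg: "c k / (z - \<gamma> k) = f k * g k" for k
    using u_pos[of k] by (simp add: f_def g_def divide_inverse)
  have f2: "(cmod (f k))^2 = (cmod (c k))^2 * u k" for k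
    using u_pos[of k] by (simp add: f_def norm_mult power_mult_distrib)
  have g2: "(cmod (g k))^2 = inverse (u k) / (cmod (z - \<gamma> k))^2" for k
    using u_pos[of k] by (simp add: g_def norm_mult norm_inverse power_mult_distrib power_inverse divide_inverse)
  have s: "sqsummable u UNIV c" by (rule supp_space_summable[OF assms])
  have sf: "(\<lambda>k. (cmod (f k))^2) summable_on UNIV" unfolding f2 by (rule s)
  have sg: "(\<lambda>k. (cmod (g k))^2) summable_on UNIV" unfolding g2 by (rule kernel_summable)
  show "(\<lambda>k. cmod (c k / (z - \<gamma> k))) summable_on UNIV"
    unfolding fg by (rule infsum_Cauchy_Schwarz[OF sf sg])
  have sfC: "(\<lambda>k. (cmod (f k))^2) summable_on C" and sgC: "(\<lambda>k. (cmod (g k))^2) summable_on C"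
    using sf sg by (auto intro: summable_on_subset_banach)
  have "ctrans \<gamma> c z = infsum (\<lambda>k. f k * g k) C"
    unfolding ctrans_def fg by (rule infsum_cong_neutral) (use supp_spaceD[OF assms] in \<open>auto simp: f_def\<close>)
  hence "(cmod (ctrans \<gamma> c z))^2 \<le> infsum (\<lambda>k. (cmod (f k))^2) C * infsum (\<lambda>k. (cmod (g k))^2) C"
    using infsum_Cauchy_Schwarz(3)[OF sfC sgC] by simp
  also have "infsum (\<lambda>k. (cmod (f k))^2) C = nsq u c"
    unfolding nsq_def f2 by (rule infsum_cong_neutral) (use supp_spaceD[OF assms] in auto)
  finally show "(cmod (ctrans \<gamma> c z))^2 \<le> nsq u c * (\<Sum>\<^sub>\<infinity>k\<in>C. inverse (u k) / (cmod (z - \<gamma> k))^2)"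
    by (simp add: g2)
qed

lemma ctrans_summable: "c \<in> supp_space u C \<Longrightarrow> (\<lambda>k. c k / (z - \<gamma> k)) summable_on UNIV"
  by (rule abs_summable_summable, rule ctrans_abs_summable)

lemma ctrans_add: "c \<in> supp_space u C \<Longrightarrow> d \<in> supp_space u D \<Longrightarrow>
    ctrans \<gamma> (\<lambda>k. c k + d k) z = ctrans \<gamma> c z + ctrans \<gamma> d z"
  unfolding ctrans_def add_divide_distrib by (intro infsum_add ctrans_summable)

lemma ctrans_scale: "ctrans \<gamma> (\<lambda>k. r * c k) z = r * ctrans \<gamma> c z"
  unfolding ctrans_def times_divide_eq_right[symmetric] by (rule infsum_cmult_right')

lemma ctrans_diff: "c \<in> supp_space u C \<Longrightarrow> d \<in> supp_space u D \<Longrightarrow>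
    ctrans \<gamma> (\<lambda>k. c k - d k) z = ctrans \<gamma> c z - ctrans \<gamma> d z"
  using ctrans_add[of c C "\<lambda>k. (-1) * d k" D] supp_space_scale[of d D "-1"] ctrans_scale[of "-1" d] by simp

lemma ctrans_zero [simp]: "ctrans \<gamma> (\<lambda>_. 0) z = 0" by (simp add: ctrans_def)

lemma mobius_supp_space: "c \<in> supp_space u C \<Longrightarrow> (\<lambda>k. (\<gamma> k - \<mu>) / (\<gamma> k - \<zeta>) * c k) \<in> supp_space u C"
proof -
  assume c: "c \<in> supp_space u C"
  obtain B where "\<And>k. cmod ((\<gamma> k - \<mu>) / (\<gamma> k - \<zeta>)) \<le> B" using bounded_multiplier by blast
  thus ?thesis by (rule supp_space_mult(1)[OF c])
qed

text \<open>If the transform of \<open>c\<close> vanishes at \<open>\<zeta>\<close>, this moves that zero to \<open>\<mu>\<close>.\<close>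

lemma ctrans_mobius:
  assumes c: "c \<in> supp_space u C" and z: "z \<noteq> \<zeta>"
    and supp: "\<And>k. k \<in> C \<Longrightarrow> \<gamma> k \<noteq> z" "\<And>k. k \<in> C \<Longrightarrow> \<gamma> k \<noteq> \<zeta>"
  shows "ctrans \<gamma> (\<lambda>k. (\<gamma> k - \<mu>) / (\<gamma> k - \<zeta>) * c k) z = ((z - \<mu>) * ctrans \<gamma> c z - (\<zeta> - \<mu>) * ctrans \<gamma> c \<zeta>) / (z - \<zeta>)"
proof -
  have "(\<gamma> k - \<mu>) / (\<gamma> k - \<zeta>) * c k / (z - \<gamma> k) = (z - \<mu>) / (z - \<zeta>) * (c k / (z - \<gamma> k)) - (\<zeta> - \<mu>) / (z - \<zeta>) * (c k / (\<zeta> - \<gamma> k))" for k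
  proof (cases "k \<in> C")
    case True
    hence "\<gamma> k \<noteq> z" "\<gamma> k \<noteq> \<zeta>" using supp by auto
    hence nz: "z - \<gamma> k \<noteq> 0" "\<zeta> - \<gamma> k \<noteq> 0" "\<gamma> k - \<zeta> \<noteq> 0" "z - \<zeta> \<noteq> 0" using z by auto
    have e: "\<gamma> k - \<zeta> = - (\<zeta> - \<gamma> k)" by simp
    show ?thesis using nz unfolding e by (simp add: divide_simps del: minus_diff_eq) (simp add: algebra_simps)
  qed (use supp_spaceD[OF c] in simp)
  hence "ctrans \<gamma> (\<lambda>k. (\<gamma> k - \<mu>) / (\<gamma> k - \<zeta>) * c k) z =
      (\<Sum>\<^sub>\<infinity>k. (z - \<mu>) / (z - \<zeta>) * (c k / (z - \<gamma> k)) - (\<zeta> - \<mu>) / (z - \<zeta>) * (c k / (\<zeta> - \<gamma> k)))"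
    by (simp add: ctrans_def)
  also have "\<dots> = (\<Sum>\<^sub>\<infinity>k. (z - \<mu>) / (z - \<zeta>) * (c k / (z - \<gamma> k)) + (- ((\<zeta> - \<mu>) / (z - \<zeta>))) * (c k / (\<zeta> - \<gamma> k)))"
    by simp
  also have "\<dots> = (z - \<mu>) / (z - \<zeta>) * ctrans \<gamma> c z + (- ((\<zeta> - \<mu>) / (z - \<zeta>))) * ctrans \<gamma> c \<zeta>"
    unfolding ctrans_def infsum_cmult_right'[symmetric]
    by (intro infsum_add summable_on_cmult_right ctrans_summable[OF c])
  also have "\<dots> = ((z - \<mu>) * ctrans \<gamma> c z - (\<zeta> - \<mu>) * ctrans \<gamma> c \<zeta>) / (z - \<zeta>)"
  proof -
    have "p / d * x + (- (q / d)) * y = (p * x - q * y) / d" for p q x y d :: complex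
      by (simp add: diff_divide_distrib)
    thus ?thesis .
  qed
  finally show ?thesis .
qed

end

lemma interp_sysD:
  assumes "interp_sys \<gamma> u C R l w"
  shows "c \<in> supp_space u C \<Longrightarrow> sqsummable w R (\<lambda>n. ctrans \<gamma> c (l n))"
    and "c \<in> supp_space u C \<Longrightarrow> (\<And>n. n \<in> R \<Longrightarrow> ctrans \<gamma> c (l n) = 0) \<Longrightarrow> c = (\<lambda>_. 0)"
proof -
  note a = assms[unfolded interp_sys_def]
  show "c \<in> supp_space u C \<Longrightarrow> sqsummable w R (\<lambda>n. ctrans \<gamma> c (l n))"
    by (rule bspec[OF conjunct1[OF a]])
  show "c \<in> supp_space u C \<Longrightarrow> (\<And>n. n \<in> R \<Longrightarrow> ctrans \<gamma> c (l n) = 0) \<Longrightarrow> c = (\<lambda>_. 0)"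
    using conjunct2[OF conjunct2[OF a]] by blast
qed

lemma interp_sys_solve:
  assumes "interp_sys \<gamma> u C R l w"
  obtains B where "B \<ge> 0" "solvable \<gamma> u C R l w B"
  using conjunct1[OF conjunct2[OF assms[unfolded interp_sys_def]]] by (elim exE conjE)

context poles
begin

lemma remove_pole:
  assumes c: "c \<in> supp_space u (insert p C)" and p: "p \<notin> C"
  defines "c' \<equiv> \<lambda>k. c k - c p * (if k = p then 1 else 0)"
  shows "c' \<in> supp_space u C" "ctrans \<gamma> c z = ctrans \<gamma> c' z + c p / (z - \<gamma> p)"
proof -
  have un: "(\<lambda>k. c p * (if k = p then 1 else 0)) \<in> supp_space u (insert p C)"
    by (intro supp_space_scale supp_space_mono[OF _ unit_supp_space]) auto
  have "c' \<in> supp_space u (insert p C)"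
    unfolding c'_def by (rule supp_space_diff[OF c un])
  thus "c' \<in> supp_space u C"
    by (rule supp_space_restrict) (use supp_spaceD[OF c] in \<open>auto simp: c'_def\<close>)
  show "ctrans \<gamma> c z = ctrans \<gamma> c' z + c p / (z - \<gamma> p)"
    unfolding c'_def by (simp only: ctrans_diff[OF c un] ctrans_scale ctrans_unit) simp
qed

text \<open>Injectivity is inherited through a multiplier that trades the new zero for the new pole.
  For surjectivity, the old system is solved and then corrected at the new row by a multiple of a
  vector that vanishes on all old rows; \<open>col\<close> allows the column of the new pole to be
  used as data for the old system.\<close>

lemma interp_sys_insert:
  assumes sys: "interp_sys \<gamma> u C R l w" and p: "p \<notin> C" and r: "r \<notin> R"
    and w: "\<And>n. n \<in> insert r R \<Longrightarrow> w n > 0"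
    and lr: "\<And>n. n \<in> R \<Longrightarrow> l n \<noteq> l r"
    and lg: "\<And>n k. n \<in> insert r R \<Longrightarrow> k \<in> insert p C \<Longrightarrow> l n \<noteq> \<gamma> k"
    and col: "(\<lambda>n. w n / (cmod (l n - \<gamma> p))^2) summable_on R"
  shows "interp_sys \<gamma> u (insert p C) (insert r R) l w"
proof -
  have wn: "\<And>n. n \<in> R \<Longrightarrow> 0 \<le> w n" using w by (simp add: less_imp_le)
  have col': "sqsummable w R (\<lambda>n. t / (l n - \<gamma> p))" for t
    using summable_on_cmult_right[OF col, of "(cmod t)^2"]
    by (simp add: norm_divide power_divide algebra_simps)
  have inj0: "c = (\<lambda>_. 0)" if c: "c \<in> supp_space u (insert p C)" and z: "\<And>n. n \<in> insert r R \<Longrightarrow> ctrans \<gamma> c (l n) = 0" for c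
  proof -
    \<comment> \<open>The factor vanishes at \<open>k = p\<close> and so removes the new residue; in
      exchange the zero at \<open>l r\<close> moves to \<open>\<gamma> p\<close>, while the zeros on
      \<open>R\<close> remain.\<close>
    define c' where "c' k = (\<gamma> k - \<gamma> p) / (\<gamma> k - l r) * c k" for k
    have "c' \<in> supp_space u (insert p C)"
      unfolding c'_def using mobius_supp_space[OF c] .
    hence c': "c' \<in> supp_space u C"
    proof (rule supp_space_restrict)
      show "c' k = 0" if "k \<notin> C" for k
        using that supp_spaceD[OF c, of k] by (cases "k = p") (auto simp: c'_def)
    qed
    have "ctrans \<gamma> c' (l n) = 0" if n: "n \<in> R" for n
    proof -
      have "\<gamma> k \<noteq> l n" "\<gamma> k \<noteq> l r" if "k \<in> insert p C" for k
        using lg[of n k] lg[of r k] n that by auto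
      hence "ctrans \<gamma> c' (l n) = ((l n - \<gamma> p) * ctrans \<gamma> c (l n) - (l r - \<gamma> p) * ctrans \<gamma> c (l r)) / (l n - l r)"
        unfolding c'_def using lr[OF n] by (intro ctrans_mobius[OF c]) auto
      thus ?thesis using z n by simp
    qed
    hence 0: "c' = (\<lambda>_. 0)" by (rule interp_sysD(2)[OF sys c'])
    have z0: "c k = 0" if "k \<noteq> p" for k
    proof (cases "k \<in> C")
      case True
      have "(\<gamma> k - \<gamma> p) / (\<gamma> k - l r) * c k = 0" using fun_cong[OF 0, of k] by (simp add: c'_def)
      moreover have "\<gamma> k \<noteq> \<gamma> p" using inj that by (auto dest: injD)
      moreover have "l r \<noteq> \<gamma> k" using lg True by auto
      ultimately show ?thesis by auto
    next
      case False thus ?thesis using that supp_spaceD[OF c] by auto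
    qed
    have "(\<lambda>k. c k - c p * (if k = p then 1 else 0)) = (\<lambda>_. 0)"
      using z0 by auto
    hence "c p / (l r - \<gamma> p) = 0"
      using remove_pole(2)[OF c p, of "l r"] z[of r] by (simp del: mult_eq_0_iff)
    thus ?thesis using z0 lg[of r p] by (intro ext) (metis divide_eq_0_iff insertI1 right_minus_eq)
  qed
  obtain B where B: "B \<ge> 0" "solvable \<gamma> u C R l w B"
    by (rule interp_sys_solve[OF sys]) (rule that; assumption)
  obtain e where e: "e \<in> supp_space u C" "\<And>n. n \<in> R \<Longrightarrow> ctrans \<gamma> e (l n) = (-1) / (l n - \<gamma> p)"
    using B(2)[rule_format, OF col'] by blast
  \<comment> \<open>Unit residue at the new pole, with the old poles cancelling its values on all of
    \<open>R\<close>; its value \<open>D\<close> at the new row is nonzero by injectivity.\<close>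
  define e' where "e' k = e k + (if k = p then 1 else 0)" for k
  have e': "e' \<in> supp_space u (insert p C)"
    unfolding e'_def by (intro supp_space_add supp_space_mono[OF _ e(1)] supp_space_mono[OF _ unit_supp_space]) auto
  have ce': "ctrans \<gamma> e' z = ctrans \<gamma> e z + 1 / (z - \<gamma> p)" for z
    unfolding e'_def by (simp add: ctrans_add[OF e(1) unit_supp_space] ctrans_unit)
  define D where "D = ctrans \<gamma> e' (l r)"
  have D: "D \<noteq> 0"
  proof
    assume "D = 0"
    hence "e' = (\<lambda>_. 0)"
      by (intro inj0[OF e']) (use e(2) ce' in \<open>auto simp: D_def\<close>)
    hence "e' p = 0" by simp
    thus False using supp_spaceD[OF e(1) p] by (simp add: e'_def)
  qed
  define K where "K = (\<Sum>\<^sub>\<infinity>k\<in>C. inverse (u k) / (cmod (l r - \<gamma> k))^2)"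
  have K: "K \<ge> 0" unfolding K_def by (auto intro!: infsum_nonneg)
  \<comment> \<open>The bound for the old solution plus that for the correction, whose coefficient
    is controlled by \<open>b r\<close> (through \<open>w r\<close>) and by the value of the old
    solution at the new row (through \<open>K * B\<close>).\<close>
  define B' where "B' = 2 * B + 2 * (((2 / w r + 2 * (K * B)) / (cmod D)^2) * nsq u e')"
  have surj: "\<exists>c\<in>supp_space u (insert p C). (\<forall>n\<in>insert r R. ctrans \<gamma> c (l n) = b n) \<and> nsq u c \<le> B' * sqsum w (insert r R) b"
    if b: "sqsummable w (insert r R) b" for b
  proof -
    have bR: "sqsummable w R b"
      using b by (simp add: summable_on_insert_iff)
    define S where "S = sqsum w (insert r R) b"
    define S0 where "S0 = sqsum w R b"
    have S: "S = (cmod (b r))^2 * w r + S0"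
      unfolding S_def S0_def by (rule infsum_insert[OF bR r])
    have S0: "0 \<le> S0" unfolding S0_def by (auto intro!: infsum_nonneg simp: wn)
    have wr: "w r > 0" using w by simp
    have br: "0 \<le> (cmod (b r))^2 * w r" using wr by simp
    obtain a where a: "a \<in> supp_space u C" "\<And>n. n \<in> R \<Longrightarrow> ctrans \<gamma> a (l n) = b n" "nsq u a \<le> B * S0"
      using B(2)[rule_format, OF bR] unfolding S0_def by blast
    define t where "t = (b r - ctrans \<gamma> a (l r)) / D"
    define c where "c k = a k + t * e' k" for k
    have a': "a \<in> supp_space u (insert p C)" by (rule supp_space_mono[OF _ a(1)]) auto
    have te: "(\<lambda>k. t * e' k) \<in> supp_space u (insert p C)" by (rule supp_space_scale[OF e'])
    have c: "c \<in> supp_space u (insert p C)" unfolding c_def by (rule supp_space_add[OF a' te])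
    have cc: "ctrans \<gamma> c z = ctrans \<gamma> a z + t * ctrans \<gamma> e' z" for z
      unfolding c_def by (simp add: ctrans_add[OF a' te] ctrans_scale)
    have int: "ctrans \<gamma> c (l n) = b n" if "n \<in> insert r R" for n
    proof (cases "n = r")
      case True thus ?thesis using D by (simp add: cc t_def D_def[symmetric])
    next
      case False
      hence "n \<in> R" using that by simp
      thus ?thesis using a(2) e(2) by (simp add: cc ce')
    qed
    have BS: "B * S0 \<le> B * S" using B(1) S br by (intro mult_left_mono) auto
    have "(cmod (ctrans \<gamma> a (l r)))^2 \<le> K * B * S"
      using ctrans_sq_le[OF a(1), of "l r"] a(3) BS K unfolding K_def[symmetric]
      by (smt (verit, best) mult.assoc mult.commute mult_left_mono)
    moreover have "(cmod (b r))^2 \<le> S / w r" using S S0 wr by (simp add: field_simps)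
    ultimately have "(cmod (b r - ctrans \<gamma> a (l r)))^2 \<le> 2 * (S / w r) + 2 * (K * B * S)"
      using cmod_diff_sq_le[of "b r" "ctrans \<gamma> a (l r)"] by linarith
    also have "\<dots> = (2 / w r + 2 * (K * B)) * S" by (simp add: algebra_simps)
    finally have "(cmod (b r - ctrans \<gamma> a (l r)))^2 \<le> (2 / w r + 2 * (K * B)) * S" .
    hence t: "(cmod t)^2 \<le> (2 / w r + 2 * (K * B)) / (cmod D)^2 * S"
      by (simp add: t_def norm_divide power_divide divide_right_mono)
    have "nsq u c \<le> 2 * nsq u a + 2 * nsq u (\<lambda>k. t * e' k)"
      unfolding c_def by (rule nsq_add_le[OF a' te])
    also have "\<dots> \<le> 2 * (B * S) + 2 * ((2 / w r + 2 * (K * B)) / (cmod D)^2 * S * nsq u e')"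
      unfolding nsq_scale using a(3) BS t by (intro add_mono mult_left_mono mult_right_mono) auto
    also have "\<dots> = B' * S" by (simp add: B'_def algebra_simps)
    finally show ?thesis using c int S_def by blast
  qed
  have "B' \<ge> 0" unfolding B'_def using B(1) K w[of r] by (intro add_nonneg_nonneg mult_nonneg_nonneg divide_nonneg_nonneg) auto
  moreover have "sqsummable w (insert r R) (\<lambda>n. ctrans \<gamma> c (l n))" if c: "c \<in> supp_space u (insert p C)" for c
  proof -
    have "sqsummable w R (\<lambda>n. ctrans \<gamma> c (l n))"
      unfolding remove_pole(2)[OF c p]
      by (intro wsq_summable_add(1) wn interp_sysD(1)[OF sys remove_pole(1)[OF c p]] col')
    thus ?thesis by (simp add: summable_on_insert_iff)
  qed
  ultimately show ?thesis unfolding interp_sys_def using inj0 surj by blast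
qed

text \<open>The reverse exchange: a null vector of the smaller system becomes a null vector of the
  larger one when its transform is multiplied by \<open>(z - l r) / (z - \<gamma> p)\<close>.
  Solutions of the larger system are freed of their residue at \<open>p\<close> with the help of the
  vector \<open>e\<close> that answers unit data at \<open>r\<close>.\<close>

lemma interp_sys_remove:
  assumes sys: "interp_sys \<gamma> u (insert p C) (insert r R) l w" and p: "p \<notin> C" and r: "r \<notin> R"
    and lr: "\<And>n. n \<in> R \<Longrightarrow> l n \<noteq> l r"
    and lg: "\<And>n k. n \<in> insert r R \<Longrightarrow> k \<in> insert p C \<Longrightarrow> l n \<noteq> \<gamma> k"
  shows "interp_sys \<gamma> u C R l w"
proof -
  have inj0: "c = (\<lambda>_. 0)" if c: "c \<in> supp_space u C" and z: "\<And>n. n \<in> R \<Longrightarrow> ctrans \<gamma> c (l n) = 0" for c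
  proof -
    \<comment> \<open>Residue at \<open>\<gamma> p\<close> of the product of
      \<open>(z - l r) / (z - \<gamma> p)\<close> with the transform of \<open>c\<close>.\<close>
    define s where "s = (\<gamma> p - l r) * ctrans \<gamma> c (\<gamma> p)"
    define c1 where "c1 k = (\<gamma> k - l r) / (\<gamma> k - \<gamma> p) * c k" for k
    define c' where "c' k = c1 k + s * (if k = p then 1 else 0)" for k
    have c1: "c1 \<in> supp_space u C" unfolding c1_def by (rule mobius_supp_space[OF c])
    have un: "(\<lambda>k. s * (if k = p then 1 else 0)) \<in> supp_space u {p}"
      by (rule supp_space_scale[OF unit_supp_space])
    have c': "c' \<in> supp_space u (insert p C)"
      unfolding c'_def by (intro supp_space_add supp_space_mono[OF _ c1] supp_space_mono[OF _ un]) auto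
    have gp: "\<gamma> k \<noteq> \<gamma> p" if "k \<in> C" for k using that p inj by (auto dest: injD)
    have tr: "ctrans \<gamma> c' (l n) = (l n - l r) * ctrans \<gamma> c (l n) / (l n - \<gamma> p)" if n: "n \<in> insert r R" for n
    proof -
      have "l n \<noteq> \<gamma> p" using lg n by auto
      moreover have "ctrans \<gamma> c1 (l n) = ((l n - l r) * ctrans \<gamma> c (l n) - (\<gamma> p - l r) * ctrans \<gamma> c (\<gamma> p)) / (l n - \<gamma> p)"
      proof -
        have "\<gamma> k \<noteq> l n" if "k \<in> C" for k using lg[of n k] n that by auto
        thus ?thesis unfolding c1_def using gp \<open>l n \<noteq> \<gamma> p\<close> by (intro ctrans_mobius[OF c]) auto
      qed
      ultimately show ?thesis
        unfolding c'_def ctrans_add[OF c1 un] ctrans_scale ctrans_unit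
        by (simp add: s_def diff_divide_distrib)
    qed
    have "c' = (\<lambda>_. 0)"
      by (rule interp_sysD(2)[OF sys c']) (use tr z in auto)
    have "c k = 0" if "k \<in> C" for k
    proof -
      have "c' k = 0" using \<open>c' = (\<lambda>_. 0)\<close> by simp
      moreover have "k \<noteq> p" using that p by auto
      ultimately have "(\<gamma> k - l r) / (\<gamma> k - \<gamma> p) * c k = 0" by (simp add: c'_def c1_def)
      moreover have "l r \<noteq> \<gamma> k" using lg that by auto
      ultimately show ?thesis using gp[OF that] by auto
    qed
    thus ?thesis using supp_spaceD[OF c] by (intro ext) blast
  qed
  obtain B where B: "B \<ge> 0" "solvable \<gamma> u (insert p C) (insert r R) l w B"
    by (rule interp_sys_solve[OF sys]) (rule that; assumption)
  have "sqsummable w R (\<lambda>n. if n = r then 1 else 0 :: complex)"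
    by (rule summable_on_cong[THEN iffD2, of _ _ "\<lambda>_. 0"]) (use r in auto)
  hence "sqsummable w (insert r R) (\<lambda>n. if n = r then 1 else 0 :: complex)"
    by (simp add: summable_on_insert_iff)
  from B(2)[rule_format, OF this] obtain e where e: "e \<in> supp_space u (insert p C)" "\<And>n. n \<in> insert r R \<Longrightarrow> ctrans \<gamma> e (l n) = (if n = r then 1 else 0)"
    by blast
  \<comment> \<open>Without a residue at \<open>p\<close>, \<open>e\<close> would be a null vector
    of the smaller system, contradicting its value 1 at \<open>r\<close>.\<close>
  have ep: "e p \<noteq> 0"
  proof
    assume "e p = 0"
    hence "e k = 0" if "k \<notin> C" for k using that supp_spaceD[OF e(1), of k] by (cases "k = p") auto
    hence "e \<in> supp_space u C" by (rule supp_space_restrict[OF e(1)])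
    hence "e = (\<lambda>_. 0)" by (rule inj0) (use e(2) r in auto)
    thus False using e(2)[of r] by simp
  qed
  define B' where "B' = 2 * B + 2 * (B / (u p * (cmod (e p))^2) * nsq u e)"
  have surj: "\<exists>c\<in>supp_space u C. (\<forall>n\<in>R. ctrans \<gamma> c (l n) = b n) \<and> nsq u c \<le> B' * sqsum w R b"
    if b: "sqsummable w R b" for b
  proof -
    define b' where "b' n = (if n = r then 0 else b n)" for n
    have 1: "sqsummable w R b'"
      by (rule summable_on_cong[THEN iffD2, OF _ b]) (use r in \<open>auto simp: b'_def\<close>)
    hence 2: "sqsummable w (insert r R) b'"
      by (simp add: summable_on_insert_iff)
    define S where "S = sqsum w R b"
    have "sqsum w (insert r R) b' = sqsum w R b'"
      by (subst infsum_insert[OF 1 r]) (simp add: b'_def)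
    also have "\<dots> = S" unfolding S_def by (rule infsum_cong) (use r in \<open>auto simp: b'_def\<close>)
    finally obtain a where a: "a \<in> supp_space u (insert p C)" "\<And>n. n \<in> insert r R \<Longrightarrow> ctrans \<gamma> a (l n) = b' n" "nsq u a \<le> B * S"
      using B(2)[rule_format, OF 2] by auto
    define t where "t = - a p / e p"
    define c where "c k = a k + t * e k" for k
    have te: "(\<lambda>k. t * e k) \<in> supp_space u (insert p C)" by (rule supp_space_scale[OF e(1)])
    have c0: "c \<in> supp_space u (insert p C)" unfolding c_def by (rule supp_space_add[OF a(1) te])
    have "c p = 0" using ep by (simp add: c_def t_def)
    hence "c k = 0" if "k \<notin> C" for k using that supp_spaceD[OF c0, of k] by (cases "k = p") auto
    hence c: "c \<in> supp_space u C" by (rule supp_space_restrict[OF c0])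
    have int: "ctrans \<gamma> c (l n) = b n" if "n \<in> R" for n
      using that r unfolding c_def ctrans_add[OF a(1) te] ctrans_scale
      by (auto simp: a(2) e(2) b'_def)
    have "(cmod (a p))^2 * u p \<le> B * S" using term_le_nsq[OF a(1), of p] a(3) by linarith
    hence "(cmod (a p))^2 \<le> B * S / u p" using u_pos[of p] by (simp add: field_simps)
    hence t: "(cmod t)^2 \<le> B / (u p * (cmod (e p))^2) * S"
      using ep by (simp add: t_def norm_divide power_divide field_simps)
    have "nsq u c \<le> 2 * nsq u a + 2 * nsq u (\<lambda>k. t * e k)"
      unfolding c_def by (rule nsq_add_le[OF a(1) te])
    also have "\<dots> \<le> 2 * (B * S) + 2 * (B / (u p * (cmod (e p))^2) * S * nsq u e)"
      unfolding nsq_scale using a(3) t by (intro add_mono mult_left_mono mult_right_mono) auto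
    also have "\<dots> = B' * S" by (simp add: B'_def algebra_simps)
    finally show ?thesis using c int S_def by blast
  qed
  have "B' \<ge> 0" unfolding B'_def using B(1) u_pos[of p] by (intro add_nonneg_nonneg mult_nonneg_nonneg divide_nonneg_nonneg) auto
  moreover have "sqsummable w R (\<lambda>n. ctrans \<gamma> c (l n))" if c: "c \<in> supp_space u C" for c
    using interp_sysD(1)[OF sys supp_space_mono[OF _ c]] by (auto simp: summable_on_insert_iff)
  ultimately show ?thesis unfolding interp_sys_def using inj0 surj by blast
qed

text \<open>The values of the column of an extra pole can already be interpolated from
  \<open>C\<close>, and the difference of the two would be a nonzero null vector of the larger
  system.\<close>

lemma interp_sys_unique:
  assumes "interp_sys \<gamma> u C R l w" "interp_sys \<gamma> u D R l w" "C \<subseteq> D"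
  shows "C = D"
proof (rule ccontr)
  assume "C \<noteq> D"
  then obtain k where k: "k \<in> D" "k \<notin> C" using assms(3) by blast
  define e :: "nat \<Rightarrow> complex" where "e = (\<lambda>j. if j = k then 1 else 0)"
  have e: "e \<in> supp_space u D" unfolding e_def by (rule supp_space_mono[OF _ unit_supp_space]) (use k in auto)
  obtain B where B: "B \<ge> 0" "solvable \<gamma> u C R l w B"
    by (rule interp_sys_solve[OF assms(1)]) (rule that; assumption)
  obtain c where c: "c \<in> supp_space u C" "\<And>n. n \<in> R \<Longrightarrow> ctrans \<gamma> c (l n) = ctrans \<gamma> e (l n)"
    using B(2)[rule_format, OF interp_sysD(1)[OF assms(2) e]] by blast
  have cD: "c \<in> supp_space u D" by (rule supp_space_mono[OF assms(3) c(1)])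
  have "(\<lambda>k. c k - e k) = (\<lambda>_. 0)"
    by (rule interp_sysD(2)[OF assms(2) supp_space_diff[OF cD e]]) (simp add: ctrans_diff[OF cD e] c(2))
  hence "c k = e k" by (metis right_minus_eq)
  thus False using supp_spaceD[OF c(1) k(2)] by (simp add: e_def)
qed

end

lemma interp_sys_cong_rows:
  assumes "\<And>n. n \<in> R \<Longrightarrow> l n = l' n" "\<And>n. n \<in> R \<Longrightarrow> w n = w' n"
  shows "interp_sys \<gamma> u C R l w \<longleftrightarrow> interp_sys \<gamma> u C R l' w'"
proof -
  have "sqsummable w R b \<longleftrightarrow> (\<lambda>n. (cmod (b n))^2 * w' n) summable_on R" for b
    by (rule summable_on_cong) (use assms in auto)
  moreover have "sqsummable w R (\<lambda>n. ctrans \<gamma> c (l n)) \<longleftrightarrow> (\<lambda>n. (cmod (ctrans \<gamma> c (l' n)))^2 * w' n) summable_on R" for c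
    by (rule summable_on_cong) (use assms in auto)
  moreover have "sqsum w R b = (\<Sum>\<^sub>\<infinity>n\<in>R. (cmod (b n))^2 * w' n)" for b
    by (rule infsum_cong) (use assms in auto)
  ultimately show ?thesis using assms(1) by (simp add: interp_sys_def cong: ball_cong)
qed

lemma interp_sys_reindex:
  assumes f: "inj_on f R"
  shows "interp_sys \<gamma> u C (f ` R) l w \<longleftrightarrow> interp_sys \<gamma> u C R (\<lambda>n. l (f n)) (\<lambda>n. w (f n))"
proof -
  have s: "(\<lambda>n. F n) summable_on f ` R \<longleftrightarrow> (\<lambda>n. F (f n)) summable_on R" for F :: "_ \<Rightarrow> real"
    using summable_on_reindex[OF f, of F] by (simp add: o_def)
  have i: "infsum F (f ` R) = (\<Sum>\<^sub>\<infinity>n\<in>R. F (f n))" for F :: "_ \<Rightarrow> real"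
    using infsum_reindex[OF f, of F] by (simp add: o_def)
  \<comment> \<open>Data on \<open>R\<close> are arbitrary functions, data on the image are composed
    with \<open>f\<close>. A property that depends on the values on \<open>R\<close> alone cannot
    tell them apart, since every \<open>b\<close> agrees on \<open>R\<close> with some function
    composed with \<open>f\<close>.\<close>
  have ex: "(\<forall>b. P (\<lambda>n. b (f n))) \<longleftrightarrow> (\<forall>b. P b)" if "\<And>b b'. (\<And>n. n \<in> R \<Longrightarrow> b n = b' n) \<Longrightarrow> P b = P b'"
    for P :: "(_ \<Rightarrow> complex) \<Rightarrow> bool"
  proof (intro iffI allI)
    fix b :: "_ \<Rightarrow> complex" assume a: "\<forall>b. P (\<lambda>n. b (f n))"
    have "P (\<lambda>n. (b (the_inv_into R f (f n))))" using spec[OF a, of "\<lambda>m. b (the_inv_into R f m)"] .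
    moreover have "P (\<lambda>n. (b (the_inv_into R f (f n)))) = P b"
      by (rule that) (simp add: the_inv_into_f_f[OF f])
    ultimately show "P b" by simp
  qed blast
  have "(\<forall>b. (\<lambda>n. (cmod (b (f n)))^2 * w (f n)) summable_on R \<longrightarrow>
        (\<exists>c\<in>supp_space u C. (\<forall>n\<in>R. ctrans \<gamma> c (l (f n)) = b (f n)) \<and> nsq u c \<le> B * (\<Sum>\<^sub>\<infinity>n\<in>R. (cmod (b (f n)))^2 * w (f n)))) \<longleftrightarrow>
     (\<forall>b. (\<lambda>n. (cmod (b n))^2 * w (f n)) summable_on R \<longrightarrow>
        (\<exists>c\<in>supp_space u C. (\<forall>n\<in>R. ctrans \<gamma> c (l (f n)) = b n) \<and> nsq u c \<le> B * (\<Sum>\<^sub>\<infinity>n\<in>R. (cmod (b n))^2 * w (f n))))" for B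
  proof (rule ex)
    fix b b' :: "_ \<Rightarrow> complex" assume e: "\<And>n. n \<in> R \<Longrightarrow> b n = b' n"
    have "(\<lambda>n. (cmod (b n))^2 * w (f n)) summable_on R \<longleftrightarrow> (\<lambda>n. (cmod (b' n))^2 * w (f n)) summable_on R"
      by (rule summable_on_cong) (use e in auto)
    moreover have "(\<Sum>\<^sub>\<infinity>n\<in>R. (cmod (b n))^2 * w (f n)) = (\<Sum>\<^sub>\<infinity>n\<in>R. (cmod (b' n))^2 * w (f n))"
      by (rule infsum_cong) (use e in auto)
    ultimately show "((\<lambda>n. (cmod (b n))^2 * w (f n)) summable_on R \<longrightarrow>
        (\<exists>c\<in>supp_space u C. (\<forall>n\<in>R. ctrans \<gamma> c (l (f n)) = b n) \<and> nsq u c \<le> B * (\<Sum>\<^sub>\<infinity>n\<in>R. (cmod (b n))^2 * w (f n)))) =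
      ((\<lambda>n. (cmod (b' n))^2 * w (f n)) summable_on R \<longrightarrow>
        (\<exists>c\<in>supp_space u C. (\<forall>n\<in>R. ctrans \<gamma> c (l (f n)) = b' n) \<and> nsq u c \<le> B * (\<Sum>\<^sub>\<infinity>n\<in>R. (cmod (b' n))^2 * w (f n))))"
      using e by (simp cong: ball_cong)
  qed
  thus ?thesis unfolding interp_sys_def s i by simp
qed

subsection \<open>Two weighted inequalities\<close>

lemma infsum_finite_sum:
  fixes f :: "'i \<Rightarrow> 'a \<Rightarrow> real"
  assumes "finite F" "\<And>i. i \<in> F \<Longrightarrow> f i summable_on A"
  shows "(\<lambda>x. \<Sum>i\<in>F. f i x) summable_on A" "(\<Sum>i\<in>F. infsum (f i) A) = (\<Sum>\<^sub>\<infinity>x\<in>A. \<Sum>i\<in>F. f i x)"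
  using assms
proof (induction rule: finite_induct)
  case (insert i F)
  { case 1 thus ?case using insert by (auto intro!: summable_on_add) }
  { case 2 thus ?case using insert by (simp add: infsum_add) }
qed auto

text \<open>With truncated subtraction \<open>(n - k) + (k - n)\<close> is the distance of
  \<open>n\<close> and \<open>k\<close>; each side of \<open>n\<close> contributes a geometric
  series.\<close>

lemma sum_geometric_dist_le:
  fixes t :: real
  assumes t: "0 < t" "t < 1" and F: "finite F"
  shows "(\<Sum>k\<in>F. t ^ ((n - k) + (k - n))) \<le> 2 / (1 - t)"
proof -
  have geo: "(\<Sum>j\<in>G. t ^ j) \<le> 1 / (1 - t)" if "finite G" for G :: "nat set"
    using sum_le_suminf[of "\<lambda>j. t ^ j" G] that t by (simp add: suminf_geometric summable_geometric)
  have 1: "(\<Sum>k\<in>{k\<in>F. k \<le> n}. t ^ ((n - k) + (k - n))) = (\<Sum>j\<in>(\<lambda>k. n - k) ` {k\<in>F. k \<le> n}. t ^ j)"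
    by (subst sum.reindex) (auto simp: inj_on_def)
  have 2: "(\<Sum>k\<in>{k\<in>F. \<not> k \<le> n}. t ^ ((n - k) + (k - n))) = (\<Sum>j\<in>(\<lambda>k. k - n) ` {k\<in>F. \<not> k \<le> n}. t ^ j)"
    by (subst sum.reindex) (auto simp: inj_on_def)
  have "(\<Sum>k\<in>F. t ^ ((n - k) + (k - n))) = (\<Sum>k\<in>{k\<in>F. k \<le> n}. t ^ ((n - k) + (k - n))) + (\<Sum>k\<in>{k\<in>F. \<not> k \<le> n}. t ^ ((n - k) + (k - n)))"
    using F by (subst sum.union_disjoint[symmetric]) (auto intro!: sum.cong)
  also have "\<dots> \<le> 1 / (1 - t) + 1 / (1 - t)"
    unfolding 1 2 using F by (intro add_mono geo) auto
  finally show ?thesis by simp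
qed

text \<open>Schur's test: Cauchy-Schwarz with the square root of the kernel on each factor, then the
  row and column sums of the symmetric kernel \<open>T\<close>, both at most
  \<open>2 / (1 - t)\<close>.\<close>

lemma geometric_kernel_bound:
  fixes t :: real and x :: "nat \<Rightarrow> real"
  assumes t: "0 < t" "t < 1" and x: "(\<lambda>k. (x k)^2) summable_on UNIV" and F: "finite F"
  shows "(\<Sum>n\<in>F. (\<Sum>\<^sub>\<infinity>k. t ^ ((n - k) + (k - n)) * \<bar>x k\<bar>)^2) \<le> (2 / (1 - t))^2 * (\<Sum>\<^sub>\<infinity>k. (x k)^2)"
    and "(\<lambda>k. t ^ ((n - k) + (k - n)) * \<bar>x k\<bar>) summable_on UNIV"
proof -
  define T where "T n k = t ^ ((n - k) + (k - n))" for n k :: nat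
  define A where "A = 2 / (1 - t)"
  have A0: "A \<ge> 0" using t by (simp add: A_def)
  have T0: "T n k \<ge> 0" "T n k \<le> 1" for n k using t by (auto simp: T_def intro: power_le_one)
  have Tsum: "(\<lambda>k. T n k) summable_on UNIV" "(\<Sum>\<^sub>\<infinity>k. T n k) \<le> A" for n
    by (rule nonneg_bounded_summable[where B=A]; use T0 sum_geometric_dist_le[OF t] in \<open>auto simp: A_def T_def\<close>)+
  have Tx: "(\<lambda>k. T n k * (x k)^2) summable_on UNIV" for n
    by (rule summable_on_comparison_test[OF x]) (use T0 mult_right_mono[of "T n _" 1 "(x _)^2"] in auto)
  have CS: "(\<lambda>k. T n k * \<bar>x k\<bar>) summable_on UNIV \<and> (\<Sum>\<^sub>\<infinity>k. T n k * \<bar>x k\<bar>)^2 \<le> A * (\<Sum>\<^sub>\<infinity>k. T n k * (x k)^2)" for n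
  proof -
    have f: "(\<lambda>k. (norm (sqrt (T n k)))^2) = (\<lambda>k. T n k)" using T0 by auto
    have g: "(\<lambda>k. (norm (sqrt (T n k) * \<bar>x k\<bar>))^2) = (\<lambda>k. T n k * (x k)^2)"
      using T0 by (auto simp: power_mult_distrib)
    have e: "norm (sqrt (T n k) * (sqrt (T n k) * \<bar>x k\<bar>)) = T n k * \<bar>x k\<bar>" for k
      using T0[of n k] by (simp add: mult.assoc[symmetric] abs_mult)
    have sf: "(\<lambda>k. (norm (sqrt (T n k)))^2) summable_on UNIV" unfolding f by (rule Tsum)
    have sg: "(\<lambda>k. (norm (sqrt (T n k) * \<bar>x k\<bar>))^2) summable_on UNIV" unfolding g by (rule Tx)
    have "(\<Sum>\<^sub>\<infinity>k. T n k * \<bar>x k\<bar>)^2 \<le> (\<Sum>\<^sub>\<infinity>k. T n k) * (\<Sum>\<^sub>\<infinity>k. T n k * (x k)^2)"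
      using infsum_Cauchy_Schwarz(2)[OF sf sg] unfolding e f g .
    also have "\<dots> \<le> A * (\<Sum>\<^sub>\<infinity>k. T n k * (x k)^2)"
      using Tsum T0 by (intro mult_right_mono infsum_nonneg) auto
    finally show ?thesis using infsum_Cauchy_Schwarz(1)[OF sf sg] unfolding e by simp
  qed
  show "(\<lambda>k. t ^ ((n - k) + (k - n)) * \<bar>x k\<bar>) summable_on UNIV" using CS[of n] by (simp add: T_def)
  have "(\<Sum>n\<in>F. (\<Sum>\<^sub>\<infinity>k. T n k * \<bar>x k\<bar>)^2) \<le> (\<Sum>n\<in>F. A * (\<Sum>\<^sub>\<infinity>k. T n k * (x k)^2))"
    by (intro sum_mono) (use CS in auto)
  also have "\<dots> = A * (\<Sum>\<^sub>\<infinity>k. \<Sum>n\<in>F. T n k * (x k)^2)"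
    by (simp add: sum_distrib_left[symmetric] infsum_finite_sum(2)[OF F Tx])
  also have "\<dots> \<le> A * (\<Sum>\<^sub>\<infinity>k. A * (x k)^2)"
  proof (intro mult_left_mono infsum_mono A0)
    show "(\<lambda>k. \<Sum>n\<in>F. T n k * (x k)^2) summable_on UNIV" by (rule infsum_finite_sum(1)[OF F Tx])
    show "(\<lambda>k. A * (x k)^2) summable_on UNIV" by (rule summable_on_cmult_right[OF x])
    show "(\<Sum>n\<in>F. T n k * (x k)^2) \<le> A * (x k)^2" for k
      unfolding sum_distrib_right[symmetric]
      using sum_geometric_dist_le[OF t F, of k] by (intro mult_right_mono) (auto simp: T_def A_def add.commute)
  qed
  also have "\<dots> = A^2 * (\<Sum>\<^sub>\<infinity>k. (x k)^2)"
    by (simp add: infsum_cmult_right' power2_eq_square)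
  finally show "(\<Sum>n\<in>F. (\<Sum>\<^sub>\<infinity>k. t ^ ((n - k) + (k - n)) * \<bar>x k\<bar>)^2) \<le> (2 / (1 - t))^2 * (\<Sum>\<^sub>\<infinity>k. (x k)^2)"
    by (simp add: T_def A_def)
qed

lemma sum_triangle_swap:
  fixes f :: "nat \<Rightarrow> nat \<Rightarrow> real"
  shows "(\<Sum>n=m..<l. \<Sum>j=m..n. f n j) = (\<Sum>j=m..<l. \<Sum>n=j..<l. f n j)"
proof -
  have "(\<Sum>n=m..<l. \<Sum>j=m..n. f n j) = (\<Sum>n=m..<l. \<Sum>j\<in>{j. j \<in> {m..<l} \<and> j \<le> n}. f n j)"
    by (intro sum.cong) auto
  also have "\<dots> = (\<Sum>j=m..<l. \<Sum>n\<in>{n. n \<in> {m..<l} \<and> j \<le> n}. f n j)"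
    by (rule sum.swap_restrict) auto
  also have "\<dots> = (\<Sum>j=m..<l. \<Sum>n=j..<l. f n j)"
    by (intro sum.cong) auto
  finally show ?thesis .
qed

text \<open>The weights in the Cauchy--Schwarz step are the square roots of the partial sums of \<open>u\<close>.\<close>

lemma Hardy_inequality:
  fixes u h c :: "nat \<Rightarrow> real"
  assumes u: "\<And>j. m \<le> j \<Longrightarrow> j < l \<Longrightarrow> u j > 0" and h: "\<And>j. m \<le> j \<Longrightarrow> j < l \<Longrightarrow> h j \<ge> 0"
    and XY: "\<And>n. m \<le> n \<Longrightarrow> n < l \<Longrightarrow> (\<Sum>j=m..n. u j) * (\<Sum>j=n..<l. h j) \<le> B"
  shows "(\<Sum>n=m..<l. h n * (\<Sum>j=m..n. sqrt (u j) * c j)^2) \<le> 4 * B * (\<Sum>n=m..<l. (c n)^2)"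
proof (cases "m < l")
  case True
  define X where "X n = (\<Sum>j=m..n. u j)" for n
  define Y where "Y n = (\<Sum>j=n..<l. h j)" for n
  have Xpos: "X n > 0" if "m \<le> n" "n < l" for n
    unfolding X_def using that by (intro sum_pos u) auto
  have Ynn: "Y n \<ge> 0" if "m \<le> n" for n unfolding Y_def using that by (intro sum_nonneg h) auto
  have B0: "0 \<le> B" using XY[of m] Xpos[of m] Ynn[of m] True unfolding X_def Y_def
    by (smt (verit) le_refl mult_nonneg_nonneg)
  \<comment> \<open>Telescoping: as \<open>u n\<close> is the increment of \<open>X\<close>,
    \<open>u n / sqrt (X n) \<le> 2 * (sqrt (X n) - sqrt (X (n - 1)))\<close>.\<close>
  have s1: "(\<Sum>j=m..n. u j / sqrt (X j)) \<le> 2 * sqrt (X n)" if "m \<le> n" "n < l" for n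
    using that
  proof (induction n rule: dec_induct)
    case base
    thus ?case using u[of m] by (simp add: X_def real_div_sqrt)
  next
    case (step n)
    have Xs: "X (Suc n) = X n + u (Suc n)" using step by (simp add: X_def)
    have p: "0 < X n" "0 < X (Suc n)" using Xpos step by auto
    define a b where "a = sqrt (X n)" and "b = sqrt (X (Suc n))"
    have ab: "0 < a" "0 < b" "a^2 = X n" "b^2 = X (Suc n)" using p by (auto simp: a_def b_def)
    have "u (Suc n) = b^2 - a^2" using ab Xs by simp
    moreover have "b^2 - a^2 \<le> (2 * b - 2 * a) * b"
      using zero_le_power2[of "a - b"] by (simp add: power2_eq_square algebra_simps)
    ultimately have "u (Suc n) / b \<le> 2 * b - 2 * a" using ab by (simp add: divide_le_eq)
    thus ?case using step by (simp add: a_def b_def)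
  qed
  have cs: "(\<Sum>j=m..n. sqrt (u j) * c j)^2 \<le> 2 * sqrt (X n) * (\<Sum>j=m..n. (c j)^2 * sqrt (X j))" if "m \<le> n" "n < l" for n
  proof -
    define a where "a j = sqrt (u j / sqrt (X j))" for j
    define b where "b j = c j * sqrt (sqrt (X j))" for j
    have "(\<Sum>j=m..n. sqrt (u j) * c j) = (\<Sum>j=m..n. a j * b j)"
    proof (intro sum.cong refl)
      fix j assume "j \<in> {m..n}"
      hence "X j > 0" using Xpos that by auto
      thus "sqrt (u j) * c j = a j * b j" by (simp add: a_def b_def real_sqrt_divide)
    qed
    hence "(\<Sum>j=m..n. sqrt (u j) * c j)^2 \<le> (\<Sum>j=m..n. (a j)^2) * (\<Sum>j=m..n. (b j)^2)"
      by (simp add: Cauchy_Schwarz_ineq_sum)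
    also have "(\<Sum>j=m..n. (a j)^2) = (\<Sum>j=m..n. u j / sqrt (X j))"
    proof (intro sum.cong refl)
      fix j assume "j \<in> {m..n}"
      hence "X j > 0" "u j > 0" using Xpos u that by auto
      thus "(a j)^2 = u j / sqrt (X j)" by (simp add: a_def)
    qed
    also have "(\<Sum>j=m..n. (b j)^2) = (\<Sum>j=m..n. (c j)^2 * sqrt (X j))"
    proof (intro sum.cong refl)
      fix j assume "j \<in> {m..n}"
      hence "X j > 0" using Xpos that by auto
      thus "(b j)^2 = (c j)^2 * sqrt (X j)" by (simp add: b_def power_mult_distrib)
    qed
    also have "(\<Sum>j=m..n. u j / sqrt (X j)) * (\<Sum>j=m..n. (c j)^2 * sqrt (X j)) \<le> 2 * sqrt (X n) * (\<Sum>j=m..n. (c j)^2 * sqrt (X j))"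
      using Xpos that by (intro mult_right_mono s1 sum_nonneg mult_nonneg_nonneg) (auto simp: less_imp_le)
    finally show ?thesis .
  qed
  \<comment> \<open>The same telescoping from the other end, for \<open>sqrt (Y n)\<close>; the
    hypothesis enters as \<open>sqrt (X n) * sqrt (Y n) \<le> sqrt B\<close>.\<close>
  have s2: "(\<Sum>n=j..<l. h n * sqrt (X n)) \<le> 2 * sqrt B * sqrt (Y j)" if "m \<le> j" "j \<le> l" for j
    using that(2) that(1)
  proof (induction j rule: inc_induct)
    case base
    thus ?case by (simp add: Y_def)
  next
    case (step n)
    define a b where "a = sqrt (Y n)" and "b = sqrt (Y (Suc n))"
    have Ys: "Y n = h n + Y (Suc n)" using step by (simp add: Y_def sum.atLeast_Suc_lessThan)
    have Yn: "Y n \<ge> 0" "Y (Suc n) \<ge> 0" using Ynn step by auto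
    have ab: "0 \<le> b" "b \<le> a" "a^2 = Y n" "b^2 = Y (Suc n)" using Yn Ys h[of n] step by (auto simp: a_def b_def)
    have "X n * Y n \<le> B" using XY[of n] step by (simp add: X_def Y_def)
    hence Xa: "sqrt (X n) * a \<le> sqrt B" by (simp add: a_def real_sqrt_mult[symmetric])
    have "h n = a^2 - b^2" using ab Ys by simp
    hence "h n * sqrt (X n) = (a^2 - b^2) * sqrt (X n)" by simp
    also have "\<dots> = (a - b) * ((a + b) * sqrt (X n))" by (simp add: power2_eq_square algebra_simps)
    also have "\<dots> \<le> (a - b) * ((2 * a) * sqrt (X n))"
      using ab Xpos[of n] step by (intro mult_left_mono mult_right_mono) auto
    also have "\<dots> \<le> (a - b) * (2 * sqrt B)"
      using Xa ab by (intro mult_left_mono) (auto simp: mult.commute)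
    finally have "h n * sqrt (X n) \<le> 2 * sqrt B * (a - b)" by (simp add: mult.commute)
    moreover have "(\<Sum>n=Suc n..<l. h n * sqrt (X n)) \<le> 2 * sqrt B * b"
      using step by (simp add: b_def)
    ultimately show ?case using step by (simp add: sum.atLeast_Suc_lessThan a_def algebra_simps)
  qed
  have "(\<Sum>n=m..<l. h n * (\<Sum>j=m..n. sqrt (u j) * c j)^2) \<le> (\<Sum>n=m..<l. h n * (2 * sqrt (X n) * (\<Sum>j=m..n. (c j)^2 * sqrt (X j))))"
    by (intro sum_mono mult_left_mono cs h) auto
  also have "\<dots> = (\<Sum>n=m..<l. \<Sum>j=m..n. 2 * ((c j)^2 * sqrt (X j)) * (h n * sqrt (X n)))"
    by (simp add: sum_distrib_left mult_ac)
  also have "\<dots> = (\<Sum>j=m..<l. 2 * ((c j)^2 * sqrt (X j)) * (\<Sum>n=j..<l. h n * sqrt (X n)))"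
    by (subst sum_triangle_swap) (simp add: sum_distrib_left)
  also have "\<dots> \<le> (\<Sum>j=m..<l. 2 * ((c j)^2 * sqrt (X j)) * (2 * sqrt B * sqrt (Y j)))"
    using Xpos by (intro sum_mono mult_left_mono s2 mult_nonneg_nonneg) (auto simp: less_imp_le)
  also have "\<dots> = (\<Sum>j=m..<l. (4 * sqrt B * (c j)^2) * sqrt (X j * Y j))"
    by (simp add: real_sqrt_mult mult_ac)
  also have "\<dots> \<le> (\<Sum>j=m..<l. (4 * sqrt B * (c j)^2) * sqrt B)"
    using XY B0 by (intro sum_mono mult_left_mono) (auto simp: X_def Y_def)
  also have "\<dots> = 4 * B * (\<Sum>n=m..<l. (c n)^2)"
    using B0 by (simp add: sum_distrib_left mult_ac real_sqrt_mult_self[symmetric] del: real_sqrt_mult_self) (simp add: mult.assoc[symmetric])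
  finally show ?thesis .
qed simp

text \<open>The reflection \<open>r\<close> of the interval \<open>{m..<l}\<close> interchanges sums
  from the left end with sums to the right end.\<close>

lemma Hardy_inequality_dual:
  fixes u h c :: "nat \<Rightarrow> real"
  assumes u: "\<And>j. m \<le> j \<Longrightarrow> j < l \<Longrightarrow> u j > 0" and h: "\<And>j. m \<le> j \<Longrightarrow> j < l \<Longrightarrow> h j \<ge> 0"
    and XY: "\<And>n. m \<le> n \<Longrightarrow> n < l \<Longrightarrow> (\<Sum>j=n..<l. u j) * (\<Sum>j=m..n. h j) \<le> B"
  shows "(\<Sum>n=m..<l. h n * (\<Sum>j=n..<l. sqrt (u j) * c j)^2) \<le> 4 * B * (\<Sum>n=m..<l. (c n)^2)"
proof -
  define r where "r i = l + m - Suc i" for i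
  have up: "(\<Sum>j=m..r n. f (r j)) = (\<Sum>j=n..<l. f j)" if "m \<le> n" "n < l" for f :: "nat \<Rightarrow> real" and n
    by (rule sum.reindex_bij_witness[where i=r and j=r]) (use that in \<open>auto simp: r_def\<close>)
  have down: "(\<Sum>j=r n..<l. f (r j)) = (\<Sum>j=m..n. f j)" if "m \<le> n" "n < l" for f :: "nat \<Rightarrow> real" and n
    by (rule sum.reindex_bij_witness[where i=r and j=r]) (use that in \<open>auto simp: r_def\<close>)
  have all: "(\<Sum>j=m..<l. f (r j)) = (\<Sum>j=m..<l. f j)" for f :: "nat \<Rightarrow> real"
    unfolding r_def by (rule sum.atLeastLessThan_rev[symmetric])
  have rr: "r (r n) = n" "m \<le> r n" "r n < l" if "m \<le> n" "n < l" for n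
    using that by (auto simp: r_def)
  have "(\<Sum>n=m..<l. h (r n) * (\<Sum>j=m..n. sqrt (u (r j)) * c (r j))^2) \<le> 4 * B * (\<Sum>n=m..<l. (c (r n))^2)"
  proof (rule Hardy_inequality)
    fix n assume n: "m \<le> n" "n < l"
    show "u (r n) > 0" "h (r n) \<ge> 0" using u h rr[OF n] by auto
    have "(\<Sum>j=m..r (r n). u (r j)) * (\<Sum>j=r (r n)..<l. h (r j)) \<le> B"
      using XY[of "r n"] rr[OF n] up[of "r n" u] down[of "r n" h] by simp
    thus "(\<Sum>j=m..n. u (r j)) * (\<Sum>j=n..<l. h (r j)) \<le> B" by (simp add: rr[OF n])
  qed
  moreover have "(\<Sum>n=m..<l. h (r n) * (\<Sum>j=m..n. sqrt (u (r j)) * c (r j))^2) = (\<Sum>n=m..<l. h (r n) * (\<Sum>j=r n..<l. sqrt (u j) * c j)^2)"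
  proof (intro sum.cong refl)
    fix n assume "n \<in> {m..<l}"
    hence n: "m \<le> n" "n < l" by auto
    show "h (r n) * (\<Sum>j=m..n. sqrt (u (r j)) * c (r j))^2 = h (r n) * (\<Sum>j=r n..<l. sqrt (u j) * c j)^2"
      using up[of "r n" "\<lambda>j. sqrt (u j) * c j"] rr[OF n] by simp
  qed
  ultimately show ?thesis
    using all[of "\<lambda>n. h n * (\<Sum>j=n..<l. sqrt (u j) * c j)^2"] all[of "\<lambda>n. (c n)^2"] by simp
qed

subsection \<open>Lacunary poles\<close>

text \<open>Since the residues are \<open>a k * v k\<close>, the norm of \<open>a\<close> with
  weight \<open>v\<close> is the norm of the residues with weight \<open>1 / v\<close>. The weight
  \<open>s\<close> of the auxiliary pole is left free because the tail systems choose it according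
  to where the tail begins.\<close>

definition col_weight :: "(nat \<Rightarrow> real) \<Rightarrow> real \<Rightarrow> nat \<Rightarrow> real" where
  "col_weight v s k = (if k = 0 then s else 1 / v k)"

text \<open>The index \<open>0\<close>, unused by the problem, carries an auxiliary pole at the origin.\<close>

locale lacunary =
  fixes \<gamma> :: "nat \<Rightarrow> complex" and v :: "nat \<Rightarrow> real" and q :: real and N0 :: nat
  assumes q: "q > 1"
    and gamma0: "\<gamma> 0 = 0" and gamma1: "\<gamma> 1 \<noteq> 0"
    and lac: "n \<ge> 1 \<Longrightarrow> q * cmod (\<gamma> n) \<le> cmod (\<gamma> (Suc n))"
    and v_pos: "n \<ge> 1 \<Longrightarrow> v n > 0"
    and v_sum: "(\<lambda>k. v k / (cmod (\<gamma> k))^2) summable_on {1..}"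
    and V_inf: "filterlim (Vseq v) at_top sequentially"
    and v_small: "v \<in> o(Vseq v)"
    and N0: "N0 \<ge> 2" "n \<ge> N0 \<Longrightarrow> v n \<le> Vseq v n" "n \<ge> N0 \<Longrightarrow> v n \<le> (q - 1) * Vseq v n"
begin

abbreviation V :: "nat \<Rightarrow> real" where "V \<equiv> Vseq v"
abbreviation g :: "nat \<Rightarrow> real" where "g n \<equiv> cmod (\<gamma> n)"

text \<open>Separation constant, chosen below both \<open>(q - 1) / (q + 1)\<close>, which serves
  the poles inside, and \<open>(q - 1) / (2 * q)\<close>, which serves the poles outside.\<close>

definition \<kappa> :: real where "\<kappa> = (q - 1) / (2 * (q + 1))"

lemma kappa: "0 < \<kappa>" "\<kappa> \<le> 1 / 2" "\<kappa> \<le> (q - 1) / (q + 1)" "\<kappa> \<le> (q - 1) / (2 * q)"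
proof -
  have "1 \<le> q * q" using q mult_mono[of 1 q 1 q] by simp
  thus "0 < \<kappa>" "\<kappa> \<le> 1 / 2" "\<kappa> \<le> (q - 1) / (q + 1)" "\<kappa> \<le> (q - 1) / (2 * q)"
    using q by (auto simp: \<kappa>_def field_simps)
qed

lemma g_pos: "n \<ge> 1 \<Longrightarrow> g n > 0"
proof (induction n rule: dec_induct)
  case base show ?case using gamma1 by simp
next
  case (step n)
  have "0 < q * g n" using step q by simp
  thus ?case using lac[of n] step by linarith
qed

lemma g_growth:
  assumes "1 \<le> m" "m \<le> n"
  shows "q ^ (n - m) * g m \<le> g n"
  using assms(2)
proof (induction n rule: dec_induct)
  case (step n)
  have "q ^ (Suc n - m) * g m = q * (q ^ (n - m) * g m)" using step by (simp add: Suc_diff_le)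
  also have "\<dots> \<le> q * g n" using step q by (intro mult_left_mono) auto
  also have "\<dots> \<le> g (Suc n)" using step assms(1) by (intro lac) auto
  finally show ?case .
qed simp

lemma g_mono: "1 \<le> m \<Longrightarrow> m \<le> n \<Longrightarrow> g m \<le> g n"
proof -
  assume a: "1 \<le> m" "m \<le> n"
  have "1 * g m \<le> q ^ (n - m) * g m" using q by (intro mult_right_mono one_le_power) auto
  thus ?thesis using g_growth[OF a] by simp
qed

lemma g_strict: "1 \<le> m \<Longrightarrow> m < n \<Longrightarrow> q * g m \<le> g n"
proof -
  assume a: "1 \<le> m" "m < n"
  have "g (Suc m) \<le> g n" using a by (intro g_mono) auto
  thus ?thesis using lac[OF a(1)] by linarith
qed

lemma inj_gamma: "inj \<gamma>"
proof (rule injI)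
  have lt: "\<gamma> m \<noteq> \<gamma> n" if "m < n" for m n
  proof (cases "m = 0")
    case True thus ?thesis using g_pos[of n] that by (auto simp: gamma0)
  next
    case False
    hence "1 < q" "0 < g m" "q * g m \<le> g n" using q g_pos[of m] g_strict[of m n] that by auto
    moreover from this have "1 * g m < q * g m" by (intro mult_strict_right_mono) auto
    ultimately have "g m < g n" by linarith
    thus ?thesis by auto
  qed
  fix m n assume "\<gamma> m = \<gamma> n"
  thus "m = n" using lt[of m n] lt[of n m] by (cases m n rule: linorder_cases) auto
qed

text \<open>The recursion starts at 2: the value at 1 is the convention \<open>V 1 = 1\<close>,
  while \<open>V 2 = v 1\<close>.\<close>

lemma V_Suc: "n \<ge> 2 \<Longrightarrow> V (Suc n) = V n + v n"
  by (simp add: Vseq_def)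

lemma V_pos: "V n > 0"
proof (cases "n \<le> 1")
  case False thus ?thesis by (auto simp: Vseq_def intro!: sum_pos v_pos)
qed (simp add: Vseq_def)

lemma V_mono:
  assumes "2 \<le> m" "m \<le> n"
  shows "V m \<le> V n"
  using assms(2)
proof (induction n rule: dec_induct)
  case (step n) thus ?case using V_Suc[of n] v_pos[of n] assms(1) by simp
qed simp

lemma V_sum:
  assumes "2 \<le> m" "m \<le> n"
  shows "(\<Sum>j=m..<n. v j) = V n - V m"
  using assms(2)
proof (induction n rule: dec_induct)
  case (step n) thus ?case using V_Suc[of n] assms(1) by simp
qed simp

lemma V_sum_all: "2 \<le> n \<Longrightarrow> (\<Sum>j=1..<n. v j) = V n"
  by (simp add: Vseq_def)

lemma V_Suc_le: "n \<ge> N0 \<Longrightarrow> V (Suc n) \<le> 2 * V n" "n \<ge> N0 \<Longrightarrow> V (Suc n) \<le> q * V n"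
  using N0(1) N0(2,3)[of n] V_Suc[of n] by (auto simp: algebra_simps)

text \<open>By the choice of \<open>N0\<close> one step multiplies \<open>V\<close> by at most
  \<open>q\<close>, while lacunarity multiplies \<open>g\<close> by at least \<open>q\<close>; hence
  \<open>V / g\<close> cannot increase.\<close>

lemma V_growth:
  assumes "N0 \<le> n" "n \<le> k"
  shows "V k * g n \<le> V n * g k"
  using assms(2)
proof (induction k rule: dec_induct)
  case (step k)
  have "V (Suc k) * g n \<le> (q * V k) * g n" using V_Suc_le(2)[of k] step assms(1) by (intro mult_right_mono) auto
  also have "\<dots> \<le> q * (V n * g k)" using step q by simp
  also have "\<dots> = V n * (q * g k)" by simp
  also have "\<dots> \<le> V n * g (Suc k)" using lac[of k] step N0(1) assms(1) V_pos[of n] by (intro mult_left_mono) auto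
  finally show ?case .
qed simp

lemma v_eventually_small: "\<epsilon> > 0 \<Longrightarrow> \<exists>N\<ge>N0. \<forall>k\<ge>N. v k \<le> \<epsilon> * V k"
proof -
  assume "\<epsilon> > 0"
  hence "eventually (\<lambda>n. norm (v n) \<le> \<epsilon> * norm (V n)) sequentially"
    using v_small landau_o.smallD by blast
  then obtain N where "\<And>n. n \<ge> N \<Longrightarrow> norm (v n) \<le> \<epsilon> * norm (V n)" by (auto simp: eventually_sequentially)
  hence "v k \<le> \<epsilon> * V k" if "k \<ge> max N N0" for k using that V_pos[of k] by (smt (verit) max.bounded_iff real_norm_def)
  thus ?thesis by (intro exI[of _ "max N N0"]) auto
qed

text \<open>The inner edge \<open>(g (n - 1) + g n) / 2\<close> of the annulus is at least
  \<open>(1 + q) / 2\<close> times \<open>g k\<close>, which leaves a fixed fraction of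
  \<open>cmod z\<close>.\<close>

lemma sep_below:
  assumes "2 \<le> n" "1 \<le> k" "k < n" "(g (n - 1) + g n) / 2 \<le> cmod z"
  shows "\<kappa> * cmod z \<le> cmod (z - \<gamma> k)"
proof -
  have "g k \<le> g (n - 1)" using assms by (intro g_mono) auto
  moreover have "q * g (n - 1) \<le> g n" using g_strict[of "n - 1" n] assms by auto
  moreover have "q * g k \<le> q * g (n - 1)" using calculation(1) q by simp
  ultimately have "(1 + q) * g k \<le> 2 * cmod z" using assms(4) by (simp add: distrib_right)
  hence "g k \<le> 2 * cmod z / (1 + q)" using q by (simp add: field_simps)
  moreover have "cmod z - 2 * cmod z / (1 + q) = (q - 1) / (q + 1) * cmod z" using q by (simp add: field_simps)
  moreover have "\<kappa> * cmod z \<le> (q - 1) / (q + 1) * cmod z" by (intro mult_right_mono kappa) auto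
  moreover have "cmod z - g k \<le> cmod (z - \<gamma> k)" by (rule norm_triangle_ineq2)
  ultimately show ?thesis by linarith
qed

text \<open>The outer edge of the annulus is at most \<open>(1 + q) / (2 * q)\<close> times
  \<open>g (Suc n)\<close>, which leaves a fixed fraction of \<open>g k\<close>.\<close>

lemma sep_above:
  assumes "1 \<le> n" "n < k" "cmod z \<le> (g n + g (Suc n)) / 2"
  shows "\<kappa> * g k \<le> cmod (z - \<gamma> k)"
proof -
  have "g (Suc n) \<le> g k" using assms by (intro g_mono) auto
  moreover have "q * g n \<le> g (Suc n)" using lac[of n] assms by auto
  moreover have "q * g (Suc n) \<le> q * g k" using calculation(1) q by simp
  moreover have "q * (2 * cmod z) \<le> q * (g n + g (Suc n))" using assms(3) q by simp
  ultimately have "q * (2 * cmod z) \<le> (1 + q) * g k" by (simp add: distrib_right distrib_left)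
  hence "cmod z \<le> (1 + q) * g k / (2 * q)" using q by (simp add: field_simps)
  moreover have "g k - (1 + q) * g k / (2 * q) = (q - 1) / (2 * q) * g k" using q by (simp add: field_simps)
  moreover have "\<kappa> * g k \<le> (q - 1) / (2 * q) * g k" by (intro mult_right_mono kappa) auto
  moreover have "g k - cmod z \<le> cmod (z - \<gamma> k)" by (metis norm_minus_commute norm_triangle_ineq2)
  ultimately show ?thesis by linarith
qed

lemma OmegaD:
  assumes "z \<in> Omega \<gamma> n" "n \<ge> 2"
  shows "(g (n - 1) + g n) / 2 \<le> cmod z" "cmod z \<le> (g n + g (Suc n)) / 2"
  using assms by (auto simp: Omega_def)

lemma g_at_top: "filterlim g at_top sequentially"
proof (rule filterlim_at_top_mono)
  have "filterlim (\<lambda>n. q ^ n) at_top sequentially"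
    using q by (simp add: filterlim_realpow_sequentially_gt1 filterlim_at_infinity_imp_filterlim_at_top eventually_sequentiallyI less_imp_le)
  hence "filterlim (\<lambda>n. (g 1 / q) * q ^ n) at_top sequentially"
    using g_pos[of 1] q by (intro filterlim_tendsto_pos_mult_at_top[OF tendsto_const]) auto
  thus "filterlim (\<lambda>n. (g 1 / q) * q ^ n) at_top sequentially" .
  show "eventually (\<lambda>n. (g 1 / q) * q ^ n \<le> g n) sequentially"
  proof (rule eventually_sequentiallyI[of 1])
    fix n :: nat assume n: "1 \<le> n"
    hence "q ^ n = q * q ^ (n - 1)" by (cases n) auto
    hence "(g 1 / q) * q ^ n = q ^ (n - 1) * g 1" using q by simp
    also have "\<dots> \<le> g n" by (rule g_growth[OF _ n]) simp
    finally show "(g 1 / q) * q ^ n \<le> g n" .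
  qed
qed

lemma poles_axiom: "s > 0 \<Longrightarrow> poles \<gamma> (col_weight v s)"
proof
  assume s: "s > 0"
  show "inj \<gamma>" by (rule inj_gamma)
  show "0 < col_weight v s k" for k using s v_pos[of k] by (auto simp: col_weight_def)
  show "\<exists>\<delta>>0. \<forall>k. \<gamma> k \<noteq> z \<longrightarrow> \<delta> * (1 + g k) \<le> cmod (z - \<gamma> k)" for z
  proof -
    have "eventually (\<lambda>k. 2 * cmod z + 1 \<le> g k) sequentially"
      using g_at_top by (simp add: filterlim_at_top)
    then obtain K where K: "\<And>k. k \<ge> K \<Longrightarrow> 2 * cmod z + 1 \<le> g k" by (auto simp: eventually_sequentially)
    \<comment> \<open>Beyond \<open>K\<close> the triangle inequality gives the ratio 1/4; below
      \<open>K\<close> there are finitely many positive ratios.\<close>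
    define D where "D = insert (1/4) ((\<lambda>k. cmod (z - \<gamma> k) / (1 + g k)) ` {k. k < K \<and> \<gamma> k \<noteq> z})"
    have p: "0 < 1 + g k" for k by (smt (verit) norm_ge_zero)
    have fin: "finite D" "D \<noteq> {}" by (auto simp: D_def)
    have "Min D > 0" using fin p by (auto simp: Min_gr_iff) (auto simp: D_def)
    moreover have "Min D * (1 + g k) \<le> cmod (z - \<gamma> k)" if "\<gamma> k \<noteq> z" for k
    proof (cases "k < K")
      case True
      hence "Min D \<le> cmod (z - \<gamma> k) / (1 + g k)" using fin that by (intro Min_le) (auto simp: D_def)
      thus ?thesis using p[of k] by (simp add: pos_le_divide_eq)
    next
      case False
      have "Min D \<le> 1/4" using fin by (intro Min_le) (auto simp: D_def)
      hence "Min D * (1 + g k) \<le> 1/4 * (1 + g k)" using p[of k] by (intro mult_right_mono) auto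
      also have "\<dots> \<le> g k - cmod z"
      proof -
        have "2 * cmod z + 1 \<le> g k" using K[of k] False by simp
        thus ?thesis by (simp add: field_simps) (use norm_ge_zero[of z] in linarith)
      qed
      also have "\<dots> \<le> cmod (z - \<gamma> k)" by (metis norm_minus_commute norm_triangle_ineq2)
      finally show ?thesis .
    qed
    ultimately show ?thesis by blast
  qed
  have "(\<lambda>k. inverse (col_weight v s k) / (1 + g k)^2) summable_on {1..}"
  proof (rule summable_on_comparison_test[OF v_sum])
    fix k :: nat assume k: "k \<in> {1..}"
    have "(g k)^2 \<le> (1 + g k)^2" by (intro power_mono) auto
    thus "inverse (col_weight v s k) / (1 + g k)^2 \<le> v k / (g k)^2"
      using k v_pos[of k] g_pos[of k] by (auto simp: col_weight_def intro!: divide_left_mono mult_pos_pos) (smt (verit) norm_ge_zero zero_less_power)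
    show "0 \<le> inverse (col_weight v s k) / (1 + g k)^2" using k v_pos[of k] by (auto simp: col_weight_def)
  qed
  hence "(\<lambda>k. inverse (col_weight v s k) / (1 + g k)^2) summable_on insert 0 {1..}"
    by (simp add: summable_on_insert_iff)
  moreover have "insert 0 {1..} = (UNIV :: nat set)" by auto
  ultimately show "(\<lambda>k. inverse (col_weight v s k) / (1 + g k)^2) summable_on UNIV" by simp
qed

text \<open>\<open>V k / (g k)^2\<close> shrinks at least by the factor \<open>1 / q\<close> per
  step, its numerator growing by at most \<open>q\<close> and its denominator by at least
  \<open>q^2\<close>. So the tail is dominated by its first term, and
  \<open>v \<le> \<epsilon> * V\<close> brings in the small factor.\<close>

lemma P_le:
  assumes n: "n \<ge> N0" and e: "\<And>k. k > n \<Longrightarrow> v k \<le> \<epsilon> * V k" "\<epsilon> \<ge> 0"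
  shows "Pseq \<gamma> v n \<le> \<epsilon> * (q / (q - 1)) * (V (Suc n) / (g (Suc n))^2)"
proof -
  define \<sigma> where "\<sigma> k = V k / (g k)^2" for k
  have \<sigma>: "\<sigma> (Suc k) \<le> \<sigma> k / q" if "k > n" for k
  proof -
    have k: "k \<ge> N0" "k \<ge> 1" using that n N0(1) by auto
    have gp: "g k > 0" using k g_pos by simp
    have "V (Suc k) / (g (Suc k))^2 \<le> (q * V k) / (q * g k)^2"
      using V_Suc_le(2)[OF k(1)] lac[OF k(2)] gp q V_pos[of k] by (intro frac_le power_mono) auto
    also have "\<dots> = V k / (g k)^2 / q" using q by (simp add: power2_eq_square)
    finally show ?thesis by (simp add: \<sigma>_def)
  qed
  \<comment> \<open>Subtracting \<open>\<sigma> m\<close> on the right makes the geometric bound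
    provable by induction on the upper end.\<close>
  have fs: "(\<Sum>k\<in>{n<..<m}. \<sigma> k) \<le> (q / (q - 1)) * (\<sigma> (Suc n) - \<sigma> m)" if "m \<ge> Suc n" for m
    using that
  proof (induction m rule: dec_induct)
    case base have "{n<..<Suc n} = {}" by auto
    thus ?case by simp
  next
    case (step m)
    have "{n<..<Suc m} = insert m {n<..<m}" using step by auto
    hence "(\<Sum>k\<in>{n<..<Suc m}. \<sigma> k) = \<sigma> m + (\<Sum>k\<in>{n<..<m}. \<sigma> k)" by simp
    also have "\<dots> \<le> \<sigma> m + (q / (q - 1)) * (\<sigma> (Suc n) - \<sigma> m)" using step by simp
    also have "\<dots> = (q / (q - 1)) * (\<sigma> (Suc n) - \<sigma> m / q)"
    proof -
      have "q / (q - 1) = 1 + 1 / (q - 1)" "q / (q - 1) * (\<sigma> m / q) = 1 / (q - 1) * \<sigma> m" using q by (simp_all add: field_simps)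
      hence "\<sigma> m = q / (q - 1) * \<sigma> m - q / (q - 1) * (\<sigma> m / q)" by (simp add: distrib_right)
      thus ?thesis by (simp add: right_diff_distrib)
    qed
    also have "\<dots> \<le> (q / (q - 1)) * (\<sigma> (Suc n) - \<sigma> (Suc m))" using \<sigma>[of m] step q by (intro mult_left_mono) auto
    finally show ?case .
  qed
  have nn: "0 \<le> v j / (g j)^2" if "j > n" for j using that v_pos[of j] by (auto intro!: divide_nonneg_nonneg less_imp_le)
  have "(\<Sum>k\<in>F. v k / (g k)^2) \<le> \<epsilon> * (q / (q - 1)) * \<sigma> (Suc n)" if F: "finite F" "F \<subseteq> {n<..}" for F
  proof -
    obtain m0 where m0: "\<forall>k\<in>F. k \<le> m0" using F(1) unfolding finite_nat_set_iff_bounded_le ..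
    define m where "m = Suc (n + m0)"
    have m1: "m \<ge> Suc n" by (simp add: m_def)
    have m2: "F \<subseteq> {n<..<m}"
    proof
      fix k assume k: "k \<in> F"
      hence "n < k" "k \<le> m0" using F(2) m0 by auto
      thus "k \<in> {n<..<m}" by (simp add: m_def)
    qed
    have "(\<Sum>k\<in>F. v k / (g k)^2) \<le> (\<Sum>k\<in>{n<..<m}. v k / (g k)^2)"
      using m2 nn by (intro sum_mono2) auto
    also have "\<dots> \<le> (\<Sum>k\<in>{n<..<m}. \<epsilon> * \<sigma> k)"
      using e(1) by (intro sum_mono) (auto simp: \<sigma>_def divide_right_mono)
    also have "\<dots> = \<epsilon> * (\<Sum>k\<in>{n<..<m}. \<sigma> k)" by (simp add: sum_distrib_left)
    also have "\<dots> \<le> \<epsilon> * ((q / (q - 1)) * (\<sigma> (Suc n) - \<sigma> m))" using fs[OF m1] e(2) by (intro mult_left_mono)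
    also have "\<dots> \<le> \<epsilon> * ((q / (q - 1)) * \<sigma> (Suc n))"
      using e(2) q V_pos[of m] by (intro mult_left_mono) (auto simp: \<sigma>_def)
    finally show ?thesis by simp
  qed
  thus ?thesis unfolding Pseq_def \<sigma>_def[symmetric]
    by (intro nonneg_bounded_summable) (use nn in auto)
qed

end

subsection \<open>Rows close to the poles\<close>

text \<open>Everything is required beyond \<open>N1\<close> only. \<open>d_le\<close> is the part of
  the definition of the sets D that involves \<open>V\<close>; \<open>w_le\<close> and
  \<open>w_ge\<close> record that the Bessel weight is comparable with the squared distance to
  \<open>\<gamma> n\<close> divided by \<open>v n\<close>, that is, that this pole dominates the
  kernel.\<close>

locale tail_rows = lacunary +
  fixes l :: "nat \<Rightarrow> complex" and w :: "nat \<Rightarrow> real" and M :: real and N1 :: nat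
  assumes M: "M \<ge> 1" and N1: "N1 \<ge> N0"
    and Om: "n > N1 \<Longrightarrow> l n \<in> Omega \<gamma> n"
    and w_pos: "n > N1 \<Longrightarrow> w n > 0"
    and w_le: "n > N1 \<Longrightarrow> w n * v n \<le> (cmod (l n - \<gamma> n))^2"
    and w_ge: "n > N1 \<Longrightarrow> (cmod (l n - \<gamma> n))^2 \<le> M * (w n * v n)"
    and d_le: "n > N1 \<Longrightarrow> V n * (cmod (l n - \<gamma> n))^2 \<le> M * (v n * (cmod (l n))^2)"
    and d_half: "n > N1 \<Longrightarrow> cmod (l n - \<gamma> n) \<le> g n / 2"
    and l_ne: "n > N1 \<Longrightarrow> l n \<noteq> \<gamma> k"
    and l_inj: "inj_on l {N1<..}"
begin

abbreviation d :: "nat \<Rightarrow> real" where "d n \<equiv> cmod (l n - \<gamma> n)"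

lemma idx: "n > N1 \<Longrightarrow> n \<ge> 1 \<and> n \<ge> 2 \<and> n \<ge> N0"
  using N1 N0(1) by auto

lemma l_nz: "n > N1 \<Longrightarrow> l n \<noteq> 0"
  using l_ne[of n 0] by (simp add: gamma0)

lemma d_pos: "n > N1 \<Longrightarrow> d n > 0"
  using l_ne[of n n] by simp

lemma l_bounds: "n > N1 \<Longrightarrow> g n / 2 \<le> cmod (l n)" "n > N1 \<Longrightarrow> cmod (l n) \<le> 2 * g n"
proof -
  assume n: "n > N1"
  have "g n - cmod (l n) \<le> d n" by (metis norm_minus_commute norm_triangle_ineq2)
  thus "g n / 2 \<le> cmod (l n)" using d_half[OF n] by linarith
  have "cmod (l n) - g n \<le> d n" by (rule norm_triangle_ineq2)
  thus "cmod (l n) \<le> 2 * g n" using d_half[OF n] norm_ge_zero[of "\<gamma> n"] by linarith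
qed

lemma w_V: "n > N1 \<Longrightarrow> w n * V n \<le> M * (cmod (l n))^2"
proof -
  assume n: "n > N1"
  have vn: "v n > 0" using idx[OF n] v_pos by auto
  have "v n * (w n * V n) = V n * (w n * v n)" by simp
  also have "\<dots> \<le> V n * (d n)^2" using w_le[OF n] V_pos[of n] by (intro mult_left_mono) auto
  also have "\<dots> \<le> v n * (M * (cmod (l n))^2)" using d_le[OF n] by (simp add: mult_ac)
  finally show ?thesis using vn by simp
qed

text \<open>What is left of \<open>1 / (l n - \<gamma> k)\<close> after subtracting
  \<open>1 / l n\<close> for poles inside and nothing for poles outside; the entry
  \<open>k = n\<close> belongs wholly to the main part.\<close>

definition off_entry :: "nat \<Rightarrow> nat \<Rightarrow> complex" where
  "off_entry n k = (if k < n then \<gamma> k / (l n * (l n - \<gamma> k)) else if n < k then 1 / (l n - \<gamma> k) else 0)"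

definition off_op :: "(nat \<Rightarrow> complex) \<Rightarrow> nat \<Rightarrow> complex" where
  "off_op c n = (\<Sum>\<^sub>\<infinity>k. c k * off_entry n k)"

definition main_op :: "(nat \<Rightarrow> complex) \<Rightarrow> nat \<Rightarrow> complex" where
  "main_op c n = c n / (l n - \<gamma> n) + (\<Sum>k<n. c k) / l n"

text \<open>Below the diagonal the decay comes from \<open>g k / g n\<close>, above it from
  \<open>g n / g k\<close>. In both cases the row weight is used through
  \<open>w n * V n \<le> M * (cmod (l n))^2\<close>, and the factor \<open>v k / V k\<close> is what
  becomes small on tails.\<close>

lemma off_entry_le:
  assumes n: "n > N1" and k: "k > N1"
  shows "w n * v k * (cmod (off_entry n k))^2 \<le> (4 * M / \<kappa>^2) * (v k / V k) * (1 / q) ^ ((n - k) + (k - n))"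
proof -
  have gn: "g n > 0" and gk: "g k > 0" and vk: "v k > 0" using g_pos v_pos idx n k by auto
  have Vn: "V n > 0" and Vk: "V k > 0" by (rule V_pos)+
  have ln: "cmod (l n) > 0" using l_nz[OF n] by simp
  have wn: "w n > 0" by (rule w_pos[OF n])
  consider "k < n" | "n < k" | "n = k" by linarith
  thus ?thesis
  proof cases
    case 1
    have sep: "\<kappa> * cmod (l n) \<le> cmod (l n - \<gamma> k)"
      by (rule sep_below[of n]) (use idx n k 1 OmegaD[OF Om[OF n]] in auto)
    have p: "0 < \<kappa> * cmod (l n)" using kappa ln by simp
    have e: "cmod (off_entry n k) \<le> g k / (\<kappa> * (cmod (l n))^2)"
      using 1 sep p ln gk unfolding off_entry_def
      by (auto simp: norm_divide norm_mult power2_eq_square intro!: frac_le mult_pos_pos) (use kappa in \<open>simp add: mult.left_commute\<close>)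
    define L where "L = (cmod (l n))^2"
    have L: "L > 0" using ln by (simp add: L_def)
    have Vkn: "V k \<le> V n" by (rule V_mono) (use idx[OF k] 1 in simp_all)
    have f1: "v k / V n \<le> v k / V k" by (rule divide_left_mono[OF Vkn]) (use vk Vk Vn in simp_all)
    have qk: "q ^ (n - k) * g k \<le> g n" by (rule g_growth) (use idx[OF k] 1 in simp_all)
    have q1: "1 \<le> q ^ (n - k)" using q by (intro one_le_power) simp
    have "q ^ (n - k) * (g k)^2 \<le> (q ^ (n - k) * q ^ (n - k)) * (g k)^2"
      using q1 by (intro mult_right_mono) simp_all
    also have "\<dots> = (q ^ (n - k) * g k)^2" by (simp add: power2_eq_square)
    also have "\<dots> \<le> (g n)^2" by (rule power_mono[OF qk]) (use gk q in simp)
    also have "\<dots> \<le> (2 * cmod (l n))^2" by (rule power_mono) (use l_bounds(1)[OF n] in simp_all)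
    also have "\<dots> = 4 * L" by (simp add: power_mult_distrib L_def)
    finally have f2: "(g k)^2 / L \<le> 4 * (1 / q) ^ (n - k)"
      using L q by (simp add: field_simps)
    have "w n * v k * (cmod (off_entry n k))^2 \<le> w n * v k * (g k / (\<kappa> * L))^2"
      using e wn vk unfolding L_def by (intro mult_left_mono power_mono) simp_all
    also have "\<dots> = (w n * V n) * (v k / V n * (g k)^2 / (\<kappa>^2 * (L * L)))"
      using Vn by (simp add: power_divide power_mult_distrib power2_eq_square mult_ac)
    also have "\<dots> \<le> (M * L) * (v k / V n * (g k)^2 / (\<kappa>^2 * (L * L)))"
      using vk Vn L w_V[OF n] unfolding L_def[symmetric] by (intro mult_right_mono) simp_all
    also have "\<dots> = M / \<kappa>^2 * (v k / V n) * ((g k)^2 / L)"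
      using L by (simp add: mult_ac)
    also have "\<dots> \<le> M / \<kappa>^2 * (v k / V k) * (4 * (1 / q) ^ (n - k))"
      by (rule mult_mono[OF mult_left_mono[OF f1] f2]) (use M vk Vk L in simp_all)
    finally show ?thesis using 1 by (simp add: mult_ac)
  next
    case 2
    have sep: "\<kappa> * g k \<le> cmod (l n - \<gamma> k)"
      by (rule sep_above[of n]) (use idx n k 2 OmegaD[OF Om[OF n]] in auto)
    have e: "cmod (off_entry n k) \<le> 1 / (\<kappa> * g k)"
      using 2 sep kappa gk unfolding off_entry_def
      by (auto simp: norm_divide intro!: frac_le mult_pos_pos)
    have "w n * v k * (cmod (off_entry n k))^2 \<le> w n * v k * (1 / (\<kappa> * g k))^2"
      using e wn vk by (intro mult_left_mono power_mono) auto
    also have "\<dots> = (w n * V n) * (v k / V n / (\<kappa>^2 * (g k)^2))"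
      using Vn by (simp add: power_divide power_mult_distrib)
    also have "\<dots> \<le> (M * (cmod (l n))^2) * (v k / V n / (\<kappa>^2 * (g k)^2))"
      using vk Vn by (intro mult_right_mono w_V[OF n]) auto
    also have "\<dots> \<le> (M * (4 * (g n)^2)) * (v k / V n / (\<kappa>^2 * (g k)^2))"
      using power_mono[of "cmod (l n)" "2 * g n" 2] l_bounds(2)[OF n] vk Vn M
      by (intro mult_right_mono mult_left_mono) (auto simp: power_mult_distrib)
    \<comment> \<open>\<open>V_growth\<close> pays for replacing \<open>1 / V n\<close> by
      \<open>1 / V k\<close> with one of the two factors \<open>g n / g k\<close>; the other one
      gives the geometric decay.\<close>
    also have "\<dots> = 4 * M / \<kappa>^2 * (v k / V k) * ((V k * g n) * g n / (V n * (g k)^2))"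
      using Vk by (simp add: power2_eq_square mult_ac)
    also have "\<dots> \<le> 4 * M / \<kappa>^2 * (v k / V k) * ((V n * g k) * g n / (V n * (g k)^2))"
      using V_growth[of n k] idx[OF n] 2 M vk Vk Vn gn gk
      by (intro mult_left_mono divide_right_mono mult_right_mono mult_nonneg_nonneg) auto
    also have "\<dots> = 4 * M / \<kappa>^2 * (v k / V k) * (g n / g k)"
      using Vn gk by (simp add: power2_eq_square)
    also have "\<dots> \<le> 4 * M / \<kappa>^2 * (v k / V k) * (1 / q) ^ (k - n)"
    proof (intro mult_left_mono)
      have "q ^ (k - n) * g n \<le> g k" using g_growth[of n k] idx[OF n] 2 by auto
      thus "g n / g k \<le> (1 / q) ^ (k - n)" using gk q by (simp add: field_simps)
    qed (use M vk Vk in auto)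
    finally show ?thesis using 2 by simp
  next
    case 3
    thus ?thesis using M vk Vk by (simp add: off_entry_def)
  qed
qed

definition near_cols :: "nat \<Rightarrow> nat set" where "near_cols N = insert 0 {N<..}"

text \<open>The constant of the entry estimate times that of Schur's test with ratio
  \<open>sqrt (1 / q)\<close>; the root appears because the entries are estimated in square.\<close>

definition Koff :: real where "Koff = (4 * M / \<kappa>^2) * (2 / (1 - sqrt (1 / q)))^2"

lemma Koff_pos: "Koff > 0"
proof -
  have "0 < 1 - sqrt (1 / q)" using q by simp
  thus ?thesis unfolding Koff_def using M kappa(1) by (intro mult_pos_pos divide_pos_pos zero_less_power) simp_all
qed

text \<open>After normalization by \<open>sqrt (w n)\<close> and \<open>sqrt (v k)\<close> the
  entries are at most \<open>A\<close> times \<open>t\<close> to the distance from the diagonal, so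
  Schur's test applies. The factor \<open>\<epsilon>\<close> makes the operator as small as desired
  on tails that start late enough.\<close>

lemma
  assumes s: "s > 0" and N: "N \<ge> N1" and c: "c \<in> supp_space (col_weight v s) (near_cols N)"
    and eps: "\<And>k. k > N \<Longrightarrow> v k \<le> \<epsilon> * V k"
  shows off_op_summable: "sqsummable w {N1<..} (off_op c)"
    and off_op_le: "sqsum w {N1<..} (off_op c) \<le> Koff * \<epsilon> * nsq (col_weight v s) c"
    and off_op_terms: "n > N1 \<Longrightarrow> (\<lambda>k. c k * off_entry n k) summable_on UNIV"
proof -
  interpret poles \<gamma> "col_weight v s" by (rule poles_axiom[OF s])
  define t where "t = sqrt (1 / q)"
  have t: "0 < t" "t < 1" using q by (auto simp: t_def)
  have eps0: "\<epsilon> \<ge> 0"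
  proof -
    have "0 < v (Suc N)" by (rule v_pos) simp
    also have "\<dots> \<le> \<epsilon> * V (Suc N)" by (rule eps) simp
    finally show ?thesis using V_pos[of "Suc N"] by (simp add: zero_less_mult_iff)
  qed
  define x where "x k = (if k > N then cmod (c k) / sqrt (v k) else 0)" for k
  have x2: "(x k)^2 \<le> (cmod (c k))^2 * col_weight v s k" for k
    using N v_pos[of k] s by (auto simp: x_def col_weight_def power_divide)
  have cs: "(\<lambda>k. (cmod (c k))^2 * col_weight v s k) summable_on UNIV" by (rule supp_space_summable[OF c])
  have xs: "(\<lambda>k. (x k)^2) summable_on UNIV"
    by (rule summable_on_comparison_test[OF cs]) (use x2 in auto)
  have xn: "(\<Sum>\<^sub>\<infinity>k. (x k)^2) \<le> nsq (col_weight v s) c"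
    unfolding nsq_def by (rule infsum_mono[OF xs cs x2])
  define A where "A = sqrt (4 * M / \<kappa>^2 * \<epsilon>)"
  have A0: "A \<ge> 0" and A2: "A^2 = 4 * M / \<kappa>^2 * \<epsilon>" using M eps0 by (auto simp: A_def)
  have te: "sqrt (w n) * cmod (c k * off_entry n k) \<le> A * (t ^ ((n - k) + (k - n)) * \<bar>x k\<bar>)" if n: "n > N1" for n k
  proof (cases "k > N")
    case True
    hence k: "k > N1" using N by simp
    have vk: "v k > 0" "V k > 0" using idx[OF k] v_pos V_pos by auto
    have wn: "w n > 0" by (rule w_pos[OF n])
    have "w n * v k * (cmod (off_entry n k))^2 \<le> (4 * M / \<kappa>^2) * (v k / V k) * (1 / q) ^ ((n - k) + (k - n))"
      by (rule off_entry_le[OF n k])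
    also have "\<dots> \<le> (4 * M / \<kappa>^2) * \<epsilon> * (1 / q) ^ ((n - k) + (k - n))"
      using eps[OF True] vk M q by (intro mult_right_mono mult_left_mono) (auto simp: divide_le_eq)
    also have "\<dots> = (A * t ^ ((n - k) + (k - n)))^2"
    proof -
      have "(1 / q) ^ m = (t ^ m)^2" for m using q by (simp add: t_def power_mult_distrib[symmetric] power2_eq_square)
      thus ?thesis by (simp add: power_mult_distrib A2)
    qed
    finally have "sqrt (w n * v k * (cmod (off_entry n k))^2) \<le> A * t ^ ((n - k) + (k - n))"
      using A0 t by (intro real_le_lsqrt) auto
    hence "sqrt (w n) * sqrt (v k) * cmod (off_entry n k) \<le> A * t ^ ((n - k) + (k - n))"
      by (simp add: real_sqrt_mult)
    hence "sqrt (w n) * sqrt (v k) * cmod (off_entry n k) * x k \<le> A * t ^ ((n - k) + (k - n)) * x k"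
      using vk by (intro mult_right_mono) (auto simp: x_def)
    thus ?thesis using True vk by (simp add: x_def norm_mult mult_ac)
  next
    case False
    hence "c k * off_entry n k = 0"
      using supp_spaceD[OF c, of k] n by (cases "k = 0") (auto simp: near_cols_def off_entry_def gamma0)
    hence "sqrt (w n) * cmod (c k * off_entry n k) = 0" by (simp only: norm_zero mult_zero_right)
    moreover have "0 \<le> A * (t ^ ((n - k) + (k - n)) * \<bar>x k\<bar>)" using A0 t by (intro mult_nonneg_nonneg) simp_all
    ultimately show ?thesis by (simp only:)
  qed
  have geo: "(\<lambda>k. t ^ ((n - k) + (k - n)) * \<bar>x k\<bar>) summable_on UNIV" for n
    by (rule geometric_kernel_bound(2)[OF t xs, where F="{}"]) simp
  have abs: "(\<lambda>k. sqrt (w n) * cmod (c k * off_entry n k)) summable_on UNIV" if n: "n > N1" for n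
    by (rule summable_on_comparison_test[OF summable_on_cmult_right[OF geo, of A n]]) (use te[OF n] w_pos[OF n] in auto)
  have abs': "(\<lambda>k. cmod (c k * off_entry n k)) summable_on UNIV" if n: "n > N1" for n
    using summable_on_cmult_right[OF abs[OF n], of "1 / sqrt (w n)"] w_pos[OF n] by simp
  show "(\<lambda>k. c k * off_entry n k) summable_on UNIV" if "n > N1" for n
    by (rule abs_summable_summable[OF abs'[OF that]])
  have row: "(cmod (off_op c n))^2 * w n \<le> A^2 * (\<Sum>\<^sub>\<infinity>k. t ^ ((n - k) + (k - n)) * \<bar>x k\<bar>)^2" if n: "n > N1" for n
  proof -
    have "cmod (off_op c n) \<le> (\<Sum>\<^sub>\<infinity>k. cmod (c k * off_entry n k))"
      unfolding off_op_def by (rule norm_infsum_bound[OF abs'[OF n]])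
    hence "sqrt (w n) * cmod (off_op c n) \<le> sqrt (w n) * (\<Sum>\<^sub>\<infinity>k. cmod (c k * off_entry n k))"
      using w_pos[OF n] by (intro mult_left_mono) auto
    also have "\<dots> = (\<Sum>\<^sub>\<infinity>k. sqrt (w n) * cmod (c k * off_entry n k))" by (simp add: infsum_cmult_right')
    also have "\<dots> \<le> (\<Sum>\<^sub>\<infinity>k. A * (t ^ ((n - k) + (k - n)) * \<bar>x k\<bar>))"
      by (rule infsum_mono[OF abs[OF n] summable_on_cmult_right[OF geo] te[OF n]])
    also have "\<dots> = A * (\<Sum>\<^sub>\<infinity>k. t ^ ((n - k) + (k - n)) * \<bar>x k\<bar>)" by (simp add: infsum_cmult_right')
    finally have "(sqrt (w n) * cmod (off_op c n))^2 \<le> (A * (\<Sum>\<^sub>\<infinity>k. t ^ ((n - k) + (k - n)) * \<bar>x k\<bar>))^2"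
      using w_pos[OF n] by (intro power_mono) auto
    thus ?thesis using w_pos[OF n] by (simp add: power_mult_distrib mult.commute)
  qed
  have fin: "(\<Sum>n\<in>F. (cmod (off_op c n))^2 * w n) \<le> Koff * \<epsilon> * nsq (col_weight v s) c" if F: "finite F" "F \<subseteq> {N1<..}" for F
  proof -
    have "(\<Sum>n\<in>F. (cmod (off_op c n))^2 * w n) \<le> (\<Sum>n\<in>F. A^2 * (\<Sum>\<^sub>\<infinity>k. t ^ ((n - k) + (k - n)) * \<bar>x k\<bar>)^2)"
      using F by (intro sum_mono row) auto
    also have "\<dots> \<le> A^2 * ((2 / (1 - t))^2 * (\<Sum>\<^sub>\<infinity>k. (x k)^2))"
      unfolding sum_distrib_left[symmetric] by (intro mult_left_mono geometric_kernel_bound(1)[OF t xs F(1)]) auto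
    also have "\<dots> \<le> A^2 * ((2 / (1 - t))^2 * nsq (col_weight v s) c)"
      using xn by (intro mult_left_mono) auto
    also have "\<dots> = Koff * \<epsilon> * nsq (col_weight v s) c" by (simp add: A2 Koff_def t_def mult_ac)
    finally show ?thesis .
  qed
  show "sqsummable w {N1<..} (off_op c)"
    by (rule nonneg_bounded_summable(1)[where B="Koff * \<epsilon> * nsq (col_weight v s) c"]) (use fin w_pos in \<open>auto simp: less_imp_le\<close>)
  show "sqsum w {N1<..} (off_op c) \<le> Koff * \<epsilon> * nsq (col_weight v s) c"
    by (rule nonneg_bounded_summable(2)) (use fin w_pos in \<open>auto simp: less_imp_le\<close>)
qed

lemma ctrans_split:
  assumes s: "s > 0" and N: "N \<ge> N1" and c: "c \<in> supp_space (col_weight v s) (near_cols N)" and n: "n > N1"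
  shows "ctrans \<gamma> c (l n) = main_op c n + off_op c n"
proof -
  have eps: "\<And>k. k > N \<Longrightarrow> v k \<le> 1 * V k" using N N1 N0(2) by auto
  have e: "c k / (l n - \<gamma> k) = ((if k = n then c k / (l n - \<gamma> k) else 0) + (if k < n then c k / l n else 0)) + c k * off_entry n k" for k
  proof -
    have "l n \<noteq> 0" "l n - \<gamma> k \<noteq> 0" using l_nz[OF n] l_ne[OF n, of k] by auto
    thus ?thesis by (auto simp: off_entry_def field_simps)
  qed
  have 1: "((\<lambda>k. if k = n then c k / (l n - \<gamma> k) else 0) has_sum c n / (l n - \<gamma> n)) UNIV"
    by (rule has_sum_finite_neutralI[where B="{n}"]) auto
  have 2: "((\<lambda>k. if k < n then c k / l n else 0) has_sum (\<Sum>k<n. c k) / l n) UNIV"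
    by (rule has_sum_finite_neutralI[where B="{..<n}"]) (auto simp: sum_divide_distrib)
  have "((\<lambda>k. ((if k = n then c k / (l n - \<gamma> k) else 0) + (if k < n then c k / l n else 0)) + c k * off_entry n k)
      has_sum (c n / (l n - \<gamma> n) + (\<Sum>k<n. c k) / l n + off_op c n)) UNIV"
    unfolding off_op_def by (intro has_sum_add 1 2 has_sum_infsum off_op_terms[OF s N c eps n])
  hence "((\<lambda>k. c k / (l n - \<gamma> k)) has_sum (c n / (l n - \<gamma> n) + (\<Sum>k<n. c k) / l n + off_op c n)) UNIV"
    by (rule has_sum_cong[THEN iffD2, rotated]) (rule e)
  thus ?thesis unfolding ctrans_def main_op_def by (rule infsumI)
qed

end

subsection \<open>Inverting the system on tails\<close>

context tail_rows
begin

lemma main_op_diff: "main_op (\<lambda>k. c k - e k) n = main_op c n - main_op e n"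
  by (simp add: main_op_def diff_divide_distrib sum_subtractf)

lemma main_op_add: "main_op (\<lambda>k. c k + e k) n = main_op c n + main_op e n"
  by (simp add: main_op_def add_divide_distrib sum.distrib)

lemma off_op_diff:
  assumes s: "s > 0" and c: "c \<in> supp_space (col_weight v s) (near_cols N)"
    and e: "e \<in> supp_space (col_weight v s) (near_cols N)" and N: "N \<ge> N1" and n: "n > N1"
  shows "off_op (\<lambda>k. c k - e k) n = off_op c n - off_op e n"
proof -
  have eps: "\<And>k. k > N \<Longrightarrow> v k \<le> 1 * V k" using N N1 N0(2) by auto
  have sc: "(\<lambda>k. c k * off_entry n k) summable_on UNIV" by (rule off_op_terms[OF s N c eps n])
  have se: "(\<lambda>k. e k * off_entry n k) summable_on UNIV" by (rule off_op_terms[OF s N e eps n])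
  have "off_op c n = (\<Sum>\<^sub>\<infinity>k. (c k - e k) * off_entry n k + e k * off_entry n k)"
    unfolding off_op_def by (simp add: left_diff_distrib)
  also have "\<dots> = off_op (\<lambda>k. c k - e k) n + off_op e n"
  proof -
    have "(\<lambda>k. (c k - e k) * off_entry n k) summable_on UNIV"
      using summable_on_add[OF sc summable_on_uminus[THEN iffD2, OF se]] by (simp add: left_diff_distrib)
    thus ?thesis unfolding off_op_def by (intro infsum_add se)
  qed
  finally show ?thesis by simp
qed

text \<open>With a solution operator \<open>G\<close> of the main part, the equation for
  \<open>ctrans = main_op + off_op\<close> becomes \<open>c + G (off_op c) = G b\<close>, a
  perturbation of the identity of norm at most 1/2, solved by the Neumann series in
  \<open>ell2\<close>.\<close>

lemma interp_sys_perturb: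
  assumes s: "s > 0" and N: "N \<ge> N1" and C: "C \<subseteq> near_cols N"
    and solve: "\<And>b. sqsummable w {N<..} b \<Longrightarrow>
      \<exists>c\<in>supp_space (col_weight v s) C. (\<forall>n>N. main_op c n = b n) \<and>
        nsq (col_weight v s) c \<le> CS * sqsum w {N<..} b"
    and uniq: "\<And>c. c \<in> supp_space (col_weight v s) C \<Longrightarrow> (\<And>n. n > N \<Longrightarrow> main_op c n = 0) \<Longrightarrow> c = (\<lambda>_. 0)"
    and bdd: "\<And>c. c \<in> supp_space (col_weight v s) C \<Longrightarrow> sqsummable w {N<..} (main_op c)"
    and eps: "\<And>k. k > N \<Longrightarrow> v k \<le> \<epsilon> * V k" and small: "CS * (Koff * \<epsilon>) \<le> 1 / 4" and CS: "CS \<ge> 0"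
  shows "interp_sys \<gamma> (col_weight v s) C {N<..} l w"
proof -
  define u where "u = col_weight v s"
  interpret poles \<gamma> u unfolding u_def by (rule poles_axiom[OF s])
  define sp where "sp = supp_space u C"
  define wsum where "wsum b = sqsum w {N<..} b" for b :: "nat \<Rightarrow> complex"
  \<comment> \<open>\<open>uniq\<close> leaves only one candidate, which makes \<open>G\<close>
    compatible with subtraction.\<close>
  define G where "G b = (SOME c. c \<in> sp \<and> (\<forall>n>N. main_op c n = b n) \<and> nsq u c \<le> CS * wsum b)" for b
  have G: "G b \<in> sp" "\<And>n. n > N \<Longrightarrow> main_op (G b) n = b n" "nsq u (G b) \<le> CS * wsum b"
    if "sqsummable w {N<..} b" for b
  proof -
    have "\<exists>c. c \<in> sp \<and> (\<forall>n>N. main_op c n = b n) \<and> nsq u c \<le> CS * wsum b"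
      using solve[OF that] by (auto simp: sp_def u_def wsum_def)
    from someI_ex[OF this] show "G b \<in> sp" "\<And>n. n > N \<Longrightarrow> main_op (G b) n = b n" "nsq u (G b) \<le> CS * wsum b"
      by (auto simp: G_def)
  qed
  have near: "c \<in> supp_space (col_weight v s) (near_cols N)" if "c \<in> sp" for c
    using supp_space_mono[OF C, of c u] that by (simp add: sp_def u_def)
  have sub: "{N<..} \<subseteq> {N1<..}" using N by auto
  have off_s: "sqsummable w {N<..} (off_op c)" if c: "c \<in> sp" for c
    by (rule summable_on_subset_banach[OF off_op_summable[OF s N near[OF c] eps] sub])
  have off_b: "CS * wsum (off_op c) \<le> 1 / 4 * nsq u c" if c: "c \<in> sp" for c
  proof -
    have "wsum (off_op c) \<le> sqsum w {N1<..} (off_op c)"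
      unfolding wsum_def by (rule infsum_mono2[OF off_s[OF c] off_op_summable[OF s N near[OF c] eps] sub])
        (use w_pos in \<open>auto simp: less_imp_le\<close>)
    also have "\<dots> \<le> Koff * \<epsilon> * nsq u c" unfolding u_def by (rule off_op_le[OF s N near[OF c] eps])
    finally have "CS * wsum (off_op c) \<le> CS * (Koff * \<epsilon> * nsq u c)" using CS by (intro mult_left_mono)
    also have "\<dots> = (CS * (Koff * \<epsilon>)) * nsq u c" by simp
    also have "\<dots> \<le> 1 / 4 * nsq u c" using small by (intro mult_right_mono) simp_all
    finally show ?thesis .
  qed
  have spD: "(\<lambda>k. c k - e k) \<in> sp" "(\<lambda>k. c k + e k) \<in> sp" if "c \<in> sp" "e \<in> sp" for c e
    using that by (auto simp: sp_def supp_space_diff supp_space_add)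
  have uniq': "c = e" if "c \<in> sp" "e \<in> sp" "\<And>n. n > N \<Longrightarrow> main_op c n = main_op e n" for c e
  proof -
    have "(\<lambda>k. c k - e k) = (\<lambda>_. 0)"
      by (rule uniq) (use spD[OF that(1,2)] that(3) in \<open>simp_all add: main_op_diff sp_def u_def\<close>)
    thus ?thesis by (metis (no_types) ext right_minus_eq)
  qed
  \<comment> \<open>\<open>toc\<close> and \<open>ofc\<close> translate between \<open>ell2\<close>
    and residues. \<open>toc\<close> discards the coordinates outside \<open>C\<close>, so it is
    defined on the whole space and inverts \<open>ofc\<close> on residues supported in
    \<open>C\<close>.\<close>
  define toc where "toc x k = (if k \<in> C then coord x k / of_real (sqrt (u k)) else 0)" for x :: ell2 and k
  define ofc where "ofc c = Ell2 (\<lambda>k. c k * of_real (sqrt (u k)))" for c :: "nat \<Rightarrow> complex"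
  have sq: "(cmod (c k * of_real (sqrt (u k))))^2 = (cmod (c k))^2 * u k" for c :: "nat \<Rightarrow> complex" and k
    by (simp add: norm_mult power_mult_distrib)
  have cofc: "coord (ofc c) k = c k * of_real (sqrt (u k))" if "c \<in> sp" for c k
  proof -
    have "(\<lambda>k. c k * of_real (sqrt (u k))) \<in> {x. (\<lambda>k. (cmod (x k))^2) summable_on UNIV}"
      using that unfolding sp_def mem_Collect_eq sq by (rule supp_space_summable)
    from Ell2_inverse[OF this] show ?thesis by (simp add: ofc_def)
  qed
  have nofc: "(norm (ofc c))^2 = nsq u c" if "c \<in> sp" for c
    unfolding norm_ell2_sq cofc[OF that] sq nsq_def ..
  have tocsq: "(cmod (toc x k))^2 * u k \<le> (cmod (coord x k))^2" for x k
    using u_pos[of k] by (simp add: toc_def norm_divide power_divide)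
  have cx: "(\<lambda>k. (cmod (coord x k))^2) summable_on UNIV" for x using coord[of x] by simp
  have toc_s: "sqsummable u UNIV (\<lambda>k. toc x k)" for x
    by (rule summable_on_comparison_test[OF cx[of x]]) (use tocsq in auto)
  have toc: "toc x \<in> sp" for x
    using toc_s[of x] by (auto simp: sp_def supp_space_def toc_def)
  have ntoc: "nsq u (toc x) \<le> (norm x)^2" for x
    unfolding nsq_def norm_ell2_sq by (rule infsum_mono[OF toc_s cx tocsq])
  have tocofc: "toc (ofc c) = c" if "c \<in> sp" for c
  proof
    fix k
    show "toc (ofc c) k = c k"
      using that u_pos[of k] supp_spaceD[of c u C k] by (auto simp: toc_def cofc[OF that] sp_def)
  qed
  have toc_lin: "toc (x - y) = (\<lambda>k. toc x k - toc y k)" "toc (x + y) = (\<lambda>k. toc x k + toc y k)" for x y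
    by (auto simp: toc_def coord_minus coord_plus diff_divide_distrib add_divide_distrib)
  define L where "L x = ofc (G (off_op (toc x)))" for x
  have Goff: "G (off_op c) \<in> sp" "\<And>n. n > N \<Longrightarrow> main_op (G (off_op c)) n = off_op c n" "nsq u (G (off_op c)) \<le> 1 / 4 * nsq u c"
    if c: "c \<in> sp" for c
    using G[OF off_s[OF c]] off_b[OF c] by auto
  have L_add: "L (x - y) = L x - L y" for x y
  proof -
    have e: "G (off_op (\<lambda>k. toc x k - toc y k)) = (\<lambda>k. G (off_op (toc x)) k - G (off_op (toc y)) k)"
    proof (rule uniq')
      show "G (off_op (\<lambda>k. toc x k - toc y k)) \<in> sp" by (rule Goff(1)[OF spD(1)[OF toc toc]])
      show "(\<lambda>k. G (off_op (toc x)) k - G (off_op (toc y)) k) \<in> sp" by (rule spD(1)[OF Goff(1)[OF toc] Goff(1)[OF toc]])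
      fix n assume n: "n > N"
      have "main_op (G (off_op (\<lambda>k. toc x k - toc y k))) n = off_op (\<lambda>k. toc x k - toc y k) n"
        by (rule Goff(2)[OF spD(1)[OF toc toc] n])
      also have "\<dots> = off_op (toc x) n - off_op (toc y) n"
        by (rule off_op_diff[OF s near[OF toc] near[OF toc] N]) (use n N in simp)
      finally show "main_op (G (off_op (\<lambda>k. toc x k - toc y k))) n = main_op (\<lambda>k. G (off_op (toc x)) k - G (off_op (toc y)) k) n"
        by (simp add: main_op_diff Goff(2)[OF toc n])
    qed
    have "coord (L (x - y)) = coord (L x - L y)"
    proof
      fix k
      have "G (off_op (toc (x - y))) = (\<lambda>k. G (off_op (toc x)) k - G (off_op (toc y)) k)" unfolding toc_lin by (rule e)
      moreover have cL: "coord (L z) k = G (off_op (toc z)) k * of_real (sqrt (u k))" for z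
        unfolding L_def by (rule cofc[OF Goff(1)[OF toc]])
      ultimately show "coord (L (x - y)) k = coord (L x - L y) k"
        unfolding coord_minus cL by (simp add: left_diff_distrib)
    qed
    thus ?thesis by (simp add: coord_inject)
  qed
  have L_bd: "norm (L x) \<le> norm x / 2" for x
  proof -
    have "(norm (L x))^2 \<le> 1 / 4 * (norm x)^2"
      unfolding L_def nofc[OF Goff(1)[OF toc]] using Goff(3)[OF toc, of x] ntoc[of x] by linarith
    also have "\<dots> = (norm x / 2)^2" by (simp add: power_divide)
    finally show ?thesis by (rule power2_le_imp_le) simp
  qed
  have surj: "\<exists>c\<in>supp_space u C. (\<forall>n\<in>{N<..}. ctrans \<gamma> c (l n) = b n) \<and> nsq u c \<le> (4 * CS) * sqsum w {N<..} b"
    if b: "sqsummable w {N<..} b" for b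
  proof -
    obtain x where x: "x + L x = ofc (G b)" "norm x \<le> 2 * norm (ofc (G b))"
      using Neumann_solve[OF L_add L_bd] by blast
    define c where "c = toc x"
    have c: "c \<in> sp" unfolding c_def by (rule toc)
    have "toc (x + L x) = G b" using x(1) tocofc[OF G(1)[OF b]] by simp
    hence e: "G b = (\<lambda>k. c k + G (off_op c) k)"
      unfolding toc_lin using tocofc[OF Goff(1)[OF toc, of x]] by (simp add: L_def c_def)
    have "ctrans \<gamma> c (l n) = b n" if n: "n > N" for n
    proof -
      have "b n = main_op (G b) n" using G(2)[OF b n] by simp
      also have "\<dots> = main_op c n + main_op (G (off_op c)) n" unfolding e by (rule main_op_add)
      also have "\<dots> = main_op c n + off_op c n" by (simp add: Goff(2)[OF c n])
      also have "\<dots> = ctrans \<gamma> c (l n)"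
        by (rule ctrans_split[OF s N near[OF c], symmetric]) (use n N in simp)
      finally show ?thesis by simp
    qed
    moreover have "nsq u c \<le> (4 * CS) * wsum b"
    proof -
      have "nsq u c \<le> (norm x)^2" unfolding c_def by (rule ntoc)
      also have "\<dots> \<le> (2 * norm (ofc (G b)))^2" by (rule power_mono[OF x(2)]) simp
      also have "\<dots> = 4 * nsq u (G b)" by (simp add: power_mult_distrib nofc[OF G(1)[OF b]])
      also have "\<dots> \<le> 4 * (CS * wsum b)" using G(3)[OF b] by simp
      finally show ?thesis by simp
    qed
    ultimately show ?thesis using c by (auto simp: sp_def wsum_def)
  qed
  have inj0: "c = (\<lambda>_. 0)" if c: "c \<in> supp_space u C" and z: "\<And>n. n \<in> {N<..} \<Longrightarrow> ctrans \<gamma> c (l n) = 0" for c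
  proof -
    have c': "c \<in> sp" using c by (simp add: sp_def)
    have "(\<lambda>k. c k + G (off_op c) k) = (\<lambda>_. 0)"
    proof (rule uniq')
      show "(\<lambda>k. c k + G (off_op c) k) \<in> sp" by (rule spD(2)[OF c' Goff(1)[OF c']])
      show "(\<lambda>_. 0) \<in> sp" unfolding sp_def by (rule supp_space_zero)
      fix n assume n: "n > N"
      have "main_op (\<lambda>k. c k + G (off_op c) k) n = main_op c n + off_op c n"
        by (simp add: main_op_add Goff(2)[OF c' n])
      also have "\<dots> = ctrans \<gamma> c (l n)"
        by (rule ctrans_split[OF s N near[OF c'], symmetric]) (use n N in simp)
      also have "\<dots> = 0" using z n by simp
      finally show "main_op (\<lambda>k. c k + G (off_op c) k) n = main_op (\<lambda>_. 0) n" by (simp add: main_op_def)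
    qed
    \<comment> \<open>A null vector equals \<open>- G (off_op c)\<close>, whose squared norm is at
      most a quarter of its own.\<close>
    hence "c k + G (off_op c) k = 0" for k by (rule fun_cong)
    hence "c k = - 1 * G (off_op c) k" for k by (simp add: eq_neg_iff_add_eq_0)
    hence "nsq u c = nsq u (\<lambda>k. -1 * G (off_op c) k)" by (metis (no_types) ext)
    hence "nsq u c \<le> 1 / 4 * nsq u c" using Goff(3)[OF c'] unfolding nsq_scale by simp
    hence "nsq u c \<le> 0" using nsq_nonneg[of c] by linarith
    thus ?thesis by (rule nsq_le_0[OF c])
  qed
  have "sqsummable w {N<..} (\<lambda>n. ctrans \<gamma> c (l n))" if c: "c \<in> supp_space u C" for c
  proof -
    have c': "c \<in> sp" using c by (simp add: sp_def)
    have "sqsummable w {N<..} (\<lambda>n. main_op c n + off_op c n)"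
      by (rule wsq_summable_add(1)) (use w_pos N off_s[OF c'] bdd[of c] c in \<open>auto simp: less_imp_le u_def\<close>)
    thus ?thesis
      by (rule summable_on_cong[THEN iffD1, rotated])
        (use N in \<open>simp add: ctrans_split[OF s N near[OF c']]\<close>)
  qed
  thus ?thesis unfolding interp_sys_def u_def[symmetric]
    using surj inj0 CS by (intro conjI ballI exI[of _ "4 * CS"] allI impI) simp_all
qed

end

section \<open>The main part as a first-order difference equation\<close>

lemma infsum_LIMSEQ:
  fixes f :: "nat \<Rightarrow> real"
  assumes "f summable_on {n..}"
  shows "(\<lambda>L. \<Sum>j=n..<L. f j) \<longlonglongrightarrow> infsum f {n..}"
proof -
  have "((\<lambda>j. if n \<le> j then f j else 0) has_sum infsum f {n..}) UNIV"
    by (rule has_sum_cong_neutral[THEN iffD1, OF _ _ _ has_sum_infsum[OF assms]]) auto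
  hence "(\<lambda>j. if n \<le> j then f j else 0) sums infsum f {n..}" by (rule has_sum_imp_sums)
  moreover have "(\<Sum>j<L. if n \<le> j then f j else 0) = (\<Sum>j=n..<L. f j)" for L
    by (simp add: sum.If_cases) (intro sum.cong; auto)
  ultimately show ?thesis by (simp add: sums_def)
qed

context tail_rows
begin

text \<open>Homogeneous solution: where \<open>main_op c\<close> vanishes, each step multiplies the
  partial sums of \<open>c\<close> by \<open>\<gamma> n / l n\<close>. Its squared modulus
  \<open>R\<close> is the sequence \<rho> up to a constant factor, the product here starting after
  \<open>N1\<close>.\<close>

definition pr :: "nat \<Rightarrow> complex" where "pr n = (\<Prod>j\<in>{N1<..n}. \<gamma> j / l j)"
definition R :: "nat \<Rightarrow> real" where "R n = (cmod (pr n))^2"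
text \<open>Weight of the increments: for \<open>y\<close>, the partial sums of \<open>c\<close>
  divided by \<open>pr\<close>, the increment caused by data \<open>b\<close> is at most
  \<open>sqrt (ucoef n)\<close> times \<open>sqrt (M * w n) * cmod (b n)\<close>.\<close>

definition ucoef :: "nat \<Rightarrow> real" where "ucoef n = v n / R n"
text \<open>Weight of the sums: up to a multiple of \<open>(cmod (b n))^2 * w n\<close>, the
  contribution \<open>(cmod (c n))^2 / v n\<close> to the norm is at most
  \<open>2 * hcoef n * (cmod (y n))^2\<close>.\<close>

definition hcoef :: "nat \<Rightarrow> real" where "hcoef n = (d n)^2 / ((g n)^2 * v n) * R n"

lemma gamma_nz: "n > N1 \<Longrightarrow> \<gamma> n \<noteq> 0"
  using g_pos[of n] idx[of n] by auto

lemma pr_Suc: "n \<ge> N1 \<Longrightarrow> pr (Suc n) = pr n * (\<gamma> (Suc n) / l (Suc n))"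
proof -
  assume "n \<ge> N1"
  hence "{N1<..Suc n} = insert (Suc n) {N1<..n}" by auto
  thus ?thesis by (simp add: pr_def mult.commute)
qed

lemma pr_nz: "pr n \<noteq> 0"
  unfolding pr_def using gamma_nz l_nz by (subst prod_zero_iff) auto

lemma R_pos: "R n > 0" using pr_nz[of n] by (simp add: R_def)

lemma R_Suc: "n \<ge> N1 \<Longrightarrow> R (Suc n) = R n * ((g (Suc n))^2 / (cmod (l (Suc n)))^2)"
  by (simp add: R_def pr_Suc norm_mult norm_divide power_mult_distrib power_divide)

lemma R_Suc_bounds: "n \<ge> N1 \<Longrightarrow> R (Suc n) \<le> 4 * R n" "n \<ge> N1 \<Longrightarrow> R n \<le> 4 * R (Suc n)"
proof -
  assume n: "n \<ge> N1"
  hence n': "Suc n > N1" by simp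
  have gp: "g (Suc n) > 0" using gamma_nz[OF n'] by simp
  have lp: "cmod (l (Suc n)) > 0" using l_nz[OF n'] by simp
  have "(g (Suc n))^2 \<le> (2 * cmod (l (Suc n)))^2" by (rule power_mono) (use l_bounds(1)[OF n'] in simp_all)
  hence "(g (Suc n))^2 / (cmod (l (Suc n)))^2 \<le> 4" using lp by (simp add: divide_le_eq power_mult_distrib)
  thus "R (Suc n) \<le> 4 * R n"
    using mult_left_mono[of "(g (Suc n))^2 / (cmod (l (Suc n)))^2" 4 "R n"] R_pos[of n] by (simp add: R_Suc[OF n] mult.commute)
  have "(cmod (l (Suc n)))^2 \<le> (2 * g (Suc n))^2" by (rule power_mono) (use l_bounds(2)[OF n'] in simp_all)
  hence "1 \<le> 4 * ((g (Suc n))^2 / (cmod (l (Suc n)))^2)" using lp by (simp add: le_divide_eq power_mult_distrib)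
  thus "R n \<le> 4 * R (Suc n)"
    using mult_left_mono[of 1 "4 * ((g (Suc n))^2 / (cmod (l (Suc n)))^2)" "R n"] R_pos[of n] by (simp add: R_Suc[OF n] mult_ac)
qed

lemma ucoef_pos: "n > N1 \<Longrightarrow> ucoef n > 0"
  using v_pos[of n] idx[of n] R_pos[of n] by (simp add: ucoef_def)

lemma hcoef_nonneg: "n > N1 \<Longrightarrow> hcoef n \<ge> 0"
  using v_pos[of n] idx[of n] R_pos[of n] by (auto simp: hcoef_def intro!: mult_nonneg_nonneg divide_nonneg_nonneg)

text \<open>The residues are the differences of \<open>pr n * y n\<close>, so their partial sums are
  known in closed form; residue 0 carries the initial value \<open>pr N * y N\<close>. Each residue
  is written in two ways, through \<open>y (n - 1)\<close> to verify the equation and through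
  \<open>y n\<close> to estimate it.\<close>

lemma
  assumes N: "N \<ge> N1"
    and rec: "\<And>n. n \<ge> N \<Longrightarrow> y (Suc n) = y n + (l (Suc n) - \<gamma> (Suc n)) * b (Suc n) / pr (Suc n)"
  defines "c \<equiv> \<lambda>k. if k = 0 then pr N * y N else if N < k then pr k * y k - pr (k - 1) * y (k - 1) else 0"
  shows main_op_rec: "n > N \<Longrightarrow> main_op c n = b n"
    and rec_sq_le: "n > N \<Longrightarrow> (cmod (c n))^2 / v n \<le> 2 * (hcoef n * (cmod (y n))^2) + 8 * M * ((cmod (b n))^2 * w n)"
proof -
  have N2: "N \<ge> 2" using N N1 N0(1) by simp
  have S: "(\<Sum>k<n. c k) = pr (n - 1) * y (n - 1)" if "Suc N \<le> n" for n
    using that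
  proof (induction n rule: dec_induct)
    case base
    have "(\<Sum>k<Suc N. c k) = (\<Sum>k\<in>{0}. c k)"
      by (rule sum.mono_neutral_right) (auto simp: c_def)
    thus ?case by (simp add: c_def)
  next
    case (step n)
    thus ?case by (simp add: c_def)
  qed
  have main: "main_op c n = b n \<and> (cmod (c n))^2 / v n \<le> 2 * (hcoef n * (cmod (y n))^2) + 8 * M * ((cmod (b n))^2 * w n)" if n: "n > N" for n
  proof -
    have n1: "n > N1" using n N by simp
    define m where "m = n - 1"
    have m: "n = Suc m" "m \<ge> N" "m \<ge> N1" using n N by (auto simp: m_def)
    define \<alpha> where "\<alpha> = l n - \<gamma> n"
    have nz: "l n \<noteq> 0" "\<gamma> n \<noteq> 0" "\<alpha> \<noteq> 0" "pr n \<noteq> 0" "pr m \<noteq> 0"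
      using l_nz[OF n1] gamma_nz[OF n1] l_ne[OF n1, of n] pr_nz by (auto simp: \<alpha>_def)
    have pn: "pr n = pr m * (\<gamma> n / l n)" using pr_Suc[OF m(3)] m(1) by simp
    have yn: "pr n * y n = pr n * y m + \<alpha> * b n"
      using rec[OF m(2)] nz m(1) by (simp add: \<alpha>_def distrib_left)
    have cn: "c n = pr n * y n - pr m * y m" using n m(1) by (simp add: c_def)
    have c1: "c n = \<alpha> * (b n - pr m * y m / l n)"
    proof -
      have "pr n * y m = pr m * y m - \<alpha> * (pr m * y m / l n)"
        unfolding pn using nz by (simp add: \<alpha>_def field_simps)
      thus ?thesis unfolding cn yn by (simp add: right_diff_distrib)
    qed
    have pm: "pr m = pr n * (l n / \<gamma> n)" unfolding pn using nz by simp
    have e: "pr m * y m = (l n / \<gamma> n) * (pr n * y n - \<alpha> * b n)"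
      unfolding yn by (simp add: pm)
    have f: "- \<alpha> / \<gamma> n = 1 - l n / \<gamma> n" using nz by (simp add: \<alpha>_def diff_divide_distrib)
    \<comment> \<open>Expressed through \<open>y n\<close> rather than \<open>y (n - 1)\<close>, so
      that weight and sum carry the same index, as the Hardy inequality wants.\<close>
    have c2: "c n = (- \<alpha> / \<gamma> n) * (pr n * y n) + (l n / \<gamma> n) * (\<alpha> * b n)"
      unfolding cn e f by (simp only: right_diff_distrib left_diff_distrib mult_1) simp
    have d\<alpha>: "d n = cmod \<alpha>" by (simp add: \<alpha>_def)
    have "main_op c n = b n"
      using S[of n] n nz unfolding main_op_def c1 by (simp add: \<alpha>_def[symmetric] m_def)
    moreover have "(cmod (c n))^2 / v n \<le> 2 * (hcoef n * (cmod (y n))^2) + 8 * M * ((cmod (b n))^2 * w n)"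
    proof -
      have vn: "v n > 0" using v_pos idx[OF n1] by simp
      have gn: "g n > 0" using nz by simp
      have d2: "(d n)^2 / v n \<le> M * w n" using w_ge[OF n1] vn by (simp add: divide_le_eq mult_ac)
      have l2: "(cmod (l n))^2 / (g n)^2 \<le> 4"
        using power_mono[OF l_bounds(2)[OF n1], of 2] gn by (simp add: divide_le_eq power_mult_distrib)
      have "(cmod (c n))^2 \<le> 2 * (cmod ((- \<alpha> / \<gamma> n) * (pr n * y n)))^2 + 2 * (cmod ((l n / \<gamma> n) * (\<alpha> * b n)))^2"
        unfolding c2 by (rule cmod_add_sq_le)
      hence "(cmod (c n))^2 / v n \<le> (2 * (cmod ((- \<alpha> / \<gamma> n) * (pr n * y n)))^2 + 2 * (cmod ((l n / \<gamma> n) * (\<alpha> * b n)))^2) / v n"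
        using vn by (intro divide_right_mono) simp_all
      also have "\<dots> = 2 * (hcoef n * (cmod (y n))^2) + 2 * ((cmod (l n))^2 / (g n)^2) * ((d n)^2 / v n) * (cmod (b n))^2"
        by (simp add: hcoef_def R_def d\<alpha> norm_mult norm_divide power_mult_distrib power_divide add_divide_distrib mult_ac)
      also have "\<dots> \<le> 2 * (hcoef n * (cmod (y n))^2) + 2 * 4 * (M * w n) * (cmod (b n))^2"
        using d2 l2 vn by (intro add_left_mono mult_right_mono mult_mono) simp_all
      finally show ?thesis by (simp add: mult_ac)
    qed
    ultimately show ?thesis by simp
  qed
  show "n > N \<Longrightarrow> main_op c n = b n"
    and "n > N \<Longrightarrow> (cmod (c n))^2 / v n \<le> 2 * (hcoef n * (cmod (y n))^2) + 8 * M * ((cmod (b n))^2 * w n)"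
    using main by blast+
qed

text \<open>Reduces a bounded solution of the main part to two estimates for \<open>y\<close>: a
  Hardy bound \<open>hy\<close> for the residues beyond \<open>N\<close>, and \<open>y0\<close> for
  the initial value, which is the residue of the auxiliary pole up to the factor
  \<open>pr N\<close>.\<close>

lemma main_solve:
  assumes N: "N \<ge> N1" and s: "s > 0"
    and b: "sqsummable w {N<..} b"
    and rec: "\<And>n. n \<ge> N \<Longrightarrow> y (Suc n) = y n + (l (Suc n) - \<gamma> (Suc n)) * b (Suc n) / pr (Suc n)"
    and hy: "\<And>L. (\<Sum>n=Suc N..<L. hcoef n * (cmod (y n))^2) \<le> K1 * sqsum w {N<..} b"
    and y0: "s * (R N * (cmod (y N))^2) \<le> K2 * sqsum w {N<..} b"
  shows "\<exists>c\<in>supp_space (col_weight v s) (if y N = 0 then {N<..} else near_cols N). (\<forall>n>N. main_op c n = b n) \<and>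
    nsq (col_weight v s) c \<le> (K2 + 2 * K1 + 8 * M) * sqsum w {N<..} b"
proof -
  define S where "S = sqsum w {N<..} b"
  define c where "c k = (if k = 0 then pr N * y N else if N < k then pr k * y k - pr (k - 1) * y (k - 1) else 0)" for k
  have c_fun: "c = (\<lambda>k. if k = 0 then pr N * y N else if N < k then pr k * y k - pr (k - 1) * y (k - 1) else 0)"
    by (rule ext) (simp add: c_def)
  have main: "main_op c n = b n" if "n > N" for n unfolding c_fun by (rule main_op_rec[OF N rec that])
  have sq: "(cmod (c n))^2 / v n \<le> 2 * (hcoef n * (cmod (y n))^2) + 8 * M * ((cmod (b n))^2 * w n)" if "n > N" for n
    unfolding c_fun by (rule rec_sq_le[OF N rec that])
  have N2: "N \<ge> 2" using N N1 N0(1) by simp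
  interpret poles \<gamma> "col_weight v s" by (rule poles_axiom[OF s])
  have fin: "(\<Sum>k\<in>F. (cmod (c k))^2 * col_weight v s k) \<le> (K2 + 2 * K1 + 8 * M) * S" if F: "finite F" for F
  proof -
    obtain m0 where m0: "\<forall>k\<in>F. k \<le> m0" using F unfolding finite_nat_set_iff_bounded_le ..
    define L where "L = Suc (N + m0)"
    have FL: "k < L" if "k \<in> F" for k using m0 that by (auto simp: L_def)
    have "(\<Sum>k\<in>F. (cmod (c k))^2 * col_weight v s k) \<le> (\<Sum>k<L. (cmod (c k))^2 * col_weight v s k)"
      by (rule sum_mono2) (use FL in auto)
    also have "\<dots> = (\<Sum>k\<in>insert 0 {Suc N..<L}. (cmod (c k))^2 * col_weight v s k)"
      by (rule sum.mono_neutral_right) (auto simp: c_def L_def)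
    also have "\<dots> = s * (R N * (cmod (y N))^2) + (\<Sum>k=Suc N..<L. (cmod (c k))^2 / v k)"
      by (subst sum.insert) (auto simp: c_def col_weight_def R_def norm_mult power_mult_distrib intro!: sum.cong)
    also have "\<dots> \<le> K2 * S + (\<Sum>k=Suc N..<L. 2 * (hcoef k * (cmod (y k))^2) + 8 * M * ((cmod (b k))^2 * w k))"
      unfolding S_def by (intro add_mono y0 sum_mono sq) simp
    also have "\<dots> = K2 * S + (2 * (\<Sum>k=Suc N..<L. hcoef k * (cmod (y k))^2) + 8 * M * (\<Sum>k=Suc N..<L. (cmod (b k))^2 * w k))"
      by (simp add: sum.distrib sum_distrib_left)
    also have "\<dots> \<le> K2 * S + (2 * (K1 * S) + 8 * M * S)"
    proof -
      have "(\<Sum>k=Suc N..<L. (cmod (b k))^2 * w k) \<le> S" unfolding S_def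
        by (rule finite_sum_le_infsum[OF b]) (use w_pos N in \<open>auto simp: less_imp_le\<close>)
      thus ?thesis using hy[of L] M unfolding S_def[symmetric]
        by (intro add_left_mono[of _ _ "K2 * S"] add_mono[of "2 * _"] mult_left_mono) simp_all
    qed
    finally show ?thesis by (simp add: algebra_simps)
  qed
  have nn: "0 \<le> (cmod (c k))^2 * col_weight v s k" for k by simp
  have "(\<lambda>k. (cmod (c k))^2 * col_weight v s k) summable_on UNIV" "nsq (col_weight v s) c \<le> (K2 + 2 * K1 + 8 * M) * S"
    unfolding nsq_def by (rule nonneg_bounded_summable[OF nn fin]; simp)+
  moreover have "c k = 0" if "k \<notin> (if y N = 0 then {N<..} else near_cols N)" for k
    using that by (auto simp: c_def near_cols_def split: if_splits)
  ultimately show ?thesis using main unfolding supp_space_def S_def[symmetric]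
    by (intro bexI[of _ c]) auto
qed

lemma beta_le:
  assumes n: "n > N1"
  shows "cmod ((l n - \<gamma> n) * b / pr n) \<le> sqrt (ucoef n) * (sqrt (M * w n) * cmod b)"
proof -
  have "(d n)^2 \<le> v n * (M * w n)" using w_ge[OF n] by (simp add: mult_ac)
  hence "d n \<le> sqrt (v n * (M * w n))" by (rule real_le_rsqrt)
  hence "d n * cmod b / cmod (pr n) \<le> sqrt (v n * (M * w n)) * cmod b / cmod (pr n)"
    by (intro divide_right_mono mult_right_mono) simp_all
  thus ?thesis
    by (simp add: norm_mult norm_divide ucoef_def R_def real_sqrt_divide real_sqrt_mult)
qed

text \<open>\<open>y\<close> is summed from the beginning of the tail with \<open>y N = 0\<close>,
  so the auxiliary pole stays empty, and the Hardy inequality asks for partial sums of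
  \<open>ucoef\<close> against tails of \<open>hcoef\<close>.\<close>

lemma solve_exact:
  assumes XY: "\<And>N n L. N1 \<le> N \<Longrightarrow> N < n \<Longrightarrow> n < L \<Longrightarrow> (\<Sum>j=Suc N..n. ucoef j) * (\<Sum>j=n..<L. hcoef j) \<le> B"
    and N: "N \<ge> N1" and s: "s > 0" and b: "sqsummable w {N<..} b"
  shows "\<exists>c\<in>supp_space (col_weight v s) {N<..}. (\<forall>n>N. main_op c n = b n) \<and>
    nsq (col_weight v s) c \<le> (8 * B * M + 8 * M) * sqsum w {N<..} b"
proof -
  define S where "S = sqsum w {N<..} b"
  define y where "y n = (\<Sum>j=Suc N..n. (l j - \<gamma> j) * b j / pr j)" for n
  define t where "t j = sqrt (M * w j) * cmod (b j)" for j
  have B0: "B \<ge> 0"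
  proof -
    have "0 \<le> (\<Sum>j=Suc N..Suc N. ucoef j) * (\<Sum>j=Suc N..<Suc (Suc N). hcoef j)"
      using N ucoef_pos[of "Suc N"] hcoef_nonneg[of "Suc N"] by simp
    also have "\<dots> \<le> B" by (rule XY[OF N]) simp_all
    finally show ?thesis .
  qed
  have yle: "cmod (y n) \<le> (\<Sum>j=Suc N..n. sqrt (ucoef j) * t j)" for n
    unfolding y_def t_def by (rule order_trans[OF norm_sum sum_mono], rule beta_le) (use N in simp)
  have t2: "(t j)^2 = M * ((cmod (b j))^2 * w j)" if "j > N1" for j
    using M w_pos[OF that] by (simp add: t_def power_mult_distrib)
  have hy: "(\<Sum>n=Suc N..<L. hcoef n * (cmod (y n))^2) \<le> (4 * B * M) * S" for L
  proof -
    have "(\<Sum>n=Suc N..<L. hcoef n * (cmod (y n))^2) \<le> (\<Sum>n=Suc N..<L. hcoef n * (\<Sum>j=Suc N..n. sqrt (ucoef j) * t j)^2)"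
      using N by (intro sum_mono mult_left_mono power_mono yle hcoef_nonneg) simp_all
    also have "\<dots> \<le> 4 * B * (\<Sum>n=Suc N..<L. (t n)^2)"
      by (rule Hardy_inequality) (use N ucoef_pos hcoef_nonneg XY in auto)
    also have "(\<Sum>n=Suc N..<L. (t n)^2) = M * (\<Sum>n=Suc N..<L. (cmod (b n))^2 * w n)"
      unfolding sum_distrib_left by (intro sum.cong refl t2) (use N in simp)
    also have "4 * B * (M * (\<Sum>n=Suc N..<L. (cmod (b n))^2 * w n)) \<le> 4 * B * (M * S)"
      unfolding S_def using B0 M N w_pos
      by (intro mult_left_mono finite_sum_le_infsum[OF b]) (auto simp: less_imp_le)
    finally show ?thesis by simp
  qed
  have "y N = 0" by (simp add: y_def)
  moreover have "\<exists>c\<in>supp_space (col_weight v s) (if y N = 0 then {N<..} else near_cols N). (\<forall>n>N. main_op c n = b n) \<and>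
    nsq (col_weight v s) c \<le> (0 + 2 * (4 * B * M) + 8 * M) * sqsum w {N<..} b"
  proof (rule main_solve[OF N s b])
    show "y (Suc n) = y n + (l (Suc n) - \<gamma> (Suc n)) * b (Suc n) / pr (Suc n)" if "n \<ge> N" for n
      using that by (simp add: y_def)
  qed (use hy \<open>y N = 0\<close> in \<open>simp_all add: S_def\<close>)
  ultimately show ?thesis by (simp add: mult.assoc)
qed

text \<open>\<open>y\<close> is summed from infinity; \<open>XR\<close> provides the summability of
  \<open>ucoef\<close> that this takes, and an initial value is left over. Its cost is measured with
  weight \<open>1 / V (Suc N)\<close>, precisely the scale that \<open>XR\<close> controls, so the
  constant does not depend on \<open>N\<close>.\<close>

lemma solve_deficient:
  assumes XY: "\<And>n L. N1 < n \<Longrightarrow> n < L \<Longrightarrow> (\<Sum>j=n..<L. ucoef j) * (\<Sum>j=Suc N1..n. hcoef j) \<le> B"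
    and XR: "\<And>n L. N1 < n \<Longrightarrow> n < L \<Longrightarrow> (\<Sum>j=n..<L. ucoef j) * R n \<le> B * V n"
    and N: "N \<ge> N1" and b: "sqsummable w {N<..} b"
  shows "\<exists>c\<in>supp_space (col_weight v (1 / V (Suc N))) (near_cols N). (\<forall>n>N. main_op c n = b n) \<and>
    nsq (col_weight v (1 / V (Suc N))) c \<le> (12 * B * M + 8 * M) * sqsum w {N<..} b"
proof -
  define S where "S = sqsum w {N<..} b"
  define \<beta> where "\<beta> j = (l j - \<gamma> j) * b j / pr j" for j
  define y where "y n = - (\<Sum>\<^sub>\<infinity>j\<in>{n<..}. \<beta> j)" for n
  define t where "t j = sqrt (M * w j) * cmod (b j)" for j
  have V0: "V n > 0" for n by (rule V_pos)
  have us: "ucoef summable_on {n..}" "R n * infsum ucoef {n..} \<le> B * V n" if n: "n > N1" for n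
  proof -
    have fin: "(\<Sum>j\<in>F. ucoef j) \<le> B * V n / R n" if F: "finite F" "F \<subseteq> {n..}" for F
    proof -
      obtain m0 where m0: "\<forall>k\<in>F. k \<le> m0" using F(1) unfolding finite_nat_set_iff_bounded_le ..
      have "(\<Sum>j\<in>F. ucoef j) \<le> (\<Sum>j=n..<Suc (n + m0). ucoef j)"
      proof (rule sum_mono2)
        show "F \<subseteq> {n..<Suc (n + m0)}" using F(2) m0 by fastforce
      qed (use ucoef_pos n in \<open>auto simp: less_imp_le\<close>)
      also have "\<dots> \<le> B * V n / R n" using XR[OF n, of "Suc (n + m0)"] R_pos[of n] by (simp add: le_divide_eq)
      finally show ?thesis .
    qed
    have nn: "0 \<le> ucoef j" if "j \<in> {n..}" for j using ucoef_pos[of j] that n by simp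
    show "ucoef summable_on {n..}" by (rule nonneg_bounded_summable(1)[OF nn fin])
    have "infsum ucoef {n..} \<le> B * V n / R n" by (rule nonneg_bounded_summable(2)[OF nn fin])
    thus "R n * infsum ucoef {n..} \<le> B * V n" using R_pos[of n] by (simp add: le_divide_eq mult.commute)
  qed
  have B0: "B \<ge> 0"
  proof -
    have "0 \<le> (\<Sum>j=Suc N1..<Suc (Suc N1). ucoef j) * R (Suc N1)"
      using ucoef_pos[of "Suc N1"] R_pos[of "Suc N1"] by simp
    also have "\<dots> \<le> B * V (Suc N1)" by (rule XR) simp_all
    finally show ?thesis using V0[of "Suc N1"] by (simp add: zero_le_mult_iff)
  qed
  have t2: "(t j)^2 = M * ((cmod (b j))^2 * w j)" if "j > N1" for j
    using M w_pos[OF that] by (simp add: t_def power_mult_distrib)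
  have ts: "(\<lambda>j. (t j)^2) summable_on {N<..}"
    by (rule summable_on_cong[THEN iffD2, OF t2 summable_on_cmult_right[OF b]]) (use N in simp)
  have tS: "(\<Sum>\<^sub>\<infinity>j\<in>{N<..}. (t j)^2) = M * S"
    unfolding S_def infsum_cmult_right'[symmetric] by (rule infsum_cong) (use N t2 in simp)
  have uts: "(\<lambda>j. sqrt (ucoef j) * t j) summable_on {n..}" and uts2: "(infsum (\<lambda>j. sqrt (ucoef j) * t j) {n..})^2 \<le> infsum ucoef {n..} * (M * S)"
    if n: "n > N" for n
  proof -
    have n1: "n > N1" using n N by simp
    have sub: "{n..} \<subseteq> {N<..}" using n by auto
    have nn: "0 \<le> ucoef j" if "j \<in> {n..}" for j using ucoef_pos[of j] that n1 by simp
    have 1: "(\<lambda>j. (norm (sqrt (ucoef j)))^2) summable_on {n..}"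
      by (rule summable_on_cong[THEN iffD2, OF _ us(1)[OF n1]]) (use nn in simp)
    have e1: "(\<Sum>\<^sub>\<infinity>j\<in>{n..}. (norm (sqrt (ucoef j)))^2) = infsum ucoef {n..}"
      by (rule infsum_cong) (use nn in simp)
    have 2: "(\<lambda>j. (norm (t j))^2) summable_on {n..}"
      using summable_on_subset_banach[OF ts sub] by simp
    have e2: "(\<Sum>\<^sub>\<infinity>j\<in>{n..}. (norm (t j))^2) \<le> M * S"
      unfolding tS[symmetric] real_norm_def power2_abs
      by (rule infsum_mono2[OF summable_on_subset_banach[OF ts sub] ts sub]) simp
    show "(\<lambda>j. sqrt (ucoef j) * t j) summable_on {n..}"
      using infsum_Cauchy_Schwarz(1)[OF 1 2] by (rule abs_summable_summable)
    have "(infsum (\<lambda>j. sqrt (ucoef j) * t j) {n..})^2 \<le> infsum ucoef {n..} * (\<Sum>\<^sub>\<infinity>j\<in>{n..}. (norm (t j))^2)"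
      using infsum_Cauchy_Schwarz(3)[OF 1 2] unfolding e1 by simp
    also have "\<dots> \<le> infsum ucoef {n..} * (M * S)"
      using e2 nn by (intro mult_left_mono infsum_nonneg) auto
    finally show "(infsum (\<lambda>j. sqrt (ucoef j) * t j) {n..})^2 \<le> infsum ucoef {n..} * (M * S)" .
  qed
  have ble: "cmod (\<beta> j) \<le> sqrt (ucoef j) * t j" if "j > N1" for j
    unfolding \<beta>_def t_def by (rule beta_le[OF that])
  have babs: "(\<lambda>j. cmod (\<beta> j)) summable_on {n..}" if n: "n > N" for n
    by (rule summable_on_comparison_test[OF uts[OF n]]) (use ble n N in auto)
  have bsum: "\<beta> summable_on {n<..}" if n: "n \<ge> N" for n
  proof -
    have "{n<..} = {Suc n..}" by auto
    thus ?thesis using babs[of "Suc n"] n by (simp add: abs_summable_summable)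
  qed
  have yle: "cmod (y n) \<le> infsum (\<lambda>j. sqrt (ucoef j) * t j) {Suc n..}" if n: "n \<ge> N" for n
  proof -
    have e: "{n<..} = {Suc n..}" by auto
    have n': "Suc n > N" using n by simp
    have "cmod (y n) \<le> infsum (\<lambda>j. cmod (\<beta> j)) {Suc n..}"
      unfolding y_def norm_minus_cancel e by (rule norm_infsum_bound[OF babs[OF n']])
    also have "\<dots> \<le> infsum (\<lambda>j. sqrt (ucoef j) * t j) {Suc n..}"
      by (rule infsum_mono[OF babs[OF n'] uts[OF n'] ble]) (use n N in simp)
    finally show ?thesis .
  qed
  have tn: "0 \<le> sqrt (ucoef j) * t j" if "j > N1" for j
    using ucoef_pos[OF that] M w_pos[OF that] by (simp add: t_def)
  \<comment> \<open>One more term than \<open>y n\<close> involves, so that the sum starts at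
    \<open>n\<close> like the one in the dual Hardy inequality.\<close>
  have yle': "cmod (y n) \<le> infsum (\<lambda>j. sqrt (ucoef j) * t j) {n..}" if n: "n > N" for n
  proof -
    have "infsum (\<lambda>j. sqrt (ucoef j) * t j) {Suc n..} \<le> infsum (\<lambda>j. sqrt (ucoef j) * t j) {n..}"
      by (rule infsum_mono2[OF uts uts]) (use n N tn in auto)
    thus ?thesis using yle[of n] n by simp
  qed
  have hy: "(\<Sum>n=Suc N..<L. hcoef n * (cmod (y n))^2) \<le> (4 * B * M) * S" for L
  proof -
    have "(\<Sum>n=Suc N..<L. hcoef n * (cmod (y n))^2) \<le> (\<Sum>n=Suc N..<L. hcoef n * (infsum (\<lambda>j. sqrt (ucoef j) * t j) {n..})^2)"
      using N by (intro sum_mono mult_left_mono power_mono yle' hcoef_nonneg) simp_all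
    \<comment> \<open>The dual inequality is finite; it is applied on \<open>{Suc N..<L'}\<close>,
      and \<open>L'\<close> tends to infinity while \<open>L\<close> is fixed.\<close>
    also have "\<dots> \<le> (4 * B * M) * S"
    proof (rule LIMSEQ_le_const2)
      show "(\<lambda>L'. \<Sum>n=Suc N..<L. hcoef n * (\<Sum>j=n..<L'. sqrt (ucoef j) * t j)^2) \<longlonglongrightarrow> (\<Sum>n=Suc N..<L. hcoef n * (infsum (\<lambda>j. sqrt (ucoef j) * t j) {n..})^2)"
        by (intro tendsto_intros infsum_LIMSEQ uts) simp
      show "\<exists>L0. \<forall>L'\<ge>L0. (\<Sum>n=Suc N..<L. hcoef n * (\<Sum>j=n..<L'. sqrt (ucoef j) * t j)^2) \<le> 4 * B * M * S"
      proof (intro exI allI impI)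
        fix L' assume L': "L \<le> L'"
        have "(\<Sum>n=Suc N..<L. hcoef n * (\<Sum>j=n..<L'. sqrt (ucoef j) * t j)^2) \<le> (\<Sum>n=Suc N..<L'. hcoef n * (\<Sum>j=n..<L'. sqrt (ucoef j) * t j)^2)"
          by (rule sum_mono2) (use L' N hcoef_nonneg in auto)
        also have "\<dots> \<le> 4 * B * (\<Sum>n=Suc N..<L'. (t n)^2)"
        proof (rule Hardy_inequality_dual)
          fix n assume n: "Suc N \<le> n" "n < L'"
          show "0 < ucoef n" "0 \<le> hcoef n" using n N ucoef_pos hcoef_nonneg by simp_all
          have "(\<Sum>j=Suc N..n. hcoef j) \<le> (\<Sum>j=Suc N1..n. hcoef j)"
            by (rule sum_mono2) (use N hcoef_nonneg in auto)
          hence "(\<Sum>j=n..<L'. ucoef j) * (\<Sum>j=Suc N..n. hcoef j) \<le> (\<Sum>j=n..<L'. ucoef j) * (\<Sum>j=Suc N1..n. hcoef j)"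
            using ucoef_pos n N by (intro mult_left_mono sum_nonneg) (auto simp: less_imp_le)
          also have "\<dots> \<le> B" by (rule XY) (use n N in simp_all)
          finally show "(\<Sum>j=n..<L'. ucoef j) * (\<Sum>j=Suc N..n. hcoef j) \<le> B" .
        qed
        also have "\<dots> \<le> 4 * B * (M * S)"
          unfolding tS[symmetric] using B0 by (intro mult_left_mono finite_sum_le_infsum[OF ts]) auto
        finally show "(\<Sum>n=Suc N..<L. hcoef n * (\<Sum>j=n..<L'. sqrt (ucoef j) * t j)^2) \<le> 4 * B * M * S" by simp
      qed
    qed
    finally show ?thesis .
  qed
  have S0: "S \<ge> 0" unfolding S_def using w_pos N by (intro infsum_nonneg) (auto simp: less_imp_le)
  have y0: "1 / V (Suc N) * (R N * (cmod (y N))^2) \<le> (4 * B * M) * S"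
  proof -
    have N': "Suc N > N1" "Suc N > N" using N by simp_all
    have "(cmod (y N))^2 \<le> (infsum (\<lambda>j. sqrt (ucoef j) * t j) {Suc N..})^2"
      by (rule power_mono[OF yle]) simp_all
    also have "\<dots> \<le> infsum ucoef {Suc N..} * (M * S)" by (rule uts2) simp
    finally have "R N * (cmod (y N))^2 \<le> (4 * R (Suc N)) * (infsum ucoef {Suc N..} * (M * S))"
      using R_Suc_bounds(2)[OF N] R_pos by (intro mult_mono) (auto simp: less_imp_le)
    also have "\<dots> = 4 * (R (Suc N) * infsum ucoef {Suc N..}) * (M * S)" by simp
    also have "\<dots> \<le> 4 * (B * V (Suc N)) * (M * S)"
      using us(2)[OF N'(1)] M S0 by (intro mult_right_mono mult_left_mono) simp_all
    finally show ?thesis using V0[of "Suc N"] by (simp add: divide_le_eq mult_ac)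
  qed
  have rec: "y (Suc n) = y n + (l (Suc n) - \<gamma> (Suc n)) * b (Suc n) / pr (Suc n)" if n: "n \<ge> N" for n
  proof -
    have "{n<..} = insert (Suc n) {Suc n<..}" by auto
    hence "(\<Sum>\<^sub>\<infinity>j\<in>{n<..}. \<beta> j) = \<beta> (Suc n) + (\<Sum>\<^sub>\<infinity>j\<in>{Suc n<..}. \<beta> j)"
      using infsum_insert[OF bsum[of "Suc n"], of "Suc n"] n by simp
    thus ?thesis by (simp add: y_def \<beta>_def)
  qed
  have "\<exists>c\<in>supp_space (col_weight v (1 / V (Suc N))) (if y N = 0 then {N<..} else near_cols N). (\<forall>n>N. main_op c n = b n) \<and>
    nsq (col_weight v (1 / V (Suc N))) c \<le> (4 * B * M + 2 * (4 * B * M) + 8 * M) * sqsum w {N<..} b"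
    by (rule main_solve[OF N _ b rec]) (use hy y0 V0 in \<open>simp_all add: S_def\<close>)
  then obtain c where c: "c \<in> supp_space (col_weight v (1 / V (Suc N))) (if y N = 0 then {N<..} else near_cols N)"
    "\<forall>n>N. main_op c n = b n" "nsq (col_weight v (1 / V (Suc N))) c \<le> (4 * B * M + 2 * (4 * B * M) + 8 * M) * S"
    by (auto simp: S_def)
  have "(if y N = 0 then {N<..} else near_cols N) \<subseteq> near_cols N" by (auto simp: near_cols_def)
  from supp_space_mono[OF this c(1)] show ?thesis using c(2,3)
    by (intro bexI[of _ c]) (simp_all add: S_def algebra_simps)
qed

end

section \<open>Mapping properties of the main part and invertible tail systems\<close>

context tail_rows
begin

text \<open>The averaging term \<open>(\<Sum>k<n. c k) / l n\<close> is controlled by the Hardy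
  inequality with weights \<open>v\<close> and \<open>w n / (cmod (l n))^2\<close>; its hypothesis
  is the boundedness of \<open>V n * Q n\<close>.\<close>

lemma main_op_summable:
  assumes Q: "\<And>n L. N1 < n \<Longrightarrow> n < L \<Longrightarrow> V n * (\<Sum>j=n..<L. w j / (cmod (l j))^2) \<le> BQ"
    and N: "N \<ge> N1" and s: "s > 0" and c: "c \<in> supp_space (col_weight v s) (near_cols N)"
  shows "sqsummable w {N<..} (main_op c)"
proof -
  interpret poles \<gamma> "col_weight v s" by (rule poles_axiom[OF s])
  define h where "h n = w n / (cmod (l n))^2" for n
  define t where "t j = cmod (c j) / sqrt (v j)" for j
  define K where "K = nsq (col_weight v s) c"
  have Nn: "n > N1 \<and> n \<ge> 2 \<and> n \<ge> N0" if "n > N" for n using that N idx[of n] by simp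
  have vp: "v n > 0" if "n > N" for n using v_pos Nn[OF that] by simp
  have hn: "h n \<ge> 0" if "n > N" for n using w_pos[of n] Nn[OF that] by (simp add: h_def)
  have BQ0: "BQ \<ge> 0"
  proof -
    have "0 \<le> V (Suc N) * (\<Sum>j=Suc N..<Suc (Suc N). h j)" using V_pos[of "Suc N"] hn[of "Suc N"] by simp
    also have "\<dots> \<le> BQ" unfolding h_def by (rule Q) (use N in simp_all)
    finally show ?thesis .
  qed
  have tK: "(\<Sum>j=Suc N..<L. (t j)^2) \<le> K" for L
  proof -
    have "(\<Sum>j=Suc N..<L. (t j)^2) = (\<Sum>j=Suc N..<L. (cmod (c j))^2 * col_weight v s j)"
      by (rule sum.cong) (use vp in \<open>auto simp: t_def col_weight_def power_divide less_imp_le\<close>)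
    also have "\<dots> \<le> K" unfolding K_def nsq_def
      by (rule finite_sum_le_infsum[OF supp_space_summable[OF c]]) simp_all
    finally show ?thesis .
  qed
  have cz: "c k = 0" if "k \<noteq> 0" "\<not> Suc N \<le> k" for k
    using supp_spaceD[OF c, of k] that by (simp add: near_cols_def)
  have A: "cmod (\<Sum>k<n. c k) \<le> cmod (c 0) + (\<Sum>j=Suc N..n. sqrt (v j) * t j)" if n: "n > N" for n
  proof -
    have "(\<Sum>k<n. c k) = (\<Sum>k\<in>insert 0 {Suc N..<n}. c k)"
      by (rule sum.mono_neutral_right) (use n in \<open>auto intro!: cz\<close>)
    hence "(\<Sum>k<n. c k) = c 0 + (\<Sum>k=Suc N..<n. c k)" by simp
    hence "cmod (\<Sum>k<n. c k) \<le> cmod (c 0) + (\<Sum>k=Suc N..<n. cmod (c k))"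
      using norm_triangle_ineq[of "c 0" "\<Sum>k=Suc N..<n. c k"] norm_sum[of c "{Suc N..<n}"] by simp
    also have "(\<Sum>k=Suc N..<n. cmod (c k)) \<le> (\<Sum>k=Suc N..n. cmod (c k))" by (rule sum_mono2) auto
    also have "\<dots> = (\<Sum>j=Suc N..n. sqrt (v j) * t j)"
    proof (rule sum.cong[OF refl])
      fix j assume "j \<in> {Suc N..n}"
      hence "v j > 0" using vp by simp
      thus "cmod (c j) = sqrt (v j) * t j" by (simp add: t_def)
    qed
    finally show ?thesis by simp
  qed
  have row: "(cmod (main_op c n))^2 * w n \<le> 2 * (t n)^2 + 4 * (cmod (c 0))^2 * h n + 4 * (h n * (\<Sum>j=Suc N..n. sqrt (v j) * t j)^2)"
    if n: "n > N" for n
  proof -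
    have n1: "n > N1" using Nn[OF n] by simp
    define X where "X = (\<Sum>j=Suc N..n. sqrt (v j) * t j)"
    have "(cmod (\<Sum>k<n. c k))^2 \<le> (cmod (c 0) + X)^2"
      unfolding X_def by (rule power_mono[OF A[OF n]]) simp
    also have "\<dots> \<le> 2 * (cmod (c 0))^2 + 2 * X^2"
      using sum_squares_bound[of "cmod (c 0)" X] by (simp add: power2_sum)
    finally have a: "(cmod (\<Sum>k<n. c k))^2 \<le> 2 * (cmod (c 0))^2 + 2 * X^2" .
    have "(cmod (c n / (l n - \<gamma> n)))^2 * w n = (cmod (c n))^2 * (w n / (d n)^2)"
      by (simp add: norm_divide power_divide)
    also have "\<dots> \<le> (cmod (c n))^2 * (1 / v n)"
      using w_le[OF n1] vp[OF n] d_pos[OF n1] by (intro mult_left_mono) (simp_all add: field_simps)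
    also have "\<dots> = (t n)^2" using vp[OF n] by (simp add: t_def power_divide)
    finally have b: "(cmod (c n / (l n - \<gamma> n)))^2 * w n \<le> (t n)^2" .
    have e: "(cmod ((\<Sum>k<n. c k) / l n))^2 * w n = h n * (cmod (\<Sum>k<n. c k))^2"
      by (simp add: h_def norm_divide power_divide)
    have "(cmod (main_op c n))^2 * w n \<le> (2 * (cmod (c n / (l n - \<gamma> n)))^2 + 2 * (cmod ((\<Sum>k<n. c k) / l n))^2) * w n"
      unfolding main_op_def using w_pos[OF n1] by (intro mult_right_mono cmod_add_sq_le) simp
    also have "\<dots> = 2 * ((cmod (c n / (l n - \<gamma> n)))^2 * w n) + 2 * (h n * (cmod (\<Sum>k<n. c k))^2)"
      using e by (simp add: distrib_right)
    also have "\<dots> \<le> 2 * (t n)^2 + 2 * (h n * (2 * (cmod (c 0))^2 + 2 * X^2))"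
      using a b hn[OF n] by (intro add_mono mult_left_mono) simp_all
    finally show ?thesis by (simp add: X_def algebra_simps)
  qed
  have hsum: "(\<Sum>n=Suc N..<L. h n) \<le> BQ / V (Suc N)" for L
  proof (cases "Suc N < L")
    case True
    have "V (Suc N) * (\<Sum>n=Suc N..<L. h n) \<le> BQ" unfolding h_def by (rule Q[OF _ True]) (use N in simp)
    thus ?thesis using V_pos[of "Suc N"] by (simp add: le_divide_eq mult.commute)
  next
    case False thus ?thesis using BQ0 V_pos[of "Suc N"] by simp
  qed
  show ?thesis
  proof (rule nonneg_bounded_summable(1))
    show "0 \<le> (cmod (main_op c n))^2 * w n" if "n \<in> {N<..}" for n
      using that w_pos[of n] N by simp
    fix F assume F: "finite F" "F \<subseteq> {N<..}"
    obtain m0 where m0: "\<forall>k\<in>F. k \<le> m0" using F(1) unfolding finite_nat_set_iff_bounded_le ..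
    define L where "L = Suc m0"
    have FL: "F \<subseteq> {Suc N..<L}" using F(2) m0 by (auto simp: L_def less_Suc_eq_le)
    have "(\<Sum>n\<in>F. (cmod (main_op c n))^2 * w n) \<le> (\<Sum>n=Suc N..<L. (cmod (main_op c n))^2 * w n)"
      by (rule sum_mono2[OF _ FL]) (use w_pos N in \<open>auto simp: less_imp_le\<close>)
    also have "\<dots> \<le> (\<Sum>n=Suc N..<L. 2 * (t n)^2 + 4 * (cmod (c 0))^2 * h n + 4 * (h n * (\<Sum>j=Suc N..n. sqrt (v j) * t j)^2))"
      by (intro sum_mono row) simp
    also have "\<dots> = 2 * (\<Sum>n=Suc N..<L. (t n)^2) + 4 * (cmod (c 0))^2 * (\<Sum>n=Suc N..<L. h n) + 4 * (\<Sum>n=Suc N..<L. h n * (\<Sum>j=Suc N..n. sqrt (v j) * t j)^2)"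
      by (simp add: sum.distrib sum_distrib_left)
    also have "\<dots> \<le> 2 * K + 4 * (cmod (c 0))^2 * (BQ / V (Suc N)) + 4 * (4 * (2 * BQ) * K)"
    proof (intro add_mono mult_left_mono tK hsum)
      have "(\<Sum>n=Suc N..<L. h n * (\<Sum>j=Suc N..n. sqrt (v j) * t j)^2) \<le> 4 * (2 * BQ) * (\<Sum>n=Suc N..<L. (t n)^2)"
      proof (rule Hardy_inequality)
        fix n assume n: "Suc N \<le> n" "n < L"
        hence nN: "n > N" by simp
        show "v n > 0" "h n \<ge> 0" using vp[OF nN] hn[OF nN] by simp_all
        have "(\<Sum>j=Suc N..n. v j) = (\<Sum>j=Suc N..<Suc n. v j)" by (rule sum.cong) auto
        also have "\<dots> = V (Suc n) - V (Suc N)" by (rule V_sum) (use n N N1 N0(1) in simp_all)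
        also have "\<dots> \<le> 2 * V n" using V_Suc_le(1)[of n] Nn[OF nN] V_pos[of "Suc N"] by simp
        finally have "(\<Sum>j=Suc N..n. v j) * (\<Sum>j=n..<L. h j) \<le> (2 * V n) * (\<Sum>j=n..<L. h j)"
          using hn nN by (intro mult_right_mono sum_nonneg) auto
        also have "\<dots> \<le> 2 * BQ" using Q[of n L] Nn[OF nN] n by (simp add: h_def)
        finally show "(\<Sum>j=Suc N..n. v j) * (\<Sum>j=n..<L. h j) \<le> 2 * BQ" .
      qed
      also have "\<dots> \<le> 4 * (2 * BQ) * K" using tK BQ0 by (intro mult_left_mono) simp_all
      finally show "(\<Sum>n=Suc N..<L. h n * (\<Sum>j=Suc N..n. sqrt (v j) * t j)^2) \<le> 4 * (2 * BQ) * K" .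
    qed simp_all
    finally show "(\<Sum>n\<in>F. (cmod (main_op c n))^2 * w n) \<le> 2 * K + 4 * (cmod (c 0))^2 * (BQ / V (Suc N)) + 4 * (4 * (2 * BQ) * K)" .
  qed
qed

text \<open>On these residues the matrix of \<open>main_op\<close> is lower triangular with nonzero
  diagonal.\<close>

lemma main_op_zero:
  assumes N: "N \<ge> N1" and c: "\<And>k. k \<notin> {N<..} \<Longrightarrow> c k = 0" and z: "\<And>n. n > N \<Longrightarrow> main_op c n = 0"
  shows "c = (\<lambda>_. 0)"
proof
  fix k show "c k = 0"
  proof (induction k rule: less_induct)
    case (less k)
    show ?case
    proof (cases "k > N")
      case True
      have "(\<Sum>j<k. c j) = 0" using less by simp
      hence "c k / (l k - \<gamma> k) = 0" using z[OF True] by (simp add: main_op_def)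
      moreover have "l k \<noteq> \<gamma> k" using l_ne True N by simp
      ultimately show ?thesis by simp
    qed (use c in simp)
  qed
qed

text \<open>Along a null vector the partial sums equal \<open>c 0 * pr n / pr N\<close>, while
  Cauchy-Schwarz lets them grow at most like \<open>sqrt (V (Suc n))\<close>. As \<open>R\<close>
  exceeds every multiple of \<open>V\<close> somewhere beyond \<open>N\<close>, this forces
  \<open>c 0 = 0\<close>, and the triangular case applies.\<close>

lemma main_op_zero_deficient:
  assumes N: "N \<ge> N1" and c: "c \<in> supp_space (col_weight v (1 / V (Suc N))) (near_cols N)"
    and z: "\<And>n. n > N \<Longrightarrow> main_op c n = 0"
    and unb: "\<And>K. \<exists>n>N. R n > K * V (Suc n)"
  shows "c = (\<lambda>_. 0)"
proof (rule main_op_zero[OF N _ z])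
  have s: "1 / V (Suc N) > 0" using V_pos by simp
  interpret poles \<gamma> "col_weight v (1 / V (Suc N))" by (rule poles_axiom[OF s])
  define A where "A n = (\<Sum>k<n. c k)" for n
  have AN: "A (Suc N) = c 0"
  proof -
    have "(\<Sum>k<Suc N. c k) = (\<Sum>k\<in>{0}. c k)"
      by (rule sum.mono_neutral_right) (use supp_spaceD[OF c] in \<open>auto simp: near_cols_def\<close>)
    thus ?thesis by (simp add: A_def)
  qed
  have AS: "A (Suc n) = pr n / pr N * c 0" if "n \<ge> N" for n
    using that
  proof (induction n rule: dec_induct)
    case base thus ?case using pr_nz by (simp add: AN)
  next
    case (step n)
    have n1: "Suc n > N1" using step N by simp
    have nz: "l (Suc n) \<noteq> 0" "l (Suc n) - \<gamma> (Suc n) \<noteq> 0" using l_nz[OF n1] l_ne[OF n1, of "Suc n"] by auto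
    have "c (Suc n) / (l (Suc n) - \<gamma> (Suc n)) + A (Suc n) / l (Suc n) = 0"
      using z[of "Suc n"] step by (simp add: main_op_def A_def)
    hence "c (Suc n) / (l (Suc n) - \<gamma> (Suc n)) = - (A (Suc n) / l (Suc n))" by (simp add: eq_neg_iff_add_eq_0)
    hence "c (Suc n) = - (A (Suc n) / l (Suc n)) * (l (Suc n) - \<gamma> (Suc n))" using nz by (simp add: divide_eq_eq)
    hence "A (Suc (Suc n)) = A (Suc n) * (\<gamma> (Suc n) / l (Suc n))"
      using nz by (simp add: A_def field_simps)
    thus ?case using step pr_Suc[of n] N by (simp add: mult_ac)
  qed
  have A_le: "(cmod (A (Suc n)))^2 \<le> nsq (col_weight v (1 / V (Suc N))) c * V (Suc n)" if n: "n \<ge> N" for n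
  proof -
    define I where "I = insert 0 {Suc N..<Suc n}"
    have 1: "A (Suc n) = (\<Sum>k\<in>I. c k)"
    proof -
      have cz: "c k = 0" if "k \<noteq> 0" "\<not> Suc N \<le> k" for k
        using supp_spaceD[OF c, of k] that by (simp add: near_cols_def)
      show ?thesis
        unfolding A_def I_def by (rule sum.mono_neutral_right) (use n in \<open>auto intro!: cz\<close>)
    qed
    define u where "u = col_weight v (1 / V (Suc N))"
    have up: "u k > 0" for k unfolding u_def by (rule u_pos)
    have "cmod (A (Suc n)) \<le> (\<Sum>k\<in>I. cmod (c k))" unfolding 1 by (rule norm_sum)
    also have "\<dots> = (\<Sum>k\<in>I. (cmod (c k) * sqrt (u k)) * (1 / sqrt (u k)))"
      using up by (intro sum.cong) (auto simp: less_imp_neq[symmetric])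
    finally have "(cmod (A (Suc n)))^2 \<le> (\<Sum>k\<in>I. (cmod (c k) * sqrt (u k)) * (1 / sqrt (u k)))^2" by (rule power_mono) simp
    also have "\<dots> \<le> (\<Sum>k\<in>I. (cmod (c k) * sqrt (u k))^2) * (\<Sum>k\<in>I. (1 / sqrt (u k))^2)"
      by (rule Cauchy_Schwarz_ineq_sum)
    also have "(\<Sum>k\<in>I. (cmod (c k) * sqrt (u k))^2) = (\<Sum>k\<in>I. (cmod (c k))^2 * u k)"
      using up by (simp add: power_mult_distrib less_imp_le)
    also have "(\<Sum>k\<in>I. (1 / sqrt (u k))^2) = (\<Sum>k\<in>I. 1 / u k)"
      using up by (simp add: power_divide less_imp_le)
    \<comment> \<open>The weight \<open>1 / V (Suc N)\<close> at index 0 makes the reciprocal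
      weights add up to exactly \<open>V (Suc n)\<close>.\<close>
    also have "\<dots> = V (Suc n)"
    proof -
      have "(\<Sum>k\<in>I. 1 / u k) = V (Suc N) + (\<Sum>k=Suc N..<Suc n. 1 / u k)"
        unfolding I_def by (subst sum.insert) (auto simp: u_def col_weight_def)
      also have "(\<Sum>k=Suc N..<Suc n. 1 / u k) = (\<Sum>k=Suc N..<Suc n. v k)"
        by (rule sum.cong) (auto simp: u_def col_weight_def)
      also have "\<dots> = V (Suc n) - V (Suc N)" by (rule V_sum) (use n N N1 N0(1) in simp_all)
      finally show ?thesis by simp
    qed
    finally have "(cmod (A (Suc n)))^2 \<le> (\<Sum>k\<in>I. (cmod (c k))^2 * u k) * V (Suc n)" .
    also have "\<dots> \<le> nsq u c * V (Suc n)"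
      unfolding nsq_def u_def using V_pos[of "Suc n"]
      by (intro mult_right_mono finite_sum_le_infsum[OF supp_space_summable[OF c]]) (auto simp: I_def)
    finally show ?thesis by (simp add: u_def)
  qed
  have c0: "c 0 = 0"
  proof (rule ccontr)
    assume c0: "c 0 \<noteq> 0"
    define K where "K = nsq (col_weight v (1 / V (Suc N))) c * R N / (cmod (c 0))^2"
    obtain n where n: "n > N" "R n > K * V (Suc n)" using unb by blast
    have "R n / R N * (cmod (c 0))^2 \<le> nsq (col_weight v (1 / V (Suc N))) c * V (Suc n)"
      using A_le[of n] n(1) unfolding AS[OF less_imp_le[OF n(1)]]
      by (simp add: norm_mult norm_divide power_mult_distrib power_divide R_def)
    hence "R n \<le> K * V (Suc n)" using c0 R_pos[of N] by (simp add: K_def field_simps)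
    thus False using n(2) by simp
  qed
  fix k assume "k \<notin> {N<..}"
  thus "c k = 0" using c0 supp_spaceD[OF c, of k] by (cases "k = 0") (auto simp: near_cols_def)
qed

text \<open>The solution constant \<open>CS\<close> is the same for all tails and all
  \<open>s\<close>, so a single threshold for \<open>v k / V k\<close> makes the off-diagonal part
  small enough on every later tail.\<close>

theorem tail_invertible_exact:
  assumes Q: "\<And>n L. N1 < n \<Longrightarrow> n < L \<Longrightarrow> V n * (\<Sum>j=n..<L. w j / (cmod (l j))^2) \<le> BQ"
    and XY: "\<And>N n L. N1 \<le> N \<Longrightarrow> N < n \<Longrightarrow> n < L \<Longrightarrow> (\<Sum>j=Suc N..n. ucoef j) * (\<Sum>j=n..<L. hcoef j) \<le> B"
    and B: "B \<ge> 0"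
  shows "\<exists>N2\<ge>N1. \<forall>N\<ge>N2. \<forall>s>0. interp_sys \<gamma> (col_weight v s) {N<..} {N<..} l w"
proof -
  define CS where "CS = 8 * B * M + 8 * M"
  have CS: "CS > 0" using B M by (simp add: CS_def add_nonneg_pos)
  define \<epsilon> where "\<epsilon> = 1 / (4 * CS * Koff)"
  have e: "\<epsilon> > 0" "CS * (Koff * \<epsilon>) \<le> 1 / 4" using CS Koff_pos by (simp_all add: \<epsilon>_def)
  obtain N3 where N3: "N3 \<ge> N0" "\<forall>k\<ge>N3. v k \<le> \<epsilon> * V k" using v_eventually_small[OF e(1)] by blast
  show ?thesis
  proof (intro exI[of _ "max N1 N3"] conjI allI impI)
    fix N s assume N: "max N1 N3 \<le> N" and s: "(s::real) > 0"
    have N': "N1 \<le> N" using N by simp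
    show "interp_sys \<gamma> (col_weight v s) {N<..} {N<..} l w"
    proof (rule interp_sys_perturb[OF s N'])
      show "{N<..} \<subseteq> near_cols N" by (auto simp: near_cols_def)
      show "\<exists>c\<in>supp_space (col_weight v s) {N<..}. (\<forall>n>N. main_op c n = b n) \<and>
        nsq (col_weight v s) c \<le> CS * sqsum w {N<..} b"
        if "sqsummable w {N<..} b" for b
        unfolding CS_def by (rule solve_exact[OF XY N' s that])
      show "c = (\<lambda>_. 0)" if "c \<in> supp_space (col_weight v s) {N<..}" "\<And>n. N < n \<Longrightarrow> main_op c n = 0" for c
        by (rule main_op_zero[OF N' supp_spaceD[OF that(1)] that(2)])
      show "sqsummable w {N<..} (main_op c)" if "c \<in> supp_space (col_weight v s) {N<..}" for c
        by (rule main_op_summable[OF Q N' s supp_space_mono[OF _ that]]) (auto simp: near_cols_def)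
      show "v k \<le> \<epsilon> * V k" if "N < k" for k using N3(2) N that by simp
    qed (use e CS in simp_all)
  qed simp
qed

text \<open>The weight of the auxiliary pole moves with \<open>N\<close>, so that \<open>CS\<close>
  stays independent of \<open>N\<close> and can be matched against the size of the off-diagonal
  part.\<close>

theorem tail_invertible_deficient:
  assumes Q: "\<And>n L. N1 < n \<Longrightarrow> n < L \<Longrightarrow> V n * (\<Sum>j=n..<L. w j / (cmod (l j))^2) \<le> BQ"
    and XY: "\<And>n L. N1 < n \<Longrightarrow> n < L \<Longrightarrow> (\<Sum>j=n..<L. ucoef j) * (\<Sum>j=Suc N1..n. hcoef j) \<le> B"
    and XR: "\<And>n L. N1 < n \<Longrightarrow> n < L \<Longrightarrow> (\<Sum>j=n..<L. ucoef j) * R n \<le> B * V n"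
    and unb: "\<And>K N. \<exists>n>N. R n > K * V (Suc n)"
    and B: "B \<ge> 0"
  shows "\<exists>N2\<ge>N1. \<forall>N\<ge>N2. interp_sys \<gamma> (col_weight v (1 / V (Suc N))) (near_cols N) {N<..} l w"
proof -
  define CS where "CS = 12 * B * M + 8 * M"
  have CS: "CS > 0" using B M by (simp add: CS_def add_nonneg_pos)
  define \<epsilon> where "\<epsilon> = 1 / (4 * CS * Koff)"
  have e: "\<epsilon> > 0" "CS * (Koff * \<epsilon>) \<le> 1 / 4" using CS Koff_pos by (simp_all add: \<epsilon>_def)
  obtain N3 where N3: "N3 \<ge> N0" "\<forall>k\<ge>N3. v k \<le> \<epsilon> * V k" using v_eventually_small[OF e(1)] by blast
  show ?thesis
  proof (intro exI[of _ "max N1 N3"] conjI allI impI)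
    fix N assume N: "max N1 N3 \<le> N"
    have N': "N1 \<le> N" using N by simp
    have s: "1 / V (Suc N) > 0" using V_pos by simp
    show "interp_sys \<gamma> (col_weight v (1 / V (Suc N))) (near_cols N) {N<..} l w"
    proof (rule interp_sys_perturb[OF s N' order_refl])
      show "\<exists>c\<in>supp_space (col_weight v (1 / V (Suc N))) (near_cols N). (\<forall>n>N. main_op c n = b n) \<and>
        nsq (col_weight v (1 / V (Suc N))) c \<le> CS * sqsum w {N<..} b"
        if "sqsummable w {N<..} b" for b
        unfolding CS_def by (rule solve_deficient[OF XY XR N' that])
      show "c = (\<lambda>_. 0)" if "c \<in> supp_space (col_weight v (1 / V (Suc N))) (near_cols N)" "\<And>n. N < n \<Longrightarrow> main_op c n = 0" for c
        by (rule main_op_zero_deficient[OF N' that unb])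
      show "sqsummable w {N<..} (main_op c)" if "c \<in> supp_space (col_weight v (1 / V (Suc N))) (near_cols N)" for c
        by (rule main_op_summable[OF Q N' s that])
      show "v k \<le> \<epsilon> * V k" if "N < k" for k using N3(2) N that by simp
    qed (use e CS in simp_all)
  qed simp
qed

end

section \<open>From the growth conditions to the hypotheses of the Hardy inequalities\<close>

lemma powr_MVT:
  fixes a b r :: real
  assumes "0 < a" "a < b"
  obtains z where "a < z" "z < b" "b powr r - a powr r = (b - a) * (r * z powr (r - 1))"
proof -
  have "\<exists>z>a. z < b \<and> b powr r - a powr r = (b - a) * (r * z powr (r - 1))"
    by (rule MVT2[OF assms(2)]) (use assms(1) in \<open>auto intro!: has_real_derivative_powr\<close>)
  thus ?thesis using that by blast
qed

lemma powr_concave_diff: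
  fixes a b :: real
  assumes "0 < r" "r \<le> 1" "0 < b" "0 \<le> a" "a \<le> b"
  shows "r * b powr (r - 1) * (b - a) \<le> b powr r - a powr r"
proof -
  consider "a = 0" | "a = b" | "0 < a" "a < b" using assms by linarith
  thus ?thesis
  proof cases
    case 1
    have "b powr (r - 1) * b = b powr r" using assms by (simp add: powr_diff)
    hence "r * b powr (r - 1) * b = r * b powr r" by (simp add: mult.assoc)
    also have "\<dots> \<le> b powr r" using assms by (simp add: mult_left_le_one_le)
    finally show ?thesis using 1 by simp
  next
    case 3
    then obtain z where z: "a < z" "z < b" "b powr r - a powr r = (b - a) * (r * z powr (r - 1))" by (rule powr_MVT)
    have "b powr (r - 1) \<le> z powr (r - 1)" using z 3 assms by (intro powr_mono2') auto
    hence "(b - a) * (r * b powr (r - 1)) \<le> (b - a) * (r * z powr (r - 1))" using 3 assms by (intro mult_left_mono) auto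
    thus ?thesis using z(3) by (simp add: mult_ac)
  qed simp
qed

lemma powr_neg_diff:
  fixes a b :: real
  assumes "0 < r" "0 < a" "a \<le> b"
  shows "r * b powr (- r - 1) * (b - a) \<le> a powr (- r) - b powr (- r)"
proof (cases "a = b")
  case False
  hence "a < b" using assms by simp
  then obtain z where z: "a < z" "z < b" "b powr (- r) - a powr (- r) = (b - a) * (- r * z powr (- r - 1))"
    using powr_MVT[of a b "- r"] assms by blast
  have "b powr (- r - 1) \<le> z powr (- r - 1)" using z assms by (intro powr_mono2') auto
  hence "(b - a) * (r * b powr (- r - 1)) \<le> (b - a) * (r * z powr (- r - 1))" using z assms by (intro mult_left_mono) auto
  thus ?thesis using z(3) by (simp add: mult_ac)
qed simp

lemma powr_convex_diff:
  fixes a b :: real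
  assumes "1 \<le> r" "0 < a" "a \<le> b"
  shows "b powr r - a powr r \<le> r * b powr (r - 1) * (b - a)"
proof (cases "a = b")
  case False
  hence "a < b" using assms by simp
  then obtain z where z: "a < z" "z < b" "b powr r - a powr r = (b - a) * (r * z powr (r - 1))"
    using powr_MVT[of a b r] assms by blast
  have "z powr (r - 1) \<le> b powr (r - 1)" using z assms by (intro powr_mono2) auto
  hence "(b - a) * (r * z powr (r - 1)) \<le> (b - a) * (r * b powr (r - 1))" using z assms by (intro mult_left_mono) auto
  thus ?thesis using z(3) by (simp add: mult_ac)
qed simp

lemma ratio_powr: "0 < a \<Longrightarrow> 0 < b \<Longrightarrow> (a / b) powr r = a powr r * b powr (- r)" for a b r :: real
  by (simp add: powr_divide powr_minus_divide)

context tail_rows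
begin

lemma vV: "n > N1 \<Longrightarrow> v n > 0 \<and> V n > 0 \<and> V (Suc n) > 0 \<and> V (Suc n) = V n + v n \<and> V (Suc n) \<le> 2 * V n"
  using v_pos[of n] V_pos[of n] V_pos[of "Suc n"] V_Suc[of n] V_Suc_le(1)[of n] idx[of n] by auto

abbreviation qcoef :: "nat \<Rightarrow> real" where "qcoef n \<equiv> w n / (cmod (l n))^2"

lemma qcoef_pos: "n > N1 \<Longrightarrow> qcoef n > 0"
  using w_pos[of n] l_nz[of n] by simp

lemma hcoef_le: "n > N1 \<Longrightarrow> hcoef n \<le> 4 * M * qcoef n * R n"
proof -
  assume n: "n > N1"
  have vn: "v n > 0" and gn: "g n > 0" and ln: "cmod (l n) > 0" using v_pos idx[OF n] gamma_nz[OF n] l_nz[OF n] by auto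
  have "(d n)^2 / ((g n)^2 * v n) \<le> M * (w n * v n) / ((g n)^2 * v n)"
    using w_ge[OF n] vn by (intro divide_right_mono) simp_all
  also have "\<dots> = M * w n * (1 / (g n)^2)" using vn by simp
  also have "\<dots> \<le> M * w n * (4 / (cmod (l n))^2)"
  proof (rule mult_left_mono)
    have "(cmod (l n))^2 \<le> 4 * (g n)^2" using power_mono[OF l_bounds(2)[OF n], of 2] by (simp add: power_mult_distrib)
    thus "1 / (g n)^2 \<le> 4 / (cmod (l n))^2" using gn ln by (simp add: field_simps)
  qed (use M w_pos[OF n] in simp)
  finally have "(d n)^2 / ((g n)^2 * v n) * R n \<le> M * w n * (4 / (cmod (l n))^2) * R n"
    using R_pos[of n] by (intro mult_right_mono) simp_all
  thus ?thesis by (simp add: hcoef_def mult_ac)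
qed

text \<open>Comparison with the telescoping sum of
  \<open>V (Suc j) powr \<delta> - V j powr \<delta>\<close>; since \<open>V\<close> at most doubles
  in one step, evaluating the power at \<open>V j\<close> instead of \<open>V (Suc j)\<close> costs
  a factor 2.\<close>

lemma sum_v_powr:
  assumes \<delta>: "0 < \<delta>" "\<delta> \<le> 1" and n: "N1 \<le> N" "N \<le> n"
  shows "(\<Sum>j=Suc N..n. v j * V j powr (\<delta> - 1)) \<le> 4 / \<delta> * V n powr \<delta>"
proof -
  have st: "v j * V j powr (\<delta> - 1) \<le> 2 / \<delta> * (V (Suc j) powr \<delta> - V j powr \<delta>)" if j: "j > N1" for j
  proof -
    have vj: "v j > 0" "V j > 0" "V (Suc j) > 0" "V (Suc j) = V j + v j" "V (Suc j) \<le> 2 * V j"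
      using vV[OF j] by auto
    have "V (Suc j) powr (\<delta> - 1) \<ge> (2 * V j) powr (\<delta> - 1)" using vj \<delta> by (intro powr_mono2') auto
    also have "(2 * V j) powr (\<delta> - 1) = 2 powr (\<delta> - 1) * V j powr (\<delta> - 1)" using vj by (simp add: powr_mult)
    finally have a: "2 powr (\<delta> - 1) * V j powr (\<delta> - 1) \<le> V (Suc j) powr (\<delta> - 1)" .
    have "2 powr (-1) \<le> (2::real) powr (\<delta> - 1)" using \<delta> by (intro powr_mono) auto
    hence "1/2 \<le> (2::real) powr (\<delta> - 1)" by (simp add: powr_minus_divide)
    hence "1/2 * V j powr (\<delta> - 1) \<le> 2 powr (\<delta> - 1) * V j powr (\<delta> - 1)" by (intro mult_right_mono) auto
    hence "V j powr (\<delta> - 1) \<le> 2 * V (Suc j) powr (\<delta> - 1)" using a by linarith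
    hence "\<delta> * (v j * V j powr (\<delta> - 1)) \<le> \<delta> * (v j * (2 * V (Suc j) powr (\<delta> - 1)))"
      using vj \<delta> by (intro mult_left_mono) auto
    also have "\<dots> = 2 * (\<delta> * V (Suc j) powr (\<delta> - 1) * (V (Suc j) - V j))" using vj by simp
    also have "\<dots> \<le> 2 * (V (Suc j) powr \<delta> - V j powr \<delta>)"
      using vj \<delta> by (intro mult_left_mono powr_concave_diff) auto
    finally show ?thesis using \<delta> by (simp add: field_simps)
  qed
  have "(\<Sum>j=Suc N..n. v j * V j powr (\<delta> - 1)) \<le> (\<Sum>j=Suc N..n. 2 / \<delta> * (V (Suc j) powr \<delta> - V j powr \<delta>))"
    by (intro sum_mono st) (use n in simp)
  also have "\<dots> = 2 / \<delta> * (V (Suc n) powr \<delta> - V (Suc N) powr \<delta>)"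
    unfolding sum_distrib_left[symmetric] using n by (subst sum_Suc_diff) simp_all
  also have "\<dots> \<le> 2 / \<delta> * (2 * V n powr \<delta>)"
  proof (rule mult_left_mono)
    have "V (Suc n) powr \<delta> \<le> (2 * V n) powr \<delta>"
      using \<delta> V_Suc_le(1)[of n] n N1 V_pos[of "Suc n"] by (intro powr_mono2) auto
    also have "\<dots> = 2 powr \<delta> * V n powr \<delta>" using V_pos[of n] by (simp add: powr_mult)
    also have "\<dots> \<le> 2 powr 1 * V n powr \<delta>" using \<delta> by (intro mult_right_mono powr_mono) auto
    also have "(2::real) powr 1 = 2" by simp
    finally show "V (Suc n) powr \<delta> - V (Suc N) powr \<delta> \<le> 2 * V n powr \<delta>"
      using powr_ge_zero[of "V (Suc N)" \<delta>] by linarith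
  qed (use \<delta> in simp)
  finally show ?thesis by simp
qed

text \<open>With \<open>R\<close> growing more slowly than \<open>V\<close>, the sum of
  \<open>ucoef\<close> up to \<open>n\<close> is dominated by \<open>V n / R n\<close> and the tail
  of \<open>hcoef\<close> by \<open>R n / V n\<close>. The gap \<open>\<delta>\<close> in the
  exponent is what makes both sums comparable with these quantities at \<open>n\<close>.\<close>

lemma XY_exact:
  assumes Q: "\<And>n L. N1 < n \<Longrightarrow> n < L \<Longrightarrow> V n * (\<Sum>j=n..<L. qcoef j) \<le> BQ"
    and \<delta>: "0 < \<delta>" "\<delta> \<le> 1" and C: "C \<ge> 1"
    and gr: "\<And>m n. N1 \<le> n \<Longrightarrow> n < m \<Longrightarrow> R m / R n \<le> C * (V m / V n) powr (1 - \<delta>)"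
    and N: "N1 \<le> N" "N < n" "n < L"
  shows "(\<Sum>j=Suc N..n. ucoef j) * (\<Sum>j=n..<L. hcoef j) \<le> (4 * C / \<delta>) * (4 * M * C * (BQ / \<delta>))"
proof -
  have n1: "n > N1" using N by simp
  have Vn: "V n > 0" and Rn: "R n > 0" by (rule V_pos R_pos)+
  have gr': "R m \<le> C * R n' * (V m / V n') powr (1 - \<delta>)" if "N1 \<le> n'" "n' \<le> m" for m n'
  proof (cases "n' = m")
    case True thus ?thesis using C R_pos[of m] V_pos[of m] by (simp add: mult_le_cancel_right1)
  next
    case False
    hence "R m / R n' \<le> C * (V m / V n') powr (1 - \<delta>)" using gr that by simp
    thus ?thesis using R_pos[of n'] by (simp add: divide_le_eq mult_ac)
  qed
  have X: "(\<Sum>j=Suc N..n. ucoef j) \<le> (4 * C / \<delta>) * (V n / R n)"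
  proof -
    have "ucoef j \<le> C / R n * V n powr (1 - \<delta>) * (v j * V j powr (\<delta> - 1))" if j: "j \<in> {Suc N..n}" for j
    proof -
      have j1: "j > N1" "j \<le> n" using j N by auto
      have vj: "v j > 0" "V j > 0" "R j > 0" using v_pos V_pos R_pos idx[OF j1(1)] by auto
      have "1 / R j \<le> C / R n * (V n / V j) powr (1 - \<delta>)"
        using gr'[of j n] j1 vj Rn by (simp add: field_simps)
      also have "(V n / V j) powr (1 - \<delta>) = V n powr (1 - \<delta>) * V j powr (\<delta> - 1)"
        using Vn vj by (simp add: ratio_powr)
      finally have "v j * (1 / R j) \<le> v j * (C / R n * (V n powr (1 - \<delta>) * V j powr (\<delta> - 1)))"
        using vj by (intro mult_left_mono) auto
      thus ?thesis by (simp add: ucoef_def mult_ac)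
    qed
    hence "(\<Sum>j=Suc N..n. ucoef j) \<le> (\<Sum>j=Suc N..n. C / R n * V n powr (1 - \<delta>) * (v j * V j powr (\<delta> - 1)))"
      by (rule sum_mono)
    also have "\<dots> = C / R n * V n powr (1 - \<delta>) * (\<Sum>j=Suc N..n. v j * V j powr (\<delta> - 1))"
      by (simp add: sum_distrib_left)
    also have "\<dots> \<le> C / R n * V n powr (1 - \<delta>) * (4 / \<delta> * V n powr \<delta>)"
      using C Rn N by (intro mult_left_mono sum_v_powr \<delta>) auto
    also have "\<dots> = (4 * C / \<delta>) * (V n powr (1 - \<delta>) * V n powr \<delta>) / R n" by (simp add: mult_ac)
    also have "V n powr (1 - \<delta>) * V n powr \<delta> = V n" using Vn by (simp add: powr_add[symmetric])
    finally show ?thesis by simp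
  qed
  define T where "T j = (\<Sum>i=j..<L. qcoef i)" for j
  have TV: "V j * T j \<le> BQ" if "N1 < j" "j < L" for j unfolding T_def by (rule Q[OF that])
  have Tpos: "T j > 0" if "N1 < j" "j < L" for j
    unfolding T_def by (rule sum_pos) (use that qcoef_pos in auto)
  have T0: "T j \<ge> 0" if "N1 < j" for j
    unfolding T_def by (rule sum_nonneg) (use that qcoef_pos in \<open>auto intro!: less_imp_le\<close>)
  have BQ0: "BQ > 0" using TV[OF n1 N(3)] mult_pos_pos[OF Vn Tpos[OF n1 N(3)]] by linarith
  have Y: "(\<Sum>j=n..<L. hcoef j) \<le> (4 * M * C * (BQ / \<delta>)) * (R n / V n)"
  proof -
    have hj: "hcoef j \<le> 4 * M * C * R n * V n powr (\<delta> - 1) * (BQ powr (1 - \<delta>) / \<delta> * (T j powr \<delta> - T (Suc j) powr \<delta>))" if j: "j \<in> {n..<L}" for j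
    proof -
      have j1: "N1 < j" "n \<le> j" "j < L" using j n1 by auto
      have Vj: "V j > 0" by (rule V_pos)
      have Tj: "T j = qcoef j + T (Suc j)" unfolding T_def by (rule sum.atLeast_Suc_lessThan[OF j1(3)])
      \<comment> \<open>Powers of \<open>V j\<close> are traded for powers of the tail
        \<open>T j\<close>, after which the sum over \<open>j\<close> telescopes in
        \<open>T j powr \<delta>\<close>.\<close>
      have "V j \<le> BQ / T j" using TV[OF j1(1,3)] Tpos[OF j1(1,3)] by (simp add: le_divide_eq)
      hence "V j powr (1 - \<delta>) \<le> (BQ / T j) powr (1 - \<delta>)" using Vj \<delta> by (intro powr_mono2) auto
      also have "\<dots> = BQ powr (1 - \<delta>) * T j powr (\<delta> - 1)"
        using BQ0 Tpos[OF j1(1,3)] by (simp add: ratio_powr)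
      finally have "qcoef j * V j powr (1 - \<delta>) \<le> qcoef j * (BQ powr (1 - \<delta>) * T j powr (\<delta> - 1))"
        using qcoef_pos[OF j1(1)] by (intro mult_left_mono) auto
      also have "\<dots> = BQ powr (1 - \<delta>) / \<delta> * (\<delta> * T j powr (\<delta> - 1) * (T j - T (Suc j)))"
        using \<delta> by (simp add: Tj)
      also have "\<dots> \<le> BQ powr (1 - \<delta>) / \<delta> * (T j powr \<delta> - T (Suc j) powr \<delta>)"
        using \<delta> Tpos[OF j1(1,3)] T0[of "Suc j"] j1 qcoef_pos[OF j1(1)] by (intro mult_left_mono powr_concave_diff) (auto simp: Tj)
      finally have a: "qcoef j * V j powr (1 - \<delta>) \<le> BQ powr (1 - \<delta>) / \<delta> * (T j powr \<delta> - T (Suc j) powr \<delta>)" .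
      have "hcoef j \<le> 4 * M * qcoef j * R j" by (rule hcoef_le[OF j1(1)])
      also have "\<dots> \<le> 4 * M * qcoef j * (C * R n * (V j / V n) powr (1 - \<delta>))"
      proof (rule mult_left_mono)
        show "R j \<le> C * R n * (V j / V n) powr (1 - \<delta>)" using gr'[of n j] j1 n1 by simp
      qed (use M less_imp_le[OF qcoef_pos[OF j1(1)]] in \<open>intro mult_nonneg_nonneg; simp\<close>)
      also have "(V j / V n) powr (1 - \<delta>) = V j powr (1 - \<delta>) * V n powr (\<delta> - 1)"
        using Vj Vn by (simp add: ratio_powr)
      also have "4 * M * qcoef j * (C * R n * (V j powr (1 - \<delta>) * V n powr (\<delta> - 1))) = 4 * M * C * R n * V n powr (\<delta> - 1) * (qcoef j * V j powr (1 - \<delta>))"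
        by simp
      also have "\<dots> \<le> 4 * M * C * R n * V n powr (\<delta> - 1) * (BQ powr (1 - \<delta>) / \<delta> * (T j powr \<delta> - T (Suc j) powr \<delta>))"
        using M C Rn by (intro mult_left_mono a) auto
      finally show ?thesis .
    qed
    have "(\<Sum>j=n..<L. hcoef j) \<le> (\<Sum>j=n..<L. 4 * M * C * R n * V n powr (\<delta> - 1) * (BQ powr (1 - \<delta>) / \<delta> * (T j powr \<delta> - T (Suc j) powr \<delta>)))"
      by (rule sum_mono[OF hj])
    also have "\<dots> = 4 * M * C * R n * V n powr (\<delta> - 1) * (BQ powr (1 - \<delta>) / \<delta> * (\<Sum>j=n..<L. T j powr \<delta> - T (Suc j) powr \<delta>))"
      by (simp add: sum_distrib_left)
    also have "(\<Sum>j=n..<L. T j powr \<delta> - T (Suc j) powr \<delta>) = T n powr \<delta> - T L powr \<delta>"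
      using sum_Suc_diff'[of n L "\<lambda>j. - (T j powr \<delta>)"] N by simp
    also have "4 * M * C * R n * V n powr (\<delta> - 1) * (BQ powr (1 - \<delta>) / \<delta> * (T n powr \<delta> - T L powr \<delta>)) \<le> 4 * M * C * R n * V n powr (\<delta> - 1) * (BQ powr (1 - \<delta>) / \<delta> * (BQ / V n) powr \<delta>)"
    proof (intro mult_left_mono)
      have "T n powr \<delta> \<le> (BQ / V n) powr \<delta>"
        using TV[OF n1 N(3)] Tpos[OF n1 N(3)] Vn \<delta> by (intro powr_mono2) (auto simp: le_divide_eq mult.commute)
      thus "T n powr \<delta> - T L powr \<delta> \<le> (BQ / V n) powr \<delta>" using powr_ge_zero[of "T L" \<delta>] by linarith
    qed (use M C Rn \<delta> in auto)
    also have "\<dots> = 4 * M * C / \<delta> * R n * ((BQ powr (1 - \<delta>) * BQ powr \<delta>) * (V n powr (\<delta> - 1) * V n powr (- \<delta>)))"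
      using BQ0 Vn by (simp add: ratio_powr mult_ac)
    also have "BQ powr (1 - \<delta>) * BQ powr \<delta> = BQ" using BQ0 by (simp add: powr_add[symmetric])
    also have "V n powr (\<delta> - 1) * V n powr (- \<delta>) = 1 / V n"
    proof -
      have "V n powr (\<delta> - 1) * V n powr (- \<delta>) = V n powr (- 1)" by (simp only: powr_add[symmetric]) simp
      thus ?thesis using Vn by (simp add: powr_minus_divide)
    qed
    also have "4 * M * C / \<delta> * R n * (BQ * (1 / V n)) = (4 * M * C * (BQ / \<delta>)) * (R n / V n)" by simp
    finally show ?thesis .
  qed
  have "(\<Sum>j=Suc N..n. ucoef j) * (\<Sum>j=n..<L. hcoef j) \<le> ((4 * C / \<delta>) * (V n / R n)) * ((4 * M * C * (BQ / \<delta>)) * (R n / V n))"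
    by (rule mult_mono[OF X Y])
      (use C \<delta> Vn Rn n1 hcoef_nonneg in \<open>auto intro!: sum_nonneg mult_nonneg_nonneg divide_nonneg_nonneg\<close>)
  also have "\<dots> = (4 * C / \<delta>) * (4 * M * C * (BQ / \<delta>))" using Vn Rn by simp
  finally show ?thesis .
qed

lemma sum_v_powr_neg:
  assumes \<delta>: "0 < \<delta>" "\<delta> \<le> 1" and n: "N1 < n" "n \<le> L"
  shows "(\<Sum>j=n..<L. v j * V j powr (- \<delta> - 1)) \<le> 4 / \<delta> * V n powr (- \<delta>)"
proof -
  have st: "v j * V j powr (- \<delta> - 1) \<le> 4 / \<delta> * (V j powr (- \<delta>) - V (Suc j) powr (- \<delta>))" if j: "j > N1" for j
  proof -
    have vj: "v j > 0" "V j > 0" "V (Suc j) > 0" "V (Suc j) = V j + v j" "V (Suc j) \<le> 2 * V j"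
      using vV[OF j] by auto
    have "V (Suc j) powr (- \<delta> - 1) \<ge> (2 * V j) powr (- \<delta> - 1)" using vj \<delta> by (intro powr_mono2') auto
    also have "(2 * V j) powr (- \<delta> - 1) = 2 powr (- \<delta> - 1) * V j powr (- \<delta> - 1)" using vj by (simp add: powr_mult)
    finally have a: "2 powr (- \<delta> - 1) * V j powr (- \<delta> - 1) \<le> V (Suc j) powr (- \<delta> - 1)" .
    have "2 powr (-2) \<le> (2::real) powr (- \<delta> - 1)" using \<delta> by (intro powr_mono) auto
    hence "1/4 \<le> (2::real) powr (- \<delta> - 1)" by (simp add: powr_minus_divide)
    hence "1/4 * V j powr (- \<delta> - 1) \<le> 2 powr (- \<delta> - 1) * V j powr (- \<delta> - 1)" by (intro mult_right_mono) auto
    hence "V j powr (- \<delta> - 1) \<le> 4 * V (Suc j) powr (- \<delta> - 1)" using a by linarith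
    hence "\<delta> * (v j * V j powr (- \<delta> - 1)) \<le> \<delta> * (v j * (4 * V (Suc j) powr (- \<delta> - 1)))"
      using vj \<delta> by (intro mult_left_mono) auto
    also have "\<dots> = 4 * (\<delta> * V (Suc j) powr (- \<delta> - 1) * (V (Suc j) - V j))" using vj by simp
    also have "\<dots> \<le> 4 * (V j powr (- \<delta>) - V (Suc j) powr (- \<delta>))"
      using vj \<delta> by (intro mult_left_mono powr_neg_diff) auto
    finally show ?thesis using \<delta> by (simp add: field_simps)
  qed
  have "(\<Sum>j=n..<L. v j * V j powr (- \<delta> - 1)) \<le> (\<Sum>j=n..<L. 4 / \<delta> * (V j powr (- \<delta>) - V (Suc j) powr (- \<delta>)))"
    by (intro sum_mono st) (use n in simp)
  also have "\<dots> = 4 / \<delta> * (V n powr (- \<delta>) - V L powr (- \<delta>))"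
    unfolding sum_distrib_left[symmetric] using sum_Suc_diff'[of n L "\<lambda>j. - (V j powr (- \<delta>))"] n by simp
  also have "\<dots> \<le> 4 / \<delta> * V n powr (- \<delta>)" using \<delta> by (intro mult_left_mono) auto
  finally show ?thesis .
qed

text \<open>Summation by parts: \<open>qcoef\<close> is the decrement of its tail \<open>T\<close>,
  and \<open>T j \<le> BQ / V j\<close> turns the remaining sum into one that telescopes in
  \<open>V j powr \<delta>\<close>.\<close>

lemma sum_q_powr:
  assumes Q: "\<And>n L. N1 < n \<Longrightarrow> n < L \<Longrightarrow> V n * (\<Sum>j=n..<L. qcoef j) \<le> BQ"
    and \<delta>: "0 < \<delta>" "\<delta> \<le> 1" and n: "N1 < n"
  shows "(\<Sum>j=Suc N1..n. qcoef j * V j powr (1 + \<delta>)) \<le> 3 / \<delta> * BQ * V n powr \<delta>"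
proof -
  define T where "T j = (\<Sum>i=j..<Suc n. qcoef i)" for j
  have TV: "V j * T j \<le> BQ" if "N1 < j" "j \<le> n" for j unfolding T_def by (rule Q) (use that in simp_all)
  have T0: "T j \<ge> 0" if "N1 < j" for j
    unfolding T_def by (rule sum_nonneg) (use that qcoef_pos in \<open>auto intro!: less_imp_le\<close>)
  have BQ0: "BQ \<ge> 0" using TV[OF n order_refl] mult_nonneg_nonneg[OF less_imp_le[OF V_pos[of n]] T0[OF n]] by linarith
  define \<Phi> where "\<Phi> j = T j * V j powr (1 + \<delta>)" for j
  have \<Phi>le: "\<Phi> j \<le> BQ * V j powr \<delta>" if "N1 < j" "j \<le> n" for j
  proof -
    have "\<Phi> j = (V j * T j) * V j powr \<delta>" using V_pos[of j] by (simp add: \<Phi>_def powr_add)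
    thus ?thesis using TV[OF that] by (simp add: mult_right_mono)
  qed
  have st: "qcoef j * V j powr (1 + \<delta>) \<le> \<Phi> j - \<Phi> (Suc j) + 2 / \<delta> * BQ * (V (Suc j) powr \<delta> - V j powr \<delta>)" if j: "j > N1" "j < n" for j
  proof -
    have vj: "v j > 0" "V j > 0" "V (Suc j) > 0" "V (Suc j) = V j + v j"
      using vV[OF j(1)] by auto
    have Tj: "T j = qcoef j + T (Suc j)" unfolding T_def by (rule sum.atLeast_Suc_lessThan) (use j in simp)
    have "V (Suc j) powr (1 + \<delta>) - V j powr (1 + \<delta>) \<le> (1 + \<delta>) * V (Suc j) powr (1 + \<delta> - 1) * (V (Suc j) - V j)"
      by (rule powr_convex_diff) (use vj \<delta> in auto)
    also have "\<dots> \<le> 2 * V (Suc j) powr \<delta> * (V (Suc j) - V j)" using vj \<delta> by (intro mult_right_mono) auto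
    finally have "T (Suc j) * (V (Suc j) powr (1 + \<delta>) - V j powr (1 + \<delta>)) \<le> T (Suc j) * (2 * V (Suc j) powr \<delta> * (V (Suc j) - V j))"
      using T0[of "Suc j"] j by (intro mult_left_mono) auto
    also have "\<dots> = (V (Suc j) * T (Suc j)) * (2 * V (Suc j) powr (\<delta> - 1) * (V (Suc j) - V j))"
      using vj by (simp add: powr_diff)
    also have "\<dots> \<le> BQ * (2 * V (Suc j) powr (\<delta> - 1) * (V (Suc j) - V j))"
      using TV[of "Suc j"] j vj by (intro mult_right_mono) auto
    also have "\<dots> = 2 / \<delta> * BQ * (\<delta> * V (Suc j) powr (\<delta> - 1) * (V (Suc j) - V j))" using \<delta> by simp
    also have "\<dots> \<le> 2 / \<delta> * BQ * (V (Suc j) powr \<delta> - V j powr \<delta>)"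
      using vj \<delta> BQ0 by (intro mult_left_mono powr_concave_diff) auto
    finally show ?thesis by (simp add: \<Phi>_def Tj algebra_simps)
  qed
  have Tn: "T n = qcoef n" by (simp add: T_def)
  have le: "V (Suc N1) powr \<delta> \<le> V n powr \<delta>" using V_mono[of "Suc N1" n] n N1 N0(1) \<delta> V_pos[of "Suc N1"] by (intro powr_mono2) auto
  have "(\<Sum>j=Suc N1..n. qcoef j * V j powr (1 + \<delta>)) = (\<Sum>j=Suc N1..<n. qcoef j * V j powr (1 + \<delta>)) + \<Phi> n"
    using n by (simp add: \<Phi>_def Tn sum.last_plus)
  also have "\<dots> \<le> (\<Sum>j=Suc N1..<n. \<Phi> j - \<Phi> (Suc j) + 2 / \<delta> * BQ * (V (Suc j) powr \<delta> - V j powr \<delta>)) + \<Phi> n"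
    by (intro add_right_mono sum_mono st) auto
  also have "\<dots> = \<Phi> (Suc N1) + 2 / \<delta> * BQ * (V n powr \<delta> - V (Suc N1) powr \<delta>)"
    using sum_Suc_diff'[of "Suc N1" n "\<lambda>j. - \<Phi> j"] sum_Suc_diff'[of "Suc N1" n "\<lambda>j. V j powr \<delta>"] n
    by (simp only: sum.distrib sum_distrib_left[symmetric]) simp
  also have "\<dots> \<le> BQ * V n powr \<delta> + 2 / \<delta> * BQ * V n powr \<delta>"
  proof (rule add_mono)
    show "\<Phi> (Suc N1) \<le> BQ * V n powr \<delta>"
      using \<Phi>le[of "Suc N1"] n mult_left_mono[OF le BQ0] by simp
    show "2 / \<delta> * BQ * (V n powr \<delta> - V (Suc N1) powr \<delta>) \<le> 2 / \<delta> * BQ * V n powr \<delta>"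
      using \<delta> BQ0 by (intro mult_left_mono) auto
  qed
  also have "\<dots> \<le> 1 / \<delta> * BQ * V n powr \<delta> + 2 / \<delta> * BQ * V n powr \<delta>"
  proof -
    have "1 * (BQ * V n powr \<delta>) \<le> 1 / \<delta> * (BQ * V n powr \<delta>)" using \<delta> BQ0 by (intro mult_right_mono) auto
    thus ?thesis by simp
  qed
  finally show ?thesis by (simp add: add_divide_distrib[symmetric] distrib_right[symmetric])
qed

text \<open>When \<open>R\<close> grows faster than \<open>V\<close> the two ends exchange their
  roles: the tail of \<open>ucoef\<close> is dominated by \<open>V n / R n\<close> and the sum of
  \<open>hcoef\<close> up to \<open>n\<close> by \<open>R n / V n\<close>. The last claim excludes
  null vectors that use the auxiliary pole.\<close>

lemma
  assumes Q: "\<And>n L. N1 < n \<Longrightarrow> n < L \<Longrightarrow> V n * (\<Sum>j=n..<L. qcoef j) \<le> BQ"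
    and \<delta>: "0 < \<delta>" "\<delta> \<le> 1" and C: "0 < C" "C \<le> 1"
    and gr: "\<And>m n. N1 \<le> n \<Longrightarrow> n < m \<Longrightarrow> R m / R n \<ge> C * (V m / V n) powr (1 + \<delta>)"
  shows XR_deficient: "N1 < n \<Longrightarrow> n < L \<Longrightarrow> (\<Sum>j=n..<L. ucoef j) * R n \<le> 4 / (C * \<delta>) * V n"
    and XY_deficient: "N1 < n \<Longrightarrow> n < L \<Longrightarrow> (\<Sum>j=n..<L. ucoef j) * (\<Sum>j=Suc N1..n. hcoef j) \<le> 4 / (C * \<delta>) * (12 * M * BQ / (C * \<delta>))"
    and R_unbounded: "\<exists>n>N. R n > K * V (Suc n)"
proof -
  have gr': "C * R n' * (V m / V n') powr (1 + \<delta>) \<le> R m" if "N1 \<le> n'" "n' \<le> m" for m n'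
  proof (cases "n' = m")
    case True thus ?thesis using C R_pos[of m] V_pos[of m] by simp
  next
    case False
    hence "R m / R n' \<ge> C * (V m / V n') powr (1 + \<delta>)" using gr that by simp
    thus ?thesis using R_pos[of n'] by (simp add: le_divide_eq mult_ac)
  qed
  show XR: "(\<Sum>j=n..<L. ucoef j) * R n \<le> 4 / (C * \<delta>) * V n" if n: "N1 < n" "n < L" for n L
  proof -
    have Vn: "V n > 0" and Rn: "R n > 0" by (rule V_pos R_pos)+
    have "ucoef j * R n \<le> 1 / C * V n powr (1 + \<delta>) * (v j * V j powr (- \<delta> - 1))" if j: "j \<in> {n..<L}" for j
    proof -
      have j1: "j > N1" "n \<le> j" using j n by auto
      have vj: "v j > 0" "V j > 0" "R j > 0" using v_pos V_pos R_pos idx[OF j1(1)] by auto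
      have p: "(V j / V n) powr (1 + \<delta>) > 0" using vj Vn by simp
      have "C * R n * (V j / V n) powr (1 + \<delta>) \<le> R j" using gr'[of n j] j1 n by simp
      hence "R n / R j \<le> 1 / (C * (V j / V n) powr (1 + \<delta>))"
        using vj C p by (simp add: field_simps)
      also have "\<dots> = 1 / C * (V n powr (1 + \<delta>) * V j powr (- \<delta> - 1))"
      proof -
        have "- \<delta> - 1 = - (1 + \<delta>)" by simp
        thus ?thesis using Vn vj by (simp only: powr_divide powr_minus) (simp add: divide_inverse)
      qed
      finally have "v j * (R n / R j) \<le> v j * (1 / C * (V n powr (1 + \<delta>) * V j powr (- \<delta> - 1)))"
        using vj by (intro mult_left_mono) auto
      thus ?thesis by (simp add: ucoef_def mult_ac)
    qed
    hence "(\<Sum>j=n..<L. ucoef j * R n) \<le> (\<Sum>j=n..<L. 1 / C * V n powr (1 + \<delta>) * (v j * V j powr (- \<delta> - 1)))"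
      by (rule sum_mono)
    also have "\<dots> = 1 / C * V n powr (1 + \<delta>) * (\<Sum>j=n..<L. v j * V j powr (- \<delta> - 1))"
      by (simp add: sum_distrib_left)
    also have "\<dots> \<le> 1 / C * V n powr (1 + \<delta>) * (4 / \<delta> * V n powr (- \<delta>))"
      using C n by (intro mult_left_mono sum_v_powr_neg \<delta>) auto
    also have "\<dots> = 4 / (C * \<delta>) * (V n powr (1 + \<delta>) * V n powr (- \<delta>))" by simp
    also have "V n powr (1 + \<delta>) * V n powr (- \<delta>) = V n" using Vn by (simp add: powr_add[symmetric])
    finally show ?thesis by (simp add: sum_distrib_right)
  qed
  show "(\<Sum>j=n..<L. ucoef j) * (\<Sum>j=Suc N1..n. hcoef j) \<le> 4 / (C * \<delta>) * (12 * M * BQ / (C * \<delta>))" if n: "N1 < n" "n < L" for n L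
  proof -
    have Vn: "V n > 0" and Rn: "R n > 0" by (rule V_pos R_pos)+
    have Y: "(\<Sum>j=Suc N1..n. hcoef j) \<le> 12 * M * BQ / (C * \<delta>) * (R n / V n)"
    proof -
      have "hcoef j \<le> 4 * M / C * R n * V n powr (- \<delta> - 1) * (qcoef j * V j powr (1 + \<delta>))" if j: "j \<in> {Suc N1..n}" for j
      proof -
        have j1: "N1 < j" "j \<le> n" using j by auto
        have Vj: "V j > 0" by (rule V_pos)
        have p: "(V n / V j) powr (1 + \<delta>) > 0" using Vj Vn by simp
        have "C * R j * (V n / V j) powr (1 + \<delta>) \<le> R n" using gr'[of j n] j1 by simp
        hence "R j \<le> 1 / C * R n * (1 / (V n / V j) powr (1 + \<delta>))"
          using C p by (simp add: field_simps)
        also have "1 / (V n / V j) powr (1 + \<delta>) = V j powr (1 + \<delta>) * V n powr (- \<delta> - 1)"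
        proof -
          have "- \<delta> - 1 = - (1 + \<delta>)" by simp
          thus ?thesis using Vn Vj by (simp only: ratio_powr powr_minus) (simp add: divide_inverse)
        qed
        finally have "4 * M * qcoef j * R j \<le> 4 * M * qcoef j * (1 / C * R n * (V j powr (1 + \<delta>) * V n powr (- \<delta> - 1)))"
          by (rule mult_left_mono) (use M less_imp_le[OF qcoef_pos[OF j1(1)]] in \<open>intro mult_nonneg_nonneg; simp\<close>)
        thus ?thesis using hcoef_le[OF j1(1)] by (simp add: mult_ac)
      qed
      hence "(\<Sum>j=Suc N1..n. hcoef j) \<le> (\<Sum>j=Suc N1..n. 4 * M / C * R n * V n powr (- \<delta> - 1) * (qcoef j * V j powr (1 + \<delta>)))"
        by (rule sum_mono)
      also have "\<dots> = 4 * M / C * R n * V n powr (- \<delta> - 1) * (\<Sum>j=Suc N1..n. qcoef j * V j powr (1 + \<delta>))"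
        by (simp add: sum_distrib_left)
      also have "\<dots> \<le> 4 * M / C * R n * V n powr (- \<delta> - 1) * (3 / \<delta> * BQ * V n powr \<delta>)"
        using M C Rn by (intro mult_left_mono sum_q_powr[OF Q \<delta> n(1)]) auto
      also have "\<dots> = 12 * M * BQ / (C * \<delta>) * R n * (V n powr (- \<delta> - 1) * V n powr \<delta>)" by simp
      also have "V n powr (- \<delta> - 1) * V n powr \<delta> = 1 / V n"
        using Vn by (simp add: powr_add[symmetric] powr_minus_divide)
      finally show ?thesis by simp
    qed
    have X: "(\<Sum>j=n..<L. ucoef j) \<le> 4 / (C * \<delta>) * (V n / R n)" 
    proof -
      have "(\<Sum>j=n..<L. ucoef j) \<le> 4 / (C * \<delta>) * V n / R n" using XR[OF n] Rn by (simp only: pos_le_divide_eq)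
      thus ?thesis by simp
    qed
    have "(\<Sum>j=n..<L. ucoef j) * (\<Sum>j=Suc N1..n. hcoef j) \<le> (4 / (C * \<delta>) * (V n / R n)) * (12 * M * BQ / (C * \<delta>) * (R n / V n))"
      by (rule mult_mono[OF X Y])
        (use C \<delta> Vn Rn hcoef_nonneg in \<open>auto intro!: sum_nonneg mult_nonneg_nonneg divide_nonneg_nonneg\<close>)
    also have "\<dots> = 4 / (C * \<delta>) * (12 * M * BQ / (C * \<delta>))" using Vn Rn by simp
    finally show ?thesis .
  qed
  show "\<exists>n>N. R n > K * V (Suc n)"
  proof -
    define N' where "N' = max (Suc N) (Suc N1)"
    define c where "c = C * R N' / V N' powr (1 + \<delta>)"
    have c: "c > 0" using C R_pos[of N'] V_pos[of N'] by (simp add: c_def)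
    have "eventually (\<lambda>n. V n > (2 * \<bar>K\<bar> / c + 1) powr (1 / \<delta>)) sequentially"
      using V_inf by (simp add: filterlim_at_top_dense)
    then obtain m where m: "\<And>n. n \<ge> m \<Longrightarrow> V n > (2 * \<bar>K\<bar> / c + 1) powr (1 / \<delta>)" by (auto simp: eventually_sequentially)
    define n where "n = max m N'"
    have n: "n \<ge> m" "n \<ge> N'" "n > N" "n > N1" by (auto simp: n_def N'_def)
    have Vn: "V n > 0" by (rule V_pos)
    have "2 * \<bar>K\<bar> / c + 1 = ((2 * \<bar>K\<bar> / c + 1) powr (1 / \<delta>)) powr \<delta>"
      using \<delta> c by (simp add: powr_powr add_nonneg_pos)
    also have "\<dots> \<le> V n powr \<delta>" using m[OF n(1)] \<delta> by (intro powr_mono2) auto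
    finally have "2 * \<bar>K\<bar> / c < V n powr \<delta>" by simp
    hence "2 * \<bar>K\<bar> < c * V n powr \<delta>" using c by (simp add: divide_less_eq mult.commute)
    hence "2 * \<bar>K\<bar> * V n < c * V n powr \<delta> * V n" using Vn by simp
    also have "\<dots> = c * V n powr (1 + \<delta>)" using Vn by (simp add: powr_add)
    also have "\<dots> = C * R N' * (V n / V N') powr (1 + \<delta>)" using Vn V_pos[of N'] by (simp add: c_def powr_divide)
    also have "\<dots> \<le> R n" using gr'[of N' n] n by (simp add: N'_def)
    finally have "2 * \<bar>K\<bar> * V n < R n" .
    moreover have "K * V (Suc n) \<le> \<bar>K\<bar> * (2 * V n)"
      using V_Suc_le(1)[of n] V_pos[of "Suc n"] n N1 by (intro mult_mono) auto
    ultimately show ?thesis using n(3) by (intro exI[of _ n]) auto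
  qed
qed

end

section \<open>From the lower bound on tails to the growth dichotomy\<close>

lemma abs_ln_le:
  fixes x e :: real
  assumes "\<bar>x - 1\<bar> \<le> e" "e \<le> 1 / 2"
  shows "\<bar>ln x\<bar> \<le> 2 * e"
proof -
  have x: "1 / 2 \<le> x" using assms by linarith
  have 1: "ln x \<le> x - 1" using x by (intro ln_le_minus_one) simp
  have "ln (1 / x) \<le> 1 / x - 1" using x by (intro ln_le_minus_one) simp
  hence 2: "- ln x \<le> (1 - x) / x" using x by (simp add: ln_div diff_divide_distrib)
  have "(1 - x) / x \<le> 2 * e"
  proof -
    have "1 - x \<le> e" using assms by linarith
    moreover have "e * 1 \<le> e * (2 * x)" using x assms by (intro mult_left_mono) auto
    ultimately have "1 - x \<le> 2 * e * x" by simp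
    thus ?thesis using x by (simp add: divide_le_eq)
  qed
  thus ?thesis using 1 2 assms by linarith
qed

lemma sum_sqrt_mult_le:
  fixes a b :: "'a \<Rightarrow> real"
  assumes "\<And>j. j \<in> A \<Longrightarrow> 0 \<le> a j" "\<And>j. j \<in> A \<Longrightarrow> 0 \<le> b j"
  shows "(\<Sum>j\<in>A. sqrt (a j * b j)) \<le> sqrt ((\<Sum>j\<in>A. a j) * (\<Sum>j\<in>A. b j))"
proof (rule real_le_rsqrt)
  have "(\<Sum>j\<in>A. sqrt (a j * b j))^2 = (\<Sum>j\<in>A. sqrt (a j) * sqrt (b j))^2" by (simp add: real_sqrt_mult)
  also have "\<dots> \<le> (\<Sum>j\<in>A. (sqrt (a j))^2) * (\<Sum>j\<in>A. (sqrt (b j))^2)" by (rule Cauchy_Schwarz_ineq_sum)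
  also have "\<dots> = (\<Sum>j\<in>A. a j) * (\<Sum>j\<in>A. b j)" using assms by simp
  finally show "(\<Sum>j\<in>A. sqrt (a j * b j))^2 \<le> (\<Sum>j\<in>A. a j) * (\<Sum>j\<in>A. b j)" .
qed

lemma ln_ratio_bounds:
  fixes x y e :: real
  assumes "0 < x" "0 < y" "\<bar>ln x - ln y\<bar> \<le> e"
  shows "x \<le> exp e * y" "y \<le> exp e * x"
proof -
  have "ln x \<le> e + ln y" "ln y \<le> e + ln x" using assms(3) by linarith+
  hence "exp (ln x) \<le> exp (e + ln y)" "exp (ln y) \<le> exp (e + ln x)" by simp_all
  thus "x \<le> exp e * y" "y \<le> exp e * x" using assms by (simp_all add: exp_add)
qed

context tail_rows
begin

text \<open>The lower bound is tested on residues whose partial sums are \<open>pr n * y n\<close>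
  for a finitely supported real \<open>y\<close>. Their image under \<open>main_op\<close> is
  governed by the increments of \<open>y\<close>, so the norm inequality turns into a weighted Hardy
  inequality; the upper limit \<open>Suc L\<close> on the right includes the last increment, back to
  0.\<close>

lemma Hardy_from_below:
  assumes N: "N \<ge> N1"
    and below: "\<And>c L. c \<in> supp_space (col_weight v 1) {N<..} \<Longrightarrow> (\<And>k. k \<ge> L \<Longrightarrow> c k = 0) \<Longrightarrow>
      (\<And>n. n \<ge> L \<Longrightarrow> main_op c n = 0) \<Longrightarrow> nsq (col_weight v 1) c \<le> K * (\<Sum>n=Suc N..<L. (cmod (main_op c n))^2 * w n)"
    and K: "K \<ge> 0" and y: "y N = 0" "\<And>n. n \<ge> L \<Longrightarrow> y n = 0" and NL: "N < L"
  shows "(\<Sum>n=Suc N..<L. hcoef n * (y n)^2) \<le> (8 + 2 * K) * (\<Sum>n=Suc N..<Suc L. (y n - y (n - 1))^2 / ucoef n)"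
proof -
  define yc where "yc n = complex_of_real (y n)" for n
  define b where "b n = of_real (y n - y (n - 1)) * pr n / (l n - \<gamma> n)" for n
  define c where "c = (\<lambda>k. if k = 0 then pr N * yc N else if N < k then pr k * yc k - pr (k - 1) * yc (k - 1) else 0)"
  define S where "S = (\<Sum>n=Suc N..<Suc L. (y n - y (n - 1))^2 / ucoef n)"
  have n1: "n > N1" if "n > N" for n using that N by simp
  have rec: "yc (Suc n) = yc n + (l (Suc n) - \<gamma> (Suc n)) * b (Suc n) / pr (Suc n)" if "n \<ge> N" for n
  proof -
    have "l (Suc n) - \<gamma> (Suc n) \<noteq> 0" using l_ne[of "Suc n" "Suc n"] that N by simp
    thus ?thesis using pr_nz[of "Suc n"] by (simp add: yc_def b_def)
  qed
  have main: "main_op c n = b n" if "n > N" for n unfolding c_def by (rule main_op_rec[OF N rec that])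
  have c0: "c k = 0" if "k \<notin> {N<..<Suc L}" for k
    using that y by (auto simp: c_def yc_def)
  have b0: "b n = 0" if "n > L" for n using that y(2)[of n] y(2)[of "n - 1"] by (simp add: b_def)
  have cs: "c \<in> supp_space (col_weight v 1) {N<..}"
  proof -
    have "(\<lambda>k. (cmod (c k))^2 * col_weight v 1 k) summable_on UNIV"
      by (rule finite_nonzero_values_imp_summable_on, rule finite_subset[of _ "{N<..<Suc L}"],
          rule subsetI, rule ccontr) (use c0 in auto)
    thus ?thesis using c0 by (auto simp: supp_space_def)
  qed
  have bw: "(cmod (b n))^2 * w n \<le> (y n - y (n - 1))^2 / ucoef n" if n: "n > N" for n
  proof -
    have vn: "v n > 0" using vV[OF n1[OF n]] by simp
    have "w n / (d n)^2 \<le> 1 / v n" using w_le[OF n1[OF n]] vn d_pos[OF n1[OF n]] by (simp add: field_simps)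
    hence "(y n - y (n - 1))^2 * R n * (w n / (d n)^2) \<le> (y n - y (n - 1))^2 * R n * (1 / v n)"
      using R_pos[of n] by (intro mult_left_mono) auto
    moreover have "cmod (of_real (y n - y (n - 1))) = \<bar>y n - y (n - 1)\<bar>" by (rule norm_of_real)
    ultimately show ?thesis
      by (simp add: b_def norm_mult norm_divide power_mult_distrib power_divide R_def ucoef_def del: of_real_diff)
  qed
  have "nsq (col_weight v 1) c \<le> K * (\<Sum>n=Suc N..<Suc L. (cmod (main_op c n))^2 * w n)"
  proof (rule below[OF cs])
    show "c k = 0" if "Suc L \<le> k" for k using c0 that by simp
    show "main_op c n = 0" if "Suc L \<le> n" for n using main[of n] b0[of n] that NL by simp
  qed
  also have "\<dots> \<le> K * S"
    unfolding S_def using K by (intro mult_left_mono sum_mono) (use main bw in auto)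
  finally have nc: "nsq (col_weight v 1) c \<le> K * S" .
  have row: "hcoef n * (y n)^2 \<le> 2 * ((cmod (c n))^2 * col_weight v 1 n) + 8 * ((y n - y (n - 1))^2 / ucoef n)" if n: "n > N" for n
  proof -
    have nz: "\<gamma> n \<noteq> 0" "l n \<noteq> 0" using gamma_nz[OF n1[OF n]] l_nz[OF n1[OF n]] by auto
    have vn: "v n > 0" using vV[OF n1[OF n]] by simp
    have pn: "pr (n - 1) = pr n * (l n / \<gamma> n)" using pr_Suc[of "n - 1"] n N nz by simp
    define D where "D = complex_of_real (y n - y (n - 1))"
    have cn: "c n = pr n * yc n - pr (n - 1) * yc (n - 1)" using n by (simp add: c_def)
    have yD: "yc (n - 1) = yc n - D" by (simp add: yc_def D_def)
    have f: "(\<gamma> n - l n) / \<gamma> n = 1 - l n / \<gamma> n" using nz by (simp add: diff_divide_distrib)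
    \<comment> \<open>The relation between \<open>c n\<close>, \<open>y n\<close> and the increment,
      solved for the term that carries \<open>hcoef\<close>: the opposite direction to the one used
      for constructing solutions.\<close>
    have e: "pr n * yc n * ((\<gamma> n - l n) / \<gamma> n) = c n - pr n * (l n / \<gamma> n) * D"
      unfolding cn pn yD f by (simp only: right_diff_distrib mult_1_right) (simp add: mult_ac)
    have l2: "(cmod (l n))^2 / (g n)^2 \<le> 4"
      using power_mono[OF l_bounds(2)[OF n1[OF n]], of 2] nz by (simp add: divide_le_eq power_mult_distrib)
    have Dn: "(cmod D)^2 = (y n - y (n - 1))^2" unfolding D_def norm_of_real by simp
    have "hcoef n * (y n)^2 = (cmod (pr n * yc n * ((\<gamma> n - l n) / \<gamma> n)))^2 / v n"
      by (simp add: hcoef_def R_def yc_def norm_mult norm_divide power_mult_distrib power_divide norm_minus_commute)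
    also have "\<dots> \<le> (2 * (cmod (c n))^2 + 2 * (cmod (pr n * (l n / \<gamma> n) * D))^2) / v n"
      unfolding e using vn by (intro divide_right_mono cmod_diff_sq_le) simp
    also have "\<dots> = 2 * ((cmod (c n))^2 * col_weight v 1 n) + 2 * ((cmod (l n))^2 / (g n)^2) * ((y n - y (n - 1))^2 / ucoef n)"
      using n by (simp add: col_weight_def ucoef_def R_def norm_mult norm_divide power_mult_distrib power_divide add_divide_distrib Dn mult_ac)
    also have "\<dots> \<le> 2 * ((cmod (c n))^2 * col_weight v 1 n) + 2 * 4 * ((y n - y (n - 1))^2 / ucoef n)"
      using l2 ucoef_pos[OF n1[OF n]] by (intro add_left_mono mult_right_mono mult_left_mono) (auto simp: less_imp_le)
    finally show ?thesis by simp
  qed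
  interpret poles \<gamma> "col_weight v 1" by (rule poles_axiom) simp
  have "(\<Sum>n=Suc N..<L. hcoef n * (y n)^2) \<le> (\<Sum>n=Suc N..<L. 2 * ((cmod (c n))^2 * col_weight v 1 n) + 8 * ((y n - y (n - 1))^2 / ucoef n))"
    by (intro sum_mono row) simp
  also have "\<dots> = 2 * (\<Sum>n=Suc N..<L. (cmod (c n))^2 * col_weight v 1 n) + 8 * (\<Sum>n=Suc N..<L. (y n - y (n - 1))^2 / ucoef n)"
    by (simp add: sum.distrib sum_distrib_left)
  also have "\<dots> \<le> 2 * (K * S) + 8 * S"
  proof (intro add_mono mult_left_mono)
    have "(\<Sum>n=Suc N..<L. (cmod (c n))^2 * col_weight v 1 n) \<le> nsq (col_weight v 1) c"
      unfolding nsq_def by (rule finite_sum_le_infsum[OF supp_space_summable[OF cs]]) simp_all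
    thus "(\<Sum>n=Suc N..<L. (cmod (c n))^2 * col_weight v 1 n) \<le> K * S" using nc by linarith
    show "(\<Sum>n=Suc N..<L. (y n - y (n - 1))^2 / ucoef n) \<le> S"
      unfolding S_def by (rule sum_mono2) (use ucoef_pos n1 in \<open>auto intro!: divide_nonneg_nonneg less_imp_le[OF ucoef_pos]\<close>)
  qed simp_all
  finally show ?thesis by (simp add: S_def algebra_simps)
qed

text \<open>Test function of a condenser: \<open>y\<close> rises linearly in \<open>X\<close> up to
  \<open>n\<close>, stays 1 until \<open>m\<close>, and falls linearly in \<open>X\<close> to 0 at
  \<open>l'\<close>. This profile minimizes the energy, and its value is the sum of the reciprocals
  of the two lengths measured by \<open>X\<close>.\<close>

lemma capacity_bound:
  assumes N: "N \<ge> N1"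
    and hardy: "\<And>y L. y N = 0 \<Longrightarrow> (\<And>n. n \<ge> L \<Longrightarrow> y n = 0) \<Longrightarrow> N < L \<Longrightarrow>
      (\<Sum>n=Suc N..<L. hcoef n * (y n)^2) \<le> K * (\<Sum>n=Suc N..<Suc L. (y n - y (n - 1))^2 / ucoef n)"
    and nml: "N < n" "n \<le> m" "m < l'"
  defines "X \<equiv> \<lambda>n. \<Sum>j=Suc N..n. ucoef j"
  shows "(\<Sum>j=n..m. hcoef j) \<le> K * (1 / X n + 1 / (X l' - X m))"
proof -
  have up: "ucoef j > 0" if "j > N" for j using ucoef_pos[of j] that N by simp
  have XS: "X (Suc j) = X j + ucoef (Suc j)" if "j \<ge> N" for j using that by (simp add: X_def)
  have Xn: "X n > 0" unfolding X_def by (rule sum_pos) (use nml up in auto)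
  have Xlm: "X l' - X m = (\<Sum>j=Suc m..l'. ucoef j)"
  proof -
    have "{Suc N..l'} = {Suc N..m} \<union> {Suc m..l'}" using nml by auto
    thus ?thesis unfolding X_def by (simp add: sum.union_disjoint)
  qed
  define P where "P = X l' - X m"
  have P: "P > 0" unfolding P_def Xlm by (rule sum_pos) (use nml up in auto)
  define y where "y j = (if j \<le> n then X j / X n else if j \<le> m then 1 else if j \<le> l' then 1 - (X j - X m) / P else 0)" for j
  have yN: "y N = 0" using nml by (simp add: y_def X_def)
  have yl: "y j = 0" if "j \<ge> l'" for j using that nml P by (auto simp: y_def P_def[symmetric])
  have D1: "y j - y (j - 1) = ucoef j / X n" if "j \<in> {Suc N..n}" for j
  proof -
    have "X j = X (j - 1) + ucoef j" using XS[of "j - 1"] that by (cases j) auto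
    moreover have "j \<le> n" "j - 1 \<le> n" using that by auto
    ultimately show ?thesis by (simp add: y_def diff_divide_distrib[symmetric])
  qed
  have D2: "y j - y (j - 1) = 0" if "j \<in> {Suc n..m}" for j
  proof (cases "j = Suc n")
    case True
    thus ?thesis using that Xn by (simp add: y_def)
  next
    case False
    thus ?thesis using that by (cases j) (auto simp: y_def)
  qed
  have D3: "y j - y (j - 1) = - ucoef j / P" if "j \<in> {Suc m..l'}" for j
  proof -
    have Xj: "X j = X (j - 1) + ucoef j" using XS[of "j - 1"] that nml by (cases j) auto
    have yj: "y j = 1 - (X j - X m) / P" using that nml by (simp add: y_def)
    have "y (j - 1) = 1 - (X (j - 1) - X m) / P"
    proof (cases "j = Suc m")
      case True
      thus ?thesis using nml Xn by (auto simp: y_def)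
    next
      case False
      thus ?thesis using that nml by (cases j) (auto simp: y_def)
    qed
    thus ?thesis unfolding yj Xj by (simp add: add_divide_distrib diff_divide_distrib)
  qed
  have D4: "y (Suc l') - y (Suc l' - 1) = 0" using yl by simp
  define F where "F j = (y j - y (j - 1))^2 / ucoef j" for j
  have "(\<Sum>j=Suc N..<Suc (Suc l'). F j) = (\<Sum>j=Suc N..n. F j) + ((\<Sum>j=Suc n..m. F j) + (\<Sum>j=Suc m..l'. F j)) + F (Suc l')"
  proof -
    have e: "{Suc N..<Suc (Suc l')} = insert (Suc l') {Suc N..l'}" using nml by auto
    have e1: "{Suc N..l'} = {Suc N..n} \<union> {Suc n..l'}" and e2: "{Suc n..l'} = {Suc n..m} \<union> {Suc m..l'}" using nml by auto
    have "(\<Sum>j=Suc N..l'. F j) = (\<Sum>j=Suc N..n. F j) + (\<Sum>j=Suc n..l'. F j)"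
      unfolding e1 by (subst sum.union_disjoint) auto
    moreover have "(\<Sum>j=Suc n..l'. F j) = (\<Sum>j=Suc n..m. F j) + (\<Sum>j=Suc m..l'. F j)"
      unfolding e2 by (subst sum.union_disjoint) auto
    ultimately show ?thesis unfolding e by simp
  qed
  also have "(\<Sum>j=Suc N..n. F j) = 1 / X n"
  proof -
    have "F j = ucoef j / (X n)^2" if "j \<in> {Suc N..n}" for j
      unfolding F_def D1[OF that] using up[of j] that by (simp add: power_divide power2_eq_square)
    hence "(\<Sum>j=Suc N..n. F j) = (\<Sum>j=Suc N..n. ucoef j) / (X n)^2" by (simp add: sum_divide_distrib)
    also have "(\<Sum>j=Suc N..n. ucoef j) = X n" by (simp add: X_def)
    finally show ?thesis using Xn by (simp add: power2_eq_square)
  qed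
  also have "(\<Sum>j=Suc n..m. F j) = 0"
    by (rule sum.neutral, rule ballI, unfold F_def, subst D2) simp_all
  also have "(\<Sum>j=Suc m..l'. F j) = 1 / P"
  proof -
    have "F j = ucoef j / P^2" if "j \<in> {Suc m..l'}" for j
      unfolding F_def D3[OF that] using up[of j] that nml by (simp add: power_divide power2_eq_square)
    hence "(\<Sum>j=Suc m..l'. F j) = (\<Sum>j=Suc m..l'. ucoef j) / P^2" by (simp add: sum_divide_distrib)
    also have "(\<Sum>j=Suc m..l'. ucoef j) = P" unfolding P_def by (rule Xlm[symmetric])
    finally show ?thesis using P by (simp add: power2_eq_square)
  qed
  also have "F (Suc l') = 0" using D4 by (simp add: F_def)
  finally have E: "(\<Sum>j=Suc N..<Suc (Suc l'). F j) = 1 / X n + 1 / P" by simp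
  have "(\<Sum>j=n..m. hcoef j) = (\<Sum>j=n..m. hcoef j * (y j)^2)"
  proof (rule sum.cong[OF refl])
    fix j assume "j \<in> {n..m}"
    hence "y j = 1" using Xn by (auto simp: y_def)
    thus "hcoef j = hcoef j * (y j)^2" by simp
  qed
  also have "\<dots> \<le> (\<Sum>j=Suc N..<Suc l'. hcoef j * (y j)^2)"
    by (rule sum_mono2) (use nml N hcoef_nonneg in auto)
  also have "\<dots> \<le> K * (\<Sum>j=Suc N..<Suc (Suc l'). (y j - y (j - 1))^2 / ucoef j)"
    by (rule hardy[of y "Suc l'", OF yN]) (use yl nml in auto)
  also have "\<dots> = K * (1 / X n + 1 / (X l' - X m))" using E by (simp add: F_def P_def)
  finally show ?thesis .
qed

text \<open>One step changes \<open>ln R\<close> by at most \<open>4 * d n / g n\<close>, and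
  \<open>d n / g n\<close> is exactly \<open>sqrt (hcoef n * ucoef n)\<close>.\<close>

lemma ln_R_diff:
  assumes "N1 \<le> n" "n \<le> m"
  shows "\<bar>ln (R m) - ln (R n)\<bar> \<le> 4 * (\<Sum>j=Suc n..m. sqrt (hcoef j * ucoef j))"
  using assms(2)
proof (induction m rule: dec_induct)
  case (step m)
  have m: "m \<ge> N1" "Suc m > N1" using step assms by auto
  have gp: "g (Suc m) > 0" using gamma_nz[OF m(2)] by simp
  have lp: "cmod (l (Suc m)) > 0" using l_nz[OF m(2)] by simp
  define e where "e = d (Suc m) / g (Suc m)"
  have e: "0 \<le> e" "e \<le> 1 / 2" using d_half[OF m(2)] gp by (auto simp: e_def divide_le_eq)
  have "\<bar>cmod (l (Suc m)) - g (Suc m)\<bar> \<le> d (Suc m)" by (rule norm_triangle_ineq3)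
  hence "\<bar>cmod (l (Suc m)) / g (Suc m) - 1\<bar> \<le> e"
  proof -
    have "cmod (l (Suc m)) / g (Suc m) - 1 = (cmod (l (Suc m)) - g (Suc m)) / g (Suc m)" using gp by (simp add: diff_divide_distrib)
    hence "\<bar>cmod (l (Suc m)) / g (Suc m) - 1\<bar> = \<bar>cmod (l (Suc m)) - g (Suc m)\<bar> / g (Suc m)" using gp by simp
    also have "\<dots> \<le> e" unfolding e_def using \<open>\<bar>cmod (l (Suc m)) - g (Suc m)\<bar> \<le> d (Suc m)\<close> gp by (intro divide_right_mono) auto
    finally show ?thesis .
  qed
  hence le: "\<bar>ln (cmod (l (Suc m)) / g (Suc m))\<bar> \<le> 2 * e" using e(2) by (rule abs_ln_le)
  have "ln (R (Suc m)) - ln (R m) = ln ((g (Suc m))^2 / (cmod (l (Suc m)))^2)"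
    unfolding R_Suc[OF m(1)] using R_pos[of m] gp lp by (subst ln_mult_pos) auto
  also have "\<dots> = - 2 * ln (cmod (l (Suc m)) / g (Suc m))"
    using gp lp by (simp add: ln_div ln_realpow)
  finally have 1: "\<bar>ln (R (Suc m)) - ln (R m)\<bar> \<le> 4 * e" using le by simp
  have "hcoef (Suc m) * ucoef (Suc m) = e^2"
    using vV[OF m(2)] R_pos[of "Suc m"] by (simp add: hcoef_def ucoef_def e_def power_divide)
  hence 2: "sqrt (hcoef (Suc m) * ucoef (Suc m)) = e" using e by simp
  have "\<bar>ln (R (Suc m)) - ln (R n)\<bar> \<le> 4 * e + 4 * (\<Sum>j=Suc n..m. sqrt (hcoef j * ucoef j))"
    using 1 step by linarith
  thus ?case using 2 step by (simp add: distrib_left)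
qed simp

text \<open>On a stretch where \<open>V\<close> grows by at most the factor 4, Cauchy-Schwarz bounds
  the variation of \<open>ln R\<close> through the sum of \<open>qcoef\<close>, at most
  \<open>BQ / V n\<close>, and the sum of \<open>v\<close>, at most \<open>8 * V n\<close>; the
  powers of \<open>V n\<close> cancel.\<close>

lemma R_comparable:
  assumes Q: "\<And>n L. N1 < n \<Longrightarrow> n < L \<Longrightarrow> V n * (\<Sum>j=n..<L. qcoef j) \<le> BQ"
  obtains E where "E \<ge> 1" "\<And>n m. N1 < n \<Longrightarrow> n \<le> m \<Longrightarrow> V m \<le> 4 * V n \<Longrightarrow> R m \<le> E * R n \<and> R n \<le> E * R m"
proof -
  have BQ0: "BQ \<ge> 0"
  proof -
    have "0 \<le> V (Suc N1) * (\<Sum>j=Suc N1..<Suc (Suc N1). qcoef j)"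
      using V_pos[of "Suc N1"] less_imp_le[OF qcoef_pos[of "Suc N1"]] by (intro mult_nonneg_nonneg sum_nonneg) auto
    also have "\<dots> \<le> BQ" by (rule Q) simp_all
    finally show ?thesis .
  qed
  define e where "e = 4 * sqrt (4 * M * BQ * 8)"
  have e0: "e \<ge> 0" using M BQ0 by (simp add: e_def)
  have "R m \<le> exp e * R n \<and> R n \<le> exp e * R m" if n: "N1 < n" "n \<le> m" "V m \<le> 4 * V n" for n m
  proof -
    have Vn: "V n > 0" by (rule V_pos)
    have jn: "j > N1" if "j \<in> {Suc n..m}" for j using that n by simp
    have "\<bar>ln (R m) - ln (R n)\<bar> \<le> 4 * (\<Sum>j=Suc n..m. sqrt (hcoef j * ucoef j))"
      by (rule ln_R_diff) (use n in auto)
    also have "(\<Sum>j=Suc n..m. sqrt (hcoef j * ucoef j)) \<le> (\<Sum>j=Suc n..m. sqrt ((4 * M * qcoef j) * v j))"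
    proof (intro sum_mono real_sqrt_le_mono)
      fix j assume "j \<in> {Suc n..m}"
      hence j: "j > N1" by (rule jn)
      have "hcoef j * ucoef j \<le> (4 * M * qcoef j * R j) * ucoef j"
        using hcoef_le[OF j] ucoef_pos[OF j] by (intro mult_right_mono) auto
      also have "\<dots> = (4 * M * qcoef j) * v j" using R_pos[of j] by (simp add: ucoef_def)
      finally show "hcoef j * ucoef j \<le> (4 * M * qcoef j) * v j" .
    qed
    also have "\<dots> \<le> sqrt ((\<Sum>j=Suc n..m. 4 * M * qcoef j) * (\<Sum>j=Suc n..m. v j))"
    proof (rule sum_sqrt_mult_le)
      fix j assume "j \<in> {Suc n..m}"
      hence j: "j > N1" by (rule jn)
      show "0 \<le> 4 * M * qcoef j" using M less_imp_le[OF qcoef_pos[OF j]] by (intro mult_nonneg_nonneg) auto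
      show "0 \<le> v j" using vV[OF j] by simp
    qed
    also have "\<dots> \<le> sqrt ((4 * M * (BQ / V n)) * (8 * V n))"
    proof (intro real_sqrt_le_mono mult_mono)
      have "V n * (\<Sum>j=Suc n..m. qcoef j) \<le> V n * (\<Sum>j=n..<Suc m. qcoef j)"
        using n Vn less_imp_le[OF qcoef_pos] by (intro mult_left_mono sum_mono2) auto
      also have "\<dots> \<le> BQ" by (rule Q) (use n in auto)
      finally have "(\<Sum>j=Suc n..m. qcoef j) \<le> BQ / V n" using Vn by (simp add: le_divide_eq mult.commute)
      thus "(\<Sum>j=Suc n..m. 4 * M * qcoef j) \<le> 4 * M * (BQ / V n)"
        unfolding sum_distrib_left[symmetric] using M by (intro mult_left_mono) auto
      have "(\<Sum>j=Suc n..m. v j) \<le> (\<Sum>j=n..<Suc m. v j)"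
        by (rule sum_mono2) (use n in \<open>auto intro!: less_imp_le[OF vV[THEN conjunct1]]\<close>)
      also have "\<dots> = V (Suc m) - V n" by (rule V_sum) (use idx[OF n(1)] n in auto)
      also have "\<dots> \<le> 8 * V n" using vV[of m] n Vn by auto
      finally show "(\<Sum>j=Suc n..m. v j) \<le> 8 * V n" .
      show "0 \<le> (\<Sum>j=Suc n..m. v j)" by (intro sum_nonneg less_imp_le[OF vV[THEN conjunct1]] jn)
    qed (use M BQ0 Vn in auto)
    also have "(4 * M * (BQ / V n)) * (8 * V n) = 4 * M * BQ * 8" using Vn by simp
    finally have "\<bar>ln (R m) - ln (R n)\<bar> \<le> e" by (simp add: e_def)
    thus ?thesis using ln_ratio_bounds[OF R_pos R_pos] by blast
  qed
  thus thesis using that[of "exp e"] e0 by simp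
qed

text \<open>Discrete Gronwall argument: \<open>1 + k * t\<close> dominates
  \<open>(1 + t) powr \<delta>\<close> for \<open>\<delta> = min 1 k\<close>, and the factors
  \<open>1 + t\<close> multiply up to quotients of \<open>V\<close>. Passing from
  \<open>V (Suc n)\<close> back to \<open>V n\<close> costs the factor 1/2.\<close>

lemma power_growth:
  assumes N': "N' \<ge> N1" and k: "k > 0" and a: "\<And>n. n \<ge> N' \<Longrightarrow> a n > 0"
    and step: "\<And>n. n \<ge> N' \<Longrightarrow> a (Suc n) \<ge> a n * (1 + k * (v (Suc n) / V (Suc n)))"
  obtains \<delta> where "0 < \<delta>" "\<delta> \<le> 1" "\<And>n m. N' < n \<Longrightarrow> n \<le> m \<Longrightarrow> a m / a n \<ge> 1 / 2 * (V m / V n) powr \<delta>"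
proof -
  define \<delta> where "\<delta> = min 1 k"
  have \<delta>: "0 < \<delta>" "\<delta> \<le> 1" "\<delta> \<le> k" using k by (auto simp: \<delta>_def)
  have main: "a m \<ge> a n * (V (Suc m) / V (Suc n)) powr \<delta>" if n: "N' < n" "n \<le> m" for n m
    using n(2)
  proof (induction m rule: dec_induct)
    case base
    thus ?case using V_pos[of "Suc n"] by simp
  next
    case (step m)
    have m: "Suc m > N1" "m \<ge> N'" using step n N' by auto
    define t where "t = v (Suc m) / V (Suc m)"
    have t: "t > 0" using vV[OF m(1)] by (simp add: t_def)
    have "(1 + t) powr \<delta> \<le> 1 + \<delta> * t"
    proof -
      obtain z where z: "1 < z" "z < 1 + t" "(1 + t) powr \<delta> - 1 powr \<delta> = (1 + t - 1) * (\<delta> * z powr (\<delta> - 1))"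
        using powr_MVT[of 1 "1 + t" \<delta>] t by auto
      have "z powr (\<delta> - 1) \<le> 1 powr (\<delta> - 1)" using z \<delta> by (intro powr_mono2') auto
      hence "t * (\<delta> * z powr (\<delta> - 1)) \<le> t * (\<delta> * 1)" using t \<delta> by (intro mult_left_mono) auto
      thus ?thesis using z(3) by (simp add: mult.commute)
    qed
    also have "\<dots> \<le> 1 + k * t" using \<delta> t by simp
    finally have b: "(1 + t) powr \<delta> \<le> 1 + k * t" .
    have "V (Suc (Suc m)) / V (Suc n) = V (Suc m) / V (Suc n) * (1 + t)"
    proof -
      have "V (Suc m) * (1 + t) = V (Suc (Suc m))" using vV[OF m(1)] by (simp add: t_def distrib_left)
      thus ?thesis by simp
    qed
    hence "(V (Suc (Suc m)) / V (Suc n)) powr \<delta> = (V (Suc m) / V (Suc n) * (1 + t)) powr \<delta>" by (rule arg_cong)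
    also have "\<dots> = (V (Suc m) / V (Suc n)) powr \<delta> * (1 + t) powr \<delta>"
      using V_pos[of "Suc n"] V_pos[of "Suc m"] t by (subst powr_mult) auto
    finally have "a n * (V (Suc (Suc m)) / V (Suc n)) powr \<delta> = a n * (V (Suc m) / V (Suc n)) powr \<delta> * (1 + t) powr \<delta>" by simp
    also have "\<dots> \<le> a m * (1 + k * t)"
      using step b a[of n] a[OF m(2)] n by (intro mult_mono) auto
    also have "\<dots> \<le> a (Suc m)" using assms(4)[OF m(2)] by (simp add: t_def)
    finally show ?case .
  qed
  have "a m / a n \<ge> 1 / 2 * (V m / V n) powr \<delta>" if n: "N' < n" "n \<le> m" for n m
  proof -
    have nm: "n > N1" "m > N1" using n N' by auto
    have p: "V n > 0" "V m > 0" "V (Suc n) > 0" "a n > 0" using V_pos a n by auto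
    have "V m / (2 * V n) \<le> V (Suc m) / V (Suc n)"
      using vV[OF nm(1)] vV[OF nm(2)] by (intro frac_le) auto
    hence "(V m / (2 * V n)) powr \<delta> \<le> (V (Suc m) / V (Suc n)) powr \<delta>" using p \<delta> by (intro powr_mono2) auto
    moreover have "(V m / (2 * V n)) powr \<delta> = (1 / 2) powr \<delta> * (V m / V n) powr \<delta>"
    proof -
      have "V m / (2 * V n) = (1 / 2) * (V m / V n)" by simp
      thus ?thesis using p by (simp only: powr_mult)
    qed
    moreover have "1 / 2 * (V m / V n) powr \<delta> \<le> (1 / 2) powr \<delta> * (V m / V n) powr \<delta>"
    proof (rule mult_right_mono)
      have "(1 / 2) powr 1 \<le> (1 / 2 :: real) powr \<delta>" using \<delta> by (intro powr_mono') auto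
      thus "1 / 2 \<le> (1 / 2 :: real) powr \<delta>" by simp
    qed simp
    ultimately have "1 / 2 * (V m / V n) powr \<delta> \<le> (V (Suc m) / V (Suc n)) powr \<delta>" by linarith
    also have "\<dots> \<le> a m / a n" using main[OF n] p by (simp add: le_divide_eq mult.commute)
    finally show ?thesis .
  qed
  thus thesis using that \<delta> by blast
qed

end

context tail_rows
begin

text \<open>In each case the relevant sum of \<open>ucoef\<close> (the partial sum \<open>X\<close>
  or the remainder \<open>Z\<close>) turns out comparable with \<open>V / R\<close>. Its steps have
  size \<open>v / R\<close>, hence at least a multiple of itself times \<open>v / V\<close>, and
  \<open>power_growth\<close> compares it with a power of \<open>V\<close>; solving for
  \<open>R\<close> puts the exponent on the corresponding side of 1.\<close>

theorem growth_dichotomy: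
  assumes Q: "\<And>n L. N1 < n \<Longrightarrow> n < L \<Longrightarrow> V n * (\<Sum>j=n..<L. qcoef j) \<le> BQ"
    and N: "N \<ge> N1" and K: "K > 0"
    and cap: "\<And>n m l'. N < n \<Longrightarrow> n \<le> m \<Longrightarrow> m < l' \<Longrightarrow>
      (\<Sum>j=n..m. hcoef j) \<le> K * (1 / (\<Sum>j=Suc N..n. ucoef j) + 1 / ((\<Sum>j=Suc N..l'. ucoef j) - (\<Sum>j=Suc N..m. ucoef j)))"
  shows "\<exists>N' C \<delta>. C > 0 \<and> 0 < \<delta> \<and> \<delta> \<le> 1 \<and>
    ((\<forall>n m. N' < n \<longrightarrow> n \<le> m \<longrightarrow> R m / R n \<le> C * (V m / V n) powr (1 - \<delta>)) \<or>
     (\<forall>n m. N' < n \<longrightarrow> n \<le> m \<longrightarrow> R m / R n \<ge> C * (V m / V n) powr (1 + \<delta>)))"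
proof -
  define X where "X n = (\<Sum>j=Suc N..n. ucoef j)" for n
  have up: "ucoef j > 0" if "j > N" for j using ucoef_pos[of j] that N by simp
  have XS: "X (Suc j) = X j + ucoef (Suc j)" if "j \<ge> N" for j using that by (simp add: X_def)
  have Xmono: "X n \<le> X m" if "n \<le> m" for n m
    unfolding X_def by (rule sum_mono2) (use that up in \<open>auto intro!: less_imp_le[OF up]\<close>)
  have Xpos: "X n > 0" if "n > N" for n unfolding X_def by (rule sum_pos) (use that up in auto)
  have Xdiff: "(\<Sum>j=Suc n..m. ucoef j) = X m - X n" if "N \<le> n" "n \<le> m" for n m
  proof -
    have e: "{Suc N..m} = {Suc N..n} \<union> {Suc n..m}" using that by auto
    show ?thesis unfolding X_def e by (subst sum.union_disjoint) auto
  qed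
  have Vdiff: "(\<Sum>j=Suc n..m. v j) = V (Suc m) - V (Suc n)" if "N \<le> n" "n \<le> m" for n m
  proof -
    have "(\<Sum>j=Suc n..m. v j) = (\<Sum>j=Suc n..<Suc m. v j)" by (rule sum.cong) auto
    also have "\<dots> = V (Suc m) - V (Suc n)" by (rule V_sum) (use that N N1 N0(1) in auto)
    finally show ?thesis .
  qed
  have V2: "V (Suc n) \<le> 2 * V n" if "n > N" for n using vV[of n] that N by simp
  have Vm: "V n \<le> V m" if "N < n" "n \<le> m" for n m using that N N1 N0(1) by (intro V_mono) auto
  obtain E where E: "E \<ge> 1" "\<And>n m. N1 < n \<Longrightarrow> n \<le> m \<Longrightarrow> V m \<le> 4 * V n \<Longrightarrow> R m \<le> E * R n \<and> R n \<le> E * R m"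
    using R_comparable[OF Q] by blast
  have lnX: "\<bar>ln (R m) - ln (R n)\<bar> \<le> 4 * sqrt ((\<Sum>j=Suc n..m. hcoef j) * (X m - X n))" if "N \<le> n" "n \<le> m" for n m
  proof -
    have "\<bar>ln (R m) - ln (R n)\<bar> \<le> 4 * (\<Sum>j=Suc n..m. sqrt (hcoef j * ucoef j))"
      by (rule ln_R_diff) (use that N in auto)
    also have "(\<Sum>j=Suc n..m. sqrt (hcoef j * ucoef j)) \<le> sqrt ((\<Sum>j=Suc n..m. hcoef j) * (\<Sum>j=Suc n..m. ucoef j))"
      by (rule sum_sqrt_mult_le) (use that N hcoef_nonneg in \<open>auto intro!: less_imp_le[OF up]\<close>)
    finally show ?thesis using Xdiff[OF that] by simp
  qed
  have Vlarge: "\<exists>m. \<forall>n\<ge>m. V n > z" for z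
    using V_inf unfolding filterlim_at_top_dense eventually_sequentially by blast
  show ?thesis
  proof (cases "\<exists>b. \<forall>n. X n \<le> b")
    case False
    \<comment> \<open>As \<open>X\<close> is unbounded, the second reciprocal in \<open>cap\<close>
      disappears when \<open>l'\<close> tends to infinity.\<close>
    have hs: "(\<Sum>j=n..m. hcoef j) \<le> K / X n" if n: "N < n" "n \<le> m" for n m
    proof (rule field_le_epsilon)
      fix e :: real assume e: "e > 0"
      obtain i where i: "X i > X m + K / e" using False by (metis not_le)
      define l' where "l' = max i (Suc m)"
      have l': "m < l'" "X l' > X m + K / e" using i Xmono[of i l'] by (auto simp: l'_def)
      have "0 < K / e" using K e by simp
      hence p: "0 < X l' - X m" using l' by linarith
      have "K / e < X l' - X m" using l'(2) by linarith
      hence "K < e * (X l' - X m)" using e by (simp add: divide_less_eq mult.commute)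
      hence "K / (X l' - X m) \<le> e" using p by (simp add: divide_le_eq)
      moreover have "(\<Sum>j=n..m. hcoef j) \<le> K * (1 / X n + 1 / (X l' - X m))"
        unfolding X_def by (rule cap) (use n l' in auto)
      ultimately show "(\<Sum>j=n..m. hcoef j) \<le> K / X n + e" by (simp add: distrib_left)
    qed
    define e1 where "e1 = exp (4 * sqrt (2 * K))"
    have e1: "e1 > 0" by (simp add: e1_def)
    have cmp: "R n \<le> e1 * R j" if j: "N < j" "j \<le> n" "X n \<le> 2 * X j" for j n
    proof -
      have Xj: "X j > 0" using Xpos j by simp
      have "(\<Sum>i=Suc j..n. hcoef i) \<le> (\<Sum>i=j..n. hcoef i)"
        by (rule sum_mono2) (use j N hcoef_nonneg in auto)
      also have "\<dots> \<le> K / X j" by (rule hs) (use j in auto)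
      finally have "(\<Sum>i=Suc j..n. hcoef i) * (X n - X j) \<le> (K / X j) * (2 * X j)"
        using j(3) Xj K Xmono[OF j(2)] by (intro mult_mono) auto
      hence "(\<Sum>i=Suc j..n. hcoef i) * (X n - X j) \<le> 2 * K" using Xj by simp
      hence "\<bar>ln (R n) - ln (R j)\<bar> \<le> 4 * sqrt (2 * K)"
        using lnX[of j n] j real_sqrt_le_mono[of "(\<Sum>i=Suc j..n. hcoef i) * (X n - X j)" "2 * K"] by linarith
      thus ?thesis unfolding e1_def by (rule ln_ratio_bounds(1)[OF R_pos R_pos])
    qed
    define C1 where "C1 = 4 * e1"
    have C1: "C1 > 0" using e1 by (simp add: C1_def)
    have upper: "X n \<le> C1 * (V n / R n)" if n: "N < n" for n
    proof -
      \<comment> \<open>Start of the last block, on which \<open>X\<close> is at least half of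
        \<open>X n\<close>: it carries at least half of the sum, and \<open>cmp\<close> bounds
        \<open>R n\<close> by a multiple of \<open>R\<close> there.\<close>
      define j0 where "j0 = (LEAST j. N < j \<and> X n \<le> 2 * X j)"
      have ex: "N < n \<and> X n \<le> 2 * X n" using n Xpos[OF n] by simp
      have j0: "N < j0" "X n \<le> 2 * X j0" using LeastI[of "\<lambda>j. N < j \<and> X n \<le> 2 * X j", OF ex] by (auto simp: j0_def)
      have j0n: "j0 \<le> n" unfolding j0_def by (rule Least_le[of "\<lambda>j. N < j \<and> X n \<le> 2 * X j", OF ex])
      define i where "i = j0 - 1"
      have i: "j0 = Suc i" "N \<le> i" "i \<le> n" using j0(1) j0n by (auto simp: i_def)
      have "2 * X i \<le> X n"
      proof (cases "i = N")
        case True thus ?thesis using Xpos[OF n] by (simp add: X_def)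
      next
        case False
        have "\<not> (N < i \<and> X n \<le> 2 * X i)"
          using not_less_Least[of i "\<lambda>j. N < j \<and> X n \<le> 2 * X j"] i(1) by (simp add: j0_def)
        thus ?thesis using False i(2) by linarith
      qed
      hence "X n \<le> 2 * (\<Sum>j=Suc i..n. ucoef j)" using Xdiff[OF i(2,3)] by simp
      also have "(\<Sum>j=Suc i..n. ucoef j) \<le> (\<Sum>j=Suc i..n. e1 / R n * v j)"
      proof (rule sum_mono)
        fix j assume j: "j \<in> {Suc i..n}"
        hence jN: "N < j" "j \<le> n" "j0 \<le> j" using i by auto
        have "X n \<le> 2 * X j" using j0(2) Xmono[OF jN(3)] by linarith
        hence "R n \<le> e1 * R j" by (rule cmp[OF jN(1,2)])
        hence "1 / R j \<le> e1 / R n" using R_pos[of j] R_pos[of n] by (simp add: field_simps)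
        hence "v j * (1 / R j) \<le> v j * (e1 / R n)" using vV[of j] jN N by (intro mult_left_mono) auto
        thus "ucoef j \<le> e1 / R n * v j" by (simp add: ucoef_def mult.commute)
      qed
      also have "\<dots> = e1 / R n * (V (Suc n) - V (Suc i))"
        unfolding sum_distrib_left[symmetric] Vdiff[OF i(2,3)] ..
      also have "\<dots> \<le> e1 / R n * (2 * V n)"
        using e1 R_pos[of n] V2[OF n] V_pos[of "Suc i"] by (intro mult_left_mono) auto
      finally show ?thesis by (simp add: C1_def)
    qed
    obtain N3 where N3: "\<And>n. n \<ge> N3 \<Longrightarrow> V n > 4 * V (Suc N)" using Vlarge by blast
    define N4 where "N4 = max N3 (Suc N)"
    have lower: "V n / R n \<le> 2 * E * X n" if n: "n \<ge> N4" for n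
    proof -
      have nN: "N < n" "V n > 4 * V (Suc N)" using n N3 by (auto simp: N4_def)
      \<comment> \<open>Last block in the scale of \<open>V\<close>: it carries at least half of
        \<open>V n\<close>, and \<open>R_comparable\<close> applies on it.\<close>
      define j0 where "j0 = (LEAST j. N < j \<and> V n \<le> 4 * V j)"
      have ex: "N < n \<and> V n \<le> 4 * V n" using nN V_pos[of n] by simp
      have j0: "N < j0" "V n \<le> 4 * V j0" using LeastI[of "\<lambda>j. N < j \<and> V n \<le> 4 * V j", OF ex] by (auto simp: j0_def)
      have j0n: "j0 \<le> n" unfolding j0_def by (rule Least_le[of "\<lambda>j. N < j \<and> V n \<le> 4 * V j", OF ex])
      have "j0 \<noteq> Suc N" using j0(2) nN(2) by auto
      then obtain i where i: "j0 = Suc i" "N < i" using j0(1) by (cases j0) auto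
      have "\<not> (N < i \<and> V n \<le> 4 * V i)"
        using not_less_Least[of i "\<lambda>j. N < j \<and> V n \<le> 4 * V j"] i(1) by (simp add: j0_def)
      hence Vi: "4 * V (Suc i) \<le> 2 * V n" using i(2) V2[OF i(2)] by linarith
      have "V n / R n = 2 * (1 / R n * (V n / 2))" by simp
      also have "\<dots> \<le> 2 * (1 / R n * (V (Suc n) - V (Suc i)))"
        using Vi Vm[of n "Suc n"] nN R_pos[of n] by (intro mult_left_mono) auto
      also have "\<dots> = 2 * (\<Sum>j=Suc i..n. 1 / R n * v j)"
        unfolding sum_distrib_left[symmetric] using Vdiff[of i n] i j0n by simp
      also have "\<dots> \<le> 2 * (\<Sum>j=Suc i..n. E * ucoef j)"
      proof (intro mult_left_mono sum_mono)
        fix j assume j: "j \<in> {Suc i..n}"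
        hence jN: "N < j" "j \<le> n" "j0 \<le> j" using i by auto
        have "V n \<le> 4 * V j" using j0(2) Vm[OF j0(1) jN(3)] by linarith
        hence "R j \<le> E * R n" using E(2)[of j n] jN N by simp
        hence "1 / R n \<le> E / R j" using R_pos[of j] R_pos[of n] by (simp add: field_simps)
        hence "1 / R n * v j \<le> E / R j * v j" using vV[of j] jN N by (intro mult_right_mono) auto
        thus "1 / R n * v j \<le> E * ucoef j" by (simp add: ucoef_def)
      qed simp
      also have "\<dots> = 2 * E * (X n - X i)"
        unfolding sum_distrib_left[symmetric] using Xdiff[of i n] i j0n by simp
      also have "\<dots> \<le> 2 * E * X n" using E(1) Xpos[OF i(2)] by (intro mult_left_mono) auto
      finally show ?thesis .
    qed
    \<comment> \<open>\<open>X (Suc n) - X n = v (Suc n) / R (Suc n)\<close>, and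
      \<open>upper\<close> bounds \<open>1 / R\<close> from below by
      \<open>X / (C1 * V)\<close>.\<close>
    obtain \<delta> where \<delta>: "0 < \<delta>" "\<delta> \<le> 1" "\<And>n m. N4 < n \<Longrightarrow> n \<le> m \<Longrightarrow> X m / X n \<ge> 1 / 2 * (V m / V n) powr \<delta>"
    proof (rule power_growth[of N4 "1 / C1" X])
      show "N1 \<le> N4" using N by (simp add: N4_def)
      show "0 < 1 / C1" using C1 by simp
      show "0 < X n" if "N4 \<le> n" for n using that by (intro Xpos) (simp add: N4_def)
      show "X n * (1 + 1 / C1 * (v (Suc n) / V (Suc n))) \<le> X (Suc n)" if n: "N4 \<le> n" for n
      proof -
        have nN: "N < n" using n by (simp add: N4_def)
        have vp: "v (Suc n) > 0" "V (Suc n) > 0" using vV[of "Suc n"] nN N by auto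
        have "X n \<le> X (Suc n)" by (rule Xmono) simp
        also have "\<dots> \<le> C1 * (V (Suc n) / R (Suc n))" by (rule upper) (use nN in simp)
        finally have "X n / (C1 * V (Suc n)) \<le> 1 / R (Suc n)" using C1 vp by (simp add: divide_le_eq mult_ac)
        hence "v (Suc n) * (X n / (C1 * V (Suc n))) \<le> v (Suc n) * (1 / R (Suc n))"
          using vp by (intro mult_left_mono) auto
        thus ?thesis using XS[of n] nN by (simp add: ucoef_def algebra_simps)
      qed
    qed blast
    show ?thesis
    proof (intro exI conjI disjI1 allI impI)
      show "0 < 4 * C1 * E" using C1 E by simp
      show "0 < \<delta>" "\<delta> \<le> 1" by (rule \<delta>)+
      fix n m assume n: "N4 < n" "n \<le> m"
      have nN: "N < n" "N < m" using n by (auto simp: N4_def)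
      have p: "V n > 0" "V m > 0" "R n > 0" "R m > 0" "X n > 0" "X m > 0" using V_pos R_pos Xpos nN by auto
      have a: "R m \<le> C1 * V m / X m" using upper[OF nN(2)] p by (simp add: field_simps)
      have b: "1 / R n \<le> 2 * E * X n / V n" using lower[of n] n p by (simp add: field_simps)
      have c: "X n / X m \<le> 2 * (V m / V n) powr (- \<delta>)"
      proof -
        have "1 / 2 * (V m / V n) powr \<delta> \<le> X m / X n" by (rule \<delta>(3)[OF n])
        thus ?thesis using p by (simp add: powr_minus field_simps)
      qed
      have "R m / R n = R m * (1 / R n)" by simp
      also have "\<dots> \<le> (C1 * V m / X m) * (2 * E * X n / V n)" using a b p C1 E by (intro mult_mono) auto
      also have "\<dots> = (2 * C1 * E) * (V m / V n) * (X n / X m)" by (simp add: mult_ac)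
      also have "\<dots> \<le> (2 * C1 * E) * (V m / V n) * (2 * (V m / V n) powr (- \<delta>))"
        using c p C1 E by (intro mult_left_mono) auto
      also have "\<dots> = 4 * C1 * E * ((V m / V n) powr 1 * (V m / V n) powr (- \<delta>))" using p by simp
      also have "\<dots> = 4 * C1 * E * (V m / V n) powr (1 - \<delta>)" by (simp only: powr_add[symmetric]) simp
      finally show "R m / R n \<le> 4 * C1 * E * (V m / V n) powr (1 - \<delta>)" .
    qed
  next
    case True
    then obtain b where b: "\<And>n. X n \<le> b" by blast
    have Xinc: "incseq X" using Xmono by (simp add: incseq_def)
    have bdd: "bdd_above (range X)" using b by (auto simp: bdd_above_def)
    define Xi where "Xi = (SUP n. X n)"
    have lim: "X \<longlonglongrightarrow> Xi" unfolding Xi_def by (rule LIMSEQ_incseq_SUP[OF bdd Xinc])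
    have Xi_le: "X n \<le> Xi" for n unfolding Xi_def by (rule cSUP_upper[OF _ bdd]) simp
    define Z where "Z n = Xi - X n" for n
    have Zpos: "Z n > 0" if "n \<ge> N" for n
      using Xi_le[of "Suc n"] XS[OF that] up[of "Suc n"] that by (simp add: Z_def)
    have Zmono: "Z m \<le> Z n" if "n \<le> m" for n m using Xmono[OF that] by (simp add: Z_def)
    have Zlim: "Z \<longlonglongrightarrow> 0" unfolding Z_def using tendsto_diff[OF tendsto_const lim, of Xi] by simp
    define X1 where "X1 = X (Suc N)"
    have X1: "X1 > 0" unfolding X1_def by (rule Xpos) simp
    define K2 where "K2 = K * (Z N / X1 + 1)"
    have K2: "K2 > 0" using K X1 Zpos[of N] by (simp add: K2_def add_pos_pos)
    \<comment> \<open>With \<open>X\<close> convergent, the first index is kept at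
      \<open>Suc N\<close> and \<open>l'\<close> tends to infinity; the constant first reciprocal is
      absorbed since \<open>Z m \<le> Z N\<close>.\<close>
    have hs: "(\<Sum>j=Suc N..m. hcoef j) \<le> K2 / Z m" if m: "N < m" for m
    proof (rule LIMSEQ_le_const)
      have Zm: "Z m > 0" using Zpos m by simp
      have "(\<lambda>l'. K * (1 / X1 + 1 / (X l' - X m))) \<longlonglongrightarrow> K * (1 / X1 + 1 / (Xi - X m))"
        using Zm by (intro tendsto_intros lim) (simp add: Z_def)
      moreover have "K * (1 / X1 + 1 / (Xi - X m)) \<le> K2 / Z m"
      proof -
        have "1 / X1 = (Z m / X1) / Z m" using Zm by simp
        also have "\<dots> \<le> (Z N / X1) / Z m" using Zm X1 Zmono[of N m] m by (intro divide_right_mono) auto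
        finally have "1 / X1 + 1 / Z m \<le> (Z N / X1 + 1) / Z m" by (simp add: add_divide_distrib)
        hence "K * (1 / X1 + 1 / Z m) \<le> K * ((Z N / X1 + 1) / Z m)" using K by (intro mult_left_mono) auto
        thus ?thesis by (simp add: Z_def K2_def)
      qed
      moreover have "(\<Sum>j=Suc N..m. hcoef j) \<le> K * (1 / X1 + 1 / (X l' - X m))" if "l' \<ge> Suc m" for l'
        unfolding X_def X1_def by (rule cap) (use that m in auto)
      ultimately have "(\<Sum>j=Suc N..m. hcoef j) \<le> K2 / Z m"
        by (meson LIMSEQ_le_const order_trans)
      thus "\<exists>n0. \<forall>n\<ge>n0. (\<Sum>j=Suc N..m. hcoef j) \<le> (\<lambda>_. K2 / Z m) n" by blast
    qed simp
    define e1 where "e1 = exp (4 * sqrt (2 * K2))"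
    have e1: "e1 > 0" by (simp add: e1_def)
    have cmp: "R m \<le> e1 * R j" if j: "N < j" "j \<le> m" "Z j \<le> 2 * Z m" for j m
    proof -
      have Zm: "Z m > 0" using Zpos j by simp
      have "(\<Sum>i=Suc j..m. hcoef i) \<le> (\<Sum>i=Suc N..m. hcoef i)"
        by (rule sum_mono2) (use j N hcoef_nonneg in auto)
      also have "\<dots> \<le> K2 / Z m" by (rule hs) (use j in auto)
      finally have "(\<Sum>i=Suc j..m. hcoef i) * (X m - X j) \<le> (K2 / Z m) * (2 * Z m)"
        using j(3) Zm K2 Xmono[OF j(2)] by (intro mult_mono) (auto simp: Z_def)
      hence "(\<Sum>i=Suc j..m. hcoef i) * (X m - X j) \<le> 2 * K2" using Zm by simp
      hence "\<bar>ln (R m) - ln (R j)\<bar> \<le> 4 * sqrt (2 * K2)"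
        using lnX[of j m] j real_sqrt_le_mono[of "(\<Sum>i=Suc j..m. hcoef i) * (X m - X j)" "2 * K2"] by linarith
      thus ?thesis unfolding e1_def by (rule ln_ratio_bounds(1)[OF R_pos R_pos])
    qed
    obtain N3 where N3: "\<And>n. n \<ge> N3 \<Longrightarrow> 2 * Z n < Z (Suc N)"
    proof -
      have "eventually (\<lambda>n. Z n < Z (Suc N) / 2) sequentially"
        using order_tendstoD(2)[OF Zlim, of "Z (Suc N) / 2"] Zpos[of "Suc N"] by simp
      then obtain k where k: "\<And>n. n \<ge> k \<Longrightarrow> Z n < Z (Suc N) / 2" unfolding eventually_sequentially by blast
      have "2 * Z n < Z (Suc N)" if "n \<ge> k" for n using k[OF that] by simp
      thus ?thesis by (rule that)
    qed
    define N4 where "N4 = max N3 (Suc N)"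
    define C1 where "C1 = 2 * e1"
    have C1: "C1 > 0" using e1 by (simp add: C1_def)
    have upper: "Z m \<le> C1 * (V m / R m)" if m: "N4 \<le> m" for m
    proof -
      have mN: "N < m" "2 * Z m < Z (Suc N)" using m N3 by (auto simp: N4_def)
      have Zm: "Z m > 0" using Zpos mN by simp
      define j0 where "j0 = (LEAST j. N < j \<and> Z j \<le> 2 * Z m)"
      have ex: "N < m \<and> Z m \<le> 2 * Z m" using mN Zm by simp
      have j0: "N < j0" "Z j0 \<le> 2 * Z m" using LeastI[of "\<lambda>j. N < j \<and> Z j \<le> 2 * Z m", OF ex] by (auto simp: j0_def)
      have j0m: "j0 \<le> m" unfolding j0_def by (rule Least_le[of "\<lambda>j. N < j \<and> Z j \<le> 2 * Z m", OF ex])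
      have "j0 \<noteq> Suc N" using j0(2) mN(2) by auto
      then obtain i where i: "j0 = Suc i" "N < i" using j0(1) by (cases j0) auto
      have "\<not> (N < i \<and> Z i \<le> 2 * Z m)"
        using not_less_Least[of i "\<lambda>j. N < j \<and> Z j \<le> 2 * Z m"] i(1) by (simp add: j0_def)
      hence "Z m \<le> X m - X i" using i(2) by (simp add: Z_def)
      also have "X m - X i = (\<Sum>j=Suc i..m. ucoef j)" using Xdiff[of i m] i j0m by simp
      also have "\<dots> \<le> (\<Sum>j=Suc i..m. e1 / R m * v j)"
      proof (rule sum_mono)
        fix j assume j: "j \<in> {Suc i..m}"
        hence jN: "N < j" "j \<le> m" "j0 \<le> j" using i by auto
        have "Z j \<le> 2 * Z m" using j0(2) Zmono[OF jN(3)] by linarith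
        hence "R m \<le> e1 * R j" by (rule cmp[OF jN(1,2)])
        hence "1 / R j \<le> e1 / R m" using R_pos[of j] R_pos[of m] by (simp add: field_simps)
        hence "v j * (1 / R j) \<le> v j * (e1 / R m)" using vV[of j] jN N by (intro mult_left_mono) auto
        thus "ucoef j \<le> e1 / R m * v j" by (simp add: ucoef_def mult.commute)
      qed
      also have "\<dots> = e1 / R m * (V (Suc m) - V (Suc i))"
        unfolding sum_distrib_left[symmetric] using Vdiff[of i m] i j0m by simp
      also have "\<dots> \<le> e1 / R m * (2 * V m)"
        using e1 R_pos[of m] V2[OF mN(1)] V_pos[of "Suc i"] by (intro mult_left_mono) auto
      finally show ?thesis by (simp add: C1_def mult_ac)
    qed
    have lower: "V m / R m \<le> E * Z m" if m: "N < m" for m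
    proof -
      \<comment> \<open>Looking ahead until \<open>V\<close> has tripled: subtracting
        \<open>V (Suc m) \<le> 2 * V m\<close> still leaves \<open>V m\<close>, and before
        \<open>L\<close> the values of \<open>V\<close> stay within the range of
        \<open>R_comparable\<close>.\<close>
      define L where "L = (LEAST j. m < j \<and> V j \<ge> 3 * V m)"
      obtain k0 where k0: "\<And>n. n \<ge> k0 \<Longrightarrow> V n > 3 * V m" using Vlarge by blast
      have ex: "m < max k0 (Suc m) \<and> V (max k0 (Suc m)) \<ge> 3 * V m" using k0[of "max k0 (Suc m)"] by auto
      have L: "m < L" "V L \<ge> 3 * V m" using LeastI[of "\<lambda>j. m < j \<and> V j \<ge> 3 * V m", OF ex] by (auto simp: L_def)
      then obtain i where i: "L = Suc i" "m \<le> i" by (cases L) auto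
      have Vi: "V i \<le> 4 * V m"
      proof (cases "i = m")
        case True thus ?thesis using V_pos[of m] by simp
      next
        case False
        have "\<not> (m < i \<and> V i \<ge> 3 * V m)"
          using not_less_Least[of i "\<lambda>j. m < j \<and> V j \<ge> 3 * V m"] i(1) by (simp add: L_def)
        thus ?thesis using False i(2) V_pos[of m] by linarith
      qed
      have "V m / R m = 1 / R m * V m" by simp
      also have "\<dots> \<le> 1 / R m * (V (Suc i) - V (Suc m))"
        using L(2) i(1) V2[OF m] R_pos[of m] by (intro mult_left_mono) auto
      also have "\<dots> = (\<Sum>j=Suc m..i. 1 / R m * v j)"
        unfolding sum_distrib_left[symmetric] using Vdiff[of m i] i m by simp
      also have "\<dots> \<le> (\<Sum>j=Suc m..i. E * ucoef j)"
      proof (intro sum_mono)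
        fix j assume j: "j \<in> {Suc m..i}"
        hence jN: "N < j" "m \<le> j" "j \<le> i" using m by auto
        have "V j \<le> 4 * V m" using Vi Vm[OF jN(1,3)] by linarith
        hence "R j \<le> E * R m" using E(2)[of m j] jN m N by simp
        hence "1 / R m \<le> E / R j" using R_pos[of j] R_pos[of m] by (simp add: field_simps)
        hence "1 / R m * v j \<le> E / R j * v j" using vV[of j] jN N by (intro mult_right_mono) auto
        thus "1 / R m * v j \<le> E * ucoef j" by (simp add: ucoef_def)
      qed
      also have "\<dots> = E * (X i - X m)"
        unfolding sum_distrib_left[symmetric] using Xdiff[of m i] i m by simp
      also have "\<dots> \<le> E * Z m" using E(1) Xi_le[of i] by (intro mult_left_mono) (auto simp: Z_def)
      finally show ?thesis .
    qed
    \<comment> \<open>\<open>Z\<close> decreases, so its power behaviour is obtained from growth of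
      the reciprocal.\<close>
    define a where "a n = 1 / Z n" for n
    obtain \<delta> where \<delta>: "0 < \<delta>" "\<delta> \<le> 1" "\<And>n m. N4 < n \<Longrightarrow> n \<le> m \<Longrightarrow> a m / a n \<ge> 1 / 2 * (V m / V n) powr \<delta>"
    proof (rule power_growth[of N4 "1 / C1" a])
      show "N1 \<le> N4" using N by (simp add: N4_def)
      show "0 < 1 / C1" using C1 by simp
      show "0 < a n" if "N4 \<le> n" for n using that Zpos[of n] by (simp add: N4_def a_def)
      show "a n * (1 + 1 / C1 * (v (Suc n) / V (Suc n))) \<le> a (Suc n)" if n: "N4 \<le> n" for n
      proof -
        have nN: "N \<le> n" "N4 \<le> Suc n" using n by (auto simp: N4_def)
        have vp: "v (Suc n) > 0" "V (Suc n) > 0" using vV[of "Suc n"] nN N by auto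
        have Zp: "Z n > 0" "Z (Suc n) > 0" using Zpos nN by auto
        have "Z (Suc n) / (C1 * V (Suc n)) \<le> 1 / R (Suc n)"
          using upper[OF nN(2)] C1 vp by (simp add: divide_le_eq mult_ac)
        hence "v (Suc n) * (Z (Suc n) / (C1 * V (Suc n))) \<le> v (Suc n) * (1 / R (Suc n))"
          using vp by (intro mult_left_mono) auto
        moreover have "Z n = Z (Suc n) + v (Suc n) * (1 / R (Suc n))"
          using XS[OF nN(1)] by (simp add: Z_def ucoef_def)
        moreover have "Z (Suc n) * (1 + 1 / C1 * (v (Suc n) / V (Suc n))) = Z (Suc n) + v (Suc n) * (Z (Suc n) / (C1 * V (Suc n)))"
          by (simp add: distrib_left mult_ac)
        ultimately have "Z (Suc n) * (1 + 1 / C1 * (v (Suc n) / V (Suc n))) \<le> Z n" by linarith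
        thus ?thesis using Zp by (simp add: a_def field_simps)
      qed
    qed blast
    show ?thesis
    proof (intro exI conjI disjI2 allI impI)
      show "0 < 1 / (2 * C1 * E)" using C1 E by simp
      show "0 < \<delta>" "\<delta> \<le> 1" by (rule \<delta>)+
      fix n m assume n: "N4 < n" "n \<le> m"
      have nN: "N < n" "N < m" "N4 \<le> n" using n by (auto simp: N4_def)
      have p: "V n > 0" "V m > 0" "R n > 0" "R m > 0" "Z n > 0" "Z m > 0" using V_pos R_pos Zpos nN by auto
      have a1: "V m / (E * Z m) \<le> R m" using lower[OF nN(2)] p E(1) by (simp add: field_simps)
      have b1: "Z n / (C1 * V n) \<le> 1 / R n" using upper[OF nN(3)] p C1 by (simp add: field_simps)
      have c: "1 / 2 * (V m / V n) powr \<delta> \<le> Z n / Z m" using \<delta>(3)[OF n] by (simp add: a_def)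
      have "1 / (2 * C1 * E) * (V m / V n) powr (1 + \<delta>) = 1 / (C1 * E) * (V m / V n) * (1 / 2 * (V m / V n) powr \<delta>)"
        using p by (simp add: powr_add)
      also have "\<dots> \<le> 1 / (C1 * E) * (V m / V n) * (Z n / Z m)"
        using c p C1 E by (intro mult_left_mono) auto
      also have "\<dots> = (V m / (E * Z m)) * (Z n / (C1 * V n))" by simp
      also have "\<dots> \<le> R m * (1 / R n)" using a1 b1 p C1 E by (intro mult_mono) auto
      finally show "1 / (2 * C1 * E) * (V m / V n) powr (1 + \<delta>) \<le> R m / R n" by simp
    qed
  qed
qed

end

section \<open>Boundedness and lower bounds for invertible systems\<close>

context poles
begin

text \<open>Finite families of row values define continuous seminorms on \<open>ell2\<close>;
  membership of each image in the row space bounds them pointwise, hence uniformly.\<close>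

lemma ctrans_bounded:
  fixes l :: "'r \<Rightarrow> complex"
  assumes w: "\<And>n. n \<in> R \<Longrightarrow> 0 \<le> w n"
    and into: "\<And>c. c \<in> supp_space u C \<Longrightarrow> sqsummable w R (\<lambda>n. ctrans \<gamma> c (l n))"
  shows "\<exists>B\<ge>0. \<forall>c\<in>supp_space u C. (sqsum w R (\<lambda>n. ctrans \<gamma> c (l n))) \<le> B * nsq u c"
proof -
  define toc where "toc x k = (if k \<in> C then coord x k / of_real (sqrt (u k)) else 0)" for x :: ell2 and k
  have tocsq: "(cmod (toc x k))^2 * u k \<le> (cmod (coord x k))^2" for x k
    using u_pos[of k] by (simp add: toc_def norm_divide power_divide)
  have cx: "(\<lambda>k. (cmod (coord x k))^2) summable_on UNIV" for x using coord[of x] by simp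
  have toc_s: "sqsummable u UNIV (\<lambda>k. toc x k)" for x
    by (rule summable_on_comparison_test[OF cx[of x]]) (use tocsq in auto)
  have toc: "toc x \<in> supp_space u C" for x
    using toc_s[of x] by (auto simp: supp_space_def toc_def)
  have ntoc: "nsq u (toc x) \<le> (norm x)^2" for x
    unfolding nsq_def norm_ell2_sq by (rule infsum_mono[OF toc_s cx tocsq])
  \<comment> \<open>The index runs over all sets; those that are not finite subsets of
    \<open>R\<close> get the zero seminorm.\<close>
  define p where "p F x = (if finite F \<and> F \<subseteq> R then L2_set (\<lambda>n. sqrt (w n) * cmod (ctrans \<gamma> (toc x) (l n))) F else 0)" for F x
  have sq: "(sqrt (w n) * cmod z)^2 = (cmod z)^2 * w n" if "n \<in> R" for n z
    using w[OF that] by (simp add: power_mult_distrib mult.commute)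
  have "\<exists>K. \<forall>F x. p F x \<le> K * norm x"
  proof (rule uniform_boundedness)
    fix F and x y :: ell2 and r :: real
    have toc_add: "toc (x + y) = (\<lambda>k. toc x k + toc y k)"
      by (auto simp: toc_def coord_plus add_divide_distrib)
    show "p F (x + y) \<le> p F x + p F y"
    proof (cases "finite F \<and> F \<subseteq> R")
      case True
      have "L2_set (\<lambda>n. sqrt (w n) * cmod (ctrans \<gamma> (toc (x + y)) (l n))) F
          \<le> L2_set (\<lambda>n. sqrt (w n) * cmod (ctrans \<gamma> (toc x) (l n)) + sqrt (w n) * cmod (ctrans \<gamma> (toc y) (l n))) F"
      proof (rule L2_set_mono)
        fix n assume "n \<in> F"
        hence "0 \<le> sqrt (w n)" using w True by auto
        thus "sqrt (w n) * cmod (ctrans \<gamma> (toc (x + y)) (l n)) \<le> sqrt (w n) * cmod (ctrans \<gamma> (toc x) (l n)) + sqrt (w n) * cmod (ctrans \<gamma> (toc y) (l n))"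
          unfolding toc_add ctrans_add[OF toc toc] distrib_left[symmetric] by (intro mult_left_mono norm_triangle_ineq)
        show "0 \<le> sqrt (w n) * cmod (ctrans \<gamma> (toc (x + y)) (l n))" using \<open>0 \<le> sqrt (w n)\<close> by simp
      qed
      also have "\<dots> \<le> p F x + p F y" using True L2_set_triangle_ineq by (simp add: p_def)
      finally show ?thesis using True by (simp add: p_def)
    next
      case False
      hence "p F z = 0" for z unfolding p_def by (rule if_not_P)
      thus ?thesis by simp
    qed
    have toc_scale: "toc (r *\<^sub>R x) = (\<lambda>k. of_real r * toc x k)"
      by (auto simp: toc_def coord_scaleR)
    show "p F (r *\<^sub>R x) = \<bar>r\<bar> * p F x"
    proof (cases "finite F \<and> F \<subseteq> R")
      case True
      have "(\<lambda>n. sqrt (w n) * cmod (ctrans \<gamma> (toc (r *\<^sub>R x)) (l n))) = (\<lambda>n. \<bar>r\<bar> * (sqrt (w n) * cmod (ctrans \<gamma> (toc x) (l n))))"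
        unfolding toc_scale ctrans_scale by (auto simp: norm_mult)
      thus ?thesis using True by (simp add: p_def L2_set_right_distrib)
    next
      case False
      hence "p F z = 0" for z unfolding p_def by (rule if_not_P)
      thus ?thesis by simp
    qed
    show "\<exists>K. \<forall>x. p F x \<le> K * norm x"
    proof (cases "finite F \<and> F \<subseteq> R")
      case True
      define k where "k n = (\<Sum>\<^sub>\<infinity>k\<in>C. inverse (u k) / (cmod (l n - \<gamma> k))^2)" for n
      have k0: "k n \<ge> 0" for n unfolding k_def by (intro infsum_nonneg) simp
      have "p F x \<le> (\<Sum>n\<in>F. sqrt (w n) * sqrt (k n)) * norm x" for x
      proof -
        have "p F x \<le> (\<Sum>n\<in>F. sqrt (w n) * cmod (ctrans \<gamma> (toc x) (l n)))"
          unfolding p_def using True w by (auto intro!: L2_set_le_sum)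
        also have "\<dots> \<le> (\<Sum>n\<in>F. sqrt (w n) * (sqrt (k n) * norm x))"
        proof (intro sum_mono mult_left_mono)
          fix n assume n: "n \<in> F"
          have "(cmod (ctrans \<gamma> (toc x) (l n)))^2 \<le> nsq u (toc x) * k n"
            unfolding k_def by (rule ctrans_sq_le[OF toc])
          also have "\<dots> \<le> (norm x)^2 * k n" using ntoc k0 by (intro mult_right_mono)
          also have "\<dots> = (sqrt (k n) * norm x)^2" using k0 by (simp add: power_mult_distrib mult.commute)
          finally show "cmod (ctrans \<gamma> (toc x) (l n)) \<le> sqrt (k n) * norm x"
            by (rule power2_le_imp_le) (use k0 in simp)
          show "0 \<le> sqrt (w n)" using w n True by auto
        qed
        finally show ?thesis by (simp add: sum_distrib_right mult.assoc)
      qed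
      thus ?thesis by blast
    next
      case False
      hence "p F z = 0" for z unfolding p_def by (rule if_not_P)
      thus ?thesis by (intro exI[of _ 0]) simp
    qed
  next
    fix x
    define S where "S = sqsum w R (\<lambda>n. ctrans \<gamma> (toc x) (l n))"
    have S0: "S \<ge> 0" unfolding S_def using w by (intro infsum_nonneg) simp
    have "p F x \<le> sqrt S" for F
    proof (cases "finite F \<and> F \<subseteq> R")
      case True
      have "(\<Sum>n\<in>F. (sqrt (w n) * cmod (ctrans \<gamma> (toc x) (l n)))^2) = (\<Sum>n\<in>F. (cmod (ctrans \<gamma> (toc x) (l n)))^2 * w n)"
        using True by (intro sum.cong sq) auto
      also have "\<dots> \<le> S" unfolding S_def
        using True w by (intro finite_sum_le_infsum[OF into[OF toc]]) auto
      finally show ?thesis using True by (simp add: p_def L2_set_def)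
    next
      case False
      hence "p F z = 0" for z unfolding p_def by (rule if_not_P)
      thus ?thesis using S0 by simp
    qed
    thus "\<exists>K. \<forall>F. p F x \<le> K" by blast
  qed
  then obtain K where K: "\<And>F x. p F x \<le> K * norm x" by blast
  have "sqsum w R (\<lambda>n. ctrans \<gamma> c (l n)) \<le> K^2 * nsq u c" if c: "c \<in> supp_space u C" for c
  proof -
    define x where "x = Ell2 (\<lambda>k. c k * of_real (sqrt (u k)))"
    have sqc: "(cmod (c k * of_real (sqrt (u k))))^2 = (cmod (c k))^2 * u k" for k
      by (simp add: norm_mult power_mult_distrib)
    have "(\<lambda>k. c k * of_real (sqrt (u k))) \<in> {x. (\<lambda>k. (cmod (x k))^2) summable_on UNIV}"
      unfolding mem_Collect_eq sqc by (rule supp_space_summable[OF c])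
    hence cx: "coord x = (\<lambda>k. c k * of_real (sqrt (u k)))" unfolding x_def by (rule Ell2_inverse)
    have tx: "toc x = c"
    proof
      fix k show "toc x k = c k" using supp_spaceD[OF c, of k] u_pos[of k] by (auto simp: toc_def cx)
    qed
    have nx: "(norm x)^2 = nsq u c" unfolding norm_ell2_sq cx sqc nsq_def ..
    show ?thesis
    proof (rule nonneg_bounded_summable(2))
      fix F assume F: "finite F" "F \<subseteq> R"
      have "(\<Sum>n\<in>F. (cmod (ctrans \<gamma> c (l n)))^2 * w n) = (\<Sum>n\<in>F. (sqrt (w n) * cmod (ctrans \<gamma> (toc x) (l n)))^2)"
        unfolding tx using F by (intro sum.cong sq[symmetric]) auto
      also have "\<dots> = (p F x)^2" using F by (simp add: p_def L2_set_def sum_nonneg)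
      also have "\<dots> \<le> (K * norm x)^2" using F by (intro power_mono K) (simp add: p_def)
      finally show "(\<Sum>n\<in>F. (cmod (ctrans \<gamma> c (l n)))^2 * w n) \<le> K^2 * nsq u c" by (simp add: power_mult_distrib nx)
    qed (use w in auto)
  qed
  thus ?thesis by (intro exI[of _ "K^2"]) auto
qed

lemma interp_sys_bounded_below:
  assumes "interp_sys \<gamma> u C R l w"
  obtains B where "B \<ge> 0" "\<And>c. c \<in> supp_space u C \<Longrightarrow> nsq u c \<le> B * sqsum w R (\<lambda>n. ctrans \<gamma> c (l n))"
proof -
  obtain B where B: "B \<ge> 0" "solvable \<gamma> u C R l w B"
    by (rule interp_sys_solve[OF assms]) (rule that; assumption)
  have "nsq u c \<le> B * sqsum w R (\<lambda>n. ctrans \<gamma> c (l n))" if c: "c \<in> supp_space u C" for c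
  proof -
    obtain e where e: "e \<in> supp_space u C" "\<And>n. n \<in> R \<Longrightarrow> ctrans \<gamma> e (l n) = ctrans \<gamma> c (l n)"
      "nsq u e \<le> B * sqsum w R (\<lambda>n. ctrans \<gamma> c (l n))"
      using B(2)[rule_format, OF interp_sysD(1)[OF assms c]] by blast
    have "(\<lambda>k. e k - c k) = (\<lambda>_. 0)"
      by (rule interp_sysD(2)[OF assms supp_space_diff[OF e(1) c]]) (simp add: ctrans_diff[OF e(1) c] e(2))
    hence "e k - c k = 0" for k by (rule fun_cong)
    hence "e = c" by (intro ext) simp
    thus ?thesis using e(3) by simp
  qed
  thus thesis using that B(1) by blast
qed

end

section \<open>Uniqueness for zeros asymptotic to the poles\<close>

context lacunary
begin

text \<open>By \<open>V_growth\<close> the quotient is at most a multiple of \<open>1 / g n\<close>,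
  which decays geometrically.\<close>

lemma ratio_decay: "\<exists>C>0. \<forall>n\<ge>N0. V n / (g n)^2 \<le> C * (1 / q) ^ n"
proof -
  define C where "C = V N0 / (g N0 * g N0) * q ^ N0"
  have gN: "g N0 > 0" using g_pos[of N0] N0(1) by simp
  have C: "C > 0" using V_pos[of N0] gN q by (simp add: C_def)
  have "V n / (g n)^2 \<le> C * (1 / q) ^ n" if n: "n \<ge> N0" for n
  proof -
    have gn: "g n > 0" using g_pos[of n] N0(1) n by simp
    have "V n / (g n)^2 = (V n * g N0) * (1 / (g N0 * (g n)^2))" using gN by simp
    also have "\<dots> \<le> (V N0 * g n) * (1 / (g N0 * (g n)^2))"
      using V_growth[OF order_refl n] gN gn by (intro mult_right_mono) auto
    also have "\<dots> = V N0 / g N0 * (1 / g n)" using gn by (simp add: power2_eq_square)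
    also have "\<dots> \<le> V N0 / g N0 * (1 / (q ^ (n - N0) * g N0))"
    proof (intro mult_left_mono divide_left_mono)
      show "q ^ (n - N0) * g N0 \<le> g n" by (rule g_growth) (use n N0(1) in auto)
    qed (use V_pos[of N0] gN gn q in auto)
    also have "\<dots> = C * (1 / q) ^ n"
    proof -
      have "q ^ n = q ^ (n - N0) * q ^ N0" using n by (simp add: power_add[symmetric])
      thus ?thesis using q gN by (simp add: C_def power_divide field_simps)
    qed
    finally show ?thesis .
  qed
  thus ?thesis using C by blast
qed

text \<open>The first \<open>N - 1\<close> zeros are moved onto the first \<open>N - 1\<close>
  poles, which removes those residues and multiplies the value at the origin by \<open>th N\<close>.
  The remaining residues sit at poles of index at least \<open>N\<close>, where the squared norm of
  the kernel at the origin decays like \<open>(1 / q) ^ N\<close>; since zeros and poles are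
  asymptotic, the multipliers lose less than that per step.\<close>

lemma zero_value:
  assumes minj: "inj_on \<mu> {1..}" and mne: "\<And>n k. n \<ge> 1 \<Longrightarrow> \<mu> n \<noteq> \<gamma> k"
    and close: "\<And>\<eta>. \<eta> > 0 \<Longrightarrow> \<exists>N. \<forall>n\<ge>N. cmod (\<mu> n - \<gamma> n) \<le> \<eta> * g n"
    and c: "c \<in> supp_space (col_weight v 1) {1..}" and z: "\<And>n. n \<ge> 1 \<Longrightarrow> ctrans \<gamma> c (\<mu> n) = 0"
  shows "ctrans \<gamma> c 0 = 0"
proof -
  define u where "u = col_weight v 1"
  interpret poles \<gamma> u unfolding u_def by (rule poles_axiom) simp
  have mnz: "\<mu> n \<noteq> 0" if "n \<ge> 1" for n using mne[OF that, of 0] by (simp add: gamma0)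
  have gnz: "\<gamma> k \<noteq> 0" if "k \<ge> 1" for k using g_pos[OF that] by auto
  define cN where "cN N k = (\<Prod>j=1..<N. (\<gamma> k - \<gamma> j) / (\<gamma> k - \<mu> j)) * c k" for N k
  define th where "th N = (\<Prod>j=1..<N. \<gamma> j / \<mu> j)" for N
  have cNS: "cN (Suc N) = (\<lambda>k. (\<gamma> k - \<gamma> N) / (\<gamma> k - \<mu> N) * cN N k)" if "N \<ge> 1" for N
    using that by (intro ext) (simp add: cN_def mult_ac)
  have main: "cN N \<in> supp_space u {N..} \<and> (\<forall>n\<ge>N. ctrans \<gamma> (cN N) (\<mu> n) = 0) \<and> ctrans \<gamma> (cN N) 0 = ctrans \<gamma> c 0 * th N" if "N \<ge> 1" for N
    using that
  proof (induction N rule: dec_induct)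
    case base
    have "cN 1 = c" by (simp add: cN_def fun_eq_iff)
    thus ?case using c z by (simp add: u_def th_def)
  next
    case (step N)
    have N: "N \<ge> 1" using step by simp
    have cN: "cN N \<in> supp_space u {N..}" and zN: "\<And>n. n \<ge> N \<Longrightarrow> ctrans \<gamma> (cN N) (\<mu> n) = 0"
      and vN: "ctrans \<gamma> (cN N) 0 = ctrans \<gamma> c 0 * th N" using step by auto
    have mob: "ctrans \<gamma> (cN (Suc N)) x = (x - \<gamma> N) * ctrans \<gamma> (cN N) x / (x - \<mu> N)"
      if x: "x \<noteq> \<mu> N" "\<And>k. k \<ge> 1 \<Longrightarrow> \<gamma> k \<noteq> x" for x
    proof -
      have gm: "\<gamma> k \<noteq> \<mu> N" for k using mne[OF N, of k] by simp
      have "ctrans \<gamma> (\<lambda>k. (\<gamma> k - \<gamma> N) / (\<gamma> k - \<mu> N) * cN N k) x =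
          ((x - \<gamma> N) * ctrans \<gamma> (cN N) x - (\<mu> N - \<gamma> N) * ctrans \<gamma> (cN N) (\<mu> N)) / (x - \<mu> N)"
        by (rule ctrans_mobius[OF cN]) (use x gm N in auto)
      thus ?thesis unfolding cNS[OF N] using zN[of N] by simp
    qed
    have "cN (Suc N) \<in> supp_space u {N..}" unfolding cNS[OF N] by (rule mobius_supp_space[OF cN])
    hence 1: "cN (Suc N) \<in> supp_space u {Suc N..}"
    proof (rule supp_space_restrict)
      show "cN (Suc N) k = 0" if "k \<notin> {Suc N..}" for k
        using that supp_spaceD[OF cN, of k] by (cases "k = N") (auto simp: cNS[OF N])
    qed
    have 2: "ctrans \<gamma> (cN (Suc N)) (\<mu> n) = 0" if n: "n \<ge> Suc N" for n
    proof -
      have "\<mu> n \<noteq> \<mu> N" using inj_onD[OF minj, of n N] n N by auto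
      moreover have "\<gamma> k \<noteq> \<mu> n" for k using mne[of n k] n by simp
      ultimately show ?thesis using mob[of "\<mu> n"] zN[of n] n by simp
    qed
    have 3: "ctrans \<gamma> (cN (Suc N)) 0 = ctrans \<gamma> c 0 * th (Suc N)"
      using mob[of 0] mnz[OF N] gnz N by (simp add: vN th_def mult_ac)
    show ?case using 1 2 3 by blast
  qed
  \<comment> \<open>Loss allowed per step. The norm of the residues and the value at the origin each
    lose \<open>\<tau>^2\<close> in square, together \<open>\<tau>^4 = sqrt q\<close>, which is less
    than the gain \<open>q\<close> of the kernel.\<close>
  define \<tau> where "\<tau> = sqrt (sqrt (sqrt q))"
  have tau: "\<tau> > 1" using q by (simp add: \<tau>_def)
  have tau4: "\<tau> ^ 4 = sqrt q"
  proof -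
    have "\<tau> ^ 4 = (\<tau>^2)^2" by simp
    also have "\<tau>^2 = sqrt (sqrt q)" using q by (simp add: \<tau>_def)
    also have "(sqrt (sqrt q))^2 = sqrt q" using q by simp
    finally show ?thesis .
  qed
  \<comment> \<open>The first bound keeps \<open>cmod (\<mu> N)\<close> at most
    \<open>\<tau> * g N\<close>; the second keeps \<open>\<gamma> k - \<mu> j\<close> away from 0
    and the multiplier at most \<open>\<tau>\<close>.\<close>
  define \<eta> where "\<eta> = min (\<tau> - 1) ((q - 1) / 2 * min 1 (\<tau> - 1))"
  have eta: "\<eta> > 0" "\<eta> \<le> \<tau> - 1" "\<eta> \<le> (q - 1) / 2" "\<eta> \<le> (q - 1) / 2 * (\<tau> - 1)"
  proof -
    show "\<eta> > 0" using tau q by (simp add: \<eta>_def)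
    show "\<eta> \<le> \<tau> - 1" by (simp add: \<eta>_def)
    have "(q - 1) / 2 * min 1 (\<tau> - 1) \<le> (q - 1) / 2 * 1" using q by (intro mult_left_mono) auto
    thus "\<eta> \<le> (q - 1) / 2" using min.cobounded2[of "\<tau> - 1" "(q - 1) / 2 * min 1 (\<tau> - 1)"] unfolding \<eta>_def by linarith
    have "(q - 1) / 2 * min 1 (\<tau> - 1) \<le> (q - 1) / 2 * (\<tau> - 1)" using q by (intro mult_left_mono) auto
    thus "\<eta> \<le> (q - 1) / 2 * (\<tau> - 1)" unfolding \<eta>_def by (rule order_trans[OF min.cobounded2])
  qed
  obtain J1 where J1: "\<And>n. n \<ge> J1 \<Longrightarrow> cmod (\<mu> n - \<gamma> n) \<le> \<eta> * g n" using close[OF eta(1)] by blast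
  define J where "J = max J1 (Suc N0)"
  have J: "J \<ge> 1" "J > N0" "\<And>n. n \<ge> J \<Longrightarrow> cmod (\<mu> n - \<gamma> n) \<le> \<eta> * g n" using J1 N0(1) by (auto simp: J_def)
  have fac: "cmod ((\<gamma> k - \<gamma> j) / (\<gamma> k - \<mu> j)) \<le> \<tau>" if j: "j \<ge> J" "k > j" for j k
  proof -
    have gj: "g j > 0" using g_pos[of j] J j by simp
    have gk: "q * g j \<le> g k" using g_strict[of j k] J j by simp
    have dm: "cmod (\<mu> j - \<gamma> j) \<le> \<eta> * g j" using J(3) j by simp
    have "\<eta> * g j \<le> (q - 1) / 2 * g j" using eta gj by (intro mult_right_mono) auto
    moreover have "g k - g j - cmod (\<mu> j - \<gamma> j) \<le> cmod (\<gamma> k - \<mu> j)"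
    proof -
      have "g k - cmod (\<mu> j) \<le> cmod (\<gamma> k - \<mu> j)" by (rule norm_triangle_ineq2)
      moreover have "cmod (\<mu> j) \<le> g j + cmod (\<mu> j - \<gamma> j)" using norm_triangle_sub[of "\<mu> j" "\<gamma> j"] by simp
      ultimately show ?thesis by linarith
    qed
    moreover have "q * g j - g j - (q - 1) / 2 * g j = (q - 1) / 2 * g j" by (simp add: field_simps)
    ultimately have low: "(q - 1) / 2 * g j \<le> cmod (\<gamma> k - \<mu> j)" using dm gk by linarith
    have pos: "0 < (q - 1) / 2 * g j" using q gj by simp
    have nz: "\<gamma> k - \<mu> j \<noteq> 0" using low pos by auto
    have "(\<gamma> k - \<gamma> j) / (\<gamma> k - \<mu> j) = 1 + (\<mu> j - \<gamma> j) / (\<gamma> k - \<mu> j)"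
      using nz by (simp add: field_simps)
    hence "cmod ((\<gamma> k - \<gamma> j) / (\<gamma> k - \<mu> j)) \<le> 1 + cmod (\<mu> j - \<gamma> j) / cmod (\<gamma> k - \<mu> j)"
      by (metis norm_divide norm_one norm_triangle_ineq)
    also have "cmod (\<mu> j - \<gamma> j) / cmod (\<gamma> k - \<mu> j) \<le> (\<eta> * g j) / ((q - 1) / 2 * g j)"
      using dm low pos eta gj by (intro frac_le) auto
    also have "\<dots> \<le> \<tau> - 1"
    proof -
      have "\<eta> * g j \<le> (q - 1) / 2 * (\<tau> - 1) * g j" using eta(4) gj by (intro mult_right_mono) auto
      also have "\<dots> = (\<tau> - 1) * ((q - 1) / 2 * g j)" by simp
      finally show ?thesis using pos by (simp only: pos_divide_le_eq)
    qed
    finally show ?thesis by simp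
  qed
  have growth: "nsq u (cN N) \<le> (\<tau>^2) ^ (N - J) * nsq u (cN J)" if "N \<ge> J" for N
    using that
  proof (induction N rule: dec_induct)
    case (step N)
    have N: "N \<ge> 1" using step J by simp
    \<comment> \<open>The estimate of the multiplier holds beyond \<open>N\<close>; at the other
      indices the residues of \<open>cN (Suc N)\<close> vanish, so the value 0 may be used
      there.\<close>
    define m where "m k = (if k > N then (\<gamma> k - \<gamma> N) / (\<gamma> k - \<mu> N) else 0)" for k
    have e: "cN (Suc N) = (\<lambda>k. m k * cN N k)"
    proof
      fix k
      show "cN (Suc N) k = m k * cN N k"
        using main[OF N] supp_spaceD[of "cN N" u "{N..}" k] by (cases "k = N") (auto simp: cNS[OF N] m_def)
    qed
    have "cmod (m k) \<le> \<tau>" for k using fac[of N k] step tau by (simp add: m_def)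
    hence "nsq u (cN (Suc N)) \<le> \<tau>^2 * nsq u (cN N)"
      unfolding e using main[OF N] by (intro supp_space_mult(2)) auto
    also have "\<dots> \<le> \<tau>^2 * ((\<tau>^2) ^ (N - J) * nsq u (cN J))" using step by (intro mult_left_mono) auto
    finally show ?case using step by (simp add: Suc_diff_le)
  qed simp
  have thn: "th N \<noteq> 0" if "N \<ge> 1" for N unfolding th_def using gnz mnz by (subst prod_zero_iff) auto
  have thg: "cmod (th J) \<le> \<tau> ^ (N - J) * cmod (th N)" if "N \<ge> J" for N
    using that
  proof (induction N rule: dec_induct)
    case (step N)
    have N: "N \<ge> 1" using step J by simp
    have gN: "g N > 0" using g_pos[OF N] .
    have mN: "cmod (\<mu> N) > 0" using mnz[OF N] by simp
    have "cmod (\<mu> N) \<le> g N + cmod (\<mu> N - \<gamma> N)" using norm_triangle_sub[of "\<mu> N" "\<gamma> N"] by simp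
    also have "\<dots> \<le> g N + \<eta> * g N" using J(3)[of N] step by simp
    also have "\<dots> \<le> g N + (\<tau> - 1) * g N" using eta(2) gN by (intro add_left_mono mult_right_mono) auto
    also have "\<dots> = \<tau> * g N" by (simp add: algebra_simps)
    finally have "1 \<le> \<tau> * (g N / cmod (\<mu> N))" using mN by (simp add: le_divide_eq)
    hence "cmod (th N) * 1 \<le> cmod (th N) * (\<tau> * (g N / cmod (\<mu> N)))" by (intro mult_left_mono) auto
    also have "\<dots> = \<tau> * cmod (th (Suc N))" using N by (simp add: th_def norm_mult norm_divide prod_norm[symmetric])
    finally have "cmod (th N) \<le> \<tau> * cmod (th (Suc N))" by simp
    hence "\<tau> ^ (N - J) * cmod (th N) \<le> \<tau> ^ (N - J) * (\<tau> * cmod (th (Suc N)))" using tau by (intro mult_left_mono) auto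
    thus ?case using step by (simp add: Suc_diff_le mult_ac)
  qed simp
  obtain CR where CR: "CR > 0" "\<And>n. n \<ge> N0 \<Longrightarrow> V n / (g n)^2 \<le> CR * (1 / q) ^ n" using ratio_decay by blast
  define A where "A = nsq u (cN J) / (cmod (th J))^2 * ((q / (q - 1)) * CR * (1 / q) ^ J)"
  have bound: "(cmod (ctrans \<gamma> c 0))^2 \<le> A * (sqrt q / q) ^ i" for i
  proof -
    define N where "N = J + i"
    have N: "N \<ge> J" "N \<ge> 1" "N - 1 \<ge> N0" "N > N0" "N \<ge> 2" using J N0(1) by (auto simp: N_def)
    have eq: "{N..} = {N - 1<..}" using N by auto
    have "(\<Sum>\<^sub>\<infinity>k\<in>{N..}. inverse (u k) / (cmod (0 - \<gamma> k))^2) = Pseq \<gamma> v (N - 1)"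
      unfolding Pseq_def eq by (rule infsum_cong) (auto simp: u_def col_weight_def)
    also have "\<dots> \<le> 1 * (q / (q - 1)) * (V (Suc (N - 1)) / (g (Suc (N - 1)))^2)"
      by (rule P_le) (use N N0(2) in auto)
    also have "\<dots> \<le> 1 * (q / (q - 1)) * (CR * (1 / q) ^ N)"
      using CR(2)[of N] N q by (intro mult_left_mono) auto
    finally have Pb: "(\<Sum>\<^sub>\<infinity>k\<in>{N..}. inverse (u k) / (cmod (0 - \<gamma> k))^2) \<le> (q / (q - 1)) * (CR * (1 / q) ^ N)" by simp
    have P0: "0 \<le> (\<Sum>\<^sub>\<infinity>k\<in>{N..}. inverse (u k) / (cmod (0 - \<gamma> k))^2)" by (intro infsum_nonneg) auto
    have "(cmod (ctrans \<gamma> c 0 * th N))^2 \<le> nsq u (cN N) * (\<Sum>\<^sub>\<infinity>k\<in>{N..}. inverse (u k) / (cmod (0 - \<gamma> k))^2)"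
      using ctrans_sq_le[of "cN N" "{N..}" 0] main[OF N(2)] by simp
    also have "\<dots> \<le> ((\<tau>^2) ^ i * nsq u (cN J)) * ((q / (q - 1)) * (CR * (1 / q) ^ N))"
      using growth[OF N(1)] Pb P0 by (intro mult_mono) (auto simp: N_def)
    finally have 1: "(cmod (ctrans \<gamma> c 0))^2 * (cmod (th N))^2 \<le> ((\<tau>^2) ^ i * nsq u (cN J)) * ((q / (q - 1)) * (CR * (1 / q) ^ N))"
      by (simp add: norm_mult power_mult_distrib)
    have "(cmod (th J))^2 \<le> (\<tau> ^ i * cmod (th N))^2" using thg[OF N(1)] by (intro power_mono) (auto simp: N_def)
    hence 2: "(cmod (th J))^2 \<le> (\<tau>^2) ^ i * (cmod (th N))^2" by (simp add: power_mult_distrib power_mult[symmetric] mult.commute)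
    have "(cmod (ctrans \<gamma> c 0))^2 * (cmod (th J))^2 \<le> (cmod (ctrans \<gamma> c 0))^2 * ((\<tau>^2) ^ i * (cmod (th N))^2)"
      using 2 by (intro mult_left_mono) auto
    also have "\<dots> = (\<tau>^2) ^ i * ((cmod (ctrans \<gamma> c 0))^2 * (cmod (th N))^2)" by simp
    also have "\<dots> \<le> (\<tau>^2) ^ i * (((\<tau>^2) ^ i * nsq u (cN J)) * ((q / (q - 1)) * (CR * (1 / q) ^ N)))"
      using 1 by (intro mult_left_mono) auto
    also have "\<dots> = nsq u (cN J) * ((q / (q - 1)) * CR * (1 / q) ^ J) * (((\<tau>^2) ^ i * (\<tau>^2) ^ i) * (1 / q) ^ i)"
      by (simp add: N_def power_add)
    also have "((\<tau>^2) ^ i * (\<tau>^2) ^ i) * (1 / q) ^ i = (sqrt q / q) ^ i"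
    proof -
      have "\<tau>^2 * \<tau>^2 = sqrt q" using tau4 by (simp add: power2_eq_square power4_eq_xxxx mult.assoc)
      thus ?thesis by (simp add: power_mult_distrib[symmetric])
    qed
    finally have "(cmod (ctrans \<gamma> c 0))^2 * (cmod (th J))^2 \<le> nsq u (cN J) * ((q / (q - 1)) * CR * (1 / q) ^ J) * (sqrt q / q) ^ i" .
    moreover have "(cmod (th J))^2 > 0" using thn[OF J(1)] by simp
    ultimately have "(cmod (ctrans \<gamma> c 0))^2 \<le> nsq u (cN J) * ((q / (q - 1)) * CR * (1 / q) ^ J) * (sqrt q / q) ^ i / (cmod (th J))^2"
      by (simp only: pos_le_divide_eq)
    thus ?thesis by (simp add: A_def mult_ac)
  qed
  have lt: "sqrt q / q < 1"
  proof -
    have "sqrt q < q" using q real_sqrt_less_mono[of q "q * q"] by (simp add: real_sqrt_mult_self)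
    thus ?thesis using q by simp
  qed
  have "(\<lambda>i. A * (sqrt q / q) ^ i) \<longlonglongrightarrow> A * 0"
    using q lt by (intro tendsto_mult tendsto_const LIMSEQ_power_zero) auto
  hence "(cmod (ctrans \<gamma> c 0))^2 \<le> 0"
    using bound LIMSEQ_le_const[of "\<lambda>i. A * (sqrt q / q) ^ i" 0 "(cmod (ctrans \<gamma> c 0))^2"] by auto
  thus ?thesis by simp
qed

text \<open>Zeros asymptotic to the poles, one for each pole, form a uniqueness set: dividing by
  \<open>z\<close> again and again makes all the moments of the residues at the points \<open>1/\<gamma>\<close> vanish.\<close>

theorem uniqueness_exact:
  assumes minj: "inj_on \<mu> {1..}" and mne: "\<And>n k. n \<ge> 1 \<Longrightarrow> \<mu> n \<noteq> \<gamma> k"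
    and close: "\<And>\<eta>. \<eta> > 0 \<Longrightarrow> \<exists>N. \<forall>n\<ge>N. cmod (\<mu> n - \<gamma> n) \<le> \<eta> * g n"
    and c: "c \<in> supp_space (col_weight v 1) {1..}" and z: "\<And>n. n \<ge> 1 \<Longrightarrow> ctrans \<gamma> c (\<mu> n) = 0"
  shows "c = (\<lambda>_. 0)"
proof (rule ccontr)
  assume nz: "c \<noteq> (\<lambda>_. 0)"
  define u where "u = col_weight v 1"
  interpret poles \<gamma> u unfolding u_def by (rule poles_axiom) simp
  have mnz: "\<mu> n \<noteq> 0" if "n \<ge> 1" for n using mne[OF that, of 0] by (simp add: gamma0)
  have gnz: "\<gamma> k \<noteq> 0" if "k \<ge> 1" for k using g_pos[OF that] by auto
  \<comment> \<open>Residues of the transform after \<open>j\<close> divisions by \<open>z\<close>;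
    each division is admissible because the value at the origin has just been shown to
    vanish.\<close>
  define cj where "cj j k = c k / \<gamma> k ^ j" for j k
  have c0: "c 0 = 0" using supp_spaceD[OF c, of 0] by simp
  have Z: "cj j \<in> supp_space u {1..} \<and> (\<forall>n\<ge>1. ctrans \<gamma> (cj j) (\<mu> n) = 0)" for j
  proof (induction j)
    case 0
    thus ?case using c z by (simp add: cj_def u_def)
  next
    case (Suc j)
    have s: "cj j \<in> supp_space u {1..}" using Suc by simp
    have v0: "ctrans \<gamma> (cj j) 0 = 0"
      by (rule zero_value[OF minj mne close]) (use Suc in \<open>auto simp: u_def\<close>)
    \<comment> \<open>The multiplier is \<open>1 - 1 / \<gamma> k\<close>, so subtracting
      \<open>mb\<close> from \<open>cj j\<close> leaves the division by \<open>\<gamma> k\<close>.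
      The target 1 of the moved zero is an arbitrary choice.\<close>
    define mb where "mb k = (\<gamma> k - 1) / (\<gamma> k - 0) * cj j k" for k
    have mb: "mb \<in> supp_space u {1..}" unfolding mb_def by (rule mobius_supp_space[OF s])
    have e: "cj (Suc j) = (\<lambda>k. cj j k - mb k)"
    proof
      fix k show "cj (Suc j) k = cj j k - mb k"
      proof (cases "k = 0")
        case True thus ?thesis by (simp add: cj_def mb_def c0)
      next
        case False
        hence "\<gamma> k \<noteq> 0" using gnz by simp
        thus ?thesis by (simp add: cj_def mb_def field_simps)
      qed
    qed
    have "ctrans \<gamma> mb (\<mu> n) = 0" if n: "n \<ge> 1" for n
    proof -
      have "\<gamma> k \<noteq> \<mu> n" for k using mne[OF n, of k] by simp
      hence "ctrans \<gamma> mb (\<mu> n) = ((\<mu> n - 1) * ctrans \<gamma> (cj j) (\<mu> n) - (0 - 1) * ctrans \<gamma> (cj j) 0) / (\<mu> n - 0)"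
        unfolding mb_def using mnz[OF n] gnz by (intro ctrans_mobius[OF s]) auto
      thus ?thesis using Suc v0 n by simp
    qed
    moreover have "(\<lambda>k. cj j k - mb k) \<in> supp_space u {1..}" by (rule supp_space_diff[OF s mb])
    ultimately show ?case using Suc.IH unfolding e ctrans_diff[OF s mb] by auto
  qed
  have mom: "ctrans \<gamma> (cj j) 0 = 0" for j
    by (rule zero_value[OF minj mne close]) (use Z[of j] in \<open>auto simp: u_def\<close>)
  define k0 where "k0 = (LEAST k. c k \<noteq> 0)"
  have "\<exists>k. c k \<noteq> 0" using nz by auto
  hence k0: "c k0 \<noteq> 0" unfolding k0_def by (rule LeastI_ex)
  have k0l: "c k = 0" if "k < k0" for k using not_less_Least[of k "\<lambda>k. c k \<noteq> 0"] that by (auto simp: k0_def)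
  have k1: "k0 \<ge> 1" using k0 c0 by (cases k0) auto
  define A where "A = (\<Sum>\<^sub>\<infinity>k. cmod (c k / (0 - \<gamma> k)))"
  have As: "(\<lambda>k. cmod (c k / (0 - \<gamma> k))) summable_on UNIV"
    by (rule ctrans_abs_summable) (use c in \<open>simp add: u_def\<close>)
  \<comment> \<open>In a vanishing moment the first nonzero residue has to balance all later ones,
    whose weights \<open>1 / \<gamma> k ^ j\<close> are smaller by at least the factor
    \<open>(1 / q) ^ j\<close>.\<close>
  have bound: "cmod (c k0 / \<gamma> k0) \<le> A * (1 / q) ^ j" for j
  proof -
    define f where "f k = \<gamma> k0 ^ j * (cj j k / (0 - \<gamma> k))" for k
    have fs: "f summable_on UNIV" unfolding f_def by (intro summable_on_cmult_right ctrans_summable) (use Z in blast)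
    have f0: "infsum f UNIV = 0"
      unfolding f_def infsum_cmult_right' using mom[of j] by (simp add: ctrans_def)
    have fs': "f summable_on - {k0}" by (rule summable_on_subset_banach[OF fs]) simp
    have insert_UNIV_k0: "insert k0 (- {k0}) = UNIV" by auto
    have "infsum f UNIV = f k0 + infsum f (- {k0})"
      using infsum_insert[OF fs', of k0] insert_UNIV_k0 by simp
    hence e: "f k0 = - infsum f (- {k0})" using f0 by (simp add: eq_neg_iff_add_eq_0)
    have fle: "cmod (f k) \<le> cmod (c k / (0 - \<gamma> k)) * (1 / q) ^ j" if "k \<noteq> k0" for k
    proof (cases "k < k0")
      case True thus ?thesis by (simp add: f_def cj_def k0l)
    next
      case False
      hence k: "k > k0" using that by simp
      hence gk: "g k > 0" "q * g k0 \<le> g k" using k1 g_pos g_strict by auto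
      hence "g k0 / g k \<le> 1 / q" using q by (simp add: field_simps)
      hence "(g k0 / g k) ^ j \<le> (1 / q) ^ j" by (intro power_mono) auto
      hence "cmod (c k / (0 - \<gamma> k)) * (g k0 / g k) ^ j \<le> cmod (c k / (0 - \<gamma> k)) * (1 / q) ^ j"
        by (intro mult_left_mono) auto
      moreover have "cmod (f k) = cmod (c k / (0 - \<gamma> k)) * (g k0 / g k) ^ j"
        by (simp add: f_def cj_def norm_mult norm_divide norm_power power_divide mult_ac)
      ultimately show ?thesis by simp
    qed
    have s1: "(\<lambda>k. cmod (c k / (0 - \<gamma> k)) * (1 / q) ^ j) summable_on - {k0}"
      by (intro summable_on_cmult_left summable_on_subset_banach[OF As]) simp
    have s2: "(\<lambda>k. cmod (f k)) summable_on - {k0}"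
      by (rule summable_on_comparison_test[OF s1]) (use fle in auto)
    have "cmod (f k0) \<le> (\<Sum>\<^sub>\<infinity>k\<in>- {k0}. cmod (f k))"
      unfolding e norm_minus_cancel by (rule norm_infsum_bound[OF s2])
    also have "\<dots> \<le> (\<Sum>\<^sub>\<infinity>k\<in>- {k0}. cmod (c k / (0 - \<gamma> k)) * (1 / q) ^ j)"
      by (rule infsum_mono[OF s2 s1]) (use fle in auto)
    also have "\<dots> = (\<Sum>\<^sub>\<infinity>k\<in>- {k0}. cmod (c k / (0 - \<gamma> k))) * (1 / q) ^ j" by (rule infsum_cmult_left')
    also have "\<dots> \<le> A * (1 / q) ^ j"
      unfolding A_def using q by (intro mult_right_mono infsum_mono2[OF summable_on_subset_banach[OF As] As]) auto
    finally show ?thesis using gnz[OF k1] by (simp add: f_def cj_def norm_mult norm_divide norm_power)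
  qed
  have "(\<lambda>j. A * (1 / q) ^ j) \<longlonglongrightarrow> A * 0"
    using q by (intro tendsto_mult tendsto_const LIMSEQ_power_zero) auto
  hence "cmod (c k0 / \<gamma> k0) \<le> 0"
    using bound LIMSEQ_le_const[of "\<lambda>j. A * (1 / q) ^ j" 0 "cmod (c k0 / \<gamma> k0)"] by auto
  thus False using k0 gnz[OF k1] by simp
qed

end

subsection \<open>Where the rows of an invertible system lie\<close>

lemma finite_supp:
  assumes A: "finite A" and c: "\<And>k. k \<notin> A \<Longrightarrow> c k = 0"
  shows "c \<in> supp_space u A" "nsq u c = (\<Sum>k\<in>A. (cmod (c k))^2 * u k)"
    "ctrans \<gamma> c z = (\<Sum>k\<in>A. c k / (z - \<gamma> k))"
proof -
  have s: "((\<lambda>k. (cmod (c k))^2 * u k) has_sum (\<Sum>k\<in>A. (cmod (c k))^2 * u k)) UNIV"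
    by (rule has_sum_finite_neutralI[OF A]) (use c in auto)
  thus "c \<in> supp_space u A" using c by (auto simp: supp_space_def summable_on_def)
  show "nsq u c = (\<Sum>k\<in>A. (cmod (c k))^2 * u k)" unfolding nsq_def by (rule infsumI[OF s])
  have "((\<lambda>k. c k / (z - \<gamma> k)) has_sum (\<Sum>k\<in>A. c k / (z - \<gamma> k))) UNIV"
    by (rule has_sum_finite_neutralI[OF A]) (use c in auto)
  thus "ctrans \<gamma> c z = (\<Sum>k\<in>A. c k / (z - \<gamma> k))" unfolding ctrans_def by (rule infsumI)
qed

context lacunary
begin

text \<open>Squared norm of evaluation at \<open>z\<close> as a functional on residues with weight
  \<open>1 / v\<close>, for \<open>z\<close> off the poles; the Bessel weight is its reciprocal at
  the row.\<close>

definition ker :: "complex \<Rightarrow> real" where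
  "ker z = (\<Sum>\<^sub>\<infinity>k\<in>{1..}. v k / (cmod (z - \<gamma> k))^2)"

lemma ker_summable: "(\<lambda>k. v k / (cmod (z - \<gamma> k))^2) summable_on {1..}"
proof -
  interpret poles \<gamma> "col_weight v 1" by (rule poles_axiom) simp
  have "(\<lambda>k. inverse (col_weight v 1 k) / (cmod (z - \<gamma> k))^2) summable_on {1..}"
    by (rule summable_on_subset_banach[OF kernel_summable]) simp
  thus ?thesis by (rule summable_on_cong[THEN iffD1, rotated]) (simp add: col_weight_def)
qed

lemma v_nonneg: "k \<ge> 1 \<Longrightarrow> 0 \<le> v k" using v_pos[of k] by simp

lemma ker_ge: "k \<ge> 1 \<Longrightarrow> v k / (cmod (z - \<gamma> k))^2 \<le> ker z"
  using finite_sum_le_infsum[OF ker_summable[of z], of "{k}"] v_nonneg by (simp add: ker_def)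

lemma ker_pos: "z \<noteq> \<gamma> 1 \<Longrightarrow> ker z > 0"
proof -
  assume "z \<noteq> \<gamma> 1"
  hence "0 < v 1 / (cmod (z - \<gamma> 1))^2" using v_pos[of 1] by simp
  also have "\<dots> \<le> ker z" by (rule ker_ge) simp
  finally show ?thesis .
qed

lemma DsetD:
  assumes "z \<in> Dset \<gamma> v M n" "n \<ge> 2"
  shows "z \<in> Omega \<gamma> n" "V n * (cmod (z - \<gamma> n))^2 \<le> M * (v n * (cmod z)^2)"
    "Pseq \<gamma> v n * (cmod (z - \<gamma> n))^2 \<le> M * v n" "z \<noteq> \<gamma> n" "M > 0"
proof -
  show Om: "z \<in> Omega \<gamma> n" using assms by (simp add: Dset_def)
  have vn: "v n > 0" using v_pos assms by simp
  have "g n > 0" using g_pos assms by simp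
  moreover have "(g (n - 1) + g n) / 2 \<le> cmod z" using OmegaD(1)[OF Om assms(2)] .
  moreover have "0 < (g (n - 1) + g n) / 2" using calculation(1) by (simp add: add_nonneg_pos)
  ultimately have z: "cmod z > 0" by (metis less_le_trans)
  have a: "V n / (cmod z)^2 \<le> M * v n / (cmod (z - \<gamma> n))^2" "Pseq \<gamma> v n \<le> M * v n / (cmod (z - \<gamma> n))^2"
    using assms by (auto simp: Dset_def)
  have "0 < V n / (cmod z)^2" using V_pos[of n] z by simp
  hence b: "0 < M * v n / (cmod (z - \<gamma> n))^2" using a(1) by linarith
  thus ne: "z \<noteq> \<gamma> n" by auto
  hence d: "0 < (cmod (z - \<gamma> n))^2" by simp
  show "M > 0" using b d vn by (simp add: zero_less_divide_iff zero_less_mult_iff)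
  show "V n * (cmod (z - \<gamma> n))^2 \<le> M * (v n * (cmod z)^2)"
    using a(1) d z by (simp add: divide_le_eq pos_le_divide_eq mult_ac)
  show "Pseq \<gamma> v n * (cmod (z - \<gamma> n))^2 \<le> M * v n"
    using a(2) d by (simp add: pos_le_divide_eq)
qed

text \<open>Membership gives \<open>V n * d^2 \<le> M * v n * (cmod z)^2\<close> for the distance
  \<open>d\<close> to the pole, and smallness of \<open>v n / V n\<close> makes
  \<open>d / cmod z\<close> small.\<close>

lemma Dset_close:
  assumes "\<eta> > 0"
  shows "\<exists>N\<ge>2. \<forall>n\<ge>N. \<forall>z\<in>Dset \<gamma> v M n. cmod (z - \<gamma> n) \<le> \<eta> * g n"
proof -
  define e where "e = min \<eta> 1 / 2"
  have e: "0 < e" "e \<le> 1 / 2" "2 * e \<le> \<eta>" using assms by (auto simp: e_def)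
  have "e^2 / (\<bar>M\<bar> + 1) > 0" using e by simp
  then obtain N where N: "N \<ge> N0" "\<And>k. k \<ge> N \<Longrightarrow> v k \<le> e^2 / (\<bar>M\<bar> + 1) * V k"
    using v_eventually_small by blast
  have "cmod (z - \<gamma> n) \<le> \<eta> * g n" if n: "n \<ge> N" and z: "z \<in> Dset \<gamma> v M n" for n z
  proof -
    have n2: "n \<ge> 2" using n N N0(1) by linarith
    note D = DsetD[OF z n2]
    have "M * v n \<le> (\<bar>M\<bar> + 1) * v n" using v_nonneg[of n] n2 by (intro mult_right_mono) auto
    also have "\<dots> \<le> (\<bar>M\<bar> + 1) * (e^2 / (\<bar>M\<bar> + 1) * V n)" using N(2)[OF n] by (intro mult_left_mono) auto
    also have "\<dots> = e^2 * V n" by (simp add: field_simps add_nonneg_eq_0_iff)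
    finally have "M * v n * (cmod z)^2 \<le> e^2 * V n * (cmod z)^2" by (intro mult_right_mono) auto
    hence "V n * (cmod (z - \<gamma> n))^2 \<le> V n * (e * cmod z)^2" using D(2) by (simp add: power_mult_distrib mult_ac)
    hence "(cmod (z - \<gamma> n))^2 \<le> (e * cmod z)^2" using V_pos[of n] by simp
    hence 1: "cmod (z - \<gamma> n) \<le> e * cmod z" by (rule power2_le_imp_le) (use e in auto)
    have "cmod z \<le> g n + cmod (z - \<gamma> n)" using norm_triangle_sub[of z "\<gamma> n"] by simp
    hence "e * cmod z \<le> e * (g n + cmod (z - \<gamma> n))" using e by (intro mult_left_mono) auto
    moreover have "e * cmod (z - \<gamma> n) \<le> 1 / 2 * cmod (z - \<gamma> n)" using e by (intro mult_right_mono) auto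
    ultimately have "cmod (z - \<gamma> n) \<le> (2 * e) * g n" using 1 by (simp add: distrib_left)
    also have "\<dots> \<le> \<eta> * g n" using e by (intro mult_right_mono) auto
    finally show ?thesis .
  qed
  thus ?thesis using N N0(1) by (intro exI[of _ N]) auto
qed

end

text \<open>\<open>z / (z - a)\<close> is the reciprocal of \<open>1 - a / z\<close>, and inversion
  maps the disc of radius 1 about 1 onto the half-plane of real part greater than 1/2.\<close>

lemma Re_pole_ge:
  assumes "cmod a < cmod z"
  shows "1 / 2 \<le> Re (z / (z - a))"
proof -
  have ne: "z - a \<noteq> 0" using assms by auto
  have "(cmod (z - a))^2 \<le> 2 * Re (z * cnj (z - a))"
  proof -
    have "(cmod (z - a))^2 = (cmod z)^2 - 2 * Re (z * cnj a) + (cmod a)^2"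
      by (simp add: cmod_power2 power2_diff algebra_simps)
    moreover have "Re (z * cnj (z - a)) = (cmod z)^2 - Re (z * cnj a)"
      unfolding cmod_power2 by (simp add: power2_eq_square algebra_simps)
    moreover have "(cmod a)^2 \<le> (cmod z)^2" using assms by (intro power_mono) auto
    ultimately show ?thesis by linarith
  qed
  moreover have "Re (z / (z - a)) = Re (z * cnj (z - a)) / (cmod (z - a))^2"
    unfolding complex_div_cnj[of z "z - a"] by (simp add: cmod_power2[symmetric] Re_divide_of_real flip: of_real_power)
  ultimately show ?thesis using ne by (simp add: pos_le_divide_eq)
qed

text \<open>Rows are numbered from 0 in the order of their moduli, without any relation to the
  numbering of the poles; the shift between the two numberings is what has to be found.\<close>

locale global_sys = lacunary +
  fixes L :: "nat \<Rightarrow> complex" and W :: "nat \<Rightarrow> real"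
  assumes sys: "interp_sys \<gamma> (col_weight v 1) {1..} UNIV L W"
    and L_inj: "inj L" and L_ne: "L n \<noteq> \<gamma> k"
    and L_mono: "n \<le> m \<Longrightarrow> cmod (L n) \<le> cmod (L m)"
    and W_def: "W n = inverse (ker (L n))"
begin

lemma W_pos: "W n > 0" using ker_pos[OF L_ne] by (simp add: W_def)

lemma L_nz: "L n \<noteq> 0" using L_ne[of n 0] by (simp add: gamma0)

lemma sys_bound:
  obtains B where "B > 0" "\<And>c F. c \<in> supp_space (col_weight v 1) {1..} \<Longrightarrow> finite F \<Longrightarrow>
     (\<Sum>n\<in>F. (cmod (ctrans \<gamma> c (L n)))^2 * W n) \<le> B * nsq (col_weight v 1) c"
proof -
  interpret poles \<gamma> "col_weight v 1" by (rule poles_axiom) simp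
  have W0: "0 \<le> W n" for n using W_pos[of n] by simp
  obtain B where B: "B \<ge> 0" "\<And>c. c \<in> supp_space (col_weight v 1) {1..} \<Longrightarrow>
      (\<Sum>\<^sub>\<infinity>n. (cmod (ctrans \<gamma> c (L n)))^2 * W n) \<le> B * nsq (col_weight v 1) c"
    using ctrans_bounded[of UNIV W "{1..}" L] W0 interp_sysD(1)[OF sys] by blast
  show thesis
  proof
    show "B + 1 > 0" using B by simp
    fix c F assume c: "c \<in> supp_space (col_weight v 1) {1..}" and F: "finite (F :: nat set)"
    have "(\<Sum>n\<in>F. (cmod (ctrans \<gamma> c (L n)))^2 * W n) \<le> (\<Sum>\<^sub>\<infinity>n. (cmod (ctrans \<gamma> c (L n)))^2 * W n)"
      using W0 by (intro finite_sum_le_infsum[OF interp_sysD(1)[OF sys c] F]) auto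
    also have "\<dots> \<le> B * nsq (col_weight v 1) c" by (rule B(2)[OF c])
    also have "\<dots> \<le> (B + 1) * nsq (col_weight v 1) c" by (simp add: distrib_right)
    finally show "(\<Sum>n\<in>F. (cmod (ctrans \<gamma> c (L n)))^2 * W n) \<le> (B + 1) * nsq (col_weight v 1) c" .
  qed
qed

text \<open>Test vector: the weights of the poles inside the disc.\<close>

lemma outer_bound:
  obtains B where "B > 0" "\<And>n F. n \<ge> 2 \<Longrightarrow> finite F \<Longrightarrow> (\<And>m. m \<in> F \<Longrightarrow> g (n - 1) < cmod (L m)) \<Longrightarrow>
     V n * (\<Sum>m\<in>F. W m / (cmod (L m))^2) \<le> B"
    "\<And>F. finite F \<Longrightarrow> (\<Sum>m\<in>F. W m / (cmod (L m - \<gamma> 1))^2) \<le> B"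
proof -
  interpret poles \<gamma> "col_weight v 1" by (rule poles_axiom) simp
  obtain B where B: "B > 0" "\<And>c F. c \<in> supp_space (col_weight v 1) {1..} \<Longrightarrow> finite F \<Longrightarrow>
     (\<Sum>n\<in>F. (cmod (ctrans \<gamma> c (L n)))^2 * W n) \<le> B * nsq (col_weight v 1) c" using sys_bound by blast
  show thesis
  proof
    show "4 * B + B / v 1 > 0" using B v_pos[of 1] by (simp add: add_pos_pos)
    fix F :: "nat set" assume F: "finite F"
    have "(\<Sum>m\<in>F. (cmod (ctrans \<gamma> (\<lambda>j. if j = 1 then 1 else 0) (L m)))^2 * W m) \<le> B * (1 / v 1)"
      using B(2)[OF supp_space_mono[OF _ unit_supp_space[of 1]] F] by (simp add: nsq_unit col_weight_def)
    thus "(\<Sum>m\<in>F. W m / (cmod (L m - \<gamma> 1))^2) \<le> 4 * B + B / v 1"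
      using B(1) by (simp add: ctrans_unit norm_divide power_divide)
    fix n :: nat assume n: "n \<ge> 2" and out: "\<And>m. m \<in> F \<Longrightarrow> g (n - 1) < cmod (L m)"
    define c where "c k = (if 1 \<le> k \<and> k < n then complex_of_real (v k) else 0)" for k
    have fs: "finite {1..<n}" "\<And>k. k \<notin> {1..<n} \<Longrightarrow> c k = 0" by (auto simp: c_def)
    have c: "c \<in> supp_space (col_weight v 1) {1..}" by (rule supp_space_mono[OF _ finite_supp(1)[OF fs]]) auto
    have cn: "nsq (col_weight v 1) c = (\<Sum>k\<in>{1..<n}. (cmod (c k))^2 * col_weight v 1 k)"
      and ct: "ctrans \<gamma> c z = (\<Sum>k\<in>{1..<n}. c k / (z - \<gamma> k))" for z
      using finite_supp(2,3)[OF fs] by auto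
    have "nsq (col_weight v 1) c = (\<Sum>k\<in>{1..<n}. v k)"
      unfolding cn using v_pos by (intro sum.cong) (auto simp: c_def col_weight_def power2_eq_square)
    hence nc: "nsq (col_weight v 1) c = V n" using V_sum_all[OF n] by simp
    have low: "V n * (V n / 4) * (W m / (cmod (L m))^2) \<le> (cmod (ctrans \<gamma> c (L m)))^2 * W m" if m: "m \<in> F" for m
    proof -
      define z where "z = L m"
      have z: "cmod z > 0" using L_nz by (simp add: z_def)
      \<comment> \<open>Seen from outside, every term of \<open>z * ctrans \<gamma> c z\<close> has
        real part at least half of \<open>v k\<close>, so there is no cancellation.\<close>
      have "V n / 2 = (\<Sum>k\<in>{1..<n}. v k * (1 / 2))" using V_sum_all[OF n] by (simp add: sum_divide_distrib[symmetric])
      also have "\<dots> \<le> (\<Sum>k\<in>{1..<n}. v k * Re (z / (z - \<gamma> k)))"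
      proof (intro sum_mono mult_left_mono Re_pole_ge)
        fix k assume k: "k \<in> {1..<n}"
        hence "g k \<le> g (n - 1)" by (intro g_mono) auto
        thus "g k < cmod z" using out[OF m] by (simp add: z_def)
        show "0 \<le> v k" using k v_nonneg by simp
      qed
      also have "\<dots> = Re (z * ctrans \<gamma> c z)"
        unfolding ct sum_distrib_left Re_sum
      proof (intro sum.cong refl)
        fix k assume "k \<in> {1..<n}"
        hence "z * (c k / (z - \<gamma> k)) = of_real (v k) * (z / (z - \<gamma> k))" by (simp add: c_def)
        thus "v k * Re (z / (z - \<gamma> k)) = Re (z * (c k / (z - \<gamma> k)))"
          by (simp only: times_complex.sel Re_complex_of_real Im_complex_of_real mult_zero_left diff_zero)
      qed
      also have "\<dots> \<le> cmod (z * ctrans \<gamma> c z)" by (rule complex_Re_le_cmod)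
      finally have "V n / 2 \<le> cmod z * cmod (ctrans \<gamma> c z)" by (simp add: norm_mult)
      hence "(V n / 2)^2 \<le> (cmod z * cmod (ctrans \<gamma> c z))^2" using V_pos[of n] by (intro power_mono) auto
      hence "V n * (V n / 4) / (cmod z)^2 \<le> (cmod (ctrans \<gamma> c z))^2"
        using z by (simp add: power_mult_distrib pos_divide_le_eq power2_eq_square[of "V n"] power_divide mult_ac)
      hence "V n * (V n / 4) / (cmod z)^2 * W m \<le> (cmod (ctrans \<gamma> c z))^2 * W m"
        using W_pos[of m] by (intro mult_right_mono) auto
      thus ?thesis by (simp add: z_def mult_ac)
    qed
    have "V n * (V n / 4 * (\<Sum>m\<in>F. W m / (cmod (L m))^2)) = (\<Sum>m\<in>F. V n * (V n / 4) * (W m / (cmod (L m))^2))"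
      by (simp add: sum_distrib_left mult_ac)
    also have "\<dots> \<le> (\<Sum>m\<in>F. (cmod (ctrans \<gamma> c (L m)))^2 * W m)" by (rule sum_mono[OF low])
    also have "\<dots> \<le> V n * B" using B(2)[OF c F] by (simp add: nc mult.commute)
    finally have "V n / 4 * (\<Sum>m\<in>F. W m / (cmod (L m))^2) \<le> B" using V_pos[of n] by simp
    moreover have "0 \<le> B / v 1" using B v_nonneg[of 1] by simp
    ultimately show "V n * (\<Sum>m\<in>F. W m / (cmod (L m))^2) \<le> 4 * B + B / v 1" by simp
  qed
qed

text \<open>Induction over the shells between consecutive poles: the old part shrinks relative to
  \<open>(g n)^2\<close>, because \<open>V\<close> gains at most \<open>q\<close> and
  \<open>(g n)^2\<close> at least \<open>q^2\<close>, and \<open>outer_bound\<close> controls the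
  new shell. In the first disc the column of the pole \<open>\<gamma> 1\<close> takes over.\<close>

lemma inner_bound:
  obtains K where "K > 0" "\<And>n F. n \<ge> N0 \<Longrightarrow> finite F \<Longrightarrow> (\<And>m. m \<in> F \<Longrightarrow> cmod (L m) \<le> g n) \<Longrightarrow>
     V n * (\<Sum>m\<in>F. W m) \<le> K * (g n)^2"
proof -
  obtain B where B: "B > 0" "\<And>n F. n \<ge> 2 \<Longrightarrow> finite F \<Longrightarrow> (\<And>m. m \<in> F \<Longrightarrow> g (n - 1) < cmod (L m)) \<Longrightarrow>
     V n * (\<Sum>m\<in>F. W m / (cmod (L m))^2) \<le> B"
    "\<And>F. finite F \<Longrightarrow> (\<Sum>m\<in>F. W m / (cmod (L m - \<gamma> 1))^2) \<le> B" using outer_bound by blast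
  \<comment> \<open>The first term starts the induction; the second makes
    \<open>K / q + B \<le> K\<close>, which lets it continue.\<close>
  define K where "K = 4 * B * V N0 + B * (q / (q - 1))"
  have K: "K \<ge> 4 * B * V N0" "K \<ge> B * (q / (q - 1))" "K > 0"
    using B(1) V_pos[of N0] q by (auto simp: K_def intro!: add_pos_pos divide_pos_pos mult_pos_pos)
  have "V n * (\<Sum>m\<in>F. W m) \<le> K * (g n)^2"
    if "n \<ge> N0" "finite F" "\<And>m. m \<in> F \<Longrightarrow> cmod (L m) \<le> g n" for n F
    using that
  proof (induction n arbitrary: F rule: dec_induct)
    case base
    have g1: "g 1 \<le> g N0" using N0(1) by (intro g_mono) auto
    have "(\<Sum>m\<in>F. W m) \<le> (\<Sum>m\<in>F. (4 * (g N0)^2) * (W m / (cmod (L m - \<gamma> 1))^2))"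
    proof (rule sum_mono)
      fix m assume m: "m \<in> F"
      have p: "0 < cmod (L m - \<gamma> 1)" using L_ne[of m 1] by simp
      have "cmod (L m - \<gamma> 1) \<le> 2 * g N0" using norm_triangle_ineq4[of "L m" "\<gamma> 1"] base(2)[OF m] g1 by linarith
      hence "(cmod (L m - \<gamma> 1))^2 \<le> (2 * g N0)^2" by (intro power_mono) auto
      hence "W m * (cmod (L m - \<gamma> 1))^2 \<le> W m * (4 * (g N0)^2)"
        using W_pos[of m] by (intro mult_left_mono) (auto simp: power_mult_distrib)
      thus "W m \<le> (4 * (g N0)^2) * (W m / (cmod (L m - \<gamma> 1))^2)"
        using p by (simp add: pos_le_divide_eq mult_ac)
    qed
    also have "\<dots> = (4 * (g N0)^2) * (\<Sum>m\<in>F. W m / (cmod (L m - \<gamma> 1))^2)" by (simp add: sum_distrib_left)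
    also have "\<dots> \<le> (4 * (g N0)^2) * B" using B(3)[OF base(1)] by (intro mult_left_mono) auto
    finally have "V N0 * (\<Sum>m\<in>F. W m) \<le> V N0 * ((4 * (g N0)^2) * B)" using V_pos[of N0] by (intro mult_left_mono) auto
    also have "\<dots> = (4 * B * V N0) * (g N0)^2" by simp
    also have "\<dots> \<le> K * (g N0)^2" using K(1) by (intro mult_right_mono) auto
    finally show ?case .
  next
    case (step n)
    define F1 where "F1 = {m\<in>F. cmod (L m) \<le> g n}"
    define F2 where "F2 = {m\<in>F. g n < cmod (L m)}"
    have fin: "finite F1" "finite F2" using step by (auto simp: F1_def F2_def)
    have n: "n \<ge> 1" "n \<ge> N0" using step N0(1) by auto
    have split: "(\<Sum>m\<in>F. W m) = (\<Sum>m\<in>F1. W m) + (\<Sum>m\<in>F2. W m)"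
      using step.prems(1) by (subst sum.union_disjoint[symmetric]) (auto simp: F1_def F2_def intro!: sum.cong)
    have gp: "g n > 0" "g (Suc n) > 0" using n g_pos by auto
    have Vr: "V (Suc n) \<le> q * V n" using V_Suc_le(2) n by simp
    have gr: "q * (q * (g n)^2) \<le> (g (Suc n))^2"
    proof -
      have "(q * g n)^2 \<le> (g (Suc n))^2" using lac[OF n(1)] q by (intro power_mono) auto
      thus ?thesis by (simp add: power_mult_distrib power2_eq_square mult_ac)
    qed
    have S0: "0 \<le> (\<Sum>m\<in>F1. W m)" using W_pos by (intro sum_nonneg less_imp_le)
    have "V (Suc n) * (\<Sum>m\<in>F1. W m) \<le> q * (V n * (\<Sum>m\<in>F1. W m))" using mult_right_mono[OF Vr S0] by simp
    also have "\<dots> \<le> q * (K * (g n)^2)" using step.IH[OF fin(1)] q by (intro mult_left_mono) (auto simp: F1_def)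
    also have "\<dots> \<le> K / q * (g (Suc n))^2"
    proof -
      have "K * (q * (q * (g n)^2)) \<le> K * (g (Suc n))^2" using gr K by (intro mult_left_mono) auto
      thus ?thesis using q by (simp add: field_simps)
    qed
    finally have 1: "V (Suc n) * (\<Sum>m\<in>F1. W m) \<le> K / q * (g (Suc n))^2" .
    have "(\<Sum>m\<in>F2. W m) \<le> (\<Sum>m\<in>F2. (g (Suc n))^2 * (W m / (cmod (L m))^2))"
    proof (rule sum_mono)
      fix m assume m: "m \<in> F2"
      have p: "0 < cmod (L m)" using L_nz by simp
      have "(cmod (L m))^2 \<le> (g (Suc n))^2" using step.prems(2)[of m] m by (intro power_mono) (auto simp: F2_def)
      hence "W m * (cmod (L m))^2 \<le> W m * (g (Suc n))^2"
        using W_pos[of m] by (intro mult_left_mono) auto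
      thus "W m \<le> (g (Suc n))^2 * (W m / (cmod (L m))^2)" using p by (simp add: pos_le_divide_eq mult_ac)
    qed
    hence "V (Suc n) * (\<Sum>m\<in>F2. W m) \<le> V (Suc n) * (\<Sum>m\<in>F2. (g (Suc n))^2 * (W m / (cmod (L m))^2))"
      using V_pos[of "Suc n"] by (intro mult_left_mono) auto
    also have "\<dots> = (g (Suc n))^2 * (V (Suc n) * (\<Sum>m\<in>F2. W m / (cmod (L m))^2))"
      by (simp add: sum_distrib_left mult_ac)
    also have "\<dots> \<le> (g (Suc n))^2 * B"
      using n by (intro mult_left_mono B(2)[OF _ fin(2)]) (auto simp: F2_def)
    finally have 2: "V (Suc n) * (\<Sum>m\<in>F2. W m) \<le> B * (g (Suc n))^2" by (simp add: mult.commute)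
    have "K / q + B \<le> K"
    proof -
      have "B * q \<le> K * (q - 1)" using K(2) q by (simp add: pos_divide_le_eq)
      thus ?thesis using q by (simp add: field_simps)
    qed
    hence "(K / q + B) * (g (Suc n))^2 \<le> K * (g (Suc n))^2" by (intro mult_right_mono) auto
    thus ?case unfolding split using 1 2 by (simp add: distrib_left distrib_right)
  qed
  thus thesis using that K(3) by blast
qed

text \<open>The unit residue at pole \<open>n\<close> has squared norm \<open>1 / v n\<close>. With
  no row in the set D of index \<open>n\<close>, its image would have squared norm at most a
  constant times \<open>1 / V n\<close> (rows outside the annulus) plus \<open>B / (M * v n)\<close>
  (rows inside it); for large \<open>M\<close> and small \<open>v n / V n\<close> this contradicts
  the lower bound.\<close>

lemma D_inhabited: "\<exists>M N. \<forall>n\<ge>N. \<exists>m. L m \<in> Dset \<gamma> v M n"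
proof -
  interpret poles \<gamma> "col_weight v 1" by (rule poles_axiom) simp
  obtain B where B: "B > 0" "\<And>n F. n \<ge> 2 \<Longrightarrow> finite F \<Longrightarrow> (\<And>m. m \<in> F \<Longrightarrow> g (n - 1) < cmod (L m)) \<Longrightarrow>
     V n * (\<Sum>m\<in>F. W m / (cmod (L m))^2) \<le> B"
    "\<And>F. finite F \<Longrightarrow> (\<Sum>m\<in>F. W m / (cmod (L m - \<gamma> 1))^2) \<le> B" using outer_bound by blast
  obtain K where K: "K > 0" "\<And>n F. n \<ge> N0 \<Longrightarrow> finite F \<Longrightarrow> (\<And>m. m \<in> F \<Longrightarrow> cmod (L m) \<le> g n) \<Longrightarrow>
     V n * (\<Sum>m\<in>F. W m) \<le> K * (g n)^2" using inner_bound by blast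
  obtain B0 where B0: "B0 \<ge> 0" "\<And>c. c \<in> supp_space (col_weight v 1) {1..} \<Longrightarrow>
      nsq (col_weight v 1) c \<le> B0 * (\<Sum>\<^sub>\<infinity>n. (cmod (ctrans \<gamma> c (L n)))^2 * W n)"
    by (rule interp_sys_bounded_below[OF sys]) (rule that; assumption)
  \<comment> \<open>Makes the coefficient \<open>B0 * B / M\<close> of the rows in the annulus at
    most one half.\<close>
  define M where "M = 2 * B0 * B + 1"
  have M: "M > 0" using B0 B by (simp add: M_def add_nonneg_pos)
  define A where "A = B0 * ((B + K) / \<kappa>^2)"
  have A: "A \<ge> 0" using B0 B K by (simp add: A_def)
  have k2: "\<kappa>^2 > 0" using kappa(1) by simp
  obtain Na where Na: "Na \<ge> N0" "\<And>k. k \<ge> Na \<Longrightarrow> v k \<le> ((q - 1) / (2 * q)) * V k"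
    using v_eventually_small[of "(q - 1) / (2 * q)"] q by auto
  obtain Nb where Nb: "Nb \<ge> N0" "\<And>k. k \<ge> Nb \<Longrightarrow> v k \<le> 1 / (2 * A + 1) * V k"
    using v_eventually_small[of "1 / (2 * A + 1)"] A by (auto simp: add_nonneg_pos)
  have "\<exists>m. L m \<in> Dset \<gamma> v M n" if n: "n \<ge> max Na Nb" for n
  proof (rule ccontr)
    assume no: "\<nexists>m. L m \<in> Dset \<gamma> v M n"
    have n': "n \<ge> N0" "n \<ge> 2" "n \<ge> 1" "n \<ge> Na" "n \<ge> Nb" using n Na N0(1) by auto
    have vn: "v n > 0" and gn: "g n > 0" and Vn: "V n > 0" using v_pos g_pos V_pos n' by auto
    \<comment> \<open>Within the annulus \<open>P\<close> is then at most
      \<open>V n / (cmod z)^2\<close>, so a row outside D violates the condition with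
      \<open>V\<close>; the constant in the choice of \<open>Na\<close> is made for this.\<close>
    have P: "Pseq \<gamma> v n \<le> V n / (g (Suc n))^2"
    proof -
      have "Pseq \<gamma> v n \<le> ((q - 1) / (2 * q)) * (q / (q - 1)) * (V (Suc n) / (g (Suc n))^2)"
        by (rule P_le[OF n'(1)]) (use Na n' q in auto)
      also have "((q - 1) / (2 * q)) * (q / (q - 1)) = 1 / 2" using q by simp
      also have "1 / 2 * (V (Suc n) / (g (Suc n))^2) \<le> V n / (g (Suc n))^2"
        using divide_right_mono[OF V_Suc_le(1)[OF n'(1)], of "(g (Suc n))^2"] by simp
      finally show ?thesis .
    qed
    have gs: "g (n - 1) \<le> g n" "g n \<le> g (Suc n)" using n' by (auto intro!: g_mono)
    have gs': "q * g (n - 1) \<le> g n" "q * g n \<le> g (Suc n)" using g_strict[of "n - 1" n] lac[of n] n' by auto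
    have glt: "g n < g (Suc n)"
    proof -
      have "1 * g n < q * g n" using q gn by (intro mult_strict_right_mono) auto
      thus ?thesis using gs' by simp
    qed
    have glt': "g (n - 1) < g n"
    proof -
      have "0 < g (n - 1)" using g_pos n' by simp
      hence "1 * g (n - 1) < q * g (n - 1)" using q by (intro mult_strict_right_mono) auto
      thus ?thesis using gs' by simp
    qed
    have Fin: "(\<Sum>m\<in>F. W m / (cmod (L m - \<gamma> n))^2) \<le> (B + K) / \<kappa>^2 / V n + B / M / v n" if F: "finite F" for F
    proof -
      define Fa where "Fa = {m\<in>F. (g n + g (Suc n)) / 2 \<le> cmod (L m)}"
      define Fb where "Fb = {m\<in>F. cmod (L m) < (g (n - 1) + g n) / 2}"
      define Fc where "Fc = {m\<in>F. L m \<in> Omega \<gamma> n}"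
      have fin: "finite Fa" "finite Fb" "finite Fc" using F by (auto simp: Fa_def Fb_def Fc_def)
      have un: "F = Fa \<union> Fb \<union> Fc" using n' by (auto simp: Fa_def Fb_def Fc_def Omega_def)
      have t0: "0 \<le> W m / (cmod (L m - \<gamma> n))^2" for m using W_pos[of m] by simp
      have le3: "(\<Sum>m\<in>F. W m / (cmod (L m - \<gamma> n))^2) \<le> (\<Sum>m\<in>Fa. W m / (cmod (L m - \<gamma> n))^2) +
          (\<Sum>m\<in>Fb. W m / (cmod (L m - \<gamma> n))^2) + (\<Sum>m\<in>Fc. W m / (cmod (L m - \<gamma> n))^2)"
      proof -
        have "(\<Sum>m\<in>F. W m / (cmod (L m - \<gamma> n))^2) \<le> (\<Sum>m\<in>Fa \<union> Fb. W m / (cmod (L m - \<gamma> n))^2) + (\<Sum>m\<in>Fc. W m / (cmod (L m - \<gamma> n))^2)"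
          unfolding un using fin t0 by (subst sum_Un) (auto intro!: sum_nonneg)
        moreover have "(\<Sum>m\<in>Fa \<union> Fb. W m / (cmod (L m - \<gamma> n))^2) \<le> (\<Sum>m\<in>Fa. W m / (cmod (L m - \<gamma> n))^2) + (\<Sum>m\<in>Fb. W m / (cmod (L m - \<gamma> n))^2)"
          using fin t0 by (subst sum_Un) (auto intro!: sum_nonneg)
        ultimately show ?thesis by linarith
      qed
      have sum_ge: "0 \<le> (\<Sum>m\<in>G. W m / (cmod (L m))^2)" for G using W_pos by (intro sum_nonneg) (simp add: less_imp_le)
      have outer: "(\<Sum>m\<in>G. W m / (cmod (L m))^2) \<le> B / V n" if "finite G" "\<And>m. m \<in> G \<Longrightarrow> g (n - 1) < cmod (L m)" for G
        using B(2)[OF n'(2) that] Vn by (simp add: pos_le_divide_eq mult.commute)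
      have a: "(\<Sum>m\<in>Fa. W m / (cmod (L m - \<gamma> n))^2) \<le> 1 / \<kappa>^2 * (B / V n)"
      proof -
        have "(\<Sum>m\<in>Fa. W m / (cmod (L m - \<gamma> n))^2) \<le> (\<Sum>m\<in>Fa. 1 / \<kappa>^2 * (W m / (cmod (L m))^2))"
        proof (rule sum_mono)
          fix m assume m: "m \<in> Fa"
          have p: "0 < \<kappa> * cmod (L m)" using kappa(1) L_nz by simp
          have "\<kappa> * cmod (L m) \<le> cmod (L m - \<gamma> n)"
            by (rule sep_below[of "Suc n"]) (use m n' in \<open>auto simp: Fa_def\<close>)
          hence "(\<kappa> * cmod (L m))^2 \<le> (cmod (L m - \<gamma> n))^2" using p by (intro power_mono) auto
          hence "W m / (cmod (L m - \<gamma> n))^2 \<le> W m / (\<kappa> * cmod (L m))^2"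
            using p by (intro frac_le less_imp_le[OF W_pos] order_refl zero_less_power)
          thus "W m / (cmod (L m - \<gamma> n))^2 \<le> 1 / \<kappa>^2 * (W m / (cmod (L m))^2)" by (simp add: power_mult_distrib)
        qed
        also have "\<dots> = 1 / \<kappa>^2 * (\<Sum>m\<in>Fa. W m / (cmod (L m))^2)" by (rule sum_distrib_left[symmetric])
        also have "\<dots> \<le> 1 / \<kappa>^2 * (B / V n)"
          using glt glt' k2 by (intro mult_left_mono outer[OF fin(1)]) (auto simp: Fa_def)
        finally show ?thesis .
      qed
      have b: "(\<Sum>m\<in>Fb. W m / (cmod (L m - \<gamma> n))^2) \<le> 1 / \<kappa>^2 * (K / V n)"
      proof -
        have "(\<Sum>m\<in>Fb. W m / (cmod (L m - \<gamma> n))^2) \<le> (\<Sum>m\<in>Fb. 1 / (\<kappa> * g n)^2 * W m)"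
        proof (rule sum_mono)
          fix m assume m: "m \<in> Fb"
          have p: "0 < \<kappa> * g n" using kappa(1) gn by simp
          have "\<kappa> * g n \<le> cmod (L m - \<gamma> n)"
            by (rule sep_above[of "n - 1"]) (use m n' in \<open>auto simp: Fb_def\<close>)
          hence "(\<kappa> * g n)^2 \<le> (cmod (L m - \<gamma> n))^2" using p by (intro power_mono) auto
          hence "W m / (cmod (L m - \<gamma> n))^2 \<le> W m / (\<kappa> * g n)^2"
            using p by (intro frac_le less_imp_le[OF W_pos] order_refl zero_less_power)
          thus "W m / (cmod (L m - \<gamma> n))^2 \<le> 1 / (\<kappa> * g n)^2 * W m" by simp
        qed
        also have "\<dots> = 1 / (\<kappa> * g n)^2 * (\<Sum>m\<in>Fb. W m)" by (rule sum_distrib_left[symmetric])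
        also have "\<dots> \<le> 1 / (\<kappa> * g n)^2 * (K * (g n)^2 / V n)"
        proof (rule mult_left_mono)
          have "V n * (\<Sum>m\<in>Fb. W m) \<le> K * (g n)^2"
            using glt' by (intro K(2)[OF n'(1) fin(2)]) (auto simp: Fb_def)
          thus "(\<Sum>m\<in>Fb. W m) \<le> K * (g n)^2 / V n" using Vn by (simp add: pos_le_divide_eq mult.commute)
        qed simp
        also have "\<dots> = 1 / \<kappa>^2 * (K / V n)" using gn kappa(1) by (simp add: power_mult_distrib field_simps)
        finally show ?thesis .
      qed
      have c: "(\<Sum>m\<in>Fc. W m / (cmod (L m - \<gamma> n))^2) \<le> V n / (M * v n) * (B / V n)"
      proof -
        have "(\<Sum>m\<in>Fc. W m / (cmod (L m - \<gamma> n))^2) \<le> (\<Sum>m\<in>Fc. V n / (M * v n) * (W m / (cmod (L m))^2))"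
        proof (rule sum_mono)
          fix m assume m: "m \<in> Fc"
          have Om: "L m \<in> Omega \<gamma> n" using m by (simp add: Fc_def)
          have p: "0 < (cmod (L m))^2" "0 < (cmod (L m - \<gamma> n))^2" using L_nz L_ne by auto
          have "cmod (L m) \<le> g (Suc n)" using OmegaD(2)[OF Om n'(2)] gs(2) by (simp add: field_simps)
          hence "V n / (g (Suc n))^2 \<le> V n / (cmod (L m))^2"
            using Vn p by (intro divide_left_mono power_mono mult_pos_pos) (auto simp: zero_less_power2)
          hence "Pseq \<gamma> v n \<le> V n / (cmod (L m))^2" using P by linarith
          hence "M * v n / (cmod (L m - \<gamma> n))^2 \<le> V n / (cmod (L m))^2"
            using no Om by (auto simp: Dset_def max_def not_le split: if_splits)
          hence "W m * (M * v n / (cmod (L m - \<gamma> n))^2) \<le> W m * (V n / (cmod (L m))^2)"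
            using W_pos[of m] by (intro mult_left_mono) auto
          hence "(M * v n) * (W m / (cmod (L m - \<gamma> n))^2) \<le> V n * (W m / (cmod (L m))^2)" by (simp add: mult_ac)
          moreover have "0 < M * v n" using M vn by simp
          ultimately have "W m / (cmod (L m - \<gamma> n))^2 \<le> V n * (W m / (cmod (L m))^2) / (M * v n)"
            by (simp only: pos_le_divide_eq mult.commute)
          thus "W m / (cmod (L m - \<gamma> n))^2 \<le> V n / (M * v n) * (W m / (cmod (L m))^2)" by (simp add: mult_ac)
        qed
        also have "\<dots> = V n / (M * v n) * (\<Sum>m\<in>Fc. W m / (cmod (L m))^2)" by (rule sum_distrib_left[symmetric])
        also have "\<dots> \<le> V n / (M * v n) * (B / V n)"
        proof (intro mult_left_mono outer[OF fin(3)])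
          fix m assume "m \<in> Fc"
          thus "g (n - 1) < cmod (L m)" using OmegaD(1)[of "L m" n] glt' n' by (auto simp: Fc_def)
        next
          show "0 \<le> V n / (M * v n)" using M vn Vn by simp
        qed
        finally show ?thesis .
      qed
      have "1 / \<kappa>^2 * (B / V n) + 1 / \<kappa>^2 * (K / V n) + V n / (M * v n) * (B / V n) = (B + K) / \<kappa>^2 / V n + B / M / v n"
        using Vn by (simp add: add_divide_distrib divide_divide_eq_left mult.commute)
      thus ?thesis using le3 a b c by linarith
    qed
    define e :: "nat \<Rightarrow> complex" where "e = (\<lambda>j. if j = n then 1 else 0)"
    have e: "e \<in> supp_space (col_weight v 1) {1..}" unfolding e_def
      by (rule supp_space_mono[OF _ unit_supp_space]) (use n' in auto)
    have ts: "(cmod (ctrans \<gamma> e (L m)))^2 * W m = W m / (cmod (L m - \<gamma> n))^2" for m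
      by (simp add: e_def ctrans_unit norm_divide power_divide)
    have "(\<Sum>\<^sub>\<infinity>m. (cmod (ctrans \<gamma> e (L m)))^2 * W m) \<le> (B + K) / \<kappa>^2 / V n + B / M / v n"
      unfolding ts by (rule nonneg_bounded_summable(2)) (use Fin W_pos in \<open>auto simp: less_imp_le\<close>)
    hence "1 / v n \<le> B0 * ((B + K) / \<kappa>^2 / V n + B / M / v n)"
      using order_trans[OF B0(2)[OF e] mult_left_mono[OF _ B0(1)]] n' by (simp add: e_def nsq_unit col_weight_def)
    also have "\<dots> = A / V n + (B0 * B / M) / v n" by (simp add: A_def distrib_left)
    also have "(B0 * B / M) / v n \<le> (1 / 2) / v n"
      using vn M by (intro divide_right_mono) (auto simp: pos_divide_le_eq M_def)
    finally have "1 / 2 / v n \<le> A / V n" by (simp add: field_simps)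
    hence "V n \<le> 2 * A * v n" using vn Vn by (simp add: field_simps)
    moreover have "(2 * A + 1) * v n \<le> V n"
      using Nb(2)[OF n'(5)] A by (simp add: pos_le_divide_eq add_nonneg_pos mult.commute)
    ultimately show False using vn by (simp add: distrib_right)
  qed
  thus ?thesis by blast
qed

text \<open>If the index of the chosen row did not fall behind that of its pole, a row could be left out
  while still one zero per pole remains, against the uniqueness theorem.\<close>

theorem row_structure:
  obtains M N n1 where "n1 \<ge> 1" "N \<ge> n1" "\<And>n. n \<ge> N \<Longrightarrow> L (n - n1) \<in> Dset \<gamma> v M n"
proof -
  interpret poles \<gamma> "col_weight v 1" by (rule poles_axiom) simp
  obtain M Na where Na: "\<And>n. n \<ge> Na \<Longrightarrow> \<exists>m. L m \<in> Dset \<gamma> v M n" using D_inhabited by blast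
  define N where "N = max Na 2"
  have N: "N \<ge> 2" by (simp add: N_def)
  obtain m where m: "\<And>n. n \<ge> N \<Longrightarrow> L (m n) \<in> Dset \<gamma> v M n" using Na unfolding N_def by (metis max.boundedE)
  have ms: "m n < m (Suc n)" if n: "n \<ge> N" for n
  proof (rule ccontr)
    assume "\<not> m n < m (Suc n)"
    hence "cmod (L (m (Suc n))) \<le> cmod (L (m n))" by (intro L_mono) simp
    moreover have "cmod (L (m n)) < (g n + g (Suc n)) / 2" using m[OF n] n N by (auto simp: Dset_def Omega_def)
    moreover have "(g n + g (Suc n)) / 2 \<le> cmod (L (m (Suc n)))" using m[of "Suc n"] n N by (auto simp: Dset_def Omega_def)
    ultimately show False by linarith
  qed
  have mmono: "n \<le> n' \<Longrightarrow> m n + (n' - n) \<le> m n'" if n: "n \<ge> N" for n n'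
  proof (induction n' rule: dec_induct)
    case (step k) thus ?case using ms[of k] n by (auto simp: Suc_diff_le)
  qed simp
  have lt: "m n < n" if n: "n \<ge> N" for n
  proof (rule ccontr)
    assume "\<not> m n < n"
    hence mn: "m n \<ge> n" by simp
    \<comment> \<open>Pole \<open>k < n\<close> is paired with row \<open>k - 1\<close>, pole
      \<open>k \<ge> n\<close> with row \<open>m k \<ge> n\<close>. Row \<open>n - 1\<close> stays
      free, and the solution for unit data at that row vanishes at all
      \<open>\<mu> k\<close>.\<close>
    define \<mu> where "\<mu> k = (if k < n then L (k - 1) else L (m k))" for k
    have big: "m k \<ge> n" if "k \<ge> n" for k using mmono[OF n that] mn by simp
    obtain B where B: "B \<ge> 0" "\<forall>b. sqsummable W UNIV b \<longrightarrow>
     (\<exists>c\<in>supp_space (col_weight v 1) {1..}. (\<forall>n\<in>UNIV. ctrans \<gamma> c (L n) = b n) \<and> nsq (col_weight v 1) c \<le> B * sqsum W UNIV b)"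
      by (rule interp_sys_solve[OF sys]) (rule that; assumption)
    define b :: "nat \<Rightarrow> complex" where "b j = (if j = n - 1 then 1 else 0)" for j
    have "((\<lambda>j. (cmod (b j))^2 * W j) has_sum W (n - 1)) UNIV"
      by (rule has_sum_finite_neutralI[where B="{n - 1}"]) (auto simp: b_def)
    hence bs: "sqsummable W UNIV b" by (auto simp: summable_on_def)
    obtain c where c: "c \<in> supp_space (col_weight v 1) {1..}" "\<And>j. ctrans \<gamma> c (L j) = b j"
      using B(2)[rule_format, OF bs] by blast
    have "c = (\<lambda>_. 0)"
    proof (rule uniqueness_exact[OF _ _ _ c(1)])
      have minj: "k = k'" if "k \<ge> n" "k' \<ge> n" "m k = m k'" for k k'
      proof (rule ccontr)
        assume "k \<noteq> k'"
        then consider "k < k'" | "k' < k" by linarith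
        thus False
        proof cases
          case 1 thus False using mmono[of k k'] that n by simp
        next
          case 2 thus False using mmono[of k' k] that n by simp
        qed
      qed
      show "inj_on \<mu> {1..}"
      proof (rule inj_onI)
        fix k k' assume kk: "k \<in> {1..}" "k' \<in> {1..}" "\<mu> k = \<mu> k'"
        have e: "(if k < n then k - 1 else m k) = (if k' < n then k' - 1 else m k')"
          using kk(3) injD[OF L_inj] by (auto simp: \<mu>_def split: if_splits)
        thus "k = k'" using kk(1,2) big[of k] big[of k'] minj[of k k'] by (auto split: if_splits)
      qed
      show "\<mu> k \<noteq> \<gamma> j" for k j using L_ne by (simp add: \<mu>_def)
      show "\<exists>N'. \<forall>k\<ge>N'. cmod (\<mu> k - \<gamma> k) \<le> \<eta> * g k" if "\<eta> > 0" for \<eta>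
      proof -
        obtain N' where N': "\<forall>k\<ge>N'. \<forall>z\<in>Dset \<gamma> v M k. cmod (z - \<gamma> k) \<le> \<eta> * g k" using Dset_close[OF \<open>\<eta> > 0\<close>] by blast
        show ?thesis using N' m n by (intro exI[of _ "max N' n"]) (auto simp: \<mu>_def)
      qed
      show "ctrans \<gamma> c (\<mu> k) = 0" if "k \<ge> 1" for k
      proof (cases "k < n")
        case True
        hence "k - 1 \<noteq> n - 1" using that by linarith
        thus ?thesis using True c(2)[of "k - 1"] by (simp add: \<mu>_def b_def)
      next
        case False
        hence "m k \<noteq> n - 1" using big[of k] that n N by linarith
        thus ?thesis using False c(2)[of "m k"] by (simp add: \<mu>_def b_def)
      qed
    qed
    hence "ctrans \<gamma> c (L (n - 1)) = 0" by (simp only: ctrans_zero)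
    thus False unfolding c(2) b_def by simp
  qed
  \<comment> \<open>Lag of the rows behind the poles: positive, and nonincreasing because
    \<open>m\<close> is strictly increasing; hence constant from some point on.\<close>
  define f where "f n = n - m n" for n
  have f1: "f n \<ge> 1" if "n \<ge> N" for n using lt[OF that] by (simp add: f_def)
  have fm: "f n' \<le> f n" if "N \<le> n" "n \<le> n'" for n n' using mmono[OF that] lt[of n] lt[of n'] that by (auto simp: f_def)
  obtain ns where ns: "ns \<ge> N" "\<And>n. n \<ge> N \<Longrightarrow> f ns \<le> f n"
    using ex_has_least_nat[of "\<lambda>n. n \<ge> N" N f] by auto
  have fc: "f n = f ns" if "n \<ge> ns" for n using fm[OF ns(1) that] ns(2)[of n] ns(1) that by simp
  show thesis
  proof
    show "f ns \<ge> 1" by (rule f1[OF ns(1)])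
    show "ns + f ns \<ge> f ns" by simp
    fix n assume n: "n \<ge> ns + f ns"
    hence "n \<ge> ns" by simp
    moreover have "n \<ge> N" using n ns by simp
    ultimately have "n - f ns = m n" using fc[of n] lt[of n] by (simp add: f_def)
    thus "L (n - f ns) \<in> Dset \<gamma> v M n" using m[OF \<open>n \<ge> N\<close>] by simp
  qed
qed

end

lemma infsum_tail_small:
  fixes f :: "nat \<Rightarrow> real"
  assumes f: "f summable_on {1..}" and pos: "\<And>k. k \<ge> 1 \<Longrightarrow> 0 \<le> f k" and e: "\<epsilon> > 0"
  obtains N where "N \<ge> N0" "\<And>n. n \<ge> N \<Longrightarrow> (\<Sum>\<^sub>\<infinity>k\<in>{n<..}. f k) \<le> \<epsilon>"
proof -
  have "(sum f \<longlongrightarrow> infsum f {1..}) (finite_subsets_at_top {1..})" by (rule infsum_tendsto[OF f])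
  hence "eventually (\<lambda>F. dist (sum f F) (infsum f {1..}) < \<epsilon>) (finite_subsets_at_top {1..})"
    using e by (rule tendstoD)
  then obtain F where F: "finite F" "F \<subseteq> {1..}" "dist (sum f F) (infsum f {1..}) < \<epsilon>"
    unfolding eventually_finite_subsets_at_top by blast
  define N where "N = max N0 (Max (insert 0 F))"
  have "(\<Sum>\<^sub>\<infinity>k\<in>{n<..}. f k) \<le> \<epsilon>" if n: "n \<ge> N" for n
  proof -
    have "F \<inter> {n<..} = {}"
    proof -
      have "k \<le> n" if "k \<in> F" for k using Max_ge[of "insert 0 F" k] F(1) that n by (simp add: N_def)
      thus ?thesis by force
    qed
    moreover have s: "f summable_on {n<..}" by (rule summable_on_subset_banach[OF f]) auto
    ultimately have "sum f F + (\<Sum>\<^sub>\<infinity>k\<in>{n<..}. f k) = infsum f (F \<union> {n<..})"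
      using F(1) by (subst infsum_Un_disjoint) auto
    also have "\<dots> \<le> infsum f {1..}"
      by (rule infsum_mono2[OF summable_on_subset_banach[OF f] f]) (use F(2) pos in auto)
    finally show ?thesis using F(3) by (simp add: dist_real_def)
  qed
  moreover have "N \<ge> N0" by (simp add: N_def)
  ultimately show thesis using that by blast
qed

context lacunary
begin

text \<open>With \<open>d\<close> the distance to \<open>\<gamma> n\<close>, the poles inside
  contribute at most a multiple of \<open>V n / (cmod z)^2\<close> to the kernel, those outside at
  most a multiple of \<open>P\<close>, and the definition of D bounds both by
  \<open>M * v n / d^2\<close>.\<close>

lemma ker_le_D:
  assumes z: "z \<in> Dset \<gamma> v M n" and n: "n \<ge> 2"
  shows "(cmod (z - \<gamma> n))^2 * ker z \<le> (1 + 2 * M / \<kappa>^2) * v n"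
proof -
  note D = DsetD[OF z n]
  define f where "f k = v k / (cmod (z - \<gamma> k))^2" for k
  have fs: "f summable_on {1..}" unfolding f_def by (rule ker_summable)
  have k2: "\<kappa>^2 > 0" using kappa(1) by simp
  have d: "0 < (cmod (z - \<gamma> n))^2" using D(4) by simp
  have gn: "0 < g n" using g_pos n by simp
  have "0 < (g (n - 1) + g n) / 2" using gn by (simp add: add_nonneg_pos)
  hence z0: "cmod z > 0" using OmegaD(1)[OF D(1) n] by (rule less_le_trans)
  have below: "(\<Sum>k\<in>{1..<n}. f k) \<le> V n / (\<kappa>^2 * (cmod z)^2)"
  proof -
    have "f k \<le> v k / (\<kappa> * cmod z)^2" if k: "k \<in> {1..<n}" for k
    proof -
      have "\<kappa> * cmod z \<le> cmod (z - \<gamma> k)" by (rule sep_below[OF n _ _ OmegaD(1)[OF D(1) n]]) (use k in auto)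
      moreover have p: "0 < \<kappa> * cmod z" using kappa(1) z0 by simp
      ultimately show ?thesis
        unfolding f_def using k v_nonneg by (intro frac_le power_mono zero_less_power) auto
    qed
    hence "(\<Sum>k\<in>{1..<n}. f k) \<le> (\<Sum>k\<in>{1..<n}. v k / (\<kappa> * cmod z)^2)" by (rule sum_mono)
    also have "\<dots> = V n / (\<kappa>^2 * (cmod z)^2)" using V_sum_all[OF n] by (simp add: sum_divide_distrib[symmetric] power_mult_distrib)
    finally show ?thesis .
  qed
  have ps: "(\<lambda>k. v k / (g k)^2) summable_on {n<..}" by (rule summable_on_subset_banach[OF v_sum]) (use n in auto)
  have fs2: "f summable_on {n<..}" by (rule summable_on_subset_banach[OF fs]) (use n in auto)
  have above: "(\<Sum>\<^sub>\<infinity>k\<in>{n<..}. f k) \<le> 1 / \<kappa>^2 * Pseq \<gamma> v n"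
  proof -
    have "(\<Sum>\<^sub>\<infinity>k\<in>{n<..}. f k) \<le> (\<Sum>\<^sub>\<infinity>k\<in>{n<..}. 1 / \<kappa>^2 * (v k / (g k)^2))"
    proof (rule infsum_mono[OF fs2 summable_on_cmult_right[OF ps]])
      fix k assume k: "k \<in> {n<..}"
      have "\<kappa> * g k \<le> cmod (z - \<gamma> k)" by (rule sep_above[OF _ _ OmegaD(2)[OF D(1) n]]) (use k n in auto)
      moreover have p: "0 < \<kappa> * g k" using kappa(1) g_pos[of k] k n by simp
      ultimately have "f k \<le> v k / (\<kappa> * g k)^2"
        unfolding f_def using k n v_nonneg by (intro frac_le power_mono zero_less_power) auto
      thus "f k \<le> 1 / \<kappa>^2 * (v k / (g k)^2)" by (simp add: power_mult_distrib)
    qed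
    also have "\<dots> = 1 / \<kappa>^2 * Pseq \<gamma> v n" unfolding Pseq_def by (rule infsum_cmult_right')
    finally show ?thesis .
  qed
  have "ker z = infsum f {1..}" unfolding ker_def by (rule infsum_cong) (simp add: f_def)
  also have "{1..} = {1..<n} \<union> insert n {n<..}" using n by auto
  also have "infsum f ({1..<n} \<union> insert n {n<..}) = (\<Sum>k\<in>{1..<n}. f k) + infsum f (insert n {n<..})"
    using fs2 by (subst infsum_Un_disjoint) (auto simp: summable_on_insert_iff)
  also have "infsum f (insert n {n<..}) = f n + infsum f {n<..}" by (rule infsum_insert[OF fs2]) simp
  finally have ker: "ker z = (\<Sum>k\<in>{1..<n}. f k) + (f n + infsum f {n<..})" .
  have b1: "(cmod (z - \<gamma> n))^2 * (V n / (\<kappa>^2 * (cmod z)^2)) \<le> M / \<kappa>^2 * v n"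
  proof -
    have "V n * (cmod (z - \<gamma> n))^2 * (1 / (\<kappa>^2 * (cmod z)^2)) \<le> M * (v n * (cmod z)^2) * (1 / (\<kappa>^2 * (cmod z)^2))"
      using D(2) k2 by (intro mult_right_mono) auto
    thus ?thesis using z0 by (simp add: mult_ac)
  qed
  have b3: "(cmod (z - \<gamma> n))^2 * (1 / \<kappa>^2 * Pseq \<gamma> v n) \<le> M / \<kappa>^2 * v n"
  proof -
    have "1 / \<kappa>^2 * (Pseq \<gamma> v n * (cmod (z - \<gamma> n))^2) \<le> 1 / \<kappa>^2 * (M * v n)"
      using D(3) k2 by (intro mult_left_mono) auto
    thus ?thesis by (simp add: mult_ac)
  qed
  have b2: "(cmod (z - \<gamma> n))^2 * f n = v n" using d by (simp add: f_def)
  have "(cmod (z - \<gamma> n))^2 * ker z \<le> (cmod (z - \<gamma> n))^2 * (V n / (\<kappa>^2 * (cmod z)^2) + (f n + 1 / \<kappa>^2 * Pseq \<gamma> v n))"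
    unfolding ker using below above d by (intro mult_left_mono) auto
  also have "\<dots> \<le> M / \<kappa>^2 * v n + (v n + M / \<kappa>^2 * v n)"
    unfolding distrib_left b2 using b1 b3 by linarith
  also have "\<dots> = (1 + 2 * M / \<kappa>^2) * v n" by (simp add: distrib_right)
  finally show ?thesis .
qed

text \<open>\<open>w_le\<close> holds since the kernel is at least its term of index
  \<open>n\<close>, \<open>w_ge\<close> by \<open>ker_le_D\<close>; \<open>N1\<close> is raised
  until the points of D lie within half the modulus of their poles.\<close>

lemma D_tail_rows:
  assumes D: "\<And>n. n > N \<Longrightarrow> l n \<in> Dset \<gamma> v M n" and w: "\<And>n. n > N \<Longrightarrow> w n = inverse (ker (l n))"
    and ne: "\<And>n k. n > N \<Longrightarrow> l n \<noteq> \<gamma> k" and inj: "inj_on l {N<..}"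
  obtains M' N1 where "N1 \<ge> N" "tail_rows \<gamma> v q N0 l w M' N1"
proof -
  obtain Na where Na: "\<And>n z. n \<ge> Na \<Longrightarrow> z \<in> Dset \<gamma> v M n \<Longrightarrow> cmod (z - \<gamma> n) \<le> 1 / 2 * g n"
    using Dset_close[of "1 / 2" M] by auto
  define N1 where "N1 = max (max N N0) Na"
  define M' where "M' = max (1 + 2 * M / \<kappa>^2) (max M 1)"
  have M': "M' \<ge> 1 + 2 * M / \<kappa>^2" "M' \<ge> M" "M' \<ge> 1" by (auto simp: M'_def)
  have "tail_rows \<gamma> v q N0 l w M' N1"
  proof
    show "M' \<ge> 1" "N1 \<ge> N0" using M' by (auto simp: N1_def)
    fix n assume n: "n > N1"
    hence n': "n > N" "n \<ge> 2" "n \<ge> 1" "n \<ge> Na" using N0(1) by (auto simp: N1_def)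
    have z: "l n \<in> Dset \<gamma> v M n" using D n' by simp
    note d = DsetD[OF z n'(2)]
    have kp: "ker (l n) > 0" using ker_pos[OF ne[OF n'(1)]] .
    have vn: "v n > 0" using v_pos n' by simp
    have dp: "0 < (cmod (l n - \<gamma> n))^2" using d(4) by simp
    have wk: "w n * ker (l n) = 1" using w[OF n'(1)] kp by simp
    show "l n \<in> Omega \<gamma> n" by (rule d(1))
    show wp: "w n > 0" using w[OF n'(1)] kp by simp
    have "v n \<le> (cmod (l n - \<gamma> n))^2 * ker (l n)"
      using ker_ge[OF n'(3), of "l n"] dp by (simp add: pos_divide_le_eq mult.commute)
    hence "w n * v n \<le> w n * ((cmod (l n - \<gamma> n))^2 * ker (l n))" using wp by (intro mult_left_mono) auto
    also have "\<dots> = (cmod (l n - \<gamma> n))^2 * (w n * ker (l n))" by simp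
    finally show "w n * v n \<le> (cmod (l n - \<gamma> n))^2" unfolding wk by simp
    have "(cmod (l n - \<gamma> n))^2 * ker (l n) \<le> M' * v n"
      using ker_le_D[OF z n'(2)] mult_right_mono[OF M'(1), of "v n"] vn by linarith
    hence "w n * ((cmod (l n - \<gamma> n))^2 * ker (l n)) \<le> w n * (M' * v n)" using wp by (intro mult_left_mono) auto
    moreover have "w n * ((cmod (l n - \<gamma> n))^2 * ker (l n)) = (cmod (l n - \<gamma> n))^2 * (w n * ker (l n))" by simp
    moreover have "\<dots> = (cmod (l n - \<gamma> n))^2" unfolding wk by simp
    moreover have "w n * (M' * v n) = M' * (w n * v n)" by simp
    ultimately show "(cmod (l n - \<gamma> n))^2 \<le> M' * (w n * v n)" by linarith
    have "M * (v n * (cmod (l n))^2) \<le> M' * (v n * (cmod (l n))^2)" using M'(2) vn by (intro mult_right_mono) auto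
    thus "V n * (cmod (l n - \<gamma> n))^2 \<le> M' * (v n * (cmod (l n))^2)" using d(2) by linarith
    show "cmod (l n - \<gamma> n) \<le> g n / 2" using Na[OF n'(4) z] by simp
    show "l n \<noteq> \<gamma> k" for k by (rule ne[OF n'(1)])
  next
    show "inj_on l {N1<..}" by (rule inj_on_subset[OF inj]) (auto simp: N1_def)
  qed
  moreover have "N1 \<ge> N" by (simp add: N1_def)
  ultimately show thesis using that by blast
qed

end

context tail_rows
begin

text \<open>Finitely many extra rows hardly see residues supported far out, since the kernels at the
  points \<open>p j\<close> have small tails there; the off-diagonal part is small as well. Each of
  the two takes a quarter of the norm, and a lower bound by the main part alone remains.\<close>

lemma main_op_below:
  fixes p :: "'j \<Rightarrow> complex" and \<omega> :: "'j \<Rightarrow> real"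
  assumes J: "finite J" and \<omega>: "\<And>j. j \<in> J \<Longrightarrow> 0 \<le> \<omega> j" and K: "K > 0"
    and below: "\<And>c. c \<in> supp_space (col_weight v 1) {1..} \<Longrightarrow> nsq (col_weight v 1) c \<le>
      K * ((\<Sum>j\<in>J. (cmod (ctrans \<gamma> c (p j)))^2 * \<omega> j) + sqsum w {N1<..} (\<lambda>n. ctrans \<gamma> c (l n)))"
  shows "\<exists>N\<ge>N1. \<forall>c L. c \<in> supp_space (col_weight v 1) {N<..} \<longrightarrow> (\<forall>k\<ge>L. c k = 0) \<longrightarrow>
      (\<forall>n\<ge>L. main_op c n = 0) \<longrightarrow> nsq (col_weight v 1) c \<le> 4 * K * (\<Sum>n=Suc N..<L. (cmod (main_op c n))^2 * w n)"
proof -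
  interpret poles \<gamma> "col_weight v 1" by (rule poles_axiom) simp
  define \<epsilon> where "\<epsilon> = 1 / (8 * K * Koff)"
  have eps: "\<epsilon> > 0" using K Koff_pos by (simp add: \<epsilon>_def)
  define f where "f k = (\<Sum>j\<in>J. \<omega> j * (v k / (cmod (p j - \<gamma> k))^2))" for k
  have fs: "f summable_on {1..}" unfolding f_def
    by (rule infsum_finite_sum(1)[OF J]) (intro summable_on_cmult_right ker_summable)
  have f0: "0 \<le> f k" if "k \<ge> 1" for k unfolding f_def using \<omega> v_nonneg[OF that] by (intro sum_nonneg) auto
  obtain Na where Na: "Na \<ge> N1" "\<And>n. n \<ge> Na \<Longrightarrow> (\<Sum>\<^sub>\<infinity>k\<in>{n<..}. f k) \<le> 1 / (4 * K)"
    using infsum_tail_small[OF fs f0, of "1 / (4 * K)" N1] K by auto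
  obtain Nb where Nb: "Nb \<ge> N0" "\<And>k. k \<ge> Nb \<Longrightarrow> v k \<le> \<epsilon> * V k" using v_eventually_small[OF eps] by blast
  define N where "N = max Na Nb"
  have N: "N \<ge> N1" using Na by (simp add: N_def)
  show ?thesis
  proof (intro exI[of _ N] conjI allI impI N)
    fix c L assume c: "c \<in> supp_space (col_weight v 1) {N<..}" and cL: "\<forall>k\<ge>L. c k = 0"
      and mL: "\<forall>n\<ge>L. main_op c n = 0"
    define X where "X = nsq (col_weight v 1) c"
    define S where "S = (\<Sum>n=Suc N..<L. (cmod (main_op c n))^2 * w n)"
    have cn: "c \<in> supp_space (col_weight v 1) (near_cols N)" by (rule supp_space_mono[OF _ c]) (auto simp: near_cols_def)
    have c1: "c \<in> supp_space (col_weight v 1) {1..}" by (rule supp_space_mono[OF _ c]) auto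
    have X0: "X \<ge> 0" by (simp add: X_def)
    have ev: "v k \<le> \<epsilon> * V k" if "k > N" for k using Nb that by (simp add: N_def)
    note off = off_op_summable[OF _ N cn ev, simplified] off_op_le[OF _ N cn ev, simplified]
    have m0: "main_op c n = 0" if "n \<le> N" for n
      using supp_spaceD[OF c] that by (auto simp: main_op_def)
    have ms: "((\<lambda>n. (cmod (main_op c n))^2 * w n) has_sum S) {N1<..}"
      unfolding S_def
    proof (rule has_sum_finite_neutralI)
      show "(cmod (main_op c n))^2 * w n = 0" if "n \<in> {N1<..} - {Suc N..<L}" for n
        using that m0[of n] mL by force
    qed (use N in auto)
    have rows: "sqsum w {N1<..} (\<lambda>n. ctrans \<gamma> c (l n)) \<le> 2 * S + 2 * (Koff * \<epsilon> * X)"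
    proof -
      have w0: "n \<in> {N1<..} \<Longrightarrow> 0 \<le> w n" for n using w_pos[of n] by simp
      have "sqsum w {N1<..} (\<lambda>n. ctrans \<gamma> c (l n)) = sqsum w {N1<..} (\<lambda>n. main_op c n + off_op c n)"
        by (rule infsum_cong) (use ctrans_split[OF _ N cn] in auto)
      also have "\<dots> \<le> 2 * sqsum w {N1<..} (main_op c) + 2 * sqsum w {N1<..} (off_op c)"
        by (rule wsq_summable_add(2)[OF w0 has_sum_imp_summable[OF ms] off(1)])
      also have "\<dots> \<le> 2 * S + 2 * (Koff * \<epsilon> * X)" unfolding infsumI[OF ms] using off(2) by (simp add: X_def)
      finally show ?thesis .
    qed
    have low: "(\<Sum>j\<in>J. (cmod (ctrans \<gamma> c (p j)))^2 * \<omega> j) \<le> X * (1 / (4 * K))"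
    proof -
      have ts: "(\<lambda>k. v k / (cmod (z - \<gamma> k))^2) summable_on {N<..}" for z
        by (rule summable_on_subset_banach[OF ker_summable]) auto
      have "(\<Sum>j\<in>J. (cmod (ctrans \<gamma> c (p j)))^2 * \<omega> j) \<le> (\<Sum>j\<in>J. X * (\<Sum>\<^sub>\<infinity>k\<in>{N<..}. \<omega> j * (v k / (cmod (p j - \<gamma> k))^2)))"
      proof (rule sum_mono)
        fix j assume j: "j \<in> J"
        have "(cmod (ctrans \<gamma> c (p j)))^2 \<le> X * (\<Sum>\<^sub>\<infinity>k\<in>{N<..}. inverse (col_weight v 1 k) / (cmod (p j - \<gamma> k))^2)"
          unfolding X_def by (rule ctrans_sq_le[OF c])
        also have "(\<Sum>\<^sub>\<infinity>k\<in>{N<..}. inverse (col_weight v 1 k) / (cmod (p j - \<gamma> k))^2) = (\<Sum>\<^sub>\<infinity>k\<in>{N<..}. v k / (cmod (p j - \<gamma> k))^2)"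
          by (rule infsum_cong) (auto simp: col_weight_def)
        finally have "(cmod (ctrans \<gamma> c (p j)))^2 * \<omega> j \<le> X * (\<Sum>\<^sub>\<infinity>k\<in>{N<..}. v k / (cmod (p j - \<gamma> k))^2) * \<omega> j"
          using \<omega>[OF j] by (intro mult_right_mono)
        thus "(cmod (ctrans \<gamma> c (p j)))^2 * \<omega> j \<le> X * (\<Sum>\<^sub>\<infinity>k\<in>{N<..}. \<omega> j * (v k / (cmod (p j - \<gamma> k))^2))"
          unfolding infsum_cmult_right' by (simp add: mult_ac)
      qed
      also have "\<dots> = X * (\<Sum>\<^sub>\<infinity>k\<in>{N<..}. f k)"
        unfolding sum_distrib_left[symmetric] f_def
        by (rule arg_cong[OF infsum_finite_sum(2)[OF J summable_on_cmult_right[OF ts]]])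
      also have "\<dots> \<le> X * (1 / (4 * K))" using Na(2)[of N] X0 by (intro mult_left_mono) (auto simp: N_def)
      finally show ?thesis .
    qed
    have "X \<le> K * (X * (1 / (4 * K)) + (2 * S + 2 * (Koff * \<epsilon> * X)))"
      unfolding X_def by (rule order_trans[OF below[OF c1]]) (use low rows K in \<open>auto simp: X_def intro!: mult_left_mono add_mono\<close>)
    also have "\<dots> = X / 4 + 2 * K * S + X / 4"
    proof -
      have "K * Koff * \<epsilon> = 1 / 8" using K Koff_pos by (simp add: \<epsilon>_def)
      hence "2 * (K * Koff * \<epsilon>) * X = X / 4" by simp
      hence "K * (2 * (Koff * \<epsilon> * X)) = X / 4" by (simp only: mult_ac)
      moreover have "K * (X * (1 / (4 * K))) = X / 4" using K by simp
      moreover have "K * (2 * S) = 2 * K * S" by simp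
      ultimately show ?thesis unfolding distrib_left by linarith
    qed
    finally have "X \<le> 4 * K * S" by simp
    thus "nsq (col_weight v 1) c \<le> 4 * K * (\<Sum>n=Suc N..<L. (cmod (main_op c n))^2 * w n)" by (simp add: X_def S_def)
  qed
qed

theorem tail_growth:
  fixes p :: "'j \<Rightarrow> complex" and \<omega> :: "'j \<Rightarrow> real"
  assumes J: "finite J" and \<omega>: "\<And>j. j \<in> J \<Longrightarrow> 0 \<le> \<omega> j" and K: "K > 0"
    and below: "\<And>c. c \<in> supp_space (col_weight v 1) {1..} \<Longrightarrow> nsq (col_weight v 1) c \<le>
      K * ((\<Sum>j\<in>J. (cmod (ctrans \<gamma> c (p j)))^2 * \<omega> j) + sqsum w {N1<..} (\<lambda>n. ctrans \<gamma> c (l n)))"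
    and Q: "\<And>n L. N1 < n \<Longrightarrow> n < L \<Longrightarrow> V n * (\<Sum>j=n..<L. qcoef j) \<le> BQ"
  shows "\<exists>N' C \<delta>. C > 0 \<and> 0 < \<delta> \<and> \<delta> \<le> 1 \<and>
    ((\<forall>n m. N' < n \<longrightarrow> n \<le> m \<longrightarrow> R m / R n \<le> C * (V m / V n) powr (1 - \<delta>)) \<or>
     (\<forall>n m. N' < n \<longrightarrow> n \<le> m \<longrightarrow> R m / R n \<ge> C * (V m / V n) powr (1 + \<delta>)))"
proof -
  have "\<exists>N\<ge>N1. \<forall>c L. c \<in> supp_space (col_weight v 1) {N<..} \<longrightarrow> (\<forall>k\<ge>L. c k = 0) \<longrightarrow>
      (\<forall>n\<ge>L. main_op c n = 0) \<longrightarrow> nsq (col_weight v 1) c \<le> 4 * K * (\<Sum>n=Suc N..<L. (cmod (main_op c n))^2 * w n)"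
    by (rule main_op_below[OF J \<omega> K below]) assumption+
  then obtain N where N: "N \<ge> N1" and bel: "\<And>c L. c \<in> supp_space (col_weight v 1) {N<..} \<Longrightarrow> (\<forall>k\<ge>L. c k = 0) \<Longrightarrow>
      (\<forall>n\<ge>L. main_op c n = 0) \<Longrightarrow> nsq (col_weight v 1) c \<le> 4 * K * (\<Sum>n=Suc N..<L. (cmod (main_op c n))^2 * w n)"
    by blast
  have K4: "4 * K \<ge> 0" using K by simp
  show ?thesis
  proof (rule growth_dichotomy[OF Q N])
    show "0 < 8 + 2 * (4 * K)" using K by simp
    fix n m l' :: nat assume "N < n" "n \<le> m" "m < l'"
    have hardy: "(\<Sum>n=Suc N..<L. hcoef n * (y n)^2) \<le> (8 + 2 * (4 * K)) * (\<Sum>n=Suc N..<Suc L. (y n - y (n - 1))^2 / ucoef n)"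
      if "y N = 0" "\<And>n. n \<ge> L \<Longrightarrow> y n = 0" "N < L" for y L
    proof (rule Hardy_from_below[OF N])
      show "nsq (col_weight v 1) c \<le> 4 * K * (\<Sum>n=Suc N..<L. (cmod (main_op c n))^2 * w n)"
        if "c \<in> supp_space (col_weight v 1) {N<..}" "\<And>k. k \<ge> L \<Longrightarrow> c k = 0" "\<And>n. n \<ge> L \<Longrightarrow> main_op c n = 0" for c L
        using bel[OF that(1)] that(2,3) by blast
    qed (use K4 that in auto)
    show "(\<Sum>j=n..m. hcoef j) \<le> (8 + 2 * (4 * K)) * (1 / (\<Sum>j=Suc N..n. ucoef j) + 1 / ((\<Sum>j=Suc N..l'. ucoef j) - (\<Sum>j=Suc N..m. ucoef j)))"
      by (rule capacity_bound[OF N hardy \<open>N < n\<close> \<open>n \<le> m\<close> \<open>m < l'\<close>])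
  qed
qed

end

subsection \<open>Systems whose rows approach the poles\<close>

text \<open>Because \<open>G\<close> is multiplicative, a pair reaching across the threshold splits
  at \<open>Suc N\<close> into one of finitely many values and one that is already bounded. This
  carries an eventual growth condition down to index 1.\<close>

lemma cocycle_bounded:
  fixes G :: "nat \<Rightarrow> nat \<Rightarrow> real"
  assumes mult: "\<And>n k m. 1 \<le> n \<Longrightarrow> n \<le> k \<Longrightarrow> k \<le> m \<Longrightarrow> G n m = G n k * G k m"
    and pos: "\<And>n m. 1 \<le> n \<Longrightarrow> n \<le> m \<Longrightarrow> G n m > 0"
    and bd: "\<And>n m. N < n \<Longrightarrow> n \<le> m \<Longrightarrow> G n m \<le> C"
  shows "\<exists>C>0. \<forall>n m. 1 \<le> n \<longrightarrow> n \<le> m \<longrightarrow> G n m \<le> C"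
proof -
  define A where "A = Max (insert 1 ((\<lambda>(n, m). G n m) ` ({..Suc N} \<times> {..Suc N})))"
  have A: "A \<ge> 1" unfolding A_def by (rule Max_ge) auto
  have AG: "G n m \<le> A" if "n \<le> Suc N" "m \<le> Suc N" for n m
    unfolding A_def by (rule Max_ge) (use that in auto)
  define C1 where "C1 = max C 1"
  have C1: "C1 \<ge> 1" "C \<le> C1" by (auto simp: C1_def)
  have "G n m \<le> A * C1" if n: "1 \<le> n" "n \<le> m" for n m
  proof -
    have a: "x \<le> A \<Longrightarrow> 0 \<le> y \<Longrightarrow> y \<le> C1 \<Longrightarrow> x * y \<le> A * C1" for x y using A by (intro mult_mono) auto
    consider "N < n" | "m \<le> Suc N" | "n \<le> Suc N" "Suc N \<le> m" using n by linarith
    thus ?thesis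
    proof cases
      case 1
      hence "1 * G n m \<le> A * C1" using bd[of n m] n C1 A pos[OF n] by (intro a) auto
      thus ?thesis by simp
    next
      case 2
      hence "G n m * 1 \<le> A * C1" using AG[of n m] n C1 by (intro a) auto
      thus ?thesis by simp
    next
      case 3
      have "G n (Suc N) * G (Suc N) m \<le> A * C1"
        using AG[of n "Suc N"] bd[of "Suc N" m] pos[of "Suc N" m] 3 C1 by (intro a) auto
      thus ?thesis using mult[of n "Suc N" m] n 3 by simp
    qed
  qed
  moreover have "A * C1 > 0" using A C1 by simp
  ultimately show ?thesis by blast
qed

lemma interp_sys_cong_cols:
  assumes "\<And>k. k \<in> C \<Longrightarrow> u k = u' k"
  shows "interp_sys \<gamma> u C R l w \<longleftrightarrow> interp_sys \<gamma> u' C R l w"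
proof -
  have e: "(\<lambda>k. (cmod (c k))^2 * u k) = (\<lambda>k. (cmod (c k))^2 * u' k)" if c: "\<forall>k. k \<notin> C \<longrightarrow> c k = 0" for c :: "nat \<Rightarrow> complex"
  proof
    fix k show "(cmod (c k))^2 * u k = (cmod (c k))^2 * u' k" using c assms[of k] by (cases "k \<in> C") auto
  qed
  have "c \<in> supp_space u C \<longleftrightarrow> c \<in> supp_space u' C" for c
    unfolding supp_space_def mem_Collect_eq using e[of c] by auto
  hence s: "supp_space u C = supp_space u' C" by blast
  have n: "nsq u c = nsq u' c" if "c \<in> supp_space u' C" for c
    using e[of c] that by (simp add: nsq_def supp_space_def)
  show ?thesis unfolding interp_sys_def s by (simp add: n cong: bex_cong)
qed

text \<open>Quotient of two values of \<rho>; unlike \<rho> itself it does not refer to the index at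
  which the rows begin.\<close>

definition ratio :: "(nat \<Rightarrow> complex) \<Rightarrow> (nat \<Rightarrow> complex) \<Rightarrow> nat \<Rightarrow> nat \<Rightarrow> real" where
  "ratio \<gamma> l n m = (\<Prod>j\<in>{n<..m}. (cmod (\<gamma> j))^2 / (cmod (l j))^2)"

abbreviation upper_growth :: "(nat \<Rightarrow> complex) \<Rightarrow> (nat \<Rightarrow> real) \<Rightarrow> (nat \<Rightarrow> complex) \<Rightarrow> bool" where
  "upper_growth \<gamma> v l \<equiv> \<exists>C N \<delta>. \<delta> > 0 \<and> (\<forall>n m. N < n \<longrightarrow> n \<le> m \<longrightarrow> ratio \<gamma> l n m \<le> C * (Vseq v m / Vseq v n) powr (1 - \<delta>))"

abbreviation lower_growth :: "(nat \<Rightarrow> complex) \<Rightarrow> (nat \<Rightarrow> real) \<Rightarrow> (nat \<Rightarrow> complex) \<Rightarrow> bool" where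
  "lower_growth \<gamma> v l \<equiv> \<exists>C N \<delta>. C > 0 \<and> \<delta> > 0 \<and> (\<forall>n m. N < n \<longrightarrow> n \<le> m \<longrightarrow> ratio \<gamma> l n m \<ge> C * (Vseq v m / Vseq v n) powr (1 + \<delta>))"

lemma ratio_mult: "n \<le> k \<Longrightarrow> k \<le> m \<Longrightarrow> ratio \<gamma> l n m = ratio \<gamma> l n k * ratio \<gamma> l k m"
  unfolding ratio_def by (subst prod.union_disjoint[symmetric]) (auto simp: ivl_disj_un)

context tail_rows
begin

lemma R_ratio: "N1 \<le> n \<Longrightarrow> n \<le> m \<Longrightarrow> R m / R n = ratio \<gamma> l n m"
proof -
  assume n: "N1 \<le> n" and nm: "n \<le> m"
  have "R m = R n * ratio \<gamma> l n m"
    using nm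
  proof (induction m rule: dec_induct)
    case (step m)
    have "ratio \<gamma> l n (Suc m) = ratio \<gamma> l n m * ((g (Suc m))^2 / (cmod (l (Suc m)))^2)"
    proof -
      have "{m<..Suc m} = {Suc m}" by auto
      hence "ratio \<gamma> l m (Suc m) = (g (Suc m))^2 / (cmod (l (Suc m)))^2" by (simp add: ratio_def)
      thus ?thesis using ratio_mult[of n m "Suc m" \<gamma> l] step(1) by simp
    qed
    thus ?case using step R_Suc[of m] n by simp
  qed (simp add: ratio_def)
  thus ?thesis using R_pos[of n] by simp
qed

end

text \<open>Rows renumbered to match the poles, starting at \<open>n1\<close>: the case
  \<open>n1 = 1\<close> is an exact perturbation, \<open>n1 = 2\<close> one of deficiency 1.
  \<open>D\<close> and \<open>Q\<close> are asked for eventually and with finite sums, the form in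
  which the tail estimates use them.\<close>

locale asymptotic_rows = lacunary +
  fixes l :: "nat \<Rightarrow> complex" and w :: "nat \<Rightarrow> real" and n1 :: nat
  assumes n1: "n1 \<ge> 1"
    and l_ne: "n \<ge> n1 \<Longrightarrow> l n \<noteq> \<gamma> k"
    and l_inj: "inj_on l {n1..}"
    and w_def: "n \<ge> n1 \<Longrightarrow> w n = inverse (ker (l n))"
    and D: "\<exists>M N. \<forall>n\<ge>N. l n \<in> Dset \<gamma> v M n"
    and Q: "\<exists>B N. \<forall>n\<ge>N. \<forall>L>n. V n * (\<Sum>j=n..<L. w j / (cmod (l j))^2) \<le> B"
begin

lemma w_pos: "n \<ge> n1 \<Longrightarrow> w n > 0"
  using ker_pos[OF l_ne[of n]] w_def[of n] by simp

lemma tail_exists: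
  "\<exists>M N1 B. N1 > N \<and> B \<ge> 0 \<and> tail_rows \<gamma> v q N0 l w M N1 \<and>
    (\<forall>n L. N1 < n \<longrightarrow> n < L \<longrightarrow> V n * (\<Sum>j=n..<L. w j / (cmod (l j))^2) \<le> B)"
proof -
  obtain M Na where Na: "\<And>n. n \<ge> Na \<Longrightarrow> l n \<in> Dset \<gamma> v M n" using D by blast
  obtain B Nb where Nb: "\<And>n L. n \<ge> Nb \<Longrightarrow> n < L \<Longrightarrow> V n * (\<Sum>j=n..<L. w j / (cmod (l j))^2) \<le> B" using Q by blast
  define N' where "N' = Na + Nb + n1 + Suc N"
  obtain M' N1 where N1: "N1 \<ge> N'" "tail_rows \<gamma> v q N0 l w M' N1"
  proof (rule D_tail_rows[of N' l M w])
    show "inj_on l {N'<..}" by (rule inj_on_subset[OF l_inj]) (auto simp: N'_def)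
  qed (use Na w_def l_ne in \<open>auto simp: N'_def\<close>)
  have "N1 > N" using N1 by (simp add: N'_def)
  moreover have "V n * (\<Sum>j=n..<L. w j / (cmod (l j))^2) \<le> max B 0" if "N1 < n" "n < L" for n L
    using Nb[of n L] that N1 by (simp add: N'_def)
  ultimately show ?thesis using N1(2) by (intro exI[of _ M'] exI[of _ N1] exI[of _ "max B 0"]) simp
qed

text \<open>Far out \<open>cmod (l n - \<gamma> p)\<close> is at least half of
  \<open>cmod (l n)\<close>, which reduces the column to the sums bounded by
  \<open>Q\<close>.\<close>

lemma col_summable: "(\<lambda>n. w n / (cmod (l n - \<gamma> p))^2) summable_on {n1..}"
proof -
  obtain M N1 B where t: "N1 > n1" "tail_rows \<gamma> v q N0 l w M N1"
    "\<And>n L. N1 < n \<Longrightarrow> n < L \<Longrightarrow> V n * (\<Sum>j=n..<L. w j / (cmod (l j))^2) \<le> B" using tail_exists[of n1] by blast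
  interpret T: tail_rows \<gamma> v q N0 l w M N1 by (rule t(2))
  have "eventually (\<lambda>n. 4 * g p \<le> g n) sequentially" using g_at_top by (simp add: filterlim_at_top)
  then obtain N2 where N2: "\<And>n. n \<ge> N2 \<Longrightarrow> 4 * g p \<le> g n" by (auto simp: eventually_sequentially)
  define N where "N = Suc (max N1 N2)"
  have "(\<lambda>n. w n / (cmod (l n - \<gamma> p))^2) summable_on {N..}"
  proof (rule nonneg_bounded_summable(1))
    fix n assume n: "n \<in> {N..}"
    show "0 \<le> w n / (cmod (l n - \<gamma> p))^2" using T.w_pos[of n] n by (auto simp: N_def less_imp_le)
  next
    fix F assume F: "finite F" "F \<subseteq> {N..}"
    obtain L where L: "F \<subseteq> {N..<L}" "N < L"
    proof
      show "F \<subseteq> {N..<Suc (max N (Max F))}" using F by (auto simp: less_Suc_eq_le le_max_iff_disj)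
    qed simp
    have "(\<Sum>n\<in>F. w n / (cmod (l n - \<gamma> p))^2) \<le> (\<Sum>n\<in>F. 4 * (w n / (cmod (l n))^2))"
    proof (rule sum_mono)
      fix n assume "n \<in> F"
      hence n: "n > N1" "n \<ge> N2" using F by (auto simp: N_def)
      have lp: "cmod (l n) > 0" using T.l_nz[OF n(1)] by simp
      have "2 * g p \<le> cmod (l n)" using N2[OF n(2)] T.l_bounds(1)[OF n(1)] by linarith
      hence "cmod (l n) / 2 \<le> cmod (l n - \<gamma> p)" using norm_triangle_ineq2[of "l n" "\<gamma> p"] by linarith
      hence "w n / (cmod (l n - \<gamma> p))^2 \<le> w n / (cmod (l n) / 2)^2"
        using T.w_pos[OF n(1)] lp by (intro frac_le power_mono zero_less_power) auto
      thus "w n / (cmod (l n - \<gamma> p))^2 \<le> 4 * (w n / (cmod (l n))^2)" by (simp add: power_divide mult_ac)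
    qed
    also have "\<dots> \<le> (\<Sum>n\<in>{N..<L}. 4 * (w n / (cmod (l n))^2))"
    proof (rule sum_mono2)
      fix n assume "n \<in> {N..<L} - F"
      thus "0 \<le> 4 * (w n / (cmod (l n))^2)" using T.w_pos[of n] by (auto simp: N_def less_imp_le)
    qed (use L in auto)
    also have "\<dots> \<le> 4 * (B / V N)"
      unfolding sum_distrib_left[symmetric] using t(3)[of N L] L V_pos[of N] by (simp add: N_def pos_le_divide_eq mult.commute)
    finally show "(\<Sum>n\<in>F. w n / (cmod (l n - \<gamma> p))^2) \<le> 4 * (B / V N)" .
  qed
  hence "(\<lambda>n. w n / (cmod (l n - \<gamma> p))^2) summable_on ({n1..<N} \<union> {N..})"
    by (intro summable_on_Un_disjoint) auto
  moreover have "{n1..<N} \<union> {N..} = {n1..}" using t(1) by (auto simp: N_def)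
  ultimately show ?thesis by simp
qed

text \<open>Pole \<open>n\<close> and row \<open>n\<close> are added together, going down to
  \<open>n1\<close>; an auxiliary pole in \<open>C\<close> is left in place.\<close>

lemma insert_matching:
  assumes s: "s > 0" and sys: "interp_sys \<gamma> (col_weight v s) (C \<union> {N..}) {N..} l w"
    and N: "n1 \<le> N" and C: "C \<subseteq> {0}"
  shows "interp_sys \<gamma> (col_weight v s) (C \<union> {n1..}) {n1..} l w"
proof -
  have "n1 \<le> n \<Longrightarrow> interp_sys \<gamma> (col_weight v s) (C \<union> {n..}) {n..} l w" if "n \<le> N" for n
    using that
  proof (induction n rule: inc_induct)
    case base show ?case by (rule sys)
  next
    case (step n)
    have IH: "interp_sys \<gamma> (col_weight v s) (C \<union> {Suc n..}) {Suc n..} l w" using step by simp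
    interpret poles \<gamma> "col_weight v s" by (rule poles_axiom[OF s])
    have e: "{n..} = insert n {Suc n..}" by auto
    have n: "n \<ge> 1" using step n1 by simp
    have "interp_sys \<gamma> (col_weight v s) (insert n (C \<union> {Suc n..})) (insert n {Suc n..}) l w"
    proof (rule interp_sys_insert[OF IH])
      show "n \<notin> C \<union> {Suc n..}" using C n by auto
      show "w j > 0" if "j \<in> insert n {Suc n..}" for j by (rule w_pos) (use that step in auto)
      show "l j \<noteq> l n" if "j \<in> {Suc n..}" for j
      proof
        assume "l j = l n"
        hence "j = n" by (rule inj_onD[OF l_inj]) (use that step in auto)
        thus False using that by simp
      qed
      show "l j \<noteq> \<gamma> k" if "j \<in> insert n {Suc n..}" for j k by (rule l_ne) (use that step in auto)
      show "(\<lambda>j. w j / (cmod (l j - \<gamma> n))^2) summable_on {Suc n..}"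
        by (rule summable_on_subset_banach[OF col_summable]) (use step in auto)
    qed simp
    thus ?case unfolding e by simp
  qed
  thus ?thesis using N by blast
qed

lemma exact_system:
  assumes gr: "upper_growth \<gamma> v l"
  shows "interp_sys \<gamma> (col_weight v 1) {n1..} {n1..} l w"
proof -
  obtain C N \<delta> where d: "\<delta> > 0" and g: "\<And>n m. N < n \<Longrightarrow> n \<le> m \<Longrightarrow> ratio \<gamma> l n m \<le> C * (V m / V n) powr (1 - \<delta>)"
    using gr by blast
  obtain M N1 B where t: "N1 > max N n1" "B \<ge> 0" "tail_rows \<gamma> v q N0 l w M N1"
    "\<And>n L. N1 < n \<Longrightarrow> n < L \<Longrightarrow> V n * (\<Sum>j=n..<L. w j / (cmod (l j))^2) \<le> B" using tail_exists[of "max N n1"] by blast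
  interpret T: tail_rows \<gamma> v q N0 l w M N1 by (rule t(3))
  \<comment> \<open>Lowering \<open>\<delta>\<close> to at most 1 only weakens the condition,
    because \<open>V m / V n \<ge> 1\<close>.\<close>
  define \<delta>' where "\<delta>' = min \<delta> 1"
  have d': "0 < \<delta>'" "\<delta>' \<le> 1" "\<delta>' \<le> \<delta>" using d by (auto simp: \<delta>'_def)
  define C' where "C' = max C 1"
  have C': "C' \<ge> 1" "C \<le> C'" by (auto simp: C'_def)
  have gr': "T.R m / T.R n \<le> C' * (V m / V n) powr (1 - \<delta>')" if nm: "N1 \<le> n" "n < m" for n m
  proof -
    have n2: "n \<ge> 2" using nm T.N1 N0(1) by simp
    have "1 \<le> V m / V n" using V_mono[OF n2, of m] nm V_pos[of n] by simp
    hence p: "(V m / V n) powr (1 - \<delta>) \<le> (V m / V n) powr (1 - \<delta>')" using d' by (intro powr_mono) auto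
    have "T.R m / T.R n \<le> C * (V m / V n) powr (1 - \<delta>)" using T.R_ratio[of n m] g[of n m] nm t(1) by simp
    also have "\<dots> \<le> C' * (V m / V n) powr (1 - \<delta>)" using C' by (intro mult_right_mono) auto
    also have "\<dots> \<le> C' * (V m / V n) powr (1 - \<delta>')" using p C' by (intro mult_left_mono) auto
    finally show ?thesis .
  qed
  have "\<exists>N2\<ge>N1. \<forall>N\<ge>N2. \<forall>s>0. interp_sys \<gamma> (col_weight v s) {N<..} {N<..} l w"
  proof (rule T.tail_invertible_exact[OF t(4)])
    show "(\<Sum>j=Suc N..n. T.ucoef j) * (\<Sum>j=n..<L. T.hcoef j) \<le> (4 * C' / \<delta>') * (4 * M * C' * (B / \<delta>'))"
      if "N1 \<le> N" "N < n" "n < L" for N n L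
      by (rule T.XY_exact[OF t(4) d'(1,2) C'(1) gr' that])
    show "0 \<le> (4 * C' / \<delta>') * (4 * M * C' * (B / \<delta>'))" using C' d' T.M t(2) by (intro mult_nonneg_nonneg divide_nonneg_nonneg) auto
  qed
  then obtain N2 where N2: "N2 \<ge> N1" "interp_sys \<gamma> (col_weight v 1) {N2<..} {N2<..} l w" by auto
  have e: "{N2<..} = {Suc N2..}" by auto
  have "interp_sys \<gamma> (col_weight v 1) ({} \<union> {n1..}) {n1..} l w"
    by (rule insert_matching[of _ _ "Suc N2"]) (use N2 t(1) e in auto)
  thus ?thesis by simp
qed

lemma deficient_system:
  assumes gr: "lower_growth \<gamma> v l"
  shows "\<exists>s>0. interp_sys \<gamma> (col_weight v s) (insert 0 {n1..}) {n1..} l w"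
proof -
  obtain C N \<delta> where C: "C > 0" and d: "\<delta> > 0" and g: "\<And>n m. N < n \<Longrightarrow> n \<le> m \<Longrightarrow> ratio \<gamma> l n m \<ge> C * (V m / V n) powr (1 + \<delta>)"
    using gr by blast
  obtain M N1 B where t: "N1 > max N n1" "B \<ge> 0" "tail_rows \<gamma> v q N0 l w M N1"
    "\<And>n L. N1 < n \<Longrightarrow> n < L \<Longrightarrow> V n * (\<Sum>j=n..<L. w j / (cmod (l j))^2) \<le> B" using tail_exists[of "max N n1"] by blast
  interpret T: tail_rows \<gamma> v q N0 l w M N1 by (rule t(3))
  define \<delta>' where "\<delta>' = min \<delta> 1"
  have d': "0 < \<delta>'" "\<delta>' \<le> 1" "\<delta>' \<le> \<delta>" using d by (auto simp: \<delta>'_def)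
  define C' where "C' = min C 1"
  have C': "0 < C'" "C' \<le> 1" "C' \<le> C" using C by (auto simp: C'_def)
  have gr': "C' * (V m / V n) powr (1 + \<delta>') \<le> T.R m / T.R n" if nm: "N1 \<le> n" "n < m" for n m
  proof -
    have n2: "n \<ge> 2" using nm T.N1 N0(1) by simp
    have "1 \<le> V m / V n" using V_mono[OF n2, of m] nm V_pos[of n] by simp
    hence p: "(V m / V n) powr (1 + \<delta>') \<le> (V m / V n) powr (1 + \<delta>)" using d' by (intro powr_mono) auto
    have "C' * (V m / V n) powr (1 + \<delta>') \<le> C' * (V m / V n) powr (1 + \<delta>)" using p C' by (intro mult_left_mono) auto
    also have "\<dots> \<le> C * (V m / V n) powr (1 + \<delta>)" using C' by (intro mult_right_mono) auto
    also have "\<dots> \<le> T.R m / T.R n" using T.R_ratio[of n m] g[of n m] nm t(1) by simp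
    finally show ?thesis .
  qed
  define B' where "B' = max (4 / (C' * \<delta>')) (4 / (C' * \<delta>') * (12 * M * B / (C' * \<delta>')))"
  have "\<exists>N2\<ge>N1. \<forall>N\<ge>N2. interp_sys \<gamma> (col_weight v (1 / V (Suc N))) (T.near_cols N) {N<..} l w"
  proof (rule T.tail_invertible_deficient[OF t(4)])
    show "B' \<ge> 0" using C' d' by (auto simp: B'_def le_max_iff_disj)
    show "\<exists>n>N. T.R n > K * V (Suc n)" for K N by (rule T.R_unbounded[OF t(4) d'(1,2) C'(1,2) gr'])
    fix n L :: nat assume nL: "N1 < n" "n < L"
    show "(\<Sum>j=n..<L. T.ucoef j) * (\<Sum>j=Suc N1..n. T.hcoef j) \<le> B'"
      by (rule order_trans[OF T.XY_deficient[OF t(4) d'(1,2) C'(1,2) gr' nL]]) (auto simp: B'_def)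
    have "4 / (C' * \<delta>') * V n \<le> B' * V n" using V_pos[of n] by (intro mult_right_mono) (auto simp: B'_def)
    thus "(\<Sum>j=n..<L. T.ucoef j) * T.R n \<le> B' * V n"
      using T.XR_deficient[OF t(4) d'(1,2) C'(1,2) gr' nL] by linarith
  qed
  then obtain N2 where N2: "N2 \<ge> N1" "interp_sys \<gamma> (col_weight v (1 / V (Suc N2))) (T.near_cols N2) {N2<..} l w" by auto
  have e: "{N2<..} = {Suc N2..}" "T.near_cols N2 = {0} \<union> {Suc N2..}" by (auto simp: T.near_cols_def)
  have sp: "1 / V (Suc N2) > 0" using V_pos by simp
  have "interp_sys \<gamma> (col_weight v (1 / V (Suc N2))) ({0} \<union> {n1..}) {n1..} l w"
    by (rule insert_matching[OF sp N2(2)[unfolded e]]) (use N2 t(1) in auto)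
  thus ?thesis using sp by (intro exI[of _ "1 / V (Suc N2)"]) simp
qed

text \<open>The auxiliary pole is traded for the pole of index \<open>n1 - 1\<close> with the help of a dummy row.\<close>

lemma deficient_system_swap:
  assumes gr: "lower_growth \<gamma> v l"
    and n2: "n1 \<ge> 2"
  shows "interp_sys \<gamma> (col_weight v 1) {n1 - 1..} {n1..} l w"
proof -
  obtain s where s: "s > 0" "interp_sys \<gamma> (col_weight v s) (insert 0 {n1..}) {n1..} l w" using deficient_system[OF gr] by blast
  interpret poles \<gamma> "col_weight v s" by (rule poles_axiom[OF s(1)])
  define r where "r = n1 - 1"
  have r: "r \<ge> 1" "r < n1" "{r..} = insert r {n1..}" "{r..} = {n1 - 1..}" using n2 by (auto simp: r_def)
  \<comment> \<open>The dummy row sits at a point \<open>z\<close> that is neither a row nor a pole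
    and occupies the free index \<open>r = n1 - 1\<close>. Pole \<open>r\<close> enters together
    with it, then pole 0 leaves together with it.\<close>
  have "countable (range l \<union> range \<gamma>)" by simp
  then obtain z where z: "z \<notin> range l \<union> range \<gamma>" using uncountable_UNIV_complex by (metis UNIV_eq_I)
  define l' where "l' = l(r := z)"
  define w' where "w' = w(r := 1)"
  have l'_ne: "l' n \<noteq> \<gamma> k" if "n \<ge> r" for n k
    using z l_ne[of n k] that r(2) by (auto simp: l'_def r_def)
  have l'r: "l' n \<noteq> l' r" if "n \<ge> n1" for n using that r(2) z by (auto simp: l'_def)
  have w': "w' n > 0" if "n \<ge> r" for n using that w_pos[of n] by (auto simp: w'_def r_def)
  have eqs: "l n = l' n" "w n = w' n" if "n \<in> {n1..}" for n using that r by (auto simp: l'_def w'_def)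
  have s1: "interp_sys \<gamma> (col_weight v s) (insert 0 {n1..}) {n1..} l' w'"
    using s(2) interp_sys_cong_rows[of "{n1..}" l l' w w'] eqs by blast
  have "interp_sys \<gamma> (col_weight v s) (insert r (insert 0 {n1..})) (insert r {n1..}) l' w'"
  proof (rule interp_sys_insert[OF s1])
    show "(\<lambda>n. w' n / (cmod (l' n - \<gamma> r))^2) summable_on {n1..}"
      by (rule summable_on_cong[THEN iffD1, OF _ col_summable[of r]]) (use eqs in auto)
  qed (use r w' l'_ne l'r in auto)
  hence "interp_sys \<gamma> (col_weight v s) (insert 0 (insert r {n1..})) (insert r {n1..}) l' w'" by (simp add: insert_commute)
  hence "interp_sys \<gamma> (col_weight v s) (insert r {n1..}) {n1..} l' w'"
    by (rule interp_sys_remove) (use r l'_ne l'r n1 in auto)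
  hence "interp_sys \<gamma> (col_weight v s) {r..} {n1..} l w"
    unfolding r(3) using interp_sys_cong_rows[of "{n1..}" l l' w w'] eqs by blast
  \<comment> \<open>With pole 0 gone, the remaining weights are \<open>1 / v k\<close> whatever
    \<open>s\<close> is, so \<open>s\<close> may be replaced by 1.\<close>
  thus ?thesis
    unfolding r(4)[symmetric] by (rule interp_sys_cong_cols[THEN iffD1, rotated]) (use r in \<open>auto simp: col_weight_def\<close>)
qed

end

context global_sys
begin

text \<open>The shift found in \<open>row_structure\<close> gives \<open>D\<close>, and
  \<open>outer_bound\<close> gives \<open>Q\<close>, because the rows from \<open>n\<close> on lie
  outside the circle through \<open>\<gamma> (n - 1)\<close>.\<close>

lemma rows_shift:
  obtains n1 where "asymptotic_rows \<gamma> v q N0 (\<lambda>n. L (n - n1)) (\<lambda>n. W (n - n1)) n1"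
proof -
  obtain M N n1 where n1: "n1 \<ge> 1" "N \<ge> n1" and D: "\<And>n. n \<ge> N \<Longrightarrow> L (n - n1) \<in> Dset \<gamma> v M n" by (rule row_structure) (rule that; assumption)
  obtain B where B: "B > 0" "\<And>n F. n \<ge> 2 \<Longrightarrow> finite F \<Longrightarrow> (\<And>m. m \<in> F \<Longrightarrow> g (n - 1) < cmod (L m)) \<Longrightarrow>
     V n * (\<Sum>m\<in>F. W m / (cmod (L m))^2) \<le> B"
    "\<And>F. finite F \<Longrightarrow> (\<Sum>m\<in>F. W m / (cmod (L m - \<gamma> 1))^2) \<le> B" using outer_bound by blast
  have inj: "inj_on (\<lambda>n. n - n1) {n1..}" by (auto intro: inj_onI)
  have "asymptotic_rows \<gamma> v q N0 (\<lambda>n. L (n - n1)) (\<lambda>n. W (n - n1)) n1"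
  proof
    show "inj_on (\<lambda>n. L (n - n1)) {n1..}"
      using comp_inj_on[OF inj inj_on_subset[OF L_inj]] by (simp add: o_def)
    show "\<exists>M N. \<forall>n\<ge>N. L (n - n1) \<in> Dset \<gamma> v M n" using D by blast
    show "\<exists>B N. \<forall>n\<ge>N. \<forall>L'>n. V n * (\<Sum>j=n..<L'. W (j - n1) / (cmod (L (j - n1)))^2) \<le> B"
    proof (intro exI[of _ B] exI[of _ "N + 2"] allI impI)
      fix n L' assume n: "N + 2 \<le> n" "n < L'"
      have inj2: "inj_on (\<lambda>n. n - n1) {n..<L'}" by (rule inj_on_subset[OF inj]) (use n n1 in auto)
      have "(\<Sum>j=n..<L'. W (j - n1) / (cmod (L (j - n1)))^2) = (\<Sum>m\<in>(\<lambda>n. n - n1) ` {n..<L'}. W m / (cmod (L m))^2)"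
        by (simp add: sum.reindex[OF inj2])
      moreover have "V n * (\<Sum>m\<in>(\<lambda>n. n - n1) ` {n..<L'}. W m / (cmod (L m))^2) \<le> B"
      proof (rule B(2))
        fix m assume "m \<in> (\<lambda>n. n - n1) ` {n..<L'}"
        then obtain j where j: "j \<ge> n" "m = j - n1" by auto
        have "L m \<in> Omega \<gamma> j" using D[of j] j n by (simp add: Dset_def)
        hence "(g (j - 1) + g j) / 2 \<le> cmod (L m)" by (rule OmegaD) (use j n in simp)
        moreover have "g (n - 1) \<le> g (j - 1)" using j n by (intro g_mono) auto
        moreover have "g (j - 1) < g j"
        proof -
          have gj: "0 < g (j - 1)" "q * g (j - 1) \<le> g j" using g_pos[of "j - 1"] g_strict[of "j - 1" j] j n by auto
          have "g (j - 1) = 1 * g (j - 1)" by simp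
          also have "\<dots> < q * g (j - 1)" using q gj(1) by (rule mult_strict_right_mono)
          finally show ?thesis using gj(2) by (rule less_le_trans)
        qed
        ultimately show "g (n - 1) < cmod (L m)" by (simp add: field_simps)
      qed (use n in auto)
      ultimately show "V n * (\<Sum>j=n..<L'. W (j - n1) / (cmod (L (j - n1)))^2) \<le> B" by simp
    qed
  qed (use n1 L_ne W_def in auto)
  thus thesis by (rule that)
qed

text \<open>Whichever alternative of the dichotomy holds, it makes a reference system with the same
  rows invertible, whose poles are known in terms of \<open>n1\<close>. By
  \<open>interp_sys_unique\<close> these poles must coincide with the given ones, which determines
  \<open>n1\<close>.\<close>

theorem necessity:
  "\<exists>n1. asymptotic_rows \<gamma> v q N0 (\<lambda>n. L (n - n1)) (\<lambda>n. W (n - n1)) n1 \<and>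
    (n1 = 1 \<and> upper_growth \<gamma> v (\<lambda>n. L (n - n1)) \<or>
     n1 = 2 \<and> lower_growth \<gamma> v (\<lambda>n. L (n - n1)))"
proof -
  obtain n1 where rows: "asymptotic_rows \<gamma> v q N0 (\<lambda>n. L (n - n1)) (\<lambda>n. W (n - n1)) n1" by (rule rows_shift)
  define l where "l = (\<lambda>n. L (n - n1))"
  define w where "w = (\<lambda>n. W (n - n1))"
  have r': "asymptotic_rows \<gamma> v q N0 l w n1" unfolding l_def w_def by (rule rows)
  interpret A: asymptotic_rows \<gamma> v q N0 l w n1 by (rule r')
  interpret poles \<gamma> "col_weight v 1" by (rule poles_axiom) simp
  have inj: "inj_on (\<lambda>n. n - n1) {n1..}" by (auto intro: inj_onI)
  have img: "(\<lambda>n. n - n1) ` {n1..} = UNIV"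
  proof (intro set_eqI iffI UNIV_I)
    fix x show "x \<in> (\<lambda>n. n - n1) ` {n1..}" by (rule image_eqI[of _ _ "x + n1"]) auto
  qed
  have sys': "interp_sys \<gamma> (col_weight v 1) {1..} {n1..} l w"
    using sys interp_sys_reindex[OF inj, of \<gamma> "col_weight v 1" "{1..}" L W] by (simp add: img l_def w_def)
  obtain M N1 B where t: "N1 > n1" "B \<ge> 0" "tail_rows \<gamma> v q N0 l w M N1"
    "\<And>n L. N1 < n \<Longrightarrow> n < L \<Longrightarrow> V n * (\<Sum>j=n..<L. w j / (cmod (l j))^2) \<le> B" using A.tail_exists[of n1] by blast
  interpret T: tail_rows \<gamma> v q N0 l w M N1 by (rule t(3))
  obtain B0 where B0: "B0 \<ge> 0" "\<And>c. c \<in> supp_space (col_weight v 1) {1..} \<Longrightarrow>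
      nsq (col_weight v 1) c \<le> B0 * sqsum w {n1..} (\<lambda>n. ctrans \<gamma> c (l n))"
    using interp_sys_bounded_below[OF sys'] by blast
  \<comment> \<open>The rows up to \<open>N1\<close>, which need not be close to their poles, serve
    as the finitely many extra rows.\<close>
  have "\<exists>N' C \<delta>. C > 0 \<and> 0 < \<delta> \<and> \<delta> \<le> 1 \<and>
    ((\<forall>n m. N' < n \<longrightarrow> n \<le> m \<longrightarrow> T.R m / T.R n \<le> C * (V m / V n) powr (1 - \<delta>)) \<or>
     (\<forall>n m. N' < n \<longrightarrow> n \<le> m \<longrightarrow> T.R m / T.R n \<ge> C * (V m / V n) powr (1 + \<delta>)))"
  proof (rule T.tail_growth[of "{n1..N1}" w "B0 + 1" l B])
    fix c assume c: "c \<in> supp_space (col_weight v 1) {1..}"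
    define f where "f = (\<lambda>n. (cmod (ctrans \<gamma> c (l n)))^2 * w n)"
    have fs: "f summable_on {n1..}" unfolding f_def by (rule interp_sysD(1)[OF sys' c])
    have f0: "0 \<le> infsum f {n1..}" unfolding f_def using A.w_pos by (intro infsum_nonneg) (simp add: less_imp_le)
    have fs2: "f summable_on {N1<..}" by (rule summable_on_subset_banach[OF fs]) (use t(1) in auto)
    have "{n1..} = {n1..N1} \<union> {N1<..}" using t(1) by auto
    hence "infsum f {n1..} = infsum f ({n1..N1} \<union> {N1<..})" by simp
    also have "\<dots> = (\<Sum>j\<in>{n1..N1}. f j) + infsum f {N1<..}"
      by (subst infsum_Un_disjoint) (use fs2 in auto)
    finally have e: "infsum f {n1..} = (\<Sum>j\<in>{n1..N1}. f j) + infsum f {N1<..}" .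
    have "nsq (col_weight v 1) c \<le> B0 * infsum f {n1..}" unfolding f_def by (rule B0(2)[OF c])
    also have "\<dots> \<le> (B0 + 1) * infsum f {n1..}" using f0 by (intro mult_right_mono) auto
    finally show "nsq (col_weight v 1) c \<le> (B0 + 1) * ((\<Sum>j\<in>{n1..N1}. (cmod (ctrans \<gamma> c (l j)))^2 * w j) +
        (sqsum w {N1<..} (\<lambda>n. ctrans \<gamma> c (l n))))" unfolding e by (simp add: f_def)
  next
    show "0 \<le> w j" if "j \<in> {n1..N1}" for j using A.w_pos[of j] that by simp
  qed (use B0 t(4) in auto)
  then obtain N' C \<delta> where gr: "C > 0" "0 < \<delta>"
    "(\<forall>n m. N' < n \<longrightarrow> n \<le> m \<longrightarrow> T.R m / T.R n \<le> C * (V m / V n) powr (1 - \<delta>)) \<or>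
     (\<forall>n m. N' < n \<longrightarrow> n \<le> m \<longrightarrow> T.R m / T.R n \<ge> C * (V m / V n) powr (1 + \<delta>))" by blast
  show ?thesis
  proof (rule exI[of _ n1], rule conjI[OF rows], fold l_def, use gr(3) in \<open>elim disjE\<close>)
    assume le: "\<forall>n m. N' < n \<longrightarrow> n \<le> m \<longrightarrow> T.R m / T.R n \<le> C * (V m / V n) powr (1 - \<delta>)"
    have "ratio \<gamma> l n m \<le> C * (V m / V n) powr (1 - \<delta>)" if "N' + N1 < n" "n \<le> m" for n m
      using le[rule_format, of n m] T.R_ratio[of n m] that by simp
    hence E: "upper_growth \<gamma> v l"
      using gr(2) by blast
    have "{n1..} = {1..}" by (rule interp_sys_unique[OF A.exact_system[OF E] sys']) (use A.n1 in auto)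
    hence "n1 = 1" by (metis atLeast_eq_iff)
    thus "n1 = 1 \<and> upper_growth \<gamma> v l \<or>
     n1 = 2 \<and> lower_growth \<gamma> v l"
      using E by blast
  next
    assume ge: "\<forall>n m. N' < n \<longrightarrow> n \<le> m \<longrightarrow> T.R m / T.R n \<ge> C * (V m / V n) powr (1 + \<delta>)"
    have "ratio \<gamma> l n m \<ge> C * (V m / V n) powr (1 + \<delta>)" if "N' + N1 < n" "n \<le> m" for n m
      using ge[rule_format, of n m] T.R_ratio[of n m] that by simp
    hence E: "lower_growth \<gamma> v l"
      using gr(1,2) by blast
    have "n1 = 2"
    proof (cases "n1 \<ge> 2")
      case True
      have "{n1 - 1..} = {1..}" by (rule interp_sys_unique[OF A.deficient_system_swap[OF E True] sys']) (use True in auto)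
      hence "n1 - 1 = 1" by (metis atLeast_eq_iff)
      thus ?thesis by simp
    next
      \<comment> \<open>With \<open>n1 = 1\<close> the lower growth condition makes the system with
        poles \<open>insert 0 {1..}\<close> invertible, so the given one, which lacks pole 0, could
        not be.\<close>
      case False
      hence n1: "n1 = 1" using A.n1 by simp
      obtain s where s: "s > 0" "interp_sys \<gamma> (col_weight v s) (insert 0 {n1..}) {n1..} l w"
        using A.deficient_system[OF E] by blast
      interpret S: poles \<gamma> "col_weight v s" by (rule poles_axiom[OF s(1)])
      have "interp_sys \<gamma> (col_weight v s) {1..} {n1..} l w"
        by (rule interp_sys_cong_cols[THEN iffD1, OF _ sys']) (auto simp: col_weight_def)
      hence "{1..} = insert 0 {n1..}" by (rule S.interp_sys_unique[OF _ s(2)]) (use n1 in auto)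
      hence "(0::nat) \<in> {1..}" by (metis insertI1)
      thus ?thesis by simp
    qed
    thus "n1 = 1 \<and> upper_growth \<gamma> v l \<or>
     n1 = 2 \<and> lower_growth \<gamma> v l"
      using E by blast
  qed
qed

end

subsection \<open>The transform between weighted sequence spaces\<close>

context lacunary
begin

text \<open>\<open>T\<close> is an isometry of the weighted sequence space onto the residues with
  weight \<open>1 / v\<close>, and it intertwines the operator with \<open>ctrans\<close>; sequences
  vanish off their index sets on both sides, so index 0 contributes nothing.\<close>

lemma H_invertible_iff:
  assumes w: "\<And>n. n \<ge> n0 \<Longrightarrow> 0 \<le> w n"
  shows "H_invertible \<gamma> v lam n0 w \<longleftrightarrow> interp_sys \<gamma> (col_weight v 1) {1..} {n0..} lam w"
proof -
  define u where "u = col_weight v 1"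
  interpret poles \<gamma> u unfolding u_def by (rule poles_axiom) simp
  define T where "T a k = a k * complex_of_real (v k)" for a and k :: nat
  define H where "H = Hop \<gamma> v lam n0"
  define A where "A = wl2 v {1..}"
  define B where "B = wl2 w {n0..}"
  have Tsq: "(cmod (T a k))^2 * u k = (cmod (a k))^2 * v k" if "k \<ge> 1" for a k
    using v_pos[OF that] that by (simp add: T_def u_def col_weight_def norm_mult power_mult_distrib power2_eq_square)
  have A0: "a 0 = 0" if "a \<in> A" for a using that by (auto simp: A_def wl2_def)
  have TA: "T a \<in> supp_space u {1..}" and nT: "nsq u (T a) = (wl2_norm v {1..} a)^2" if a: "a \<in> A" for a
  proof -
    have s: "sqsummable v {1..} a" using a by (simp add: A_def wl2_def)
    have "sqsummable u UNIV (\<lambda>k. T a k) \<longleftrightarrow> sqsummable v {1..} a"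
      by (rule summable_on_cong_neutral) (use A0[OF a] Tsq in \<open>auto simp: T_def not_le less_Suc_eq_0_disj\<close>)
    thus "T a \<in> supp_space u {1..}"
      using s A0[OF a] by (auto simp: supp_space_def T_def not_le less_Suc_eq_0_disj)
    have "nsq u (T a) = sqsum v {1..} a" unfolding nsq_def
      by (rule infsum_cong_neutral) (use A0[OF a] Tsq in \<open>auto simp: T_def not_le less_Suc_eq_0_disj\<close>)
    moreover have "0 \<le> sqsum v {1..} a" using v_nonneg by (intro infsum_nonneg) auto
    ultimately show "nsq u (T a) = (wl2_norm v {1..} a)^2" by (simp add: wl2_norm_def)
  qed
  have TH: "H a n = ctrans \<gamma> (T a) (lam n)" if "a \<in> A" "n \<ge> n0" for a n
    unfolding H_def Hop_def Htrans_def ctrans_def if_P[OF that(2)]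
    by (rule infsum_cong_neutral) (use A0[OF that(1)] in \<open>auto simp: T_def not_le less_Suc_eq_0_disj\<close>)
  have H0: "H a n = 0" if "\<not> n0 \<le> n" for a n using that by (simp add: H_def Hop_def)
  have AT: "\<exists>a\<in>A. T a = c" if c: "c \<in> supp_space u {1..}" for c
  proof
    define a where "a k = c k / complex_of_real (v k)" for k
    have c0: "c 0 = 0" using supp_spaceD[OF c, of 0] by simp
    show Ta: "T a = c"
    proof
      fix k show "T a k = c k" using v_pos[of k] c0 by (cases "k = 0") (auto simp: T_def a_def)
    qed
    have "sqsummable u {1..} c"
      by (rule summable_on_subset_banach[OF supp_space_summable[OF c]]) simp
    hence "sqsummable v {1..} a"
      by (rule summable_on_cong[THEN iffD1, rotated]) (use Tsq[of _ a] Ta in auto)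
    thus "a \<in> A" using c0 by (auto simp: A_def wl2_def a_def not_le less_Suc_eq_0_disj)
  qed
  have inj: "a = a'" if "a \<in> A" "a' \<in> A" "T a = T a'" for a a'
  proof
    fix k show "a k = a' k"
      using A0[OF that(1)] A0[OF that(2)] fun_cong[OF that(3), of k] v_pos[of k] by (cases "k = 0") (auto simp: T_def)
  qed
  have nB: "(wl2_norm w {n0..} b)^2 = sqsum w {n0..} b" for b
  proof -
    have "0 \<le> sqsum w {n0..} b" using w by (intro infsum_nonneg) auto
    thus ?thesis by (simp add: wl2_norm_def)
  qed
  have norm0: "0 \<le> wl2_norm w {n0..} b" for b
    unfolding wl2_norm_def using w by (intro real_sqrt_ge_zero infsum_nonneg) auto
  have norm0': "0 \<le> wl2_norm v {1..} a" for a
    unfolding wl2_norm_def using v_nonneg by (intro real_sqrt_ge_zero infsum_nonneg) auto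
  show ?thesis
  proof
    assume "H_invertible \<gamma> v lam n0 w"
    hence bij: "bij_betw H A B" and "\<exists>C. \<forall>b\<in>B. wl2_norm v {1..} (the_inv_into A H b) \<le> C * wl2_norm w {n0..} b"
      unfolding H_invertible_def H_def A_def B_def by auto
    then obtain C where C: "\<And>b. b \<in> B \<Longrightarrow> wl2_norm v {1..} (the_inv_into A H b) \<le> C * wl2_norm w {n0..} b" by blast
    show "interp_sys \<gamma> (col_weight v 1) {1..} {n0..} lam w"
      unfolding interp_sys_def u_def[symmetric]
    proof (intro conjI ballI exI[of _ "C^2"] allI impI)
      fix c assume c: "c \<in> supp_space u {1..}"
      obtain a where a: "a \<in> A" "T a = c" using AT[OF c] by blast
      have HB: "H a \<in> B" using bij a(1) by (auto simp: bij_betw_def)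
      hence "sqsummable w {n0..} (H a)" by (simp add: B_def wl2_def)
      thus "sqsummable w {n0..} (\<lambda>n. ctrans \<gamma> c (lam n))"
        by (rule summable_on_cong[THEN iffD1, rotated]) (use TH[OF a(1)] a(2) in auto)
      assume z: "\<forall>n\<in>{n0..}. ctrans \<gamma> c (lam n) = 0"
      have zA: "(\<lambda>_. 0) \<in> A" by (simp add: A_def wl2_def)
      have "H a = H (\<lambda>_. 0)"
      proof
        fix n show "H a n = H (\<lambda>_. 0) n"
          using TH[OF a(1), of n] TH[OF zA, of n] H0[of n] z a(2) by (cases "n0 \<le> n") (auto simp: T_def ctrans_def)
      qed
      hence "a = (\<lambda>_. 0)" using bij a(1) zA by (auto simp: bij_betw_def dest: inj_onD)
      thus "c = (\<lambda>_. 0)" using a(2) by (auto simp: T_def)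
    next
      fix b assume b: "sqsummable w {n0..} b"
      define b' where "b' n = (if n0 \<le> n then b n else 0)" for n
      have "sqsummable w {n0..} b'"
        by (rule summable_on_cong[THEN iffD1, OF _ b]) (simp add: b'_def)
      hence b': "b' \<in> B" by (simp add: B_def wl2_def b'_def)
      define a where "a = the_inv_into A H b'"
      have a: "a \<in> A" "H a = b'" using bij b' f_the_inv_into_f_bij_betw[OF bij, of b']
        by (auto simp: a_def bij_betw_def intro: the_inv_into_into)
      have "(wl2_norm v {1..} a)^2 \<le> (C * wl2_norm w {n0..} b')^2"
        using C[OF b'] norm0'[of a] unfolding a_def by (intro power_mono) auto
      also have "\<dots> = C^2 * sqsum w {n0..} b'" by (simp add: power_mult_distrib nB)
      also have "sqsum w {n0..} b' = sqsum w {n0..} b"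
        by (rule infsum_cong) (simp add: b'_def)
      finally have "nsq u (T a) \<le> C^2 * sqsum w {n0..} b" by (simp add: nT[OF a(1)])
      moreover have "\<forall>n\<in>{n0..}. ctrans \<gamma> (T a) (lam n) = b n"
        using TH[OF a(1)] a(2) by (auto simp: b'_def)
      ultimately show "\<exists>c\<in>supp_space u {1..}. (\<forall>n\<in>{n0..}. ctrans \<gamma> c (lam n) = b n) \<and>
          nsq u c \<le> C^2 * sqsum w {n0..} b" using TA[OF a(1)] by blast
    qed simp
  next
    assume "interp_sys \<gamma> (col_weight v 1) {1..} {n0..} lam w"
    hence sys: "interp_sys \<gamma> u {1..} {n0..} lam w" by (simp add: u_def)
    obtain K where K: "K \<ge> 0" "solvable \<gamma> u {1..} {n0..} lam w K"
      by (rule interp_sys_solve[OF sys]) (rule that; assumption)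
    have solve: "\<exists>a\<in>A. H a = b \<and> wl2_norm v {1..} a \<le> sqrt K * wl2_norm w {n0..} b" if b: "b \<in> B" for b
    proof -
      have bs: "sqsummable w {n0..} b" and bz: "\<And>n. \<not> n0 \<le> n \<Longrightarrow> b n = 0"
        using b by (auto simp: B_def wl2_def)
      obtain c where c: "c \<in> supp_space u {1..}" "\<And>n. n0 \<le> n \<Longrightarrow> ctrans \<gamma> c (lam n) = b n"
        "nsq u c \<le> K * sqsum w {n0..} b"
        using K(2)[rule_format, OF bs] by auto
      obtain a where a: "a \<in> A" "T a = c" using AT[OF c(1)] by blast
      have "H a = b"
      proof
        fix n show "H a n = b n" using TH[OF a(1), of n] c(2)[of n] H0[of n] bz[of n] a(2) by (cases "n0 \<le> n") auto
      qed
      moreover have "wl2_norm v {1..} a \<le> sqrt K * wl2_norm w {n0..} b"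
      proof (rule power2_le_imp_le)
        show "(wl2_norm v {1..} a)^2 \<le> (sqrt K * wl2_norm w {n0..} b)^2"
          using c(3) K(1) nT[OF a(1)] a(2) by (simp add: power_mult_distrib nB)
        show "0 \<le> sqrt K * wl2_norm w {n0..} b" using K(1) norm0 by simp
      qed
      ultimately show ?thesis using a(1) by blast
    qed
    have inj_H: "inj_on H A"
    proof (rule inj_onI)
      fix a a' assume a: "a \<in> A" "a' \<in> A" "H a = H a'"
      have "(\<lambda>k. T a k - T a' k) = (\<lambda>_. 0)"
      proof (rule interp_sysD(2)[OF sys supp_space_diff[OF TA[OF a(1)] TA[OF a(2)]]])
        fix n assume "n \<in> {n0..}"
        thus "ctrans \<gamma> (\<lambda>k. T a k - T a' k) (lam n) = 0"
          unfolding ctrans_diff[OF TA[OF a(1)] TA[OF a(2)]] using TH[OF a(1), of n] TH[OF a(2), of n] a(3) by simp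
      qed
      hence "T a k - T a' k = 0" for k by (rule fun_cong)
      hence "T a = T a'" by (intro ext) simp
      thus "a = a'" by (rule inj[OF a(1,2)])
    qed
    have "H a \<in> B" if a: "a \<in> A" for a
    proof -
      have "sqsummable w {n0..} (H a)"
        by (rule summable_on_cong[THEN iffD1, OF _ interp_sysD(1)[OF sys TA[OF a]]]) (use TH[OF a] in auto)
      thus ?thesis using H0 by (auto simp: B_def wl2_def)
    qed
    hence "H ` A = B" using solve by force
    hence "bij_betw H A B" using inj_H by (simp add: bij_betw_def)
    moreover have "wl2_norm v {1..} (the_inv_into A H b) \<le> sqrt K * wl2_norm w {n0..} b" if "b \<in> B" for b
    proof -
      obtain a where a: "a \<in> A" "H a = b" "wl2_norm v {1..} a \<le> sqrt K * wl2_norm w {n0..} b" using solve[OF \<open>b \<in> B\<close>] by blast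
      thus ?thesis using the_inv_into_f_eq[OF inj_H a(2) a(1)] by simp
    qed
    ultimately show "H_invertible \<gamma> v lam n0 w" unfolding H_invertible_def H_def A_def B_def by blast
  qed
qed

subsection \<open>Perturbation, tail sums and growth for rows indexed by integers\<close>

lemma vpert_iff:
  "vpert \<gamma> v x (int n1) \<longleftrightarrow> (\<exists>M N. \<forall>n\<ge>N. x (int n) \<in> Dset \<gamma> v M n)"
proof
  assume "vpert \<gamma> v x (int n1)"
  then obtain M where fin: "finite {n::int. int n1 \<le> n \<and> \<not> (1 \<le> n \<and> x n \<in> Dset \<gamma> v M (nat n))}" (is "finite ?S")
    by (auto simp: vpert_def)
  then obtain K where K: "\<And>n. n \<in> ?S \<Longrightarrow> n \<le> K" using bdd_above_finite[OF fin] by (auto simp: bdd_above_def)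
  have "x (int n) \<in> Dset \<gamma> v M n" if n: "n \<ge> n1 + nat K + 1" for n
  proof (rule ccontr)
    assume "x (int n) \<notin> Dset \<gamma> v M n"
    hence "int n \<in> ?S" using n by simp
    hence "int n \<le> K" by (rule K)
    thus False using n by linarith
  qed
  thus "\<exists>M N. \<forall>n\<ge>N. x (int n) \<in> Dset \<gamma> v M n" by blast
next
  assume "\<exists>M N. \<forall>n\<ge>N. x (int n) \<in> Dset \<gamma> v M n"
  then obtain M N where N: "\<And>n. n \<ge> N \<Longrightarrow> x (int n) \<in> Dset \<gamma> v M n" by blast
  have "n \<in> {int n1..int N + 1}" if n: "int n1 \<le> n" "\<not> (1 \<le> n \<and> x n \<in> Dset \<gamma> v M (nat n))" for n
  proof (rule ccontr)
    assume "n \<notin> {int n1..int N + 1}"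
    hence "n > int N + 1" using n by auto
    hence "nat n \<ge> N" "int (nat n) = n" "1 \<le> n" by auto
    thus False using N[of "nat n"] n(2) by simp
  qed
  hence "{n::int. int n1 \<le> n \<and> \<not> (1 \<le> n \<and> x n \<in> Dset \<gamma> v M (nat n))} \<subseteq> {int n1..int N + 1}" by blast
  thus "vpert \<gamma> v x (int n1)" unfolding vpert_def using finite_subset[OF _ finite_atLeastAtMost_int] by blast
qed

text \<open>\<open>Qseq\<close> at \<open>n\<close> starts at \<open>n + 1\<close>, the sums in
  \<open>Q\<close> at \<open>n\<close>; the difference is one step, in which \<open>V\<close> at
  most doubles. Finitely many indices do not affect the boundedness of
  \<open>V n * Q n\<close>.\<close>

lemma rows_iff:
  fixes x :: "int \<Rightarrow> complex"
  assumes n1: "n1 \<ge> 1" and ne: "\<And>n k. n \<ge> n1 \<Longrightarrow> x (int n) \<noteq> \<gamma> k" and inj: "inj_on (\<lambda>n. x (int n)) {n1..}"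
    and w: "\<And>n. n \<ge> n1 \<Longrightarrow> w (int n) = inverse (ker (x (int n)))"
  shows "asymptotic_rows \<gamma> v q N0 (\<lambda>n. x (int n)) (\<lambda>n. w (int n)) n1 \<longleftrightarrow>
    ((\<forall>n\<ge>1. Qfinite x (int n1) w n) \<and> bdd_above ((\<lambda>n. V n * Qseq x (int n1) w n) ` {1..})) \<and> vpert \<gamma> v x (int n1)"
proof -
  define f where "f = (\<lambda>j. w (int j) / (cmod (x (int j)))^2)"
  define S where "S n = {max (Suc n) n1..}" for n
  have f0: "0 \<le> f j" if "j \<ge> n1" for j
    using ker_pos[OF ne[OF that]] w[OF that] by (simp add: f_def)
  have set: "{int n + 1..} \<inter> {int n1..} = int ` S n" for n
  proof (intro set_eqI iffI)
    fix i assume "i \<in> {int n + 1..} \<inter> {int n1..}"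
    thus "i \<in> int ` S n" by (intro image_eqI[of _ _ "nat i"]) (auto simp: S_def)
  qed (auto simp: S_def)
  have Qf: "Qfinite x (int n1) w n \<longleftrightarrow> f summable_on S n" for n
    unfolding Qfinite_def set by (subst summable_on_reindex) (auto simp: f_def o_def)
  have Qs: "Qseq x (int n1) w n = infsum f (S n)" for n
    unfolding Qseq_def set by (subst infsum_reindex) (auto simp: f_def o_def)
  show ?thesis
  proof
    assume "asymptotic_rows \<gamma> v q N0 (\<lambda>n. x (int n)) (\<lambda>n. w (int n)) n1"
    then interpret A: asymptotic_rows \<gamma> v q N0 "\<lambda>n. x (int n)" "\<lambda>n. w (int n)" n1 .
    have fs: "f summable_on {n1..}" using A.col_summable[of 0] by (simp add: f_def gamma0)
    have fS: "f summable_on S n" for n by (rule summable_on_subset_banach[OF fs]) (auto simp: S_def)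
    obtain B N where B: "\<And>n L. n \<ge> N \<Longrightarrow> n < L \<Longrightarrow> V n * (\<Sum>j=n..<L. f j) \<le> B" using A.Q unfolding f_def by blast
    define N' where "N' = N + n1 + 2"
    have le: "V n * infsum f (S n) \<le> B" if n: "n \<ge> N'" for n
    proof -
      have Sn: "S n = {Suc n..}" using n by (auto simp: S_def N'_def)
      have "infsum f (S n) \<le> B / V (Suc n)"
      proof (rule nonneg_bounded_summable(2))
        show "0 \<le> f j" if "j \<in> S n" for j by (rule f0) (use that in \<open>auto simp: S_def\<close>)
        fix F assume F: "finite F" "F \<subseteq> S n"
        define L where "L = Suc (max (Suc n) (Max (insert 0 F)))"
        have "F \<subseteq> {Suc n..<L}" using F Sn by (auto simp: L_def less_Suc_eq_le le_max_iff_disj)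
        hence "sum f F \<le> (\<Sum>j=Suc n..<L. f j)" by (rule sum_mono2[rotated]) (use f0 n in \<open>auto simp: N'_def\<close>)
        also have "\<dots> \<le> B / V (Suc n)"
          using B[of "Suc n" L] n V_pos[of "Suc n"] by (simp add: N'_def L_def pos_le_divide_eq mult.commute)
        finally show "sum f F \<le> B / V (Suc n)" .
      qed
      hence "V (Suc n) * infsum f (S n) \<le> B" using V_pos[of "Suc n"] by (simp add: pos_le_divide_eq mult.commute)
      moreover have "0 \<le> infsum f (S n)" by (rule infsum_nonneg) (use f0 in \<open>auto simp: S_def\<close>)
      hence "V n * infsum f (S n) \<le> V (Suc n) * infsum f (S n)"
        using n by (intro mult_right_mono V_mono) (auto simp: N'_def)
      ultimately show ?thesis by linarith
    qed
    have "{1..} = {1..<N'} \<union> {N'..}" by (auto simp: N'_def)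
    hence "bdd_above ((\<lambda>n. V n * Qseq x (int n1) w n) ` {1..}) \<longleftrightarrow>
      bdd_above ((\<lambda>n. V n * Qseq x (int n1) w n) ` {1..<N'}) \<and> bdd_above ((\<lambda>n. V n * Qseq x (int n1) w n) ` {N'..})"
      by (simp add: image_Un)
    moreover have "bdd_above ((\<lambda>n. V n * Qseq x (int n1) w n) ` {N'..})" unfolding Qs
      by (rule bdd_aboveI2) (use le in auto)
    ultimately show "((\<forall>n\<ge>1. Qfinite x (int n1) w n) \<and> bdd_above ((\<lambda>n. V n * Qseq x (int n1) w n) ` {1..})) \<and> vpert \<gamma> v x (int n1)"
      using A.D fS by (auto simp: Qf vpert_iff)
  next
    assume a: "((\<forall>n\<ge>1. Qfinite x (int n1) w n) \<and> bdd_above ((\<lambda>n. V n * Qseq x (int n1) w n) ` {1..})) \<and> vpert \<gamma> v x (int n1)"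
    then obtain K where K: "\<And>n. n \<ge> 1 \<Longrightarrow> V n * infsum f (S n) \<le> K" unfolding Qs by (auto simp: bdd_above_def)
    have fS: "f summable_on S n" if "n \<ge> 1" for n using a that by (simp add: Qf)
    show "asymptotic_rows \<gamma> v q N0 (\<lambda>n. x (int n)) (\<lambda>n. w (int n)) n1"
    proof
      show "\<exists>M N. \<forall>n\<ge>N. x (int n) \<in> Dset \<gamma> v M n" using a by (simp add: vpert_iff)
      show "\<exists>B N. \<forall>n\<ge>N. \<forall>L>n. V n * (\<Sum>j=n..<L. w (int j) / (cmod (x (int j)))^2) \<le> B"
      proof (intro exI[of _ "2 * K"] exI[of _ "N0 + n1 + 2"] allI impI)
        fix n L assume n: "N0 + n1 + 2 \<le> n" "n < L"
        obtain m where m: "n = Suc m" "m \<ge> N0" "m \<ge> n1" "m \<ge> 1" using n n1 by (cases n) auto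
        have Sm: "S m = {n..}" using m by (auto simp: S_def)
        have i0: "0 \<le> infsum f (S m)" by (rule infsum_nonneg) (use f0 in \<open>auto simp: S_def\<close>)
        have "(\<Sum>j=n..<L. f j) \<le> infsum f (S m)"
          by (rule finite_sum_le_infsum[OF fS[OF m(4)]]) (use f0 m in \<open>auto simp: S_def\<close>)
        hence "V n * (\<Sum>j=n..<L. f j) \<le> V n * infsum f (S m)" using V_pos[of n] by (intro mult_left_mono) auto
        also have "\<dots> \<le> (2 * V m) * infsum f (S m)" using V_Suc_le(1)[OF m(2)] i0 m(1) by (intro mult_right_mono) auto
        also have "\<dots> \<le> 2 * K" using K[OF m(4)] by simp
        finally show "V n * (\<Sum>j=n..<L. w (int j) / (cmod (x (int j)))^2) \<le> 2 * K" by (simp add: f_def)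
      qed
    qed (use n1 ne inj w in auto)
  qed
qed

text \<open>\<open>n1 \<le> 2\<close> ensures that \<open>{n1..m}\<close> splits into
  \<open>{n1..n}\<close> and \<open>{n<..m}\<close> already for \<open>n = 1\<close>; for
  \<open>n1 = 2\<close> the product at 1 is empty.\<close>

lemma rho_ratio:
  assumes n1: "1 \<le> n1" "n1 \<le> 2" and x: "\<And>n. n \<ge> n1 \<Longrightarrow> x (int n) \<noteq> 0" and nm: "1 \<le> n" "n \<le> m"
  shows "rho \<gamma> x (int n1) m / rho \<gamma> x (int n1) n = ratio \<gamma> (\<lambda>n. x (int n)) n m"
proof -
  define F where "F j = (g j)^2 / (cmod (x (int j)))^2" for j
  have F0: "F j \<noteq> 0" if "j \<ge> n1" for j using x[OF that] g_pos[of j] that n1 by (auto simp: F_def)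
  have rho: "rho \<gamma> x (int n1) k = (\<Prod>j\<in>{n1..k}. F j)" for k
  proof -
    have "{max 1 (int n1)..int k} = int ` {n1..k}" using n1 by (auto simp: image_int_atLeastAtMost)
    thus ?thesis unfolding rho_def by (simp add: prod.reindex F_def)
  qed
  have un: "{n1..m} = {n1..n} \<union> {n<..m}" using n1 nm by auto
  have "rho \<gamma> x (int n1) m = rho \<gamma> x (int n1) n * ratio \<gamma> (\<lambda>n. x (int n)) n m"
  proof -
    have "ratio \<gamma> (\<lambda>n. x (int n)) n m = (\<Prod>j\<in>{n<..m}. F j)" by (simp add: ratio_def F_def)
    thus ?thesis unfolding rho un by (subst prod.union_disjoint) auto
  qed
  moreover have "rho \<gamma> x (int n1) n \<noteq> 0" unfolding rho using F0 by simp
  ultimately show ?thesis by simp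
qed

text \<open>The quotient of \<open>ratio\<close> by a power of \<open>V m / V n\<close> is a
  multiplicative cocycle, so \<open>cocycle_bounded\<close> extends an eventual bound to all
  indices; the lower condition is treated through the reciprocal cocycle.\<close>

lemma growth_iff:
  fixes x :: "int \<Rightarrow> complex"
  assumes n1: "1 \<le> n1" "n1 \<le> 2" and x: "\<And>n. n \<ge> n1 \<Longrightarrow> x (int n) \<noteq> 0"
  defines "l \<equiv> \<lambda>n. x (int n)"
  shows "(\<exists>C>0. \<exists>\<delta>>0. \<forall>m n. 1 \<le> n \<longrightarrow> n < m \<longrightarrow> rho \<gamma> x (int n1) m / rho \<gamma> x (int n1) n \<le> C * (V m / V n) powr (1 - \<delta>)) \<longleftrightarrow>
      upper_growth \<gamma> v l" (is ?upper)
    and "(\<exists>C>0. \<exists>\<delta>>0. \<forall>m n. 1 \<le> n \<longrightarrow> n < m \<longrightarrow> rho \<gamma> x (int n1) m / rho \<gamma> x (int n1) n \<ge> C * (V m / V n) powr (1 + \<delta>)) \<longleftrightarrow>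
      lower_growth \<gamma> v l" (is ?lower)
proof -
  have rr: "rho \<gamma> x (int n1) m / rho \<gamma> x (int n1) n = ratio \<gamma> l n m" if "1 \<le> n" "n \<le> m" for n m
    unfolding l_def by (rule rho_ratio[OF n1, where x=x, OF x that])
  have rp: "ratio \<gamma> l n m > 0" if "1 \<le> n" for n m
    unfolding ratio_def using that n1 x g_pos by (intro prod_pos) (auto simp: l_def)
  have r1: "ratio \<gamma> l n n = 1" for n by (simp add: ratio_def)
  define F where "F a n m = ratio \<gamma> l n m / (V m / V n) powr a" for a n m
  have pp: "(V m / V n) powr a > 0" for m n a using V_pos[of m] V_pos[of n] by simp
  have Fp: "F a n m > 0" if "1 \<le> n" for a n m using rp[OF that] pp by (simp add: F_def)
  have Fm: "F a n m = F a n k * F a k m" if "n \<le> k" "k \<le> m" for a n k m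
  proof -
    have "(V m / V n) powr a = (V k / V n) powr a * (V m / V k) powr a"
      using V_pos[of m] V_pos[of n] V_pos[of k] by (simp add: powr_mult[symmetric])
    thus ?thesis using ratio_mult[OF that, of \<gamma> l] by (simp add: F_def)
  qed
  have Fle: "F a n m \<le> C \<longleftrightarrow> ratio \<gamma> l n m \<le> C * (V m / V n) powr a" for a n m C
    using pp[of m n a] by (simp add: F_def pos_divide_le_eq)
  show ?upper
  proof
    assume "\<exists>C>0. \<exists>\<delta>>0. \<forall>m n. 1 \<le> n \<longrightarrow> n < m \<longrightarrow> rho \<gamma> x (int n1) m / rho \<gamma> x (int n1) n \<le> C * (V m / V n) powr (1 - \<delta>)"
    then obtain C \<delta> where C: "C > 0" "\<delta> > 0" "\<And>m n. 1 \<le> n \<Longrightarrow> n < m \<Longrightarrow> rho \<gamma> x (int n1) m / rho \<gamma> x (int n1) n \<le> C * (V m / V n) powr (1 - \<delta>)" by blast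
    have "ratio \<gamma> l n m \<le> max C 1 * (V m / V n) powr (1 - \<delta>)" if nm: "0 < n" "n \<le> m" for n m
    proof (cases "n = m")
      case True thus ?thesis using V_pos[of m] by (simp add: r1)
    next
      case False
      hence "ratio \<gamma> l n m \<le> C * (V m / V n) powr (1 - \<delta>)" using C(3)[of n m] rr[of n m] nm by simp
      also have "\<dots> \<le> max C 1 * (V m / V n) powr (1 - \<delta>)" by (intro mult_right_mono) auto
      finally show ?thesis .
    qed
    thus "upper_growth \<gamma> v l"
      using C(2) by blast
  next
    assume "upper_growth \<gamma> v l"
    then obtain C N \<delta> where C: "\<delta> > 0" "\<And>n m. N < n \<Longrightarrow> n \<le> m \<Longrightarrow> ratio \<gamma> l n m \<le> C * (V m / V n) powr (1 - \<delta>)" by blast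
    have "\<exists>K>0. \<forall>n m. 1 \<le> n \<longrightarrow> n \<le> m \<longrightarrow> F (1 - \<delta>) n m \<le> K"
    proof (rule cocycle_bounded)
      show "F (1 - \<delta>) n m \<le> C" if "N < n" "n \<le> m" for n m using C(2)[OF that] by (simp add: Fle)
      show "F (1 - \<delta>) n m = F (1 - \<delta>) n k * F (1 - \<delta>) k m" if "1 \<le> n" "n \<le> k" "k \<le> m" for n k m
        by (rule Fm[OF that(2,3)])
      show "F (1 - \<delta>) n m > 0" if "1 \<le> n" "n \<le> m" for n m by (rule Fp[OF that(1)])
    qed
    then obtain C' where C': "C' > 0" "\<forall>n m. 1 \<le> n \<longrightarrow> n \<le> m \<longrightarrow> F (1 - \<delta>) n m \<le> C'" by (elim exE conjE)
    have "rho \<gamma> x (int n1) m / rho \<gamma> x (int n1) n \<le> C' * (V m / V n) powr (1 - \<delta>)" if "1 \<le> n" "n < m" for n m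
      using C'(2)[rule_format, of n m] rr[of n m] that by (simp add: Fle)
    thus "\<exists>C>0. \<exists>\<delta>>0. \<forall>m n. 1 \<le> n \<longrightarrow> n < m \<longrightarrow> rho \<gamma> x (int n1) m / rho \<gamma> x (int n1) n \<le> C * (V m / V n) powr (1 - \<delta>)"
      using C(1) C'(1) by blast
  qed
  have Fge: "1 / F a n m \<le> 1 / C \<longleftrightarrow> ratio \<gamma> l n m \<ge> C * (V m / V n) powr a" if "1 \<le> n" "C > 0" for a n m C
  proof -
    have "1 / F a n m \<le> 1 / C \<longleftrightarrow> C \<le> F a n m" using Fp[OF that(1)] that(2) by (simp add: field_simps)
    thus ?thesis using pp[of m n a] by (simp add: F_def pos_le_divide_eq)
  qed
  show ?lower
  proof
    assume "\<exists>C>0. \<exists>\<delta>>0. \<forall>m n. 1 \<le> n \<longrightarrow> n < m \<longrightarrow> rho \<gamma> x (int n1) m / rho \<gamma> x (int n1) n \<ge> C * (V m / V n) powr (1 + \<delta>)"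
    then obtain C \<delta> where C: "C > 0" "\<delta> > 0" "\<And>m n. 1 \<le> n \<Longrightarrow> n < m \<Longrightarrow> rho \<gamma> x (int n1) m / rho \<gamma> x (int n1) n \<ge> C * (V m / V n) powr (1 + \<delta>)" by blast
    have "ratio \<gamma> l n m \<ge> min C 1 * (V m / V n) powr (1 + \<delta>)" if nm: "0 < n" "n \<le> m" for n m
    proof (cases "n = m")
      case True thus ?thesis using V_pos[of m] by (simp add: r1)
    next
      case False
      have "min C 1 * (V m / V n) powr (1 + \<delta>) \<le> C * (V m / V n) powr (1 + \<delta>)" by (intro mult_right_mono) auto
      also have "\<dots> \<le> ratio \<gamma> l n m" using C(3)[of n m] rr[of n m] nm False by simp
      finally show ?thesis .
    qed
    moreover have "min C 1 > 0" using C(1) by simp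
    ultimately show "lower_growth \<gamma> v l"
      using C(2) by blast
  next
    assume "lower_growth \<gamma> v l"
    then obtain C N \<delta> where C: "C > 0" "\<delta> > 0" "\<And>n m. N < n \<Longrightarrow> n \<le> m \<Longrightarrow> ratio \<gamma> l n m \<ge> C * (V m / V n) powr (1 + \<delta>)" by blast
    have "\<exists>K>0. \<forall>n m. 1 \<le> n \<longrightarrow> n \<le> m \<longrightarrow> 1 / F (1 + \<delta>) n m \<le> K"
    proof (rule cocycle_bounded)
      show "1 / F (1 + \<delta>) n m = 1 / F (1 + \<delta>) n k * (1 / F (1 + \<delta>) k m)" if "1 \<le> n" "n \<le> k" "k \<le> m" for n k m
        unfolding Fm[OF that(2,3)] by simp
      show "1 / F (1 + \<delta>) n m > 0" if "1 \<le> n" "n \<le> m" for n m using Fp[OF that(1)] by simp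
      show "1 / F (1 + \<delta>) n m \<le> 1 / C" if "N < n" "n \<le> m" for n m using Fge[of n C] C(1) C(3)[OF that] that by simp
    qed
    then obtain K where K: "K > 0" "\<forall>n m. 1 \<le> n \<longrightarrow> n \<le> m \<longrightarrow> 1 / F (1 + \<delta>) n m \<le> K" by (elim exE conjE)
    have "rho \<gamma> x (int n1) m / rho \<gamma> x (int n1) n \<ge> 1 / K * (V m / V n) powr (1 + \<delta>)" if "1 \<le> n" "n < m" for n m
      using Fge[of n "1 / K" "1 + \<delta>" m] K(1) K(2)[rule_format, of n m] rr[of n m] that by simp
    moreover have "1 / K > 0" using K(1) by simp
    ultimately show "\<exists>C>0. \<exists>\<delta>>0. \<forall>m n. 1 \<le> n \<longrightarrow> n < m \<longrightarrow> rho \<gamma> x (int n1) m / rho \<gamma> x (int n1) n \<ge> C * (V m / V n) powr (1 + \<delta>)"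
      using C(2) by blast
  qed
qed

end

text \<open>The poles are indexed from 1, so index 0 is free and \<open>\<gamma> 0\<close> is set to
  0, the site of the auxiliary pole. As the moduli are bounded below by
  \<open>cmod (\<gamma> 1) > 0\<close>, the denominators \<open>1 + (cmod (\<gamma> n))^2\<close>
  may be replaced by \<open>(cmod (\<gamma> n))^2\<close>.\<close>

lemma lacunary_exists:
  assumes lac: "\<exists>q>1. \<forall>n\<ge>1. cmod (\<gamma> (n + 1)) / cmod (\<gamma> n) \<ge> q"
    and v_pos: "\<forall>n\<ge>1. v n > 0"
    and v_sum: "(\<lambda>n. v n / (1 + (cmod (\<gamma> n))^2)) summable_on {1..}"
    and V_inf: "filterlim (Vseq v) at_top sequentially"
    and v_small: "v \<in> o(Vseq v)"
  shows "\<exists>q N0. lacunary (\<gamma>(0 := 0)) v q N0"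
proof -
  obtain q where q: "q > 1" "\<And>n. n \<ge> 1 \<Longrightarrow> q \<le> cmod (\<gamma> (n + 1)) / cmod (\<gamma> n)" using lac by blast
  \<comment> \<open>A pole at the origin would make the quotient 0 by division by zero, against
    \<open>q > 1\<close>.\<close>
  have gp: "cmod (\<gamma> n) > 0" if "n \<ge> 1" for n
    using q(2)[OF that] q(1) by (cases "\<gamma> n = 0") auto
  have gs: "q * cmod (\<gamma> n) \<le> cmod (\<gamma> (Suc n))" if "n \<ge> 1" for n
    using q(2)[OF that] gp[OF that] by (simp add: pos_le_divide_eq)
  have g1: "cmod (\<gamma> 1) \<le> cmod (\<gamma> n)" if "n \<ge> 1" for n
    using that
  proof (induction n rule: dec_induct)
    case (step n)
    have "1 * cmod (\<gamma> n) \<le> q * cmod (\<gamma> n)" using q(1) by (intro mult_right_mono) auto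
    thus ?case using gs[of n] step by linarith
  qed simp
  have V_pos: "Vseq v n > 0" for n using v_pos by (auto simp: Vseq_def intro!: sum_pos)
  have "eventually (\<lambda>n. norm (v n) \<le> min 1 (q - 1) * norm (Vseq v n)) sequentially"
    using landau_o.smallD[OF v_small, of "min 1 (q - 1)"] q(1) by simp
  then obtain N where N: "\<And>n. n \<ge> N \<Longrightarrow> norm (v n) \<le> min 1 (q - 1) * norm (Vseq v n)"
    by (auto simp: eventually_sequentially)
  have small: "v n \<le> c * Vseq v n" if "n \<ge> N" "min 1 (q - 1) \<le> c" for n c
  proof -
    have "v n \<le> min 1 (q - 1) * Vseq v n" using N[OF that(1)] V_pos[of n] by simp
    also have "\<dots> \<le> c * Vseq v n" using that(2) V_pos[of n] by (intro mult_right_mono) auto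
    finally show ?thesis .
  qed
  have "lacunary (\<gamma>(0 := 0)) v q (max N 2)"
  proof
    show "(\<lambda>k. v k / (cmod ((\<gamma>(0 := 0)) k))^2) summable_on {1..}"
    proof (rule summable_on_comparison_test)
      show "(\<lambda>n. (1 + 1 / (cmod (\<gamma> 1))^2) * (v n / (1 + (cmod (\<gamma> n))^2))) summable_on {1..}"
        by (rule summable_on_cmult_right[OF v_sum])
      fix k :: nat assume k: "k \<in> {1..}"
      have p: "0 < (cmod (\<gamma> 1))^2" "0 < (cmod (\<gamma> k))^2" using gp[of 1] gp[of k] k by auto
      have "(cmod (\<gamma> 1))^2 \<le> (cmod (\<gamma> k))^2" using g1[of k] k by (intro power_mono) auto
      hence "1 \<le> (cmod (\<gamma> k))^2 / (cmod (\<gamma> 1))^2" using p by (simp add: pos_le_divide_eq)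
      hence "1 + (cmod (\<gamma> k))^2 \<le> (1 + 1 / (cmod (\<gamma> 1))^2) * (cmod (\<gamma> k))^2" by (simp add: distrib_right)
      hence "v k * (1 + (cmod (\<gamma> k))^2) \<le> v k * ((1 + 1 / (cmod (\<gamma> 1))^2) * (cmod (\<gamma> k))^2)"
        using v_pos k by (intro mult_left_mono) (auto simp: less_imp_le)
      hence "v k / (cmod (\<gamma> k))^2 \<le> (1 + 1 / (cmod (\<gamma> 1))^2) * v k / (1 + (cmod (\<gamma> k))^2)"
        using p by (simp add: divide_le_eq pos_le_divide_eq add_pos_pos mult_ac)
      thus "v k / (cmod ((\<gamma>(0 := 0)) k))^2 \<le> (1 + 1 / (cmod (\<gamma> 1))^2) * (v k / (1 + (cmod (\<gamma> k))^2))" using k by simp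
      show "0 \<le> v k / (cmod ((\<gamma>(0 := 0)) k))^2" using v_pos k by (simp add: less_imp_le)
    qed
    show "v n \<le> Vseq v n" if "max N 2 \<le> n" for n using small[of n 1] that by simp
    show "v n \<le> (q - 1) * Vseq v n" if "max N 2 \<le> n" for n using small[of n "q - 1"] that by simp
  qed (use q(1) gp[of 1] gs v_pos V_inf v_small in auto)
  thus ?thesis by blast
qed

text \<open>The rows come with an arbitrary first index \<open>n0\<close>, whereas being a
  perturbation depends on the numbering; hence each alternative speaks of renumbered rows
  \<open>lam'\<close>, beginning at 1 in the exact case and at 2 for deficiency 1.\<close>

theorem theorem5:
  fixes \<gamma> :: "nat \<Rightarrow> complex" and v :: "nat \<Rightarrow> real"
    and lam :: "int \<Rightarrow> complex" and n0 :: int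
  assumes gamma_inj: "inj_on \<gamma> {1..}"
    and gamma_lac: "\<exists>q>1. \<forall>n\<ge>1. cmod (\<gamma> (n + 1)) / cmod (\<gamma> n) \<ge> q"
    and v_pos: "\<forall>n\<ge>1. v n > 0"
    and v_sum: "(\<lambda>n. v n / (1 + (cmod (\<gamma> n))^2)) summable_on {1..}"
    and lam_inj: "inj_on lam {n0..}"
    and lam_nz: "\<forall>n\<ge>n0. lam n \<noteq> 0"
    and lam_disj: "\<forall>n\<ge>n0. \<forall>k\<ge>1. lam n \<noteq> \<gamma> k"
    and lam_mono: "\<forall>n m. n0 \<le> n \<longrightarrow> n \<le> m \<longrightarrow> cmod (lam n) \<le> cmod (lam m)"
    and V_inf: "filterlim (Vseq v) at_top sequentially"
    and v_small: "v \<in> o(Vseq v)"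
  shows "H_invertible \<gamma> v lam n0 (bessel_weight \<gamma> v lam) \<longleftrightarrow>
    ((let lam' = (\<lambda>n. lam (n + (n0 - 1))); w' = bessel_weight \<gamma> v lam' in
       ((\<forall>n\<ge>1. Qfinite lam' 1 w' n) \<and> bdd_above ((\<lambda>n. Vseq v n * Qseq lam' 1 w' n) ` {1..})) \<and>
       vpert \<gamma> v lam' 1 \<and>
       (\<exists>C>0. \<exists>\<delta>>0. \<forall>m n. 1 \<le> n \<longrightarrow> n < m \<longrightarrow>
          rho \<gamma> lam' 1 m / rho \<gamma> lam' 1 n \<le> C * (Vseq v m / Vseq v n) powr (1 - \<delta>)))
     \<or>
     (let lam' = (\<lambda>n. lam (n + (n0 - 2))); w' = bessel_weight \<gamma> v lam' in
       ((\<forall>n\<ge>1. Qfinite lam' 2 w' n) \<and> bdd_above ((\<lambda>n. Vseq v n * Qseq lam' 2 w' n) ` {1..})) \<and>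
       vpert \<gamma> v lam' 2 \<and>
       (\<exists>C>0. \<exists>\<delta>>0. \<forall>m n. 1 \<le> n \<longrightarrow> n < m \<longrightarrow>
          rho \<gamma> lam' 2 m / rho \<gamma> lam' 2 n \<ge> C * (Vseq v m / Vseq v n) powr (1 + \<delta>))))"
proof -
  obtain q N0 where "lacunary (\<gamma>(0 := 0)) v q N0"
    using lacunary_exists[OF gamma_lac v_pos v_sum V_inf v_small] by blast
  then interpret lacunary "\<gamma>(0 := 0)" v q N0 .
  define \<gamma>' where "\<gamma>' = \<gamma>(0 := 0)"
  define u where "u = col_weight v 1"
  define w where "w = bessel_weight \<gamma> v lam"
  \<comment> \<open>The rows renumbered to begin at \<open>i\<close>: the values 1 and 2 give the
    two alternatives, and 0 gives the numbering used in \<open>global_sys\<close>.\<close>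
  define X where "X i = (\<lambda>n. lam (n + (n0 - i)))" for i
  define Wt where "Wt i = bessel_weight \<gamma> v (X i)" for i
  define Cond where "Cond i \<longleftrightarrow> ((\<forall>n\<ge>1. Qfinite (X i) i (Wt i) n) \<and> bdd_above ((\<lambda>n. Vseq v n * Qseq (X i) i (Wt i) n) ` {1..})) \<and>
       vpert \<gamma> v (X i) i" for i
  define Up where "Up i \<longleftrightarrow> (\<exists>C>0. \<exists>\<delta>>0. \<forall>m n. 1 \<le> n \<longrightarrow> n < m \<longrightarrow>
          rho \<gamma> (X i) i m / rho \<gamma> (X i) i n \<le> C * (Vseq v m / Vseq v n) powr (1 - \<delta>))" for i
  define Low where "Low i \<longleftrightarrow> (\<exists>C>0. \<exists>\<delta>>0. \<forall>m n. 1 \<le> n \<longrightarrow> n < m \<longrightarrow>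
          rho \<gamma> (X i) i m / rho \<gamma> (X i) i n \<ge> C * (Vseq v m / Vseq v n) powr (1 + \<delta>))" for i
  have bw: "bessel_weight \<gamma> v x n = inverse (ker (x n))" for x n
    unfolding bessel_weight_def ker_def by (rule arg_cong[where f=inverse], rule infsum_cong) simp
  have ne: "lam n \<noteq> \<gamma>' k" if "n \<ge> n0" for n k
    using lam_nz lam_disj that by (cases "k = 0") (auto simp: \<gamma>'_def)
  have kp: "ker (lam n) > 0" if "n \<ge> n0" for n
    using ker_pos[of "lam n"] ne[OF that, of 1] by (simp add: \<gamma>'_def)
  have "Htrans \<gamma> v = Htrans \<gamma>' v"
    unfolding Htrans_def by (intro ext infsum_cong) (simp add: \<gamma>'_def)
  hence "Hop \<gamma> v lam n0 = Hop \<gamma>' v lam n0" by (intro ext) (simp add: Hop_def)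
  hence "H_invertible \<gamma> v lam n0 w \<longleftrightarrow> H_invertible \<gamma>' v lam n0 w"
    by (simp add: H_invertible_def)
  also have "\<dots> \<longleftrightarrow> interp_sys \<gamma>' u {1..} {n0..} lam w"
    unfolding \<gamma>'_def u_def by (rule H_invertible_iff) (use kp in \<open>auto simp: w_def bw less_imp_le\<close>)
  finally have H: "H_invertible \<gamma> v lam n0 w \<longleftrightarrow> interp_sys \<gamma>' u {1..} {n0..} lam w" .
  have Dset_eq: "Dset \<gamma> v M n = Dset \<gamma>' v M n" if "n \<ge> 1" for M n
  proof -
    have "Omega \<gamma> n = Omega \<gamma>' n" using that by (auto simp: Omega_def \<gamma>'_def)
    moreover have "Pseq \<gamma> v n = Pseq \<gamma>' v n" unfolding Pseq_def by (rule infsum_cong) (simp add: \<gamma>'_def)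
    ultimately show ?thesis using that by (simp add: Dset_def \<gamma>'_def)
  qed
  have vp: "vpert \<gamma> v x i \<longleftrightarrow> vpert \<gamma>' v x i" for x i
  proof -
    have "{n. i \<le> n \<and> \<not> (1 \<le> n \<and> x n \<in> Dset \<gamma> v M (nat n))} = {n. i \<le> n \<and> \<not> (1 \<le> n \<and> x n \<in> Dset \<gamma>' v M (nat n))}" for M
      using Dset_eq by auto
    thus ?thesis by (simp add: vpert_def)
  qed
  have rho_eq: "rho \<gamma> x i n = rho \<gamma>' x i n" for x i n
    unfolding rho_def by (rule prod.cong) (auto simp: \<gamma>'_def)
  \<comment> \<open>Renumbering the rows leaves the system unchanged, so it may be examined with any
    first index \<open>n1\<close>.\<close>
  have sys_iff: "interp_sys \<gamma>' u {1..} {n0..} lam w \<longleftrightarrow>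
      interp_sys \<gamma>' u {1..} {n1..} (\<lambda>n. X (int n1) (int n)) (\<lambda>n. Wt (int n1) (int n))" for n1
  proof -
    define f where "f n = int n + (n0 - int n1)" for n
    have "inj_on f {n1..}" by (auto simp: f_def intro: inj_onI)
    moreover have "f ` {n1..} = {n0..}"
    proof (intro set_eqI iffI)
      fix i assume "i \<in> {n0..}"
      thus "i \<in> f ` {n1..}" by (intro image_eqI[of _ _ "nat (i - n0) + n1"]) (auto simp: f_def)
    qed (auto simp: f_def)
    ultimately have "interp_sys \<gamma>' u {1..} {n0..} lam w \<longleftrightarrow> interp_sys \<gamma>' u {1..} {n1..} (\<lambda>n. lam (f n)) (\<lambda>n. w (f n))"
      using interp_sys_reindex[of f "{n1..}" \<gamma>' u "{1..}" lam w] by simp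
    thus ?thesis by (simp add: f_def X_def Wt_def w_def bw)
  qed
  have Xne: "X (int n1) (int n) \<noteq> \<gamma>' k" if "n \<ge> n1" for n1 n k
    unfolding X_def by (rule ne) (use that in simp)
  have Xnz: "X (int n1) (int n) \<noteq> 0" if "n \<ge> n1" for n1 n
    using Xne[OF that, of 0] by (simp add: \<gamma>'_def)
  have rows: "Cond (int n1) \<longleftrightarrow> asymptotic_rows \<gamma>' v q N0 (\<lambda>n. X (int n1) (int n)) (\<lambda>n. Wt (int n1) (int n)) n1"
    if "n1 \<ge> 1" for n1
    unfolding Cond_def vp unfolding \<gamma>'_def
  proof (rule rows_iff[symmetric, OF that])
    show "X (int n1) (int n) \<noteq> (\<gamma>(0 := 0)) k" if "n1 \<le> n" for n k using Xne[OF that, of k] by (simp add: \<gamma>'_def)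
    show "inj_on (\<lambda>n. X (int n1) (int n)) {n1..}"
      using inj_onD[OF lam_inj] by (intro inj_onI) (fastforce simp: X_def)
    show "Wt (int n1) (int n) = inverse (ker (X (int n1) (int n)))" for n by (simp add: Wt_def bw)
  qed
  have up: "Up (int n1) \<longleftrightarrow> upper_growth \<gamma>' v (\<lambda>n. X (int n1) (int n))" if "1 \<le> n1" "n1 \<le> 2" for n1
    unfolding Up_def rho_eq unfolding \<gamma>'_def by (rule growth_iff(1)[OF that]) (rule Xnz)
  have low: "Low (int n1) \<longleftrightarrow> lower_growth \<gamma>' v (\<lambda>n. X (int n1) (int n))" if "1 \<le> n1" "n1 \<le> 2" for n1
    unfolding Low_def rho_eq unfolding \<gamma>'_def by (rule growth_iff(2)[OF that]) (rule Xnz)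
  have "H_invertible \<gamma> v lam n0 w \<longleftrightarrow> Cond (int 1) \<and> Up (int 1) \<or> Cond (int 2) \<and> Low (int 2)"
  proof
    assume "Cond (int 1) \<and> Up (int 1) \<or> Cond (int 2) \<and> Low (int 2)"
    thus "H_invertible \<gamma> v lam n0 w"
    proof (elim disjE conjE)
      assume c: "Cond (int 1)" "Up (int 1)"
      interpret A: asymptotic_rows "\<gamma>(0 := 0)" v q N0 "\<lambda>n. X (int 1) (int n)" "\<lambda>n. Wt (int 1) (int n)" 1
        using rows[of 1] c(1) by (simp add: \<gamma>'_def)
      have "interp_sys \<gamma>' u {1..} {1..} (\<lambda>n. X (int 1) (int n)) (\<lambda>n. Wt (int 1) (int n))"
        unfolding u_def \<gamma>'_def by (rule A.exact_system) (use up[of 1] c(2) in \<open>simp add: \<gamma>'_def\<close>)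
      thus ?thesis unfolding H sys_iff[of 1] .
    next
      assume c: "Cond (int 2)" "Low (int 2)"
      interpret A: asymptotic_rows "\<gamma>(0 := 0)" v q N0 "\<lambda>n. X (int 2) (int n)" "\<lambda>n. Wt (int 2) (int n)" 2
        using rows[of 2] c(1) by (simp add: \<gamma>'_def)
      have "interp_sys \<gamma>' u {2 - 1..} {2..} (\<lambda>n. X (int 2) (int n)) (\<lambda>n. Wt (int 2) (int n))"
        unfolding u_def \<gamma>'_def by (rule A.deficient_system_swap) (use low[of 2] c(2) in \<open>simp_all add: \<gamma>'_def\<close>)
      thus ?thesis unfolding H sys_iff[of 2] by simp
    qed
  next
    assume "H_invertible \<gamma> v lam n0 w"
    hence sys0: "interp_sys \<gamma>' u {1..} {0..} (\<lambda>n. X (int 0) (int n)) (\<lambda>n. Wt (int 0) (int n))"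
      unfolding H sys_iff[of 0] .
    define L where "L = (\<lambda>n. X (int 0) (int n))"
    define W where "W = (\<lambda>n. Wt (int 0) (int n))"
    interpret G: global_sys "\<gamma>(0 := 0)" v q N0 L W
    proof
      show "interp_sys (\<gamma>(0 := 0)) (col_weight v 1) {1..} UNIV L W"
        using sys0 by (simp add: L_def W_def \<gamma>'_def u_def)
      show "inj L" using inj_onD[OF lam_inj] by (intro injI) (fastforce simp: L_def X_def)
      show "L n \<noteq> (\<gamma>(0 := 0)) k" for n k using Xne[of 0 n k] by (simp add: L_def \<gamma>'_def)
      show "cmod (L n) \<le> cmod (L m)" if "n \<le> m" for n m using lam_mono that by (simp add: L_def X_def)
      show "W n = inverse (ker (L n))" for n by (simp add: L_def W_def Wt_def bw)
    qed
    \<comment> \<open>Subtraction of natural numbers agrees with the integer shift only from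
      \<open>n1\<close> on, so conditions are transferred at indices not below
      \<open>n1\<close>.\<close>
    have shift: "L (n - n1) = X (int n1) (int n)" "W (n - n1) = Wt (int n1) (int n)" if "n \<ge> n1" for n n1
      using that by (simp_all add: L_def W_def Wt_def bw X_def of_nat_diff algebra_simps)
    have cond: "Cond (int n1)" if a: "asymptotic_rows (\<gamma>(0 := 0)) v q N0 (\<lambda>n. L (n - n1)) (\<lambda>n. W (n - n1)) n1" for n1
    proof -
      interpret A: asymptotic_rows "\<gamma>(0 := 0)" v q N0 "\<lambda>n. L (n - n1)" "\<lambda>n. W (n - n1)" n1 by (rule a)
      have "asymptotic_rows (\<gamma>(0 := 0)) v q N0 (\<lambda>n. X (int n1) (int n)) (\<lambda>n. Wt (int n1) (int n)) n1"
      proof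
        show "inj_on (\<lambda>n. X (int n1) (int n)) {n1..}"
          using A.l_inj by (rule inj_on_cong[THEN iffD1, rotated]) (simp add: shift)
        obtain M N where "\<And>n. n \<ge> N \<Longrightarrow> L (n - n1) \<in> Dset (\<gamma>(0 := 0)) v M n" using A.D by blast
        thus "\<exists>M N. \<forall>n\<ge>N. X (int n1) (int n) \<in> Dset (\<gamma>(0 := 0)) v M n"
          by (intro exI[of _ M] exI[of _ "N + n1"]) (auto simp flip: shift)
        obtain B N where B: "\<And>n L'. n \<ge> N \<Longrightarrow> n < L' \<Longrightarrow> V n * (\<Sum>j=n..<L'. W (j - n1) / (cmod (L (j - n1)))^2) \<le> B" using A.Q by blast
        show "\<exists>B N. \<forall>n\<ge>N. \<forall>L'>n. V n * (\<Sum>j=n..<L'. Wt (int n1) (int j) / (cmod (X (int n1) (int j)))^2) \<le> B"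
        proof (intro exI[of _ B] exI[of _ "N + n1"] allI impI)
          fix n L' assume n: "N + n1 \<le> n" "n < L'"
          have "(\<Sum>j=n..<L'. Wt (int n1) (int j) / (cmod (X (int n1) (int j)))^2) = (\<Sum>j=n..<L'. W (j - n1) / (cmod (L (j - n1)))^2)"
            by (rule sum.cong) (use n in \<open>auto simp: shift\<close>)
          thus "V n * (\<Sum>j=n..<L'. Wt (int n1) (int j) / (cmod (X (int n1) (int j)))^2) \<le> B" using B[of n L'] n by simp
        qed
      qed (use A.n1 A.l_ne A.w_def shift in auto)
      thus ?thesis using rows[OF A.n1] by (simp add: \<gamma>'_def)
    qed
    have rs: "ratio (\<gamma>(0 := 0)) (\<lambda>n. L (n - n1)) n m = ratio \<gamma>' (\<lambda>n. X (int n1) (int n)) n m" if "n1 \<le> n" for n1 n m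
      unfolding ratio_def \<gamma>'_def by (rule prod.cong) (use that in \<open>auto simp: shift\<close>)
    from G.necessity obtain n1 where rw: "asymptotic_rows (\<gamma>(0 := 0)) v q N0 (\<lambda>n. L (n - n1)) (\<lambda>n. W (n - n1)) n1" and
      alt: "n1 = 1 \<and> upper_growth (\<gamma>(0 := 0)) v (\<lambda>n. L (n - n1)) \<or>
       n1 = 2 \<and> lower_growth (\<gamma>(0 := 0)) v (\<lambda>n. L (n - n1))"
      by blast
    from alt show "Cond (int 1) \<and> Up (int 1) \<or> Cond (int 2) \<and> Low (int 2)"
    proof (elim disjE conjE exE)
      fix C N \<delta> assume a: "n1 = 1" "\<delta> > 0"
        "\<forall>n m. N < n \<longrightarrow> n \<le> m \<longrightarrow> ratio (\<gamma>(0 := 0)) (\<lambda>n. L (n - n1)) n m \<le> C * (V m / V n) powr (1 - \<delta>)"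
      have "\<forall>n m. N + n1 < n \<longrightarrow> n \<le> m \<longrightarrow> ratio \<gamma>' (\<lambda>n. X (int n1) (int n)) n m \<le> C * (V m / V n) powr (1 - \<delta>)"
        using a(3) by (simp flip: rs)
      moreover have "1 \<le> n1" "n1 \<le> 2" using a(1) by auto
      ultimately have "Up (int n1)" unfolding up[OF \<open>1 \<le> n1\<close> \<open>n1 \<le> 2\<close>]
        by (intro exI[of _ C] exI[of _ "N + n1"] exI[of _ \<delta>] conjI a(2))
      thus ?thesis using cond[OF rw] a(1) by simp
    next
      fix C N \<delta> assume a: "n1 = 2" "C > 0" "\<delta> > 0"
        "\<forall>n m. N < n \<longrightarrow> n \<le> m \<longrightarrow> C * (V m / V n) powr (1 + \<delta>) \<le> ratio (\<gamma>(0 := 0)) (\<lambda>n. L (n - n1)) n m"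
      have "\<forall>n m. N + n1 < n \<longrightarrow> n \<le> m \<longrightarrow> C * (V m / V n) powr (1 + \<delta>) \<le> ratio \<gamma>' (\<lambda>n. X (int n1) (int n)) n m"
        using a(4) by (simp flip: rs)
      moreover have "1 \<le> n1" "n1 \<le> 2" using a(1) by auto
      ultimately have "Low (int n1)" unfolding low[OF \<open>1 \<le> n1\<close> \<open>n1 \<le> 2\<close>]
        by (intro exI[of _ C] exI[of _ "N + n1"] exI[of _ \<delta>] conjI a(2,3))
      thus ?thesis using cond[OF rw] a(1) by simp
    qed
  qed
  hence "H_invertible \<gamma> v lam n0 w \<longleftrightarrow> Cond 1 \<and> Up 1 \<or> Cond 2 \<and> Low 2" by simp
  thus ?thesis
    unfolding Cond_def Up_def Low_def Wt_def X_def w_def Let_def by (simp only: conj_assoc)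
qed

end
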